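(* Assume that $\sigma$ is a $C^1$ function on $\mathbb{R}$ and that $\Omega\times\Omega_{\mathrm{TJ}}$ supports the 2-Poincaré–Wirtinger inequality with constant $C_P>0$. Let $f_0\in L^2(\Omega\times\Omega_{\mathrm{TJ}},e^{E/D}\,d\theta\,da)$ be a probability density function. Then, for any $t_0>0$, there is a constant $C>0$ such that the associated solution $f$ of the Fokker–Planck problem with initial datum $f_0$ satisfies $$\iint_{\Omega\times\Omega_{\mathrm{TJ}}}\Bigl(3\gamma D\,|\nabla^\Omega_\theta(f-f_\infty)|^2+\eta D\,|\nabla_a(f-f_\infty)|^2\Bigr)\exp\Bigl(\frac{E(\theta,a)}{D}\Bigr)\,d\theta\,da\le C\,e^{-\frac{2\min\{3\gamma,\eta\}D}{C_W}t}$$ for all $t>t_0$, where $f_\infty=C_1e^{-E/D}$ with $\frac1{C_1}=\iint_{\Omega\times\Omega_{\mathrm{TJ}}}e^{-E/D}\,d\theta\,da$, and $C_W=\dfrac{\sup e^{-E/D}}{\inf e^{-E/D}}\,C_P$ (sup and inf over $\Omega\times\Omega_{\mathrm{TJ}}$).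
   Context: $\gamma,\eta,\beta_\theta,\beta_a>0$ are constants satisfying $\frac{6\gamma}{\beta_\theta^2}=\frac{2\eta}{\beta_a^2}$, and $D:=\frac{\beta_\theta^2}{6\gamma}=\frac{\beta_a^2}{2\eta}$. $\theta=(\theta_1,\theta_2,\theta_3)$ (the misorientations) ranges over $\Omega=\{\theta\in(-\frac{\pi}{4},\frac{\pi}{4})^3:\theta_1+\theta_2+\theta_3=0\}\subset\mathbb{R}^3$, with $d\theta$ the 2-dimensional measure on this plane; $a$ (the triple junction) ranges over a bounded domain $\Omega_{\mathrm{TJ}}\subset\mathbb{R}^2$ with $C^2$ boundary. $\nabla^\Omega_\theta,\ \nabla^\Omega_\theta\cdot,\ \Delta^\Omega_\theta$ are the tangential gradient, divergence, Laplacian on the plane of $\Omega$ ($\nabla^\Omega_\theta\phi=(I-\frac13J)(\partial_{\theta_k}\phi)_{k}$, $J$ the all-ones matrix); $\nabla_a,\Delta_a$ are the standard ones; $\nu_\theta,\nu_a$ are outer unit normals to $\partial\Omega$ and $\partial\Omega_{\mathrm{TJ}}$. $E(\theta,a)=\sum_{j=1}^3\sigma(\theta_j)|a-x^{(j)}|$ with $x^{(1)},x^{(2)},x^{(3)}\in\mathbb{R}^2$ fixed. Fokker–Planck problem: $f_t+\nabla^\Omega_\theta\cdot(v_\theta f)+\nabla_a\cdot(v_af)=\frac{\beta_\theta^2}{2}\Delta^\Omega_\theta f+\frac{\beta_a^2}{2}\Delta_af$ in $\Omega\times\Omega_{\mathrm{TJ}}$, $t>0$, with $v_\theta=-3\gamma\nabla^\Omega_\theta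 E$, $v_a=-\eta\nabla_aE$, no-flux conditions $(\frac{\beta_\theta^2}{2}\nabla^\Omega_\theta f-v_\theta f)\cdot\nu_\theta=0$ on $\partial\Omega\times\Omega_{\mathrm{TJ}}$ and $(\frac{\beta_a^2}{2}\nabla_af-v_af)\cdot\nu_a=0$ on $\Omega\times\partial\Omega_{\mathrm{TJ}}$, and $f(\cdot,\cdot,0)=f_0$. The associated solution is $f=g\,e^{-E/D}$, where, with $dm=e^{-E/D}d\theta\,da$, $g$ is the unique function in $C([0,\infty);L^2(dm))\cap C^1((0,\infty);L^2(dm))\cap C((0,\infty);H^2(dm))$ with $g_t=Lg$ for $t>0$, $g(0)=f_0e^{E/D}$; here $Lg=3\gamma D\Delta^\Omega_\theta g+\eta D\Delta_ag-3\gamma\nabla^\Omega_\theta E\cdot\nabla^\Omega_\theta g-\eta\nabla_aE\cdot\nabla_ag$ with domain the $g\in H^2(\Omega\times\Omega_{\mathrm{TJ}},dm)$ with Neumann conditions $\nabla^\Omega_\theta g\cdot\nu_\theta=0$ on $\partial\Omega\times\Omega_{\mathrm{TJ}}$, $\nabla_ag\cdot\nu_a=0$ on $\Omega\times\partial\Omega_{\mathrm{TJ}}$. Probability density: $f_0$ is positive with $\iint f_0\,d\theta\,da=1$. The 2-Poincaré–Wirtinger inequality with constant $C_P$: for all $g\in C^\infty(\Omega\times\Omega_{\mathrm{TJ}})$, $\iint|g-\bar g|^2d\theta\,da\le C_P\iint(|\nabla^\Omega_\theta g|^2+|\nabla_ag|^2)d\theta\,da$, where $\bar g$ is the mean of $g$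 over $\Omega\times\Omega_{\mathrm{TJ}}$ with respect to $d\theta\,da$. *)

theory Defs
  imports "HOL-Analysis.Analysis"
begin

section \<open>Spaces and measures\<close>

definition Omega :: "(real^3) set" where
  "Omega = {\<theta>. (\<forall>k. - (pi / 4) < \<theta> $ k \<and> \<theta> $ k < pi / 4) \<and> \<theta> $ 1 + \<theta> $ 2 + \<theta> $ 3 = 0}"

text \<open>The two-dimensional measure on the plane \<open>\<theta>\<^sub>1 + \<theta>\<^sub>2 + \<theta>\<^sub>3 = 0\<close> is the image of Lebesgue measure
  on \<open>\<real>\<^sup>2\<close> under a linear isometry onto that plane; it does not depend on the orthonormal basis
  of the plane that is used.\<close>

definition plane_isometry :: "real^2 \<Rightarrow> real^3" where
  "plane_isometry u =
     (u $ 1 / sqrt 2) *\<^sub>R vector [1, -1, 0] + (u $ 2 / sqrt 6) *\<^sub>R vector [1, 1, -2]"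

definition plane_measure :: "(real^3) measure" where
  "plane_measure = distr lborel borel plane_isometry"

definition base_measure :: "(real^2) set \<Rightarrow> ((real^3) \<times> (real^2)) measure" where
  "base_measure T = restrict_space (plane_measure \<Otimes>\<^sub>M lborel) (Omega \<times> T)"

section \<open>Classical differential calculus\<close>

text \<open>\<open>Ck_on n S f\<close> is meant for open \<open>S\<close> only.\<close>

primrec Ck_on ::
  "nat \<Rightarrow> 'a::real_normed_vector set \<Rightarrow> ('a \<Rightarrow> 'b::real_normed_vector) \<Rightarrow> bool" where
  "Ck_on 0 S f \<longleftrightarrow> continuous_on S f"
| "Ck_on (Suc n) S f \<longleftrightarrow>
     (\<forall>x\<in>S. f differentiable (at x)) \<and> (\<forall>v. Ck_on n S (\<lambda>x. frechet_derivative f (at x) v))"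

text \<open>\<open>Omega \<times> T\<close> is open in (plane) \<open>\<times> \<real>\<^sup>2\<close> but not in \<open>\<real>\<^sup>3 \<times> \<real>\<^sup>2\<close>, so smoothness on it
  means, as for any submanifold, being the restriction of a function that is smooth on an open set
  of the ambient space. The tangential gradient below, restricted to \<open>Omega \<times> T\<close>, does not depend
  on the extension.\<close>

definition smooth_on_dom :: "(real^2) set \<Rightarrow> ((real^3) \<times> (real^2) \<Rightarrow> real) \<Rightarrow> bool" where
  "smooth_on_dom T \<phi> \<longleftrightarrow> (\<exists>W. open W \<and> Omega \<times> T \<subseteq> W \<and> (\<forall>n. Ck_on n W \<phi>))"

definition tgrad :: "((real^3) \<times> (real^2) \<Rightarrow> real) \<Rightarrow> (real^3) \<times> (real^2) \<Rightarrow> real^3" where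
  "tgrad \<phi> p = ((mat 1 - (1 / 3) *\<^sub>R (\<chi> i j. 1)) :: real^3^3)
                  *v (\<chi> k. frechet_derivative \<phi> (at p) (axis k 1, 0))"

definition agrad :: "((real^3) \<times> (real^2) \<Rightarrow> real) \<Rightarrow> (real^3) \<times> (real^2) \<Rightarrow> real^2" where
  "agrad \<phi> p = (\<chi> k. frechet_derivative \<phi> (at p) (0, axis k 1))"

section \<open>The domain of the triple junction and outer normals\<close>

definition C2_boundary :: "(real^2) set \<Rightarrow> bool" where
  "C2_boundary T \<longleftrightarrow> (\<forall>p\<in>frontier T. \<exists>r>0. \<exists>\<rho>::real^2 \<Rightarrow> real.
      Ck_on 2 (ball p r) \<rho>
    \<and> (\<forall>x\<in>ball p r. frechet_derivative \<rho> (at x) \<noteq> (\<lambda>_. 0))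
    \<and> T \<inter> ball p r = {x \<in> ball p r. \<rho> x < 0})"

definition bounded_C2_domain :: "(real^2) set \<Rightarrow> bool" where
  "bounded_C2_domain T \<longleftrightarrow>
     T \<noteq> {} \<and> open T \<and> connected T \<and> bounded T \<and> C2_boundary T"

text \<open>\<open>n\<close> is the outer unit normal at \<open>p\<close> of a set \<open>S\<close> lying in a translate of the linear space \<open>V\<close>:
  rays with \<open>v \<bullet> n < 0\<close> enter \<open>S\<close>, rays with \<open>v \<bullet> n > 0\<close> leave it. Where the boundary is smooth
  there is exactly one such \<open>n\<close>; at the corners of \<open>Omega\<close> there is none.\<close>

definition outer_unit_normal ::
  "'a::euclidean_space set \<Rightarrow> 'a set \<Rightarrow> 'a \<Rightarrow> 'a \<Rightarrow> bool" where
  "outer_unit_normal V S p n \<longleftrightarrow> n \<in> V \<and> norm n = 1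
     \<and> (\<forall>v\<in>V. v \<bullet> n < 0 \<longrightarrow> (\<forall>\<^sub>F t in at_right 0. p + t *\<^sub>R v \<in> S))
     \<and> (\<forall>v\<in>V. v \<bullet> n > 0 \<longrightarrow> (\<forall>\<^sub>F t in at_right 0. p + t *\<^sub>R v \<notin> S))"

section \<open>\<open>L\<^sup>2\<close> and Sobolev spaces\<close>

text \<open>Elements of these spaces are Borel functions (not classes); identification up to null sets
  is made explicit where it matters.\<close>

definition L2_space :: "'a measure \<Rightarrow> ('a \<Rightarrow> real) set" where
  "L2_space M = {u \<in> borel_measurable M. integrable M (\<lambda>p. (u p)\<^sup>2)}"

definition L2_norm :: "'a measure \<Rightarrow> ('a \<Rightarrow> real) \<Rightarrow> real" where
  "L2_norm M u = sqrt (\<integral>p. (u p)\<^sup>2 \<partial>M)"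

definition test_function :: "(real^2) set \<Rightarrow> ((real^3) \<times> (real^2) \<Rightarrow> real) \<Rightarrow> bool" where
  "test_function T \<phi> \<longleftrightarrow> smooth_on_dom T \<phi>
     \<and> (\<exists>K. compact K \<and> K \<subseteq> Omega \<times> T \<and> (\<forall>p \<in> Omega \<times> T - K. \<phi> p = 0))"

definition loc_integrable :: "(real^2) set \<Rightarrow> ((real^3) \<times> (real^2) \<Rightarrow> real) \<Rightarrow> bool" where
  "loc_integrable T u \<longleftrightarrow>
     (\<forall>K. compact K \<and> K \<subseteq> Omega \<times> T \<longrightarrow> set_integrable (base_measure T) K u)"

definition has_weak_tgrad ::
  "(real^2) set \<Rightarrow> ((real^3) \<times> (real^2) \<Rightarrow> real) \<Rightarrow> ((real^3) \<times> (real^2) \<Rightarrow> real^3) \<Rightarrow> bool" where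
  "has_weak_tgrad T u G \<longleftrightarrow> loc_integrable T u \<and> (\<forall>k. loc_integrable T (\<lambda>p. G p $ k)
     \<and> (\<forall>\<phi>. test_function T \<phi> \<longrightarrow>
          (\<integral>p. u p * tgrad \<phi> p $ k \<partial>base_measure T) = - (\<integral>p. G p $ k * \<phi> p \<partial>base_measure T)))"

definition has_weak_agrad ::
  "(real^2) set \<Rightarrow> ((real^3) \<times> (real^2) \<Rightarrow> real) \<Rightarrow> ((real^3) \<times> (real^2) \<Rightarrow> real^2) \<Rightarrow> bool" where
  "has_weak_agrad T u A \<longleftrightarrow> loc_integrable T u \<and> (\<forall>k. loc_integrable T (\<lambda>p. A p $ k)
     \<and> (\<forall>\<phi>. test_function T \<phi> \<longrightarrow>
          (\<integral>p. u p * agrad \<phi> p $ k \<partial>base_measure T) = - (\<integral>p. A p $ k * \<phi> p \<partial>base_measure T)))"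

definition weakly_differentiable :: "(real^2) set \<Rightarrow> ((real^3) \<times> (real^2) \<Rightarrow> real) \<Rightarrow> bool" where
  "weakly_differentiable T u \<longleftrightarrow> (\<exists>G. has_weak_tgrad T u G) \<and> (\<exists>A. has_weak_agrad T u A)"

text \<open>Representatives of the weak gradients, determined up to null sets when they exist.\<close>

definition weak_tgrad ::
  "(real^2) set \<Rightarrow> ((real^3) \<times> (real^2) \<Rightarrow> real) \<Rightarrow> (real^3) \<times> (real^2) \<Rightarrow> real^3" where
  "weak_tgrad T u = (SOME G. has_weak_tgrad T u G)"

definition weak_agrad ::
  "(real^2) set \<Rightarrow> ((real^3) \<times> (real^2) \<Rightarrow> real) \<Rightarrow> (real^3) \<times> (real^2) \<Rightarrow> real^2" where
  "weak_agrad T u = (SOME A. has_weak_agrad T u A)"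

definition weak_tlaplacian ::
  "(real^2) set \<Rightarrow> ((real^3) \<times> (real^2) \<Rightarrow> real) \<Rightarrow> (real^3) \<times> (real^2) \<Rightarrow> real" where
  "weak_tlaplacian T u p = (\<Sum>k\<in>UNIV. weak_tgrad T (\<lambda>q. weak_tgrad T u q $ k) p $ k)"

definition weak_alaplacian ::
  "(real^2) set \<Rightarrow> ((real^3) \<times> (real^2) \<Rightarrow> real) \<Rightarrow> (real^3) \<times> (real^2) \<Rightarrow> real" where
  "weak_alaplacian T u p = (\<Sum>k\<in>UNIV. weak_agrad T (\<lambda>q. weak_agrad T u q $ k) p $ k)"

text \<open>In the Sobolev spaces below \<open>m\<close> is the weighted measure used for the norms; weak derivatives
  are always taken with respect to \<open>d\<theta> da\<close>.\<close>

definition H1_space ::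
  "(real^2) set \<Rightarrow> ((real^3) \<times> (real^2)) measure \<Rightarrow> ((real^3) \<times> (real^2) \<Rightarrow> real) set" where
  "H1_space T m = {u \<in> L2_space m. weakly_differentiable T u
     \<and> (\<forall>k. (\<lambda>p. weak_tgrad T u p $ k) \<in> L2_space m)
     \<and> (\<forall>k. (\<lambda>p. weak_agrad T u p $ k) \<in> L2_space m)}"

definition H1_norm ::
  "(real^2) set \<Rightarrow> ((real^3) \<times> (real^2)) measure \<Rightarrow> ((real^3) \<times> (real^2) \<Rightarrow> real) \<Rightarrow> real" where
  "H1_norm T m u = sqrt ((L2_norm m u)\<^sup>2
     + (\<Sum>k\<in>UNIV. (L2_norm m (\<lambda>p. weak_tgrad T u p $ k))\<^sup>2)
     + (\<Sum>k\<in>UNIV. (L2_norm m (\<lambda>p. weak_agrad T u p $ k))\<^sup>2))"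

definition H2_space ::
  "(real^2) set \<Rightarrow> ((real^3) \<times> (real^2)) measure \<Rightarrow> ((real^3) \<times> (real^2) \<Rightarrow> real) set" where
  "H2_space T m = {u \<in> H1_space T m.
       (\<forall>k. (\<lambda>p. weak_tgrad T u p $ k) \<in> H1_space T m)
     \<and> (\<forall>k. (\<lambda>p. weak_agrad T u p $ k) \<in> H1_space T m)}"

definition H2_norm ::
  "(real^2) set \<Rightarrow> ((real^3) \<times> (real^2)) measure \<Rightarrow> ((real^3) \<times> (real^2) \<Rightarrow> real) \<Rightarrow> real" where
  "H2_norm T m u = sqrt ((L2_norm m u)\<^sup>2
     + (\<Sum>k\<in>UNIV. (H1_norm T m (\<lambda>p. weak_tgrad T u p $ k))\<^sup>2)
     + (\<Sum>k\<in>UNIV. (H1_norm T m (\<lambda>p. weak_agrad T u p $ k))\<^sup>2))"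

section \<open>Boundary conditions\<close>

text \<open>Vanishing trace of an \<open>H\<^sup>1\<close> function on a part \<open>\<Gamma>\<close> of the boundary, defined as for \<open>H\<^sup>1\<^sub>0\<close>:
  membership in the \<open>H\<^sup>1\<close> closure of the smooth functions that vanish near \<open>\<Gamma>\<close>.\<close>

definition zero_trace ::
  "(real^2) set \<Rightarrow> ((real^3) \<times> (real^2)) measure \<Rightarrow> ((real^3) \<times> (real^2)) set
    \<Rightarrow> ((real^3) \<times> (real^2) \<Rightarrow> real) \<Rightarrow> bool" where
  "zero_trace T m \<Gamma> w \<longleftrightarrow> w \<in> H1_space T m \<and> (\<forall>\<epsilon>>0. \<exists>\<psi>\<in>H1_space T m.
      smooth_on_dom T \<psi>
    \<and> (\<exists>W. open W \<and> \<Gamma> \<subseteq> W \<and> (\<forall>p \<in> W \<inter> (Omega \<times> T). \<psi> p = 0))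
    \<and> H1_norm T m (\<lambda>p. w p - \<psi> p) < \<epsilon>)"

text \<open>\<open>Omega\<close> is a hexagon, so its outer normal takes finitely many values \<open>n\<close>, and
  \<open>\<nabla>\<^sub>\<theta> g \<bullet> \<nu>\<^sub>\<theta>\<close> is \<open>\<nabla>\<^sub>\<theta> g \<bullet> n\<close> on the open edge where \<open>\<nu>\<^sub>\<theta> = n\<close>.\<close>

definition neumann_theta ::
  "(real^2) set \<Rightarrow> ((real^3) \<times> (real^2)) measure \<Rightarrow> ((real^3) \<times> (real^2) \<Rightarrow> real) \<Rightarrow> bool" where
  "neumann_theta T m g \<longleftrightarrow> (\<forall>n.
     let \<Gamma> = {\<theta> \<in> rel_frontier Omega. outer_unit_normal {w. w $ 1 + w $ 2 + w $ 3 = 0} Omega \<theta> n}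
     in \<Gamma> \<noteq> {} \<longrightarrow> zero_trace T m (\<Gamma> \<times> T) (\<lambda>p. weak_tgrad T g p \<bullet> n))"

text \<open>The normal of a \<open>C\<^sup>2\<close> domain is the restriction of a \<open>C\<^sup>1\<close> field \<open>N\<close> on the plane, and the
  trace of \<open>\<nabla>\<^sub>a g \<bullet> N\<close> does not depend on the choice of \<open>N\<close>.\<close>

definition neumann_a ::
  "(real^2) set \<Rightarrow> ((real^3) \<times> (real^2)) measure \<Rightarrow> ((real^3) \<times> (real^2) \<Rightarrow> real) \<Rightarrow> bool" where
  "neumann_a T m g \<longleftrightarrow> (\<exists>N::real^2 \<Rightarrow> real^2. Ck_on 1 UNIV N
     \<and> (\<forall>a\<in>frontier T. outer_unit_normal UNIV T a (N a))
     \<and> zero_trace T m (Omega \<times> frontier T) (\<lambda>p. weak_agrad T g p \<bullet> N (snd p)))"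

section \<open>The Fokker--Planck problem\<close>

definition energy :: "(real \<Rightarrow> real) \<Rightarrow> (3 \<Rightarrow> real^2) \<Rightarrow> (real^3) \<times> (real^2) \<Rightarrow> real" where
  "energy \<sigma> x p = (\<Sum>j\<in>UNIV. \<sigma> (fst p $ j) * norm (snd p - x j))"

definition gibbs_measure ::
  "(real \<Rightarrow> real) \<Rightarrow> (3 \<Rightarrow> real^2) \<Rightarrow> real \<Rightarrow> (real^2) set \<Rightarrow> ((real^3) \<times> (real^2)) measure" where
  "gibbs_measure \<sigma> x D T = density (base_measure T) (\<lambda>p. ennreal (exp (- energy \<sigma> x p / D)))"

text \<open>\<open>\<nabla>\<^sub>a E\<close> is undefined (here: unspecified) on the null set where \<open>a\<close> is one of the \<open>x j\<close>.\<close>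

definition fp_operator ::
  "(real \<Rightarrow> real) \<Rightarrow> (3 \<Rightarrow> real^2) \<Rightarrow> real \<Rightarrow> real \<Rightarrow> real \<Rightarrow> (real^2) set
    \<Rightarrow> ((real^3) \<times> (real^2) \<Rightarrow> real) \<Rightarrow> (real^3) \<times> (real^2) \<Rightarrow> real" where
  "fp_operator \<sigma> x \<gamma> \<eta> D T g p =
     3 * \<gamma> * D * weak_tlaplacian T g p + \<eta> * D * weak_alaplacian T g p
     - 3 * \<gamma> * (tgrad (energy \<sigma> x) p \<bullet> weak_tgrad T g p)
     - \<eta> * (agrad (energy \<sigma> x) p \<bullet> weak_agrad T g p)"

definition fp_domain ::
  "(real \<Rightarrow> real) \<Rightarrow> (3 \<Rightarrow> real^2) \<Rightarrow> real \<Rightarrow> (real^2) set \<Rightarrow> ((real^3) \<times> (real^2) \<Rightarrow> real) set" where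
  "fp_domain \<sigma> x D T = {g \<in> H2_space T (gibbs_measure \<sigma> x D T).
     neumann_theta T (gibbs_measure \<sigma> x D T) g \<and> neumann_a T (gibbs_measure \<sigma> x D T) g}"

text \<open>Continuity of a curve \<open>u\<close> of functions on the time set \<open>I\<close>, for a (semi)norm \<open>nrm\<close>.\<close>

definition continuous_curve ::
  "(('a \<Rightarrow> real) \<Rightarrow> real) \<Rightarrow> real set \<Rightarrow> (real \<Rightarrow> 'a \<Rightarrow> real) \<Rightarrow> bool" where
  "continuous_curve nrm I u \<longleftrightarrow>
     (\<forall>t\<in>I. ((\<lambda>s. nrm (\<lambda>p. u s p - u t p)) \<longlongrightarrow> 0) (at t within I))"

definition fp_evolution ::
  "(real \<Rightarrow> real) \<Rightarrow> (3 \<Rightarrow> real^2) \<Rightarrow> real \<Rightarrow> real \<Rightarrow> real \<Rightarrow> (real^2) set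
    \<Rightarrow> ((real^3) \<times> (real^2) \<Rightarrow> real) \<Rightarrow> (real \<Rightarrow> (real^3) \<times> (real^2) \<Rightarrow> real) \<Rightarrow> bool" where
  "fp_evolution \<sigma> x \<gamma> \<eta> D T f0 g \<longleftrightarrow> (let m = gibbs_measure \<sigma> x D T in
       (\<forall>t\<ge>0. g t \<in> L2_space m) \<and> continuous_curve (L2_norm m) {0..} g
     \<and> (\<forall>t>0. g t \<in> fp_domain \<sigma> x D T) \<and> continuous_curve (H2_norm T m) {0<..} g
     \<and> (\<exists>g'. (\<forall>t>0. g' t \<in> L2_space m) \<and> continuous_curve (L2_norm m) {0<..} g'
          \<and> (\<forall>t>0. ((\<lambda>s. L2_norm m (\<lambda>p. (g s p - g t p) / (s - t) - g' t p)) \<longlongrightarrow> 0) (at t))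
          \<and> (\<forall>t>0. AE p in m. g' t p = fp_operator \<sigma> x \<gamma> \<eta> D T (g t) p))
     \<and> (AE p in m. g 0 p = f0 p * exp (energy \<sigma> x p / D)))"

definition fp_associated_solution ::
  "(real \<Rightarrow> real) \<Rightarrow> (3 \<Rightarrow> real^2) \<Rightarrow> real \<Rightarrow> real \<Rightarrow> real \<Rightarrow> (real^2) set
    \<Rightarrow> ((real^3) \<times> (real^2) \<Rightarrow> real) \<Rightarrow> (real \<Rightarrow> (real^3) \<times> (real^2) \<Rightarrow> real) \<Rightarrow> bool" where
  "fp_associated_solution \<sigma> x \<gamma> \<eta> D T f0 f \<longleftrightarrow> (\<exists>g. fp_evolution \<sigma> x \<gamma> \<eta> D T f0 g
     \<and> (\<forall>t\<ge>0. \<forall>p \<in> Omega \<times> T. f t p = g t p * exp (- energy \<sigma> x p / D)))"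

section \<open>Poincare--Wirtinger inequality\<close>

text \<open>The mean needs \<open>g\<close> to be integrable; both sides may be infinite.\<close>

definition poincare_wirtinger :: "(real^2) set \<Rightarrow> real \<Rightarrow> bool" where
  "poincare_wirtinger T C \<longleftrightarrow> (\<forall>g. smooth_on_dom T g \<and> integrable (base_measure T) g \<longrightarrow>
     (let gbar = (\<integral>p. g p \<partial>base_measure T) / measure (base_measure T) (Omega \<times> T) in
       (\<integral>\<^sup>+p. ennreal ((g p - gbar)\<^sup>2) \<partial>base_measure T)
         \<le> ennreal C * (\<integral>\<^sup>+p. ennreal ((norm (tgrad g p))\<^sup>2 + (norm (agrad g p))\<^sup>2) \<partial>base_measure T)))"

end

(* With h = g - C_1 and dm = e^(-E/D) d theta da, Green's formula turns the Neumann problem into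
   (g', v) = - a(g, v) in L^2(m), where a(g, v) is the integral of
   3 gamma D grad_theta g . grad_theta v + eta D grad_a g . grad_a v. Hence the mass is conserved,
   h has mean zero, and the weighted Poincare inequality makes |h| decay at rate
   lambda = min(3 gamma, eta) D / C_W. The same applies to g(t + s) - g(t), so the quotient limit |g'|
   decays at rate lambda for t > t_0, and a(h, h) = - (g', h) <= |g'| |h| decays at rate 2 lambda.
   The gradient of f - f_infinity = h e^(-E/D) is controlled by grad h and h.

   The work is in Green's formula on the product of the hexagon and a C^2 domain, where traces exist
   only through H^1 approximation by functions vanishing near the boundary. Cutting off at distance 1/n
   leaves a boundary term with a factor n, supported in a layer of width 1/n. Following rays from the
   layer to the boundary, a one-dimensional Poincare inequality bounds the normal component there by
   1/n times its derivative along the rays; the rays are parallel to the neighbouring edges of the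
   hexagon, respectively to the normal at the centre of a chart. The Poincare inequality passes from
   smooth functions to H^1 by the theorem of Meyers and Serrin. *)
theory Submission imports Defs begin

text \<open>Three features of the data shape the proof. The weight e^(-E/D) is only Lipschitz in the
  triple junction, because E can have conical points at the nodes x_j; it therefore enters
  integrations by parts as a Lipschitz factor with a derivative almost everywhere. Only the normal
  derivative of g vanishes at the boundary, so a cutoff may have a large gradient only along the
  normal: hence products of functions of one angle each on the hexagon, and functions of the
  defining function rho in a chart. The gradient of rho is parallel to the given normal field only
  at the frontier itself, but the discrepancy is proportional to the depth. Thus the boundary term
  is at most a constant times the norm of the second factor on the layer, and dominated convergence
  finishes. Finally, g' is not known to lie in H^1, so the energy argument applies to difference
  quotients only, with constants independent of the step. All this happens in orthonormal
  coordinates of the plane, where the domain is open and the components of the tangential gradient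
  are derivatives in three linearly dependent directions.\<close>

type_synonym coord = "(real^2) \<times> (real^2)"
type_synonym state = "(real^3) \<times> (real^2)"

abbreviation L2 :: "('a::euclidean_space \<Rightarrow> real) set" where "L2 \<equiv> L2_space lborel"
abbreviation nrm2 :: "('a::euclidean_space \<Rightarrow> real) \<Rightarrow> real" where "nrm2 \<equiv> L2_norm lborel"
lemmas lint_add = Bochner_Integration.integral_add and lint_diff = Bochner_Integration.integral_diff
 and lint_sum = Bochner_Integration.integral_sum and lint_cong = Bochner_Integration.integral_cong
 and lintegrable_add = Bochner_Integration.integrable_add and lintegrable_diff = Bochner_Integration.integrable_diff
 and lintegrable_bound = Bochner_Integration.integrable_bound and lintegrable_sum = Bochner_Integration.integrable_sum

abbreviation lims :: "(nat \<Rightarrow> 'a::topological_space) \<Rightarrow> 'a \<Rightarrow> bool" (infixr "---->" 60) where "f ----> a \<equiv> f \<longlonglongrightarrow> a"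
abbreviation Usum (binder "SS " 10) where "Usum f \<equiv> sum f UNIV"
abbreviation nnl (binder "NN " 10) where "nnl f \<equiv> nn_integral lborel f"
abbreviation borel_fun :: "('a::topological_space \<Rightarrow> 'b::topological_space) set" where "borel_fun \<equiv> borel_measurable borel"

section \<open>Smooth functions\<close>

definition smooth_on :: "'a::real_normed_vector set => ('a => 'b::real_normed_vector) => bool" where
 "smooth_on S f \<longleftrightarrow> (ALL n. Ck_on n S f)"

lemma frechet_derivative_cong_open:
 assumes "open S" "x : S" "!!y. y : S ==> f y = g y" "f differentiable (at x)"
 shows "g differentiable (at x)" "frechet_derivative g (at x) = frechet_derivative f (at x)"
proof -
 have "(f has_derivative frechet_derivative f (at x)) (at x)" using assms(4) by (simp add: frechet_derivative_works)
 hence "(g has_derivative frechet_derivative f (at x)) (at x)" by (rule has_derivative_transform_within_open[OF _ assms(1,2)]) (use assms(3) in auto)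
 thus "g differentiable (at x)" "frechet_derivative g (at x) = frechet_derivative f (at x)" by (auto simp: differentiable_def dest: frechet_derivative_at)
qed

lemma Ck_on_cong_open:
 assumes "open S" "!!x. x : S ==> f x = g x" "Ck_on n S f"
 shows "Ck_on n S g" using assms(2,3)
proof (induction n arbitrary: f g)
 case 0
 hence "continuous_on S f" by simp
 hence "continuous_on S g" by (rule continuous_on_eq) (use 0 in auto)
 thus ?case by simp
next
 case (Suc n)
 show ?case unfolding Ck_on.simps proof (intro conjI ballI allI)
  fix x assume "x : S"
  thus "g differentiable (at x)" using Suc.prems assms(1) frechet_derivative_cong_open(1)[of S x f g] by auto
 next
  fix v
  show "Ck_on n S (%x. frechet_derivative g (at x) v)" proof (rule Suc.IH)
  show "Ck_on n S (%x. frechet_derivative f (at x) v)" using Suc.prems by simp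
  show "frechet_derivative f (at x) v = frechet_derivative g (at x) v" if "x : S" for x using Suc.prems assms(1) that frechet_derivative_cong_open(2)[of S x f g] by auto
  qed
 qed
qed

lemma Ck_on_subset:
 assumes "Ck_on n S f" "R <= S" shows "Ck_on n R f" using assms(1)
proof (induction n arbitrary: f)
 case 0
 thus ?case using assms(2) continuous_on_subset by auto
next
 case (Suc n)
 thus ?case using assms(2) by auto
qed

lemma Ck_on_SucD: "Ck_on (Suc n) S f ==> Ck_on n S f"
proof (induction n arbitrary: f)
 case 0
 thus ?case by (auto intro!: continuous_at_imp_continuous_on differentiable_imp_continuous_within)
next
 case (Suc n)
 show ?case unfolding Ck_on.simps(2)[of n] proof (intro conjI allI)
  show "\<forall>x\<in>S. f differentiable (at x)" using Suc.prems by simp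
  fix v
  have "Ck_on (Suc n) S (%x. frechet_derivative f (at x) v)" using Suc.prems by (simp only: Ck_on.simps(2)[of "Suc n"])
  thus "Ck_on n S (%x. frechet_derivative f (at x) v)" by (rule Suc.IH)
 qed
qed

lemma Ck_on_union:
 assumes "open A" "open B" "Ck_on n A f" "Ck_on n B f"
 shows "Ck_on n (A \<union> B) f" using assms(3,4)
proof (induction n arbitrary: f)
 case 0
 thus ?case using assms(1,2) by (simp add: continuous_on_open_Un)
next
 case (Suc n)
 thus ?case by auto
qed

lemma Ck_on_const: "Ck_on n S (%x. c)"
proof (induction n arbitrary: c)
 case 0
 thus ?case by simp
next
 case (Suc n)
 thus ?case by (simp add: frechet_derivative_const)
qed

lemma Ck_on_add:
 assumes "open S" "Ck_on n S f" "Ck_on n S g"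
 shows "Ck_on n S (%x. f x + g x)" using assms(2,3)
proof (induction n arbitrary: f g)
 case 0
 thus ?case by (simp add: continuous_on_add)
next
 case (Suc n)
 show ?case unfolding Ck_on.simps proof (intro conjI ballI allI)
  fix x assume "x : S"
  thus "(%x. f x + g x) differentiable (at x)" using Suc.prems by auto
 next
  fix v
  have fd: "frechet_derivative (%x. f x + g x) (at x) v = frechet_derivative f (at x) v + frechet_derivative g (at x) v" if "x : S" for x proof -
  have "(f has_derivative frechet_derivative f (at x)) (at x)" "(g has_derivative frechet_derivative g (at x)) (at x)" using that Suc.prems by (auto simp: frechet_derivative_works[symmetric])
  from has_derivative_add[OF this] show ?thesis by (subst frechet_derivative_at[symmetric]) auto
  qed
  show "Ck_on n S (%x. frechet_derivative (%x. f x + g x) (at x) v)" by (rule Ck_on_cong_open[OF assms(1) _ Suc.IH]) (use Suc.prems fd in auto)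
 qed
qed

lemma Ck_on_mult:
 fixes f g :: "'a::real_normed_vector => real"
 assumes "open S" "Ck_on n S f" "Ck_on n S g"
 shows "Ck_on n S (%x. f x * g x)" using assms(2,3)
proof (induction n arbitrary: f g)
 case 0
 thus ?case by (simp add: continuous_on_mult)
next
 case (Suc n)
 show ?case unfolding Ck_on.simps proof (intro conjI ballI allI)
  fix x assume "x : S"
  thus "(%x. f x * g x) differentiable (at x)" using Suc.prems by auto
 next
  fix v
  have fd: "frechet_derivative (%x. f x * g x) (at x) v = f x * frechet_derivative g (at x) v + frechet_derivative f (at x) v * g x" if "x : S" for x proof -
  have "(f has_derivative frechet_derivative f (at x)) (at x)" "(g has_derivative frechet_derivative g (at x)) (at x)" using that Suc.prems by (auto simp: frechet_derivative_works[symmetric])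
  from has_derivative_mult[OF this] show ?thesis by (subst frechet_derivative_at[symmetric]) auto
  qed
  show "Ck_on n S (%x. frechet_derivative (%x. f x * g x) (at x) v)" proof (rule Ck_on_cong_open[OF assms(1) _ Ck_on_add[OF assms(1)]])
  show "Ck_on n S (%x. f x * frechet_derivative g (at x) v)" by (rule Suc.IH) (use Suc.prems(2) Ck_on_SucD[OF Suc.prems(1)] in auto)
  show "Ck_on n S (%x. frechet_derivative f (at x) v * g x)" by (rule Suc.IH) (use Suc.prems(1) Ck_on_SucD[OF Suc.prems(2)] in auto)
  qed (use fd in auto)
 qed
qed

lemma Ck_on_compose_linear:
 fixes f :: "'b::real_normed_vector => 'c::real_normed_vector"
 assumes "bounded_linear L" "Ck_on n S f" "L ` R <= S" "open R"
 shows "Ck_on n R (%x. f (L x))" using assms(2)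
proof (induction n arbitrary: f)
 case 0
 thus ?case using assms(1,3) by (auto intro: continuous_on_compose2[of S f R L] simp: linear_continuous_on)
next
 case (Suc n)
 have *: "((%x. f (L x)) has_derivative (%v. frechet_derivative f (at (L x)) (L v))) (at x)" if "x : R" for x proof -
  have "(f has_derivative frechet_derivative f (at (L x))) (at (L x))" using that Suc.prems assms(3) by (auto simp: frechet_derivative_works[symmetric])
  from has_derivative_compose[OF bounded_linear_imp_has_derivative[OF assms(1)] this]
  show ?thesis by simp
 qed
 show ?case unfolding Ck_on.simps proof (intro conjI ballI allI)
  fix x assume "x : R"
  thus "(%x. f (L x)) differentiable (at x)" using * by (auto simp: differentiable_def)
 next
  fix v
  show "Ck_on n R (%x. frechet_derivative (%x. f (L x)) (at x) v)" proof (rule Ck_on_cong_open[OF assms(4) _ Suc.IH])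
  show "Ck_on n S (%y. frechet_derivative f (at y) (L v))" using Suc.prems by simp
  qed (use frechet_derivative_at[OF *] in metis)
 qed
qed

text \<open>The outer function is given with the whole sequence \<open>G\<close> of its derivatives.
  The derivative of \<open>G i (f x)\<close> contains the factor \<open>G (Suc i) (f x)\<close>, so
  the induction on the order must let the index \<open>i\<close> vary.\<close>

lemma Ck_on_compose_real:
 fixes f :: "'a::real_normed_vector => real" and G :: "nat => real => real"
 assumes "open S" "!!i s. (G i has_real_derivative G (Suc i) s) (at s)" "Ck_on n S f"
 shows "Ck_on n S (%x. G i (f x))" using assms(3)
proof (induction n arbitrary: i)
 case 0
 have "continuous_on UNIV (G i)" using assms(2) by (auto intro!: DERIV_continuous_on)
 thus ?case using 0 by (auto intro: continuous_on_compose2)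
next
 case (Suc n)
 have *: "((%x. G i (f x)) has_derivative (%v. G (Suc i) (f x) * frechet_derivative f (at x) v)) (at x)" if "x : S" for x proof -
  have "(f has_derivative frechet_derivative f (at x)) (at x)" using that Suc.prems by (auto simp: frechet_derivative_works[symmetric])
  from has_derivative_compose[OF this assms(2)[of i "f x", unfolded has_field_derivative_def]]
  show ?thesis by simp
 qed
 show ?case unfolding Ck_on.simps proof (intro conjI ballI allI)
  fix x assume "x : S"
  thus "(%x. G i (f x)) differentiable (at x)" using * by (auto simp: differentiable_def)
 next
  fix v
  show "Ck_on n S (%x. frechet_derivative (%x. G i (f x)) (at x) v)" proof (rule Ck_on_cong_open[OF assms(1) _ Ck_on_mult[OF assms(1)]])
  show "Ck_on n S (%x. G (Suc i) (f x))" using Suc.IH Ck_on_SucD[OF Suc.prems] by blast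
  show "Ck_on n S (%x. frechet_derivative f (at x) v)" using Suc.prems by simp
  qed (use frechet_derivative_at[OF *] in metis)
 qed
qed

lemma Ck_on_linear:
 assumes "bounded_linear L" "open S"
 shows "Ck_on n S L"
proof (cases n)
 case 0
 thus ?thesis using assms by (simp add: linear_continuous_on)
next
 case (Suc k)
 have "frechet_derivative L (at x) = L" for x using frechet_derivative_at[OF bounded_linear_imp_has_derivative[OF assms(1)]] by metis
 thus ?thesis using assms Suc bounded_linear_imp_differentiable by (auto simp: Ck_on_const)
qed

lemma Ck_on_inner_self:
 fixes S :: "'a::real_inner set"
 assumes "open S"
 shows "Ck_on n S (%x. x \<bullet> x)"
proof (cases n)
 case 0
 thus ?thesis by (auto intro!: continuous_intros)
next
 case (Suc k)
 have *: "((%x::'a. x \<bullet> x) has_derivative (%v. 2 * (v \<bullet> x))) (at x)" for x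
  by (rule has_derivative_eq_rhs, rule derivative_intros has_derivative_inner[OF has_derivative_ident has_derivative_ident]) (simp add: inner_commute)
 have "bounded_linear (%x::'a. 2 * (v \<bullet> x))" for v by (intro bounded_linear_const_mult bounded_linear_inner_right)
 hence "Ck_on k S (%x. 2 * (v \<bullet> x))" for v using Ck_on_linear assms by blast
 moreover have "frechet_derivative (%x. x \<bullet> x) (at x) v = 2 * (v \<bullet> x)" for x v :: 'a using frechet_derivative_at[OF *] by metis
 ultimately show ?thesis using Suc *[THEN differentiableI] by auto
qed

text \<open>Induction on the order only ever asks for the next derivative, so a class closed under
  directional derivatives suffices. This suits convolutions and reflections, whose derivatives have
  the same shape again.\<close>

lemma smooth_on_coinduct:
 assumes "P f"
  and "!!f x. P f ==> x : S ==> f differentiable (at x)" and "!!f v. P f ==> P (%x. frechet_derivative f (at x) v)"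
 shows "smooth_on S f"
proof -
 have "P f --> Ck_on n S f" for n f proof (induction n arbitrary: f)
  case 0
  thus ?case using assms(2) by (auto intro!: continuous_at_imp_continuous_on differentiable_imp_continuous_within)
 next
  case (Suc n)
  thus ?case using assms(2,3) by auto
 qed
 thus ?thesis using assms(1) by (simp add: smooth_on_def)
qed

lemma smooth_onD: "smooth_on S f ==> x : S ==> f differentiable (at x)"
 unfolding smooth_on_def by (metis Ck_on.simps(2))

lemma smooth_on_frechet:
 "smooth_on S f ==> smooth_on S (%x. frechet_derivative f (at x) v)" unfolding smooth_on_def by (metis Ck_on.simps(2))

lemma smooth_on_continuous: "smooth_on S f ==> continuous_on S f"
 unfolding smooth_on_def by (metis Ck_on.simps(1))

lemma smooth_on_has_derivative:
 "smooth_on S f ==> x : S ==> (f has_derivative frechet_derivative f (at x)) (at x)" using smooth_onD frechet_derivative_works by blast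

lemma smooth_on_add: "open S ==> smooth_on S f ==> smooth_on S g ==> smooth_on S (%x. f x + g x)"
 by (simp add: smooth_on_def Ck_on_add)

lemma smooth_on_mult:
 fixes f g :: "'a::real_normed_vector => real"
 shows "open S ==> smooth_on S f ==> smooth_on S g ==> smooth_on S (%x. f x * g x)" by (simp add: smooth_on_def Ck_on_mult)

lemma smooth_on_const: "smooth_on S (%x. c)"
 by (simp add: smooth_on_def Ck_on_const)

lemma smooth_on_cmult: "open S ==> smooth_on S f ==> smooth_on S (%x. c * f x :: real)"
 by (rule smooth_on_mult[OF _ smooth_on_const])

lemma smooth_on_sum:
 assumes "open S" "!!i. i : I ==> smooth_on S (f i)"
 shows "smooth_on S (%x. \<Sum>i\<in>I. f i x)" using assms(2) by (induction I rule: infinite_finite_induct) (auto intro: smooth_on_const smooth_on_add[OF assms(1)])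

lemma smooth_on_cong: "open S ==> smooth_on S f ==> (!!x. x : S ==> f x = g x) ==> smooth_on S g"
 unfolding smooth_on_def using Ck_on_cong_open by blast

lemma smooth_on_subset: "smooth_on S f ==> R <= S ==> smooth_on R f"
 unfolding smooth_on_def using Ck_on_subset by blast

lemma smooth_on_union:
 "open A ==> open B ==> smooth_on A f ==> smooth_on B f ==> smooth_on (A \<union> B) f" by (simp add: smooth_on_def Ck_on_union)

lemma smooth_on_compose_linear:
 "bounded_linear L ==> smooth_on S f ==> L ` R <= S ==> open R ==> smooth_on R (%x. f (L x))" unfolding smooth_on_def using Ck_on_compose_linear by blast

text \<open>The derivatives of \<open>exp (-1/s)\<close> have the form \<open>p (1/s) exp (-1/s)\<close> with polynomials \<open>p\<close>.\<close>

primrec bump_poly :: "nat => real poly" where "bump_poly 0 = 1" | "bump_poly (Suc n) = monom 1 2 * (bump_poly n - pderiv (bump_poly n))"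

definition bump_deriv :: "nat => real => real" where
 "bump_deriv n s = (if s > 0 then poly (bump_poly n) (1 / s) * exp (- 1 / s) else 0)"

lemma tendsto_poly_times_exp: "((%y. poly p y * exp (- y)) \<longlongrightarrow> (0::real)) at_top"
proof -
 have "((%y. \<Sum>i\<le>degree p. coeff p i * (y ^ i / exp y)) \<longlongrightarrow> (\<Sum>i\<le>degree p. coeff p i * 0)) at_top"
  by (intro tendsto_sum tendsto_mult tendsto_const tendsto_power_div_exp_0)
 thus ?thesis by (simp add: poly_altdef sum_distrib_right exp_minus divide_inverse mult.assoc)
qed

text \<open>The delicate point is 0: the difference quotient from the right is, with y = 1/h, a
  polynomial in y times exp (- y), which tends to 0 as y grows.\<close>

lemma bump_deriv_has_derivative:
 "(bump_deriv n has_real_derivative bump_deriv (Suc n) s) (at s)"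
proof (cases s "0::real" rule: linorder_cases)
 case less
 have "((%s. 0) has_real_derivative 0) (at s)" by simp
 hence "(bump_deriv n has_real_derivative 0) (at s)" by (rule has_field_derivative_transform_within_open[where S = "{..<0}"]) (use less in "auto simp: bump_deriv_def")
 thus ?thesis using less by (simp add: bump_deriv_def)
next
 case greater
 let ?f = "%s. poly (bump_poly n) (1 / s) * exp (- 1 / s)"
 have "(?f has_real_derivative poly (bump_poly (Suc n)) (1 / s) * exp (- 1 / s)) (at s)" using greater by (auto intro!: derivative_eq_intros simp: poly_monom field_simps power2_eq_square)
 hence "(bump_deriv n has_real_derivative poly (bump_poly (Suc n)) (1 / s) * exp (- 1 / s)) (at s)" by (rule has_field_derivative_transform_within_open[where S = "{0<..}"])
  (use greater in "auto simp: bump_deriv_def")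
 thus ?thesis using greater by (simp add: bump_deriv_def)
next
 case equal
 have "((%h. bump_deriv n h / h) \<longlongrightarrow> 0) (at_right 0)" proof -
  have "((%h. poly (monom 1 1 * bump_poly n) (inverse h) * exp (- inverse h)) \<longlongrightarrow> 0) (at_right 0)"
  by (rule filterlim_compose[OF tendsto_poly_times_exp filterlim_inverse_at_top_right])
  moreover have "\<forall>\<^sub>F h in at_right 0. poly (monom 1 1 * bump_poly n) (inverse h) * exp (- inverse h) = bump_deriv n h / h" unfolding eventually_at_right_field
  by (rule exI[of _ 1]) (auto simp: bump_deriv_def poly_monom field_simps)
  ultimately show ?thesis by (rule Lim_transform_eventually)
 qed
 moreover have "((%h. bump_deriv n h / h) \<longlongrightarrow> 0) (at_left 0)" by (rule Lim_transform_eventually[OF tendsto_const])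
  (auto simp: bump_deriv_def eventually_at_left_field intro!: exI[of _ "-1"])
 ultimately have "((%h. bump_deriv n h / h) \<longlongrightarrow> 0) (at 0)" using filterlim_at_split by blast
 thus ?thesis using equal by (simp add: DERIV_def bump_deriv_def)
qed

lemma bump_deriv_0: "bump_deriv 0 s = (if s > 0 then exp (- 1 / s) else 0)"
 by (simp add: bump_deriv_def)

lemma smooth_on_bump: "smooth_on UNIV (%x::'a::euclidean_space. bump_deriv 0 (c - d * (x \<bullet> x)))"
proof -
 have "Ck_on n UNIV (%x::'a. c + (- d) * (x \<bullet> x))" for n by (intro Ck_on_add Ck_on_mult Ck_on_const Ck_on_inner_self) auto
 from Ck_on_compose_real[where G = bump_deriv, OF _ bump_deriv_has_derivative this]
 show ?thesis unfolding smooth_on_def by simp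
qed

section \<open>Square integrable functions\<close>

lemma L2D:
 assumes "u : L2_space M"
 shows "u : borel_measurable M" "integrable M (%x. (u x)^2)" using assms by (auto simp: L2_space_def)

lemma L2_spaceI:
 "u : borel_measurable M ==> integrable M (%x. (u x)^2) ==> u : L2_space M" by (auto simp: L2_space_def)

lemma L2_space_dominated:
 assumes "g : L2_space M" "f : borel_measurable M" "AE x in M. abs (f x) <= C * abs (g x)"
 shows "f : L2_space M"
proof (rule L2_spaceI[OF assms(2)])
 show "integrable M (%x. (f x)^2)" proof (rule lintegrable_bound)
  show "integrable M (%x. C^2 * (g x)^2)" using L2D[OF assms(1)] by simp
  show "(%x. (f x)^2) : borel_measurable M" using assms(2) by measurable
  show "AE x in M. norm ((f x)^2) <= norm (C^2 * (g x)^2)" using assms(3) proof eventually_elim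
  case (elim x)
  have "abs (f x)^2 <= (C * abs (g x))^2" using elim by (intro power_mono) auto
  thus ?case by (simp add: power_mult_distrib)
  qed
 qed
qed

lemma L2_space_cmult: "f : L2_space M ==> (%x. c * f x) : L2_space M"
 by (auto simp: L2_space_def power_mult_distrib)

lemma L2_mult_integrable:
 assumes "f : L2_space M" "g : L2_space M"
 shows "integrable M (%x. f x * g x)"
proof (rule lintegrable_bound)
 show "integrable M (%x. (f x)^2 + (g x)^2)" using L2D[OF assms(1)] L2D[OF assms(2)] by simp
 show "(%x. f x * g x) : borel_measurable M" using L2D[OF assms(1)] L2D[OF assms(2)] by measurable
 have "norm (a * b) <= norm (a^2 + b^2)" for a b :: real proof -
  have "0 <= (abs a - abs b)^2" by simp
  hence "2 * (abs a * abs b) <= a^2 + b^2" by (simp add: power2_diff)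
  moreover have "0 <= abs a * abs b" by simp
  moreover have "0 <= a^2 + b^2" by simp
  ultimately show ?thesis unfolding real_norm_def abs_mult by linarith
 qed
 thus "AE x in M. norm (f x * g x) <= norm ((f x)^2 + (g x)^2)" by simp
qed

lemma L2_space_add:
 assumes "f : L2_space M" "g : L2_space M"
 shows "(%x. f x + g x) : L2_space M"
proof (rule L2_spaceI)
 show "(%x. f x + g x) : borel_measurable M" using L2D[OF assms(1)] L2D[OF assms(2)] by measurable
 have "integrable M (%x. (f x)^2 + (g x)^2 + 2 * (f x * g x))" using L2D[OF assms(1)] L2D[OF assms(2)] L2_mult_integrable[OF assms] by (intro lintegrable_add integrable_mult_right) auto
 thus "integrable M (%x. (f x + g x)^2)" by (simp add: power2_sum algebra_simps)
qed

lemma L2_space_diff: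
 assumes "f : L2_space M" "g : L2_space M"
 shows "(%x. f x - g x) : L2_space M" using L2_space_add[OF assms(1) L2_space_cmult[OF assms(2), of "-1"]] by simp

lemma L2_space_sum:
 assumes "!!i. i : I ==> f i : L2_space M"
 shows "(%x. \<Sum>i\<in>I. f i x) : L2_space M" using assms
proof (induction I rule: infinite_finite_induct)
 case (insert i I)
 thus ?case by (simp add: L2_space_add)
qed (auto simp: L2_space_def)

lemma L2_space_const: "finite_measure M ==> (%x. c) : L2_space M"
 by (auto simp: L2_space_def finite_measure.integrable_const)

lemma L2_space_integrable:
 assumes "finite_measure M" "f : L2_space M"
 shows "integrable M f" using L2_mult_integrable[OF assms(2) L2_space_const[OF assms(1), of 1]] by simp

lemma L2_norm_nonneg: "L2_norm M f >= 0"
 by (simp add: L2_norm_def)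

lemma L2_norm_sq: "(L2_norm M f)^2 = (\<integral>x. (f x)^2 \<partial>M)"
 by (simp add: L2_norm_def)

text \<open>The quadratic form \<open>q\<close> in s and t is nonnegative; at s = b and t = - c it
  equals b (a b - c^2), which settles the case b > 0.\<close>

lemma L2_cauchy_schwarz:
 assumes "f : L2_space M" "g : L2_space M"
 shows "abs (\<integral>x. f x * g x \<partial>M) <= L2_norm M f * L2_norm M g"
proof -
 define a b c where "a = (\<integral>x. (f x)^2 \<partial>M)" "b = (\<integral>x. (g x)^2 \<partial>M)" "c = (\<integral>x. f x * g x \<partial>M)"
 have q: "0 <= s^2 * a + t^2 * b + 2 * s * t * c" for s t proof -
  have "0 <= (\<integral>x. (s * f x + t * g x)^2 \<partial>M)" by simp
  also have "... = (\<integral>x. s^2 * (f x)^2 + t^2 * (g x)^2 + (2 * s * t) * (f x * g x) \<partial>M)" by (intro lint_cong) (auto simp: power2_sum power_mult_distrib)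
  also have "... = s^2 * a + t^2 * b + 2 * s * t * c" using L2D[OF assms(1)] L2D[OF assms(2)] L2_mult_integrable[OF assms] by (simp add: a_b_c_def)
  finally show ?thesis .
 qed
 have ab: "a >= 0" "b >= 0" by (auto simp: a_b_c_def)
 have "c^2 <= a * b" proof (cases "b = 0")
  case True
  have "c = 0" proof (rule ccontr)
  assume "c ~= 0"
  \<comment> \<open>For b = 0 the form with s = 1 is affine in t, and this t gives it the value a -
    (a + 1) = -1.\<close>
  have "0 <= a + 2 * (- (a + 1) / (2 * c)) * c" using q[of 1 "- (a + 1) / (2 * c)"] True by simp
  also have "... = -1" using \<open>c ~= 0\<close> by (simp add: field_simps)
  finally show False by simp
  qed
  thus ?thesis using ab by simp
 next
  case False
  have "0 <= b^2 * a + c^2 * b - 2 * b * c * c" using q[of b "- c"] by simp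
  hence "0 <= b * (a * b - c^2)" by (simp add: power2_eq_square algebra_simps)
  thus ?thesis using False ab by (simp add: zero_le_mult_iff)
 qed
 hence "sqrt (c^2) <= sqrt (a * b)" by (rule real_sqrt_le_mono)
 thus ?thesis unfolding a_b_c_def L2_norm_def real_sqrt_mult real_sqrt_abs .
qed

lemma L2_norm_triangle:
 assumes "f : L2_space M" "g : L2_space M"
 shows "L2_norm M (%x. f x + g x) <= L2_norm M f + L2_norm M g"
proof (rule power2_le_imp_le)
 have "(L2_norm M (%x. f x + g x))^2 = (\<integral>x. (f x)^2 + (g x)^2 + 2 * (f x * g x) \<partial>M)" unfolding L2_norm_sq by (intro lint_cong) (auto simp: power2_sum)
 also have "... = (L2_norm M f)^2 + (L2_norm M g)^2 + 2 * (\<integral>x. f x * g x \<partial>M)" using L2D[OF assms(1)] L2D[OF assms(2)] L2_mult_integrable[OF assms] by (simp add: L2_norm_sq)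
 also have "... <= (L2_norm M f + L2_norm M g)^2" using L2_cauchy_schwarz[OF assms] by (simp add: power2_sum)
 finally show "(L2_norm M (%x. f x + g x))^2 <= (L2_norm M f + L2_norm M g)^2" .
qed (simp add: L2_norm_nonneg)

lemma L2_norm_cmult: "L2_norm M (%x. c * f x) = abs c * L2_norm M f"
 by (simp add: L2_norm_def power_mult_distrib real_sqrt_mult)

lemma L2_norm_minus: "L2_norm M (%x. f x - g x) = L2_norm M (%x. g x - f x)"
 by (simp add: L2_norm_def power2_commute)

lemma L2_norm_diff_bound:
 assumes "f : L2_space M" "g : L2_space M"
 shows "abs (L2_norm M f - L2_norm M g) <= L2_norm M (%x. f x - g x)" using L2_norm_triangle[OF L2_space_diff[OF assms] assms(2)]
  L2_norm_triangle[OF L2_space_diff[OF assms(2,1)] assms(1)] L2_norm_minus[of M f g] by simp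

lemma L2_norm_sum_le:
 assumes "!!i. i : I ==> f i : L2_space M"
 shows "L2_norm M (%x. \<Sum>i\<in>I. f i x) <= (\<Sum>i\<in>I. L2_norm M (f i))" using assms
proof (induction I rule: infinite_finite_induct)
 case (insert i I)
 have "L2_norm M (%x. f i x + (\<Sum>i\<in>I. f i x)) <= L2_norm M (f i) + L2_norm M (%x. \<Sum>i\<in>I. f i x)" using insert.prems by (intro L2_norm_triangle L2_space_sum) auto
 thus ?case using insert by simp
qed (auto simp: L2_norm_def)

lemma L2_norm_mono:
 assumes "g : L2_space M" "f : borel_measurable M" "AE x in M. abs (f x) <= abs (g x)"
 shows "L2_norm M f <= L2_norm M g"
proof -
 have "f : L2_space M" by (rule L2_space_dominated[of g _ _ 1]) (use assms in auto)
 thus ?thesis unfolding L2_norm_def real_sqrt_le_iff using assms L2D by (intro integral_mono_AE) (auto elim!: eventually_mono simp: abs_le_square_iff)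
qed

lemma L2_norm_cong_AE:
 assumes "f : borel_measurable M" "g : borel_measurable M" "AE x in M. f x = g x"
 shows "L2_norm M f = L2_norm M g" unfolding L2_norm_def by (intro arg_cong[where f=sqrt] integral_cong_AE) (use assms in auto)

lemma L2_space_cong_AE:
 assumes "f : L2_space M" "g : borel_measurable M" "AE x in M. f x = g x"
 shows "g : L2_space M" by (rule L2_space_dominated[OF assms(1,2), of 1]) (use assms(3) in auto)

lemma L2_inner_tendsto:
 assumes "!!n. f n : L2_space M" "F : L2_space M" "g : L2_space M"
  and "(%n. L2_norm M (%x. f n x - F x)) ----> 0"
 shows "(%n. \<integral>x. f n x * g x \<partial>M) ----> (\<integral>x. F x * g x \<partial>M)"
proof -
 have "(%n. (\<integral>x. f n x * g x \<partial>M) - (\<integral>x. F x * g x \<partial>M)) ----> 0" proof (rule tendsto_rabs_zero_cancel, rule tendsto_sandwich[OF _ _ tendsto_const])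
  show "(%n. L2_norm M (%x. f n x - F x) * L2_norm M g) ----> 0" using tendsto_mult[OF assms(4) tendsto_const[of "L2_norm M g"]] by simp
  show "\<forall>\<^sub>F n in sequentially. abs ((\<integral>x. f n x * g x \<partial>M) - (\<integral>x. F x * g x \<partial>M)) <= L2_norm M (%x. f n x - F x) * L2_norm M g"
  proof (rule always_eventually, rule allI)
  fix n
  have "(\<integral>x. f n x * g x \<partial>M) - (\<integral>x. F x * g x \<partial>M) = (\<integral>x. (f n x - F x) * g x \<partial>M)"
  using L2_mult_integrable[OF assms(1,3)] L2_mult_integrable[OF assms(2,3)] by (simp add: left_diff_distrib)
  thus "abs ((\<integral>x. f n x * g x \<partial>M) - (\<integral>x. F x * g x \<partial>M)) <= L2_norm M (%x. f n x - F x) * L2_norm M g"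
  using L2_cauchy_schwarz[OF L2_space_diff[OF assms(1,2)] assms(3)] by simp
  qed
 qed auto
 thus ?thesis by (simp add: LIM_zero_iff)
qed

section \<open>Continuity of translations\<close>

lemma lborel_distr_plus_right: "distr lborel borel (%x. x + c) = (lborel :: 'a::euclidean_space measure)"
 using lborel_distr_plus[of c] by (simp add: add.commute[of _ c])

lemma lborel_distr_minus: "distr lborel borel (%x. c - x) = (lborel :: 'a::euclidean_space measure)"
 using lborel_affine[of "-1" c] by (simp add: density_1)

lemma nn_integral_lborel_translate:
 fixes f :: "'a::euclidean_space => ennreal"
 assumes "f : borel_fun"
 shows "(NN x. f (x + c)) = (NN x. f x)"
proof -
 have "(NN x. f x) = (\<integral>\<^sup>+x. f x \<partial>distr lborel borel (%x. x + c))" by (simp add: lborel_distr_plus_right)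
 also have "... = (NN x. f (x + c))" by (rule nn_integral_distr) (use assms in auto)
 finally show ?thesis by simp
qed

lemma integral_lborel_translate:
 fixes f :: "'a::euclidean_space => real"
 assumes "f : borel_fun"
 shows "(LBINT x. f (x + c)) = (LBINT x. f x)" "integrable lborel (%x. f (x + c)) \<longleftrightarrow> integrable lborel f"
proof -
 have "(LBINT x. f x) = (\<integral>x. f x \<partial>distr lborel borel (%x. x + c))" by (simp add: lborel_distr_plus_right)
 also have "... = (LBINT x. f (x + c))" by (rule integral_distr) (use assms in auto)
 finally show "(LBINT x. f (x + c)) = (LBINT x. f x)" by simp
 have "integrable lborel (%x. f (x + c)) \<longleftrightarrow> integrable (distr lborel borel (%x. x + c)) f" by (rule integrable_distr_eq[symmetric]) (use assms in auto)
 thus "integrable lborel (%x. f (x + c)) \<longleftrightarrow> integrable lborel f" by (simp add: lborel_distr_plus_right)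
qed

lemma integral_lborel_reflect:
 fixes f :: "'a::euclidean_space => real"
 assumes "f : borel_fun"
 shows "(LBINT x. f (c - x)) = (LBINT x. f x)" "integrable lborel (%x. f (c - x)) \<longleftrightarrow> integrable lborel f"
proof -
 have "(LBINT x. f x) = (\<integral>x. f x \<partial>distr lborel borel (%x. c - x))" by (simp add: lborel_distr_minus)
 also have "... = (LBINT x. f (c - x))" by (rule integral_distr) (use assms in auto)
 finally show "(LBINT x. f (c - x)) = (LBINT x. f x)" by simp
 have "integrable lborel (%x. f (c - x)) \<longleftrightarrow> integrable (distr lborel borel (%x. c - x)) f" by (rule integrable_distr_eq[symmetric]) (use assms in auto)
 thus "integrable lborel (%x. f (c - x)) \<longleftrightarrow> integrable lborel f" by (simp add: lborel_distr_minus)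
qed

text \<open>The modulus of continuity of \<open>f\<close> in L^1 under translation by
  \<open>h\<close>.\<close>

definition transl_diff :: "('a::euclidean_space => real) => 'a => real" where
 "transl_diff f h = (LBINT x. abs (f (x + h) - f x))"

lemma transl_diff_integrable:
 fixes f :: "'a::euclidean_space => real"
 assumes "integrable lborel f"
 shows "integrable lborel (%x. abs (f (x + h) - f x))" using assms integral_lborel_translate(2)[of f h] by auto

text \<open>Translation preserves the L^1 norm, so exchanging \<open>f\<close> for \<open>g\<close>
  costs at most twice their distance. Hence convergence of the modulus to 0 needs to be checked only
  on a class dense in L^1.\<close>

lemma transl_diff_le:
 fixes f g :: "'a::euclidean_space => real"
 assumes f: "integrable lborel f" and g: "integrable lborel g"
 shows "transl_diff f h <= transl_diff g h + 2 * (LBINT x. abs (f x - g x))"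
proof -
 let ?d = "%x. abs (f x - g x)"
 have d: "integrable lborel ?d" using f g by auto
 hence d': "integrable lborel (%x. ?d (x + h))" "(LBINT x. ?d (x + h)) = (LBINT x. ?d x)" using integral_lborel_translate[of ?d h] by auto
 have "transl_diff f h <= (LBINT x. abs (g (x + h) - g x) + (?d (x + h) + ?d x))" unfolding transl_diff_def by (intro integral_mono lintegrable_add transl_diff_integrable d d' f g) linarith
 also have "... = transl_diff g h + 2 * (LBINT x. ?d x)" using d d' transl_diff_integrable[OF g, of h] by (simp add: transl_diff_def)
 finally show ?thesis .
qed

text \<open>Since \<open>V\<close> is open, a point of \<open>V\<close> stays in \<open>V\<close>
  under small translations, so the one-sided part max(0, 1_V(x) - 1_V(x + h)) tends to 0 pointwise,
  dominated by 1_V. All translates of \<open>V\<close> have the same measure, so the full modulus is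
  twice the one-sided part.\<close>

lemma transl_diff_open:
 fixes V :: "'a::euclidean_space set"
 assumes "open V" "emeasure lborel V < \<infinity>"
 shows "(transl_diff (indicator V) \<longlongrightarrow> 0) (at 0)" unfolding tendsto_at_iff_sequentially
proof (intro allI impI)
 fix X :: "nat => 'a" assume X: "X ----> 0"
 let ?i = "indicator V :: 'a => real"
 have iV: "integrable lborel ?i" using assms by (simp add: integrable_indicator_iff)
 have ih: "integrable lborel (%x. ?i (x + h))" "(LBINT x. ?i (x + h)) = (LBINT x. ?i x)" for h using iV integral_lborel_translate[of ?i h] assms(1) by auto
 let ?m = "%h x. max 0 (?i x - ?i (x + h))"
 have "(%n. \<integral>x. ?m (X n) x \<partial>lborel) ----> (\<integral>x. 0 \<partial>(lborel :: 'a measure))" proof (rule integral_dominated_convergence[where w = "?i"])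
  show "(%x. 0) : borel_measurable lborel" "!!n. ?m (X n) : borel_measurable lborel" "integrable lborel ?i" using iV assms(1) by auto
  show "AE x in lborel. (%n. ?m (X n) x) ----> 0" proof (rule AE_I2)
  fix x :: 'a
  show "(%n. ?m (X n) x) ----> 0" proof (cases "x : V")
  case True
  have "(%n. x + X n) ----> x" using tendsto_add[OF tendsto_const X, of x] by simp
  hence "\<forall>\<^sub>F n in sequentially. x + X n : V" using topological_tendstoD assms(1) True by blast
  thus ?thesis by (intro tendsto_eventually) (auto elim!: eventually_mono simp: True)
  qed (auto simp: indicator_def)
  qed
  show "AE x in lborel. norm (?m (X n) x) <= ?i x" for n by (auto simp: indicator_def)
 qed
 moreover have "transl_diff ?i h = 2 * (LBINT x. ?m h x)" for h proof -
  have im: "integrable lborel (?m h)" proof (rule lintegrable_bound[OF iV])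
  have [measurable]: "V : sets borel" using assms(1) by simp
  show "?m h : borel_measurable lborel" by measurable
  qed (auto simp: indicator_def)
  have "transl_diff ?i h = (LBINT x. 2 * ?m h x + (?i (x + h) - ?i x))" unfolding transl_diff_def by (intro lint_cong) (auto simp: indicator_def)
  also have "... = 2 * (LBINT x. ?m h x) + ((LBINT x. ?i (x + h)) - (LBINT x. ?i x))" by (subst lint_add) (use im ih iV in auto)
  finally show ?thesis using ih by simp
 qed
 ultimately show "(transl_diff ?i \<circ> X) ----> 0" using tendsto_mult[OF tendsto_const[of "2::real"]] by (fastforce simp: comp_def)
qed

lemma tendsto_zero_by_approx:
 fixes F :: "'a => real"
 assumes "!!x. F x >= 0"
  and "!!e. e > 0 ==> EX G. (G \<longlongrightarrow> 0) A & (ALL x. F x <= G x + e)"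
 shows "(F \<longlongrightarrow> 0) A" unfolding tendsto_iff
proof (intro allI impI)
 fix e :: real assume "e > 0"
 then obtain G where G: "(G \<longlongrightarrow> 0) A" "!!x. F x <= G x + e / 2" using assms(2)[of "e / 2"] by auto
 have "e / 2 > 0" using \<open>e > 0\<close> by simp
 hence "\<forall>\<^sub>F x in A. dist (G x) 0 < e / 2" using G(1) unfolding tendsto_iff by blast
 thus "\<forall>\<^sub>F x in A. dist (F x) 0 < e" proof eventually_elim
  case (elim x)
  thus ?case using assms(1)[of x] G(2)[of x] by (simp add: dist_real_def)
 qed
qed

lemma transl_diff_nonneg: "transl_diff f h >= 0"
 by (simp add: transl_diff_def)

text \<open>Induction over integrable functions. By outer regularity a measurable set is exchanged
  for an open superset of slightly larger measure, for which the claim is known; sums and dominated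
  limits follow by approximation.\<close>

lemma transl_diff_tendsto_0:
 fixes f :: "'a::euclidean_space => real"
 assumes "integrable lborel f"
 shows "(transl_diff f \<longlongrightarrow> 0) (at 0)" using assms
proof (induction f rule: integrable_induct)
 case (base A c)
 show ?case proof (rule tendsto_zero_by_approx[OF transl_diff_nonneg])
  fix e :: real assume "e > 0"
  define e' where "e' = e / (2 * (abs c + 1))"
  have e': "e' > 0" "2 * (abs c * e') <= e" using \<open>e > 0\<close> by (auto simp: e'_def field_simps)
  obtain V where V: "open V" "A <= V" "V - A : lmeasurable" "emeasure lebesgue (V - A) < ennreal e'" using sets_lebesgue_outer_open[of A e'] base e' by auto
  have VA: "emeasure lborel (V - A) < ennreal e'" using V base by simp
  have "emeasure lborel V <= emeasure lborel A + emeasure lborel (V - A)" using base V by (metis Diff_partition borel_open emeasure_subadditive sets.Diff sets_lborel)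
  also have "... < \<infinity>" using base VA by (auto simp: ennreal_add_eq_top less_top[symmetric])
  finally have fV: "emeasure lborel V < \<infinity>" .
  let ?V = "%x. c * indicator V x"
  have iA: "integrable lborel (%x. indicator A x *\<^sub>R c)" and iV: "integrable lborel ?V" using base V(1) fV by (auto simp: integrable_indicator_iff)
  have "(LBINT x. abs (indicator A x *\<^sub>R c - ?V x)) = (LBINT x. abs c * indicator (V - A) x)" using V(2) by (intro lint_cong) (auto simp: indicator_def)
  also have "... = abs c * measure lborel (V - A)" using V(1) base by simp
  also have "... <= abs c * e'" using VA e' by (intro mult_left_mono) (auto simp: measure_def enn2real_leI)
  finally have "2 * (LBINT x. abs (indicator A x *\<^sub>R c - ?V x)) <= e" using e' by linarith
  hence "transl_diff (%x. indicator A x *\<^sub>R c) h <= transl_diff ?V h + e" for h using transl_diff_le[OF iA iV, of h] by linarith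
  moreover have "transl_diff ?V = (%h. abs c * transl_diff (indicator V) h)" by (auto simp: transl_diff_def right_diff_distrib[symmetric] abs_mult fun_eq_iff)
  hence "(transl_diff ?V \<longlongrightarrow> 0) (at 0)" using tendsto_mult[OF tendsto_const transl_diff_open[OF V(1) fV], of "abs c"] by simp
  ultimately show "EX G. (G \<longlongrightarrow> 0) (at 0) & (ALL h. transl_diff (%x. indicator A x *\<^sub>R c) h <= G h + e)" by blast
 qed
next
 case (add f g)
 have "transl_diff (%x. f x + g x) h <= transl_diff f h + transl_diff g h" for h proof -
  have "transl_diff (%x. f x + g x) h <= (LBINT x. abs (f (x + h) - f x) + abs (g (x + h) - g x))" unfolding transl_diff_def by (intro integral_mono lintegrable_add transl_diff_integrable add
  transl_diff_integrable[where f="%x. f x + g x"]) linarith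
  also have "... = transl_diff f h + transl_diff g h" unfolding transl_diff_def by (intro lint_add transl_diff_integrable add)
  finally show ?thesis .
 qed
 moreover have "((%h. transl_diff f h + transl_diff g h) \<longlongrightarrow> 0) (at 0)" using tendsto_add[OF add(3,4)] by simp
 ultimately show ?case by (intro tendsto_zero_by_approx[OF transl_diff_nonneg] exI[of _ "%h. transl_diff f h + transl_diff g h"]) (simp add: add_increasing2)
next
 case (lim f s)
 show ?case proof (rule tendsto_zero_by_approx[OF transl_diff_nonneg])
  fix e :: real assume "e > 0"
  \<comment> \<open>The approximants satisfy abs (s i x) <= 2 * abs (f x), which gives the majorant
    with the factor 3.\<close>
  have "(%i. \<integral>x. abs (f x - s i x) \<partial>lborel) ----> (\<integral>x. 0 \<partial>(lborel :: 'a measure))" proof (rule integral_dominated_convergence[where w = "%x. 3 * abs (f x)"])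
  show "AE x in lborel. (%i. abs (f x - s i x)) ----> 0" proof (intro AE_I2 tendsto_rabs_zero)
  fix x :: 'a
  have "(%i. s i x) ----> f x" by (rule lim(2)) simp
  thus "(%i. f x - s i x) ----> 0" using tendsto_diff[OF tendsto_const, of "%i. s i x" "f x" sequentially "f x"] by simp
  qed
  show "AE x in lborel. norm (abs (f x - s i x)) <= 3 * abs (f x)" for i using lim(3)[of _ i] by (intro AE_I2) (smt (verit, best) UNIV_I real_norm_def space_borel space_lborel)
  qed (use lim in auto)
  hence "(%i. \<integral>x. abs (f x - s i x) \<partial>lborel) ----> 0" by simp
  hence "\<forall>\<^sub>F i in sequentially. dist (LBINT x. abs (f x - s i x)) 0 < e / 2" using half_gt_zero[OF \<open>e > 0\<close>] unfolding tendsto_iff by blast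
  then obtain i where "dist (LBINT x. abs (f x - s i x)) 0 < e / 2" using eventually_happens by force
  hence "(LBINT x. abs (f x - s i x)) < e / 2" by (simp add: dist_real_def)
  hence "transl_diff f h <= transl_diff (s i) h + e" for h using transl_diff_le[OF lim(4) lim(1), of h i] by linarith
  thus "EX G. (G \<longlongrightarrow> 0) (at 0) & (ALL h. transl_diff f h <= G h + e)" using lim(5) by blast
 qed
qed

section \<open>Test functions and mollification\<close>

definition test_fun :: "'a::euclidean_space set => ('a => real) => bool" where
 "test_fun U phi \<longleftrightarrow> smooth_on UNIV phi & (EX K. compact K & K <= U & (ALL x. x ~: K --> phi x = 0))"

abbreviation dird :: "'a => ('a::real_normed_vector => real) => 'a => real" where "dird v f x \<equiv> frechet_derivative f (at x) v"

lemma test_fun_mono: "test_fun U phi ==> U <= V ==> test_fun V phi"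
 unfolding test_fun_def by blast

lemma test_fun_smooth: "test_fun U phi ==> smooth_on UNIV phi"
 by (simp add: test_fun_def)

lemma test_fun_continuous: "test_fun U phi ==> continuous_on UNIV phi"
 by (simp add: test_fun_def smooth_on_continuous)

lemma test_fun_measurable: "test_fun U phi ==> phi : borel_fun"
 by (simp add: borel_measurable_continuous_onI test_fun_continuous)

lemma test_fun_has_derivative: "test_fun U phi ==> (phi has_derivative frechet_derivative phi (at x)) (at x)"
 using smooth_on_has_derivative[of UNIV phi x] by (simp add: test_fun_def)

lemma dird_zero_off_closed:
 assumes "closed K" "!!y. y ~: K ==> phi y = 0" "x ~: K"
 shows "dird v phi x = 0"
proof -
 have "frechet_derivative phi (at x) = frechet_derivative (%x. 0) (at x)" by (rule frechet_derivative_cong_open(2)[of "- K"]) (use assms in auto)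
 thus ?thesis by (simp add: frechet_derivative_const)
qed

lemma test_fun_dird: "test_fun U phi ==> test_fun U (dird v phi)"
 unfolding test_fun_def using smooth_on_frechet dird_zero_off_closed compact_imp_closed by metis

lemma bounded_of_compact_support:
 fixes phi :: "'a::euclidean_space => real"
 assumes "continuous_on UNIV phi" "compact K" "!!x. x ~: K ==> phi x = 0" obtains M where "M >= 0" "!!x. abs (phi x) <= M"
proof -
 have "bounded (phi ` K)" using assms by (intro compact_imp_bounded compact_continuous_image) (auto intro: continuous_on_subset)
 then obtain B where B: "!!x. x : K ==> norm (phi x) <= B" unfolding bounded_iff by auto
 have "abs (phi x) <= max B 0" for x using B[of x] assms(3)[of x] by (cases "x : K") auto
 thus ?thesis by (intro that[of "max B 0"]) auto
qed

lemma test_fun_bounded: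
 assumes "test_fun U phi" obtains M where "M >= 0" "!!x. abs (phi x) <= M" using assms bounded_of_compact_support[OF test_fun_continuous[OF assms]] unfolding test_fun_def by metis

lemma integrable_compact_support:
 fixes phi :: "'a::euclidean_space => real"
 assumes "phi : borel_fun" "compact K" "!!x. x ~: K ==> phi x = 0" "!!x. abs (phi x) <= M"
 shows "integrable lborel phi"
proof (rule lintegrable_bound)
 show "integrable lborel (%x. M * indicator K x)" using assms(2) by (auto simp: integrable_indicator_iff emeasure_compact_finite[unfolded infinity_ennreal_def] borel_compact)
 show "AE x in lborel. norm (phi x) <= norm (M * indicator K x)" using assms(3,4) by (intro AE_I2) (auto simp: indicator_def intro: order.trans[OF _ abs_ge_self])
qed (use assms in auto)

lemma test_fun_integrable: "test_fun U phi ==> integrable lborel phi"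
 by (metis test_fun_bounded integrable_compact_support test_fun_def test_fun_measurable)

lemma dird_bound:
 assumes "!!b. b : Basis ==> abs (f' b) <= M" "linear f'" "M >= 0"
 shows "abs (f' (v::'a::euclidean_space)) <= (real DIM('a) * M) * norm v"
proof -
 have "f' v = (\<Sum>b\<in>Basis. (v \<bullet> b) * f' b)" using linear_sum[OF assms(2)] by (subst euclidean_representation[symmetric, of v])
  (simp add: linear_sum[OF assms(2)] linear_scale[OF assms(2)])
 also have "abs (...) <= (\<Sum>b\<in>(Basis::'a set). norm v * M)" by (rule order.trans[OF sum_abs], intro sum_mono) (auto simp: abs_mult intro!: mult_mono assms(1) Basis_le_norm)
 finally show ?thesis by (simp add: mult.commute mult.left_commute)
qed

lemma test_fun_dird_bound:
 assumes "test_fun U (phi :: 'a::euclidean_space => real)" obtains M where "M >= 0" "!!x v. abs (dird v phi x) <= M * norm v"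
proof -
 have "EX M. ALL x. abs (dird b phi x) <= M" for b using test_fun_bounded[OF test_fun_dird[OF assms]] by metis
 then obtain M where M: "!!b x. abs (dird b phi x) <= M b" by metis
 define m where "m = (\<Sum>b\<in>(Basis::'a set). abs (M b))"
 have "abs (dird b phi x) <= m" if "b : Basis" for b x proof -
  have "abs (M b) <= m" unfolding m_def by (rule member_le_sum) (use that in auto)
  thus ?thesis using M[of x b] by linarith
 qed
 moreover have "m >= 0" by (simp add: m_def sum_nonneg)
 moreover have "linear (%v. dird v phi x)" for x using test_fun_has_derivative[OF assms] has_derivative_linear by blast
 ultimately have "abs (dird v phi x) <= (DIM('a) * m) * norm v" for v x by (intro dird_bound) auto
 thus ?thesis using \<open>m >= 0\<close> by (intro that[of "DIM('a) * m"]) auto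
qed

lemma onorm_le_real: "(!!v. abs (f v) <= B * norm v) ==> onorm (f :: 'a::euclidean_space => real) <= B"
 by (rule onorm_le) auto

lemma test_fun_lipschitz:
 assumes "test_fun U (phi :: 'a::euclidean_space => real)" obtains L where "L >= 0" "!!x y. abs (phi x - phi y) <= L * norm (x - y)"
proof -
 obtain M where M: "M >= 0" "!!x v. abs (dird v phi x) <= M * norm v" using test_fun_dird_bound[OF assms] by blast
 have "norm (phi x - phi y) <= M * norm (x - y)" for x y by (rule differentiable_bound[of UNIV phi "%x. frechet_derivative phi (at x)"])
  (use test_fun_has_derivative[OF assms] M in "auto intro: onorm_le_real")
 thus ?thesis using M that by auto
qed

text \<open>The first derivatives are Lipschitz with one constant for all points. The resulting
  uniformity of the remainder in \<open>x\<close> is what allows the expansion to be integrated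
  against an L^1 function in \<open>conv_has_derivative\<close>.\<close>

lemma test_fun_taylor:
 assumes "test_fun U (phi :: 'a::euclidean_space => real)" obtains C where "C >= 0" "!!x h. abs (phi (x + h) - phi x - dird h phi x) <= C * (norm h)^2"
proof -
 have "EX L. ALL x y. abs (dird b phi x - dird b phi y) <= L * norm (x - y)" for b using test_fun_lipschitz[OF test_fun_dird[OF assms]] by metis
 then obtain L where L: "!!b x y. abs (dird b phi x - dird b phi y) <= L b * norm (x - y)" by metis
 define m where "m = (\<Sum>b\<in>(Basis::'a set). abs (L b))"
 have m: "m >= 0" by (simp add: m_def sum_nonneg)
 have Lb: "abs (dird b phi x - dird b phi y) <= m * norm (x - y)" if "b : Basis" for b x y proof -
  have "abs (L b) <= m" unfolding m_def by (rule member_le_sum) (use that in auto)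
  hence "L b * norm (x - y) <= m * norm (x - y)" by (intro mult_right_mono) auto
  thus ?thesis using L[of x b y] by linarith
 qed
 have lin: "linear (%v. dird v phi x - dird v phi y)" for x y using test_fun_has_derivative[OF assms] has_derivative_linear by (blast intro: linear_compose_sub)
 have diff: "abs (dird v phi x - dird v phi y) <= (DIM('a) * (m * norm (x - y))) * norm v" for v x y using dird_bound[OF Lb lin] m by simp
 have "norm (phi (x + h) - phi x - dird (x + h - x) phi x) <= norm (x + h - x) * (DIM('a) * (m * norm h))" for x h proof (rule differentiable_bound_linearization[where S = "cball x (norm h)"])
  show "x + t *\<^sub>R (x + h - x) : cball x (norm h)" if "t : {0..1}" for t using that by (auto simp: dist_norm mult_left_le_one_le)
  show "(phi has_derivative frechet_derivative phi (at y)) (at y within cball x (norm h))" for y using test_fun_has_derivative[OF assms] has_derivative_at_withinI by blast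
  show "onorm (frechet_derivative phi (at y) - frechet_derivative phi (at x)) <= DIM('a) * (m * norm h)" if "y : cball x (norm h)" for y proof (rule onorm_le_real)
  fix v :: 'a
  have "(DIM('a) * (m * norm (y - x))) * norm v <= (DIM('a) * (m * norm h)) * norm v" using that m by (intro mult_right_mono mult_left_mono) (auto simp: dist_norm norm_minus_commute)
  thus "abs ((frechet_derivative phi (at y) - frechet_derivative phi (at x)) v) <= (DIM('a) * (m * norm h)) * norm v" using diff[of y v x] unfolding minus_apply by linarith
  qed
 qed simp
 thus ?thesis using m by (intro that[of "DIM('a) * m"]) (auto simp: power2_eq_square mult_ac)
qed

lemma test_fun_add: "test_fun U f ==> test_fun U g ==> test_fun U (%x. f x + g x)"
 unfolding test_fun_def proof (elim conjE exE, intro conjI)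
 fix K L assume "compact K" "compact L" "K <= U" "L <= U" "ALL x. x ~: K --> f x = 0" "ALL x. x ~: L --> g x = 0"
 thus "EX K. compact K & K <= U & (ALL x. x ~: K --> f x + g x = 0)" by (intro exI[of _ "K \<union> L"]) auto
qed (simp add: smooth_on_add)

lemma test_fun_supportI:
 assumes "test_fun U phi" "smooth_on UNIV psi" "!!x. phi x = 0 ==> psi x = 0"
 shows "test_fun U psi" using assms unfolding test_fun_def by blast

lemma test_fun_cmult: "test_fun U f ==> test_fun U (%x. c * f x)"
 by (rule test_fun_supportI) (auto intro: smooth_on_cmult test_fun_smooth)

text \<open>\<open>f\<close> is smooth on \<open>U\<close> only, but the product vanishes on the
  open complement of the support of \<open>phi\<close>, and these two open sets cover the
  space.\<close>

lemma test_fun_mult_smooth: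
 assumes "test_fun U phi" "open U" "smooth_on U f"
 shows "test_fun U (%x. f x * phi x)"
proof -
 obtain K where K: "compact K" "K <= U" "!!x. x ~: K ==> phi x = 0" using assms(1) by (auto simp: test_fun_def)
 have "smooth_on U (%x. f x * phi x)" using assms smooth_on_subset[OF test_fun_smooth[OF assms(1)]] by (intro smooth_on_mult) auto
 moreover have "smooth_on (- K) (%x. f x * phi x)" by (rule smooth_on_cong[OF _ smooth_on_const[of _ 0]]) (use K compact_imp_closed in auto)
 ultimately have "smooth_on (U \<union> - K) (%x. f x * phi x)" using K assms(2) by (intro smooth_on_union) (auto simp: compact_imp_closed open_Compl)
 moreover have "U \<union> - K = UNIV" using K by auto
 ultimately show ?thesis unfolding test_fun_def using K by auto
qed

lemma test_fun_reflect:
 fixes phi :: "'a::euclidean_space => real"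
 assumes "test_fun UNIV phi"
 shows "test_fun UNIV (%y. phi (x - y))" "dird v (%y. phi (x - y)) y = - dird v phi (x - y)"
proof -
 have *: "((%y. phi (x - y)) has_derivative (%v. - dird v phi (x - y))) (at y)" if "test_fun UNIV phi" for phi and y :: 'a proof -
  have "((%y. x - y) has_derivative (%v. - v)) (at y)" by (auto intro!: derivative_eq_intros)
  from has_derivative_compose[OF this test_fun_has_derivative[OF that]]
  have "((%y. phi (x - y)) has_derivative (%v. dird (- v) phi (x - y))) (at y)" .
  moreover have "dird (- v) phi z = - dird v phi z" for v z using test_fun_has_derivative[OF that] has_derivative_linear linear_neg by blast
  ultimately show ?thesis by simp
 qed
 show "dird v (%y. phi (x - y)) y = - dird v phi (x - y)" using frechet_derivative_at[OF *[OF assms]] by metis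
 have "smooth_on UNIV (%y. phi (x - y))" proof (rule smooth_on_coinduct[where P = "%g. EX psi. test_fun UNIV psi & g = (%y. psi (x - y))"])
  show "EX psi. test_fun UNIV psi & (%y. phi (x - y)) = (%y. psi (x - y))" using assms by auto
 next
  fix f :: "'a => real" and v
  assume "EX psi. test_fun UNIV psi & f = (%y. psi (x - y))"
  then obtain psi where psi: "test_fun UNIV psi" "f = (%y. psi (x - y))" by auto
  show "f differentiable (at y)" for y using *[OF psi(1)] psi(2) differentiableI by blast
  have "dird v f y = - 1 * dird v psi (x - y)" for y using frechet_derivative_at[OF *[OF psi(1)]] psi(2) by (metis mult_minus1)
  thus "EX psi. test_fun UNIV psi & dird v f = (%y. psi (x - y))" using test_fun_cmult[OF test_fun_dird[OF psi(1)], of "-1" v] by (intro exI[of _ "%z. - 1 * dird v psi z"]) auto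
 qed
 moreover obtain K where K: "compact K" "!!x. x ~: K ==> phi x = 0" using assms by (auto simp: test_fun_def)
 have "compact ((%y. x - y) ` K)" by (intro compact_continuous_image K(1)) (auto intro!: continuous_intros)
 moreover have "phi (x - y) = 0" if "y ~: (%y. x - y) ` K" for y proof (rule K(2))
  show "x - y ~: K" using that image_eqI[of y "%y. x - y" "x - y" K] by auto
 qed
 ultimately show "test_fun UNIV (%y. phi (x - y))" unfolding test_fun_def by blast
qed

text \<open>The kernel is a radial bump.\<close>

lemma mollifier_exists:
 assumes "eps > 0"
 shows "\<exists>k::'a::euclidean_space => real. test_fun (cball 0 eps) k & (ALL x. k x >= 0) & (LBINT x. k x) = 1"
proof -
 define b where "b x = bump_deriv 0 (1 - (1 / eps^2) * (x \<bullet> x))" for x :: 'a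
 have supp: "b x = 0" if "x ~: cball 0 eps" for x proof -
  have "eps^2 <= (norm x)^2" using that assms by (intro power_mono) auto
  hence "1 - (1 / eps^2) * (x \<bullet> x) <= 0" using assms by (simp add: power2_norm_eq_inner[symmetric] field_simps)
  thus ?thesis by (simp add: b_def bump_deriv_0)
 qed
 have tb: "test_fun (cball 0 eps) b" unfolding test_fun_def b_def[abs_def] using smooth_on_bump[of 1 "1 / eps^2"] supp[unfolded b_def] by (auto intro!: exI[of _ "cball 0 eps"])
 have nonneg: "b x >= 0" for x by (simp add: b_def bump_deriv_0)
 have "(LBINT x. b x) ~= 0" proof
  assume "(LBINT x. b x) = 0"
  hence "AE x in lborel. b x = 0" using integral_nonneg_eq_0_iff_AE[OF test_fun_integrable[OF tb]] nonneg by auto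
  moreover have "b x ~= 0" if "x : ball 0 eps" for x proof -
  have "(norm x)^2 < eps^2" using that assms by (intro power_strict_mono) auto
  hence "1 - (1 / eps^2) * (x \<bullet> x) > 0" using assms by (simp add: power2_norm_eq_inner[symmetric] field_simps)
  thus ?thesis by (simp add: b_def bump_deriv_0)
  qed
  ultimately have "AE x in lborel. x ~: ball (0::'a) eps" by (auto elim!: eventually_mono)
  hence "emeasure lborel (ball (0::'a) eps) = 0" by (subst (asm) AE_iff_measurable[where N = "ball 0 eps"]) auto
  moreover have "ball (0::'a) eps ~= {}" using assms by simp
  ultimately show False using open_not_negligible[OF open_ball, of "0::'a" eps] by (auto simp: negligible_iff_null_sets intro!: null_sets_completionI)
 qed
 moreover have "(LBINT x. b x) >= 0" using nonneg by simp
 ultimately have c: "(LBINT x. b x) > 0" by linarith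
 show ?thesis by (rule exI[of _ "%x. (1 / (LBINT x. b x)) * b x"]) (use c nonneg test_fun_cmult[OF tb, of "1 / (LBINT x. b x)"] in auto)
qed

definition kern :: "real => 'a::euclidean_space => real" where
 "kern eps = (SOME k. test_fun (cball 0 eps) k & (ALL x. k x >= 0) & (LBINT x. k x) = 1)"

lemma kern:
 assumes "eps > 0"
 shows "test_fun (cball 0 eps) (kern eps :: 'a::euclidean_space => real)" "(kern eps :: 'a => real) x >= 0" "(\<integral>x. kern eps x \<partial>(lborel :: 'a measure)) = 1"
 using someI_ex[OF mollifier_exists[OF assms]] unfolding kern_def by auto

lemma kern_zero: "eps > 0 ==> eps < norm x ==> kern eps x = 0"
 using kern(1)[of eps] by (force simp: test_fun_def)

lemma kern_test_fun: "eps > 0 ==> test_fun UNIV (kern eps)"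
 using kern(1) test_fun_mono by blast

definition conv :: "('a::euclidean_space => real) => ('a => real) => 'a => real" where
 "conv f k x = (LBINT y. f y * k (x - y))"

lemma conv_integrable:
 fixes f :: "'a::euclidean_space => real"
 assumes "integrable lborel f" "test_fun UNIV k"
 shows "integrable lborel (%y. f y * k (x - y))"
proof -
 obtain M where M: "!!x. abs (k x) <= M" "M >= 0" using test_fun_bounded[OF assms(2)] by metis
 have [measurable]: "f : borel_fun" "k : borel_fun" using assms test_fun_measurable by auto
 show ?thesis proof (rule lintegrable_bound)
  show "integrable lborel (%y. M * f y)" using assms by simp
  show "AE y in lborel. norm (f y * k (x - y)) <= norm (M * f y)" using M by (intro AE_I2) (auto simp: abs_mult mult.commute[of M] intro!: mult_left_mono)
 qed measurable
qed

text \<open>The quadratic Taylor bound for \<open>k\<close> is uniform in the base point, so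
  integrating it against abs (f y) yields the remainder of the convolution; integrability of
  \<open>f\<close> is enough for this.\<close>

lemma conv_has_derivative:
 fixes f :: "'a::euclidean_space => real"
 assumes f: "integrable lborel f" and k: "test_fun UNIV k"
 shows "(conv f k has_derivative (%v. conv f (dird v k) x)) (at x)"
proof -
 obtain C where C: "C >= 0" "!!x h. abs (k (x + h) - k x - dird h k x) <= C * (norm h)^2" using test_fun_taylor[OF k] by blast
 have lk: "linear (%v. dird v k z)" for z using test_fun_has_derivative[OF k] has_derivative_linear by blast
 have int: "integrable lborel (%y. f y * dird v k (x - y))" for v x by (intro conv_integrable f test_fun_dird k)
 let ?N = "\<integral>y. abs (f y) \<partial>lborel"
 have lin: "linear (%v. conv f (dird v k) x)" unfolding conv_def by (rule linearI) (use int in "simp_all add: linear_add[OF lk] linear_scale[OF lk] distrib_left mult.left_commute")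
 have est: "abs (conv f k y - conv f k x - conv f (dird (y - x) k) x) <= C * ?N * (norm (y - x))^2" for y proof -
  define r where "r z = k (y - z) - k (x - z) - dird (y - x) k (x - z)" for z
  have r: "abs (r z) <= C * (norm (y - x))^2" for z using C(2)[of "x - z" "y - x"] by (simp add: r_def algebra_simps)
  have "conv f k y - conv f k x - conv f (dird (y - x) k) x = (LBINT z. f z * r z)" unfolding conv_def r_def right_diff_distrib
  using conv_integrable[OF f k, of x] conv_integrable[OF f k, of y] int[of x "y - x"] by simp
  also have "abs (...) <= (LBINT z. abs (f z * r z))" by (rule integral_abs_bound)
  also have "... <= (LBINT z. abs (f z) * (C * (norm (y - x))^2))" proof (rule integral_mono')
  show "integrable lborel (%z. abs (f z) * (C * (norm (y - x))^2))" using f by simp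
  show "abs (f z * r z) <= abs (f z) * (C * (norm (y - x))^2)" for z unfolding abs_mult by (rule mult_left_mono[OF r]) simp
  show "0 <= abs (f z) * (C * (norm (y - x))^2)" for z using C(1) by simp
  qed
  also have "... = C * ?N * (norm (y - x))^2" by simp
  finally show ?thesis .
 qed
 show ?thesis unfolding has_derivative_iff_norm proof
  show "bounded_linear (%v. conv f (dird v k) x)" using lin linear_conv_bounded_linear by blast
  have "((%y. C * ?N * norm (y - x)) \<longlongrightarrow> C * ?N * norm (x - x)) (at x)" by (intro tendsto_intros)
  hence lim: "((%y. C * ?N * norm (y - x)) \<longlongrightarrow> 0) (at x)" by simp
  show "((%y. norm (conv f k y - conv f k x - conv f (dird (y - x) k) x) / norm (y - x)) \<longlongrightarrow> 0) (at x)" proof (rule tendsto_sandwich[OF _ _ tendsto_const lim])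
  show "\<forall>\<^sub>F y in at x. norm (conv f k y - conv f k x - conv f (dird (y - x) k) x) / norm (y - x) <= C * ?N * norm (y - x)" proof (rule always_eventually, rule allI)
  fix y
  show "norm (conv f k y - conv f k x - conv f (dird (y - x) k) x) / norm (y - x) <= C * ?N * norm (y - x)" using est[of y] by (cases "y = x") (auto simp: field_simps power2_eq_square)
  qed
  qed auto
 qed
qed

lemma dird_conv:
 assumes "integrable lborel f" "test_fun UNIV k"
 shows "dird v (conv f k) = conv f (dird v k)" by (rule ext) (simp only: frechet_derivative_at[OF conv_has_derivative[OF assms], symmetric])

lemma smooth_on_conv:
 assumes "integrable lborel f" "test_fun UNIV k"
 shows "smooth_on S (conv f k)"
proof (rule smooth_on_coinduct[where P = "%g. EX k. test_fun UNIV k & g = conv f k"])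
 show "EX k'. test_fun UNIV k' & conv f k = conv f k'" using assms by auto
next
 fix g v assume "EX k. test_fun UNIV k & g = conv f k"
 then obtain k where k: "test_fun UNIV k" "g = conv f k" by auto
 show "g differentiable (at x)" for x using conv_has_derivative[OF assms(1) k(1)] k(2) differentiableI by blast
 show "EX k. test_fun UNIV k & dird v g = conv f k" using dird_conv[OF assms(1) k(1)] k test_fun_dird by blast
qed

lemma conv_swap:
 assumes "integrable lborel f" "test_fun UNIV k"
 shows "conv f k x = (LBINT y. f (x - y) * k y)"
proof -
 have [measurable]: "f : borel_fun" "k : borel_fun" using assms test_fun_measurable by auto
 have "(%y. f (x - y) * k y) : borel_fun" by measurable
 from integral_lborel_reflect(1)[OF this, of x] show ?thesis by (simp add: conv_def)
qed

text \<open>By Tonelli the integral over \<open>x\<close> comes first and yields the translation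
  modulus at - y, which the kernel of mass one averages over norm y <= eps. The L^1 and the L^2
  convergence of mollifications both rest on this bound.\<close>

lemma mollify_double_integral:
 fixes G :: "'a::euclidean_space => real"
 assumes G: "integrable lborel G" and eps: "eps > 0" and e: "e >= 0"
  and T: "!!h. norm h <= eps ==> transl_diff G h <= e"
 shows "(NN x. \<integral>\<^sup>+y. ennreal (abs (G (x - y) - G x) * kern eps y) \<partial>lborel) <= ennreal e"
proof -
 have [measurable]: "G : borel_fun" "(kern eps :: 'a => real) : borel_fun" using G test_fun_measurable[OF kern(1)[OF eps, where 'a='a]] by auto
 have "(NN x. \<integral>\<^sup>+y. ennreal (abs (G (x - y) - G x) * kern eps y) \<partial>lborel) = (NN y. \<integral>\<^sup>+x. ennreal (abs (G (x - y) - G x) * kern eps y) \<partial>lborel)"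
  by (rule lborel_pair.Fubini'[symmetric]) measurable
 also have "... <= (\<integral>\<^sup>+y. ennreal (e * kern eps y) \<partial>(lborel :: 'a measure))" proof (rule nn_integral_mono)
  fix y :: 'a
  have "(NN x. ennreal (abs (G (x - y) - G x) * kern eps y)) = (NN x. ennreal (abs (G (x + (- y)) - G x))) * ennreal (kern eps y)"
  using kern(2)[OF eps, where 'a='a] by (subst nn_integral_multc[symmetric]) (auto simp: ennreal_mult)
  also have "... = ennreal (transl_diff G (- y) * kern eps y)" using nn_integral_eq_integral[OF transl_diff_integrable[OF G, of "- y"]] kern(2)[OF eps, of y]
  by (simp add: transl_diff_def ennreal_mult)
  also have "... <= ennreal (e * kern eps y)" proof (cases "norm y <= eps")
  case True
  thus ?thesis using T[of "- y"] kern(2)[OF eps, of y] by (intro ennreal_leI mult_right_mono) auto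
  next
  case False
  thus ?thesis using kern_zero[OF eps, of y] by simp
  qed
  finally show "(NN x. ennreal (abs (G (x - y) - G x) * kern eps y)) <= ennreal (e * kern eps y)" .
 qed
 also have "... = ennreal e" using nn_integral_eq_integral[OF test_fun_integrable[OF kern(1)[OF eps, where 'a='a]]] kern(2,3)[OF eps, where 'a='a] e by (simp add: ennreal_mult nn_integral_cmult)
 finally show ?thesis .
qed

lemma conv_measurable:
 assumes "integrable lborel f" "test_fun UNIV k"
 shows "conv f k : borel_fun" using smooth_on_continuous[OF smooth_on_conv[OF assms]] by (rule borel_measurable_continuous_onI)

lemma conv_kern_diff:
 fixes f :: "'a::euclidean_space => real"
 assumes f: "integrable lborel f" and eps: "eps > 0"
 shows "integrable lborel (%y. (f (x - y) - f x) * kern eps y)" "conv f (kern eps) x - f x = (LBINT y. (f (x - y) - f x) * kern eps y)"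
proof -
 have [measurable]: "f : borel_fun" "(kern eps :: 'a => real) : borel_fun" using f test_fun_measurable[OF kern(1)[OF eps, where 'a='a]] by auto
 have "(%y. f y * kern eps (x - y)) : borel_fun" by measurable
 from integral_lborel_reflect(2)[OF this, of x] conv_integrable[OF f kern_test_fun[OF eps], of x]
 have 1: "integrable lborel (%y. f (x - y) * kern eps y)" by simp
 have 2: "integrable lborel (%y::'a. f x * kern eps y)" using test_fun_integrable[OF kern(1)[OF eps, where 'a='a]] by simp
 show "integrable lborel (%y. (f (x - y) - f x) * kern eps y)" using lintegrable_diff[OF 1 2] by (simp add: left_diff_distrib)
 show "conv f (kern eps) x - f x = (LBINT y. (f (x - y) - f x) * kern eps y)" using lint_diff[OF 1 2] kern(3)[OF eps, where 'a='a]
  by (simp add: left_diff_distrib conv_swap[OF f kern_test_fun[OF eps]])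
qed

lemma transl_diff_small:
 fixes f :: "'a::euclidean_space => real"
 assumes "integrable lborel f" "e > 0" obtains d where "d > 0" "!!h. norm h < d ==> transl_diff f h < e"
proof -
 have "\<forall>\<^sub>F h in at 0. transl_diff f h < e" using order_tendstoD(2)[OF transl_diff_tendsto_0[OF assms(1)] assms(2)] .
 then obtain d where d: "d > 0" "!!h. h ~= 0 ==> dist h 0 < d ==> transl_diff f h < e" unfolding eventually_at by auto
 have "transl_diff f h < e" if "norm h < d" for h using d(2)[of h] that assms(2) by (cases "h = 0") (auto simp: transl_diff_def)
 thus ?thesis using d(1) that by blast
qed

lemma mollify_L1:
 fixes f :: "'a::euclidean_space => real"
 assumes f: "integrable lborel f" and "e > 0"
 shows "\<exists>d>0. ALL eps. 0 < eps & eps < d --> (NN x. ennreal (abs (conv f (kern eps) x - f x))) <= ennreal e"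
proof -
 obtain d where d: "d > 0" "!!h. norm h < d ==> transl_diff f h < e" using transl_diff_small[OF assms] by blast
 have "(NN x. ennreal (abs (conv f (kern eps) x - f x))) <= ennreal e" if eps: "0 < eps" "eps < d" for eps proof -
  have "ennreal (abs (conv f (kern eps) x - f x)) <= (NN y. ennreal (abs (f (x - y) - f x) * kern eps y))" for x proof -
  have "abs (conv f (kern eps) x - f x) <= (LBINT y. abs ((f (x - y) - f x) * kern eps y))" unfolding conv_kern_diff(2)[OF f eps(1)] by (rule integral_abs_bound)
  also have "... = (LBINT y. abs (f (x - y) - f x) * kern eps y)" using kern(2)[OF eps(1), where 'a='a] by (simp add: abs_mult)
  finally have "ennreal (abs (conv f (kern eps) x - f x)) <= ennreal ..." by (rule ennreal_leI)
  also have "... = (NN y. ennreal (abs (f (x - y) - f x) * kern eps y))" using integrable_abs[OF conv_kern_diff(1)[OF f eps(1), of x]] kern(2)[OF eps(1), where 'a='a]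
  by (intro nn_integral_eq_integral[symmetric]) (auto simp: abs_mult)
  finally show ?thesis .
  qed
  hence "(NN x. ennreal (abs (conv f (kern eps) x - f x))) <= (NN x. \<integral>\<^sup>+y. ennreal (abs (f (x - y) - f x) * kern eps y) \<partial>lborel)" by (intro nn_integral_mono)
  also have "... <= ennreal e" using eps d(2) \<open>e > 0\<close> by (intro mollify_double_integral[OF f]) (auto intro: less_imp_le)
  finally show ?thesis .
 qed
 thus ?thesis using d(1) by blast
qed

text \<open>The function a |a| grows like a square but keeps the sign, so its L^1 differences
  control squared differences. For equal signs (a - b)^2 is below the difference of the squares; for
  opposite signs it is at most twice their sum, and the sum is then what the right side
  contains.\<close>

lemma square_diff_le: "(a - b)^2 <= 2 * abs (a * abs a - b * abs b)" for a b :: real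
proof -
 have main: "(a - b)^2 <= 2 * abs (a * abs a - b * abs b)" if "abs b <= abs a" "a >= 0" for a b :: real proof (cases "b >= 0")
  case True
  have "0 <= (a - b) * (a + 3 * b)" using that True by (intro mult_nonneg_nonneg) auto
  hence "(a - b)^2 <= 2 * (a * a - b * b)" by (simp add: power2_eq_square algebra_simps)
  moreover have "b * b <= a * a" using that True by (intro mult_mono) auto
  ultimately show ?thesis using that True by simp
 next
  case False
  have "0 <= (a + b)^2" by simp
  hence "(a - b)^2 <= 2 * (a * a + b * b)" by (simp add: power2_eq_square algebra_simps)
  thus ?thesis using that False by simp
 qed
 have sym: "abs (y * abs y - x * abs x) = abs (x * abs x - y * abs y)" for x y :: real by (rule abs_minus_commute)
 have main': "(a - b)^2 <= 2 * abs (a * abs a - b * abs b)" if "abs b <= abs a" for a b :: real proof (cases "a >= 0")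
  case True
  thus ?thesis using main that by blast
 next
  case False
  have "- a - - b = b - a" "- a * abs (- a) - - b * abs (- b) = b * abs b - a * abs a" by simp_all
  thus ?thesis using main[of "- b" "- a"] that False sym[of b a] by (simp only: power2_commute[of b a]) simp
 qed
 show ?thesis proof (cases "abs b <= abs a")
  case True
  thus ?thesis by (rule main')
 next
  case False
  thus ?thesis using main'[of a b] by (simp add: power2_commute[of b a] sym[of b a])
 qed
qed

lemma integrable_mult_bounded:
 fixes f g :: "'a => real"
 assumes "integrable M f" "g : borel_measurable M" "AE x in M. abs (g x) <= B"
 shows "integrable M (%x. f x * g x)"
proof (rule lintegrable_bound)
 show "integrable M (%x. B * f x)" using assms by simp
 show "AE x in M. norm (f x * g x) <= norm (B * f x)" using assms(3) proof eventually_elim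
  case (elim x)
  have "abs (f x) * abs (g x) <= abs (f x) * abs B" using elim by (intro mult_left_mono) auto
  thus ?case by (simp add: abs_mult mult.commute)
 qed
qed (use assms in measurable)

text \<open>Jensen's inequality and \<open>square_diff_le\<close> reduce this to the \<open>L\<^sup>1\<close> case for \<open>f \<bar>f\<bar>\<close>.\<close>

lemma mollify_L2:
 fixes f :: "'a::euclidean_space => real"
 assumes f: "integrable lborel f" and f2: "f : L2" and "e > 0"
 shows "\<exists>d>0. ALL eps. 0 < eps & eps < d --> conv f (kern eps) : L2 & nrm2 (%x. conv f (kern eps) x - f x) <= e"
proof -
 define F where "F x = f x * abs (f x)" for x
 have [measurable]: "f : borel_fun" using f by auto
 have F: "integrable lborel F" by (rule lintegrable_bound[OF L2D(2)[OF f2]]) (auto simp: F_def[abs_def] power2_eq_square abs_mult)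
 \<comment> \<open>The factor 2 in \<open>square_diff_le\<close> and the square in the norm turn the
   tolerance e^2 / 2 for \<open>F\<close> into e for \<open>f\<close>.\<close>
 define e' where "e' = e^2 / 2"
 have "e' > 0" using \<open>e > 0\<close> by (simp add: e'_def)
 then obtain d where d: "d > 0" "!!h. norm h < d ==> transl_diff F h < e'" using transl_diff_small[OF F] by blast
 have "conv f (kern eps) : L2 & nrm2 (%x. conv f (kern eps) x - f x) <= e" if eps: "0 < eps" "eps < d" for eps proof -
  let ?k = "kern eps :: 'a => real"
  note k = kern[OF eps(1), where 'a = 'a]
  obtain M where M: "!!x. abs (?k x) <= M" using test_fun_bounded[OF k(1)] by metis
  have [measurable]: "?k : borel_fun" "conv f ?k : borel_fun" using test_fun_measurable[OF k(1)] conv_measurable[OF f kern_test_fun[OF eps(1)]] by auto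
  have pt: "ennreal ((conv f ?k x - f x)^2) <= 2 * (NN y. ennreal (abs (F (x - y) - F x) * ?k y))" for x proof -
  let ?g = "%y. f (x - y) - f x"
  define c where "c = (LBINT y. ?g y * ?k y)"
  have Fk: "integrable lborel (%y. abs (F (x - y) - F x) * ?k y)" using integrable_abs[OF conv_kern_diff(1)[OF F eps(1), of x]] k(2) by (simp add: abs_mult)
  have ig: "integrable lborel (%y. ?g y * ?k y)" by (rule conv_kern_diff(1)[OF f eps(1)])
  have ik: "integrable lborel ?k" by (rule test_fun_integrable[OF k(1)])
  have sq: "(?g y)^2 * ?k y <= 2 * (abs (F (x - y) - F x) * ?k y)" for y using mult_right_mono[OF square_diff_le[of "f (x - y)" "f x"] k(2)[of y]] by (simp add: F_def mult.assoc)
  have ig2: "integrable lborel (%y. (?g y)^2 * ?k y)" by (rule lintegrable_bound[OF integrable_mult_right[OF Fk, of 2]]) (use sq k(2) in "auto simp: abs_mult intro!: AE_I2")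
  have sq_expand: "(u - c)^2 * w = u^2 * w - (2 * c) * (u * w) + c^2 * w" for u w by (simp add: power2_diff algebra_simps)
  \<comment> \<open>Jensen's inequality as the nonnegativity of a variance: the kernel has mass one,
    and \<open>c\<close> is the mean of \<open>?g\<close> under it.\<close>
  have "0 <= (LBINT y. (?g y - c)^2 * ?k y)" using k(2) by simp
  also have "... = (LBINT y. (?g y)^2 * ?k y - (2 * c) * (?g y * ?k y) + c^2 * ?k y)" by (intro lint_cong refl sq_expand)
  also have "... = (LBINT y. (?g y)^2 * ?k y) - (2 * c) * c + c^2" using ig ig2 ik k(3) by (simp add: c_def)
  finally have "c^2 <= (LBINT y. (?g y)^2 * ?k y)" by (simp add: power2_eq_square)
  also have "... <= (LBINT y. 2 * (abs (F (x - y) - F x) * ?k y))" by (intro integral_mono ig2 integrable_mult_right Fk sq)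
  finally have "(conv f ?k x - f x)^2 <= 2 * (LBINT y. abs (F (x - y) - F x) * ?k y)" by (simp add: c_def conv_kern_diff(2)[OF f eps(1)])
  hence "ennreal ((conv f ?k x - f x)^2) <= ennreal (2 * (LBINT y. abs (F (x - y) - F x) * ?k y))" by (rule ennreal_leI)
  also have "... = 2 * (NN y. ennreal (abs (F (x - y) - F x) * ?k y))" using nn_integral_eq_integral[OF Fk] k(2) by (simp add: ennreal_mult)
  finally show ?thesis .
  qed
  have [measurable]: "F : borel_fun" using F by auto
  have "(NN x. ennreal ((conv f ?k x - f x)^2)) <= (NN x. 2 * (NN y. ennreal (abs (F (x - y) - F x) * ?k y)))" by (intro nn_integral_mono pt)
  also have "... = 2 * (NN x. (NN y. ennreal (abs (F (x - y) - F x) * ?k y)))" by (rule nn_integral_cmult) measurable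
  also have "... <= 2 * ennreal e'" using eps d(2) \<open>e' > 0\<close> by (intro mult_left_mono mollify_double_integral[OF F]) (auto intro: less_imp_le)
  also have "... = ennreal (e^2)" by (simp add: e'_def ennreal_mult'[symmetric] flip: ennreal_numeral)
  finally have nn: "(NN x. ennreal ((conv f ?k x - f x)^2)) <= ennreal (e^2)" .
  hence int: "integrable lborel (%x. (conv f ?k x - f x)^2)" by (intro integrableI_bounded) (auto intro: le_less_trans)
  hence L: "(%x. conv f ?k x - f x) : L2" by (intro L2_spaceI) auto
  have "(LBINT x. (conv f ?k x - f x)^2) <= e^2" using nn nn_integral_eq_integral[OF int] by simp
  hence "nrm2 (%x. conv f (kern eps) x - f x) <= e" using \<open>e > 0\<close> by (simp add: L2_norm_def real_le_lsqrt real_sqrt_le_iff real_sqrt_le_mono[of _ "e^2", simplified])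
  moreover have "conv f ?k : L2" using L2_space_add[OF L f2] by simp
  ultimately show ?thesis by simp
 qed
 thus ?thesis using d(1) by blast
qed

section \<open>Weak directional derivatives\<close>

definition loc_int :: "'a::euclidean_space set => ('a => real) => bool" where
 "loc_int U u \<longleftrightarrow> (ALL K. compact K & K <= U --> integrable lborel (%x. indicator K x * u x))"

definition weak_dird :: "'a::euclidean_space set => 'a => ('a => real) => ('a => real) => bool" where
 "weak_dird U e u G \<longleftrightarrow> loc_int U u & loc_int U G & (ALL phi. test_fun U phi --> (LBINT x. u x * dird e phi x) = - (LBINT x. G x * phi x))"

lemma loc_int_integrable:
 assumes "integrable lborel u" shows "loc_int U u" unfolding loc_int_def
proof (intro allI impI)
 fix K assume "compact K & K <= U"
 hence "(indicator K :: 'a => real) : borel_measurable lborel" by (intro borel_measurable_indicator) (simp add: borel_compact)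
 hence "integrable lborel (%x. u x * indicator K x)" by (intro integrable_mult_bounded[OF assms, where B = 1]) auto
 thus "integrable lborel (%x. indicator K x * u x)" by (simp add: mult.commute)
qed

lemma loc_int_test_fun:
 assumes "loc_int U u" "test_fun U phi"
 shows "integrable lborel (%x. u x * phi x)"
proof -
 obtain K where K: "compact K" "K <= U" "!!x. x ~: K ==> phi x = 0" using assms(2) by (auto simp: test_fun_def)
 obtain M where "!!x. abs (phi x) <= M" using test_fun_bounded[OF assms(2)] by metis
 hence "integrable lborel (%x. (indicator K x * u x) * phi x)" using assms K test_fun_measurable[OF assms(2)] by (intro integrable_mult_bounded[where B = M and g = phi]) (auto simp: loc_int_def)
 also have "(%x. (indicator K x * u x) * phi x) = (%x. u x * phi x)" using K(3) by (auto simp: indicator_def fun_eq_iff)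
 finally show ?thesis .
qed

lemma weak_dirdD:
 assumes "weak_dird U e u G" "test_fun U phi"
 shows "(LBINT x. u x * dird e phi x) = - (LBINT x. G x * phi x)" "integrable lborel (%x. u x * phi x)" "integrable lborel (%x. u x * dird v phi x)" "integrable lborel (%x. G x * phi x)"
 using assms loc_int_test_fun test_fun_dird unfolding weak_dird_def by blast+

lemma weak_dird_add:
 assumes "weak_dird U e u G" "weak_dird U e v H"
 shows "weak_dird U e (%x. u x + v x) (%x. G x + H x)" unfolding weak_dird_def
proof (intro conjI allI impI)
 show "loc_int U (%x. u x + v x)" "loc_int U (%x. G x + H x)" using assms by (auto simp: weak_dird_def loc_int_def distrib_left)
 fix phi assume t: "test_fun U phi"
 show "(LBINT x. (u x + v x) * dird e phi x) = - (LBINT x. (G x + H x) * phi x)" using weak_dirdD[OF assms(1) t] weak_dirdD[OF assms(2) t] by (simp add: distrib_right)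
qed

lemma weak_dird_cmult:
 assumes "weak_dird U e u G"
 shows "weak_dird U e (%x. c * u x) (%x. c * G x)" unfolding weak_dird_def
proof (intro conjI allI impI)
 show "loc_int U (%x. c * u x)" "loc_int U (%x. c * G x)" using assms by (auto simp: weak_dird_def loc_int_def mult.left_commute[of _ c])
 fix phi assume t: "test_fun U phi"
 show "(LBINT x. (c * u x) * dird e phi x) = - (LBINT x. (c * G x) * phi x)" using weak_dirdD[OF assms(1) t] by (simp add: mult.assoc)
qed

text \<open>The fundamental lemma of the calculus of variations: near a point, \<open>G\<close> is the \<open>L\<^sup>1\<close> limit of
 its mollifications, which vanish.\<close>

lemma loc_int_zero_AE_ball:
 fixes G :: "'a::euclidean_space => real"
 assumes G: "loc_int U G" and z: "!!phi. test_fun U phi ==> (LBINT x. G x * phi x) = 0"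
  and r: "r > 0" "cball x0 (2 * r) <= U"
 shows "AE x in lborel. x : ball x0 r --> G x = 0"
proof -
 define f where "f x = indicator (cball x0 (2 * r)) x * G x" for x
 have f: "integrable lborel f" using G r by (auto simp: loc_int_def f_def[abs_def])
 have [measurable]: "f : borel_fun" using f by auto
 have "(NN x. ennreal (abs (f x)) * indicator (ball x0 r) x) <= ennreal e" if "e > 0" for e :: real proof -
  obtain d where d: "d > 0" "!!eps. 0 < eps ==> eps < d ==> (NN x. ennreal (abs (conv f (kern eps) x - f x))) <= ennreal e" using mollify_L1[OF f \<open>e > 0\<close>] by blast
  \<comment> \<open>With eps <= r a kernel centred in \<open>ball x0 r\<close> is supported in
    \<open>cball x0 (2 * r)\<close>. There \<open>f\<close> agrees with \<open>G\<close>, and the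
    kernel is an admissible test function of \<open>U\<close>.\<close>
  define eps where "eps = min (d / 2) r"
  have eps: "eps > 0" "eps < d" "eps <= r" using d(1) r(1) by (auto simp: eps_def min_def)
  have "conv f (kern eps) x = 0" if x: "x : ball x0 r" for x proof -
  let ?phi = "%y. kern eps (x - y)"
  have supp: "?phi y = 0" if "y ~: cball x eps" for y using that by (intro kern_zero eps) (simp add: dist_norm)
  have sub: "cball x eps <= cball x0 (2 * r)" proof
  fix y assume "y : cball x eps"
  thus "y : cball x0 (2 * r)" using x eps(3) dist_triangle[of x0 y x] by simp
  qed
  have t: "test_fun U ?phi" unfolding test_fun_def using test_fun_smooth[OF test_fun_reflect(1)[OF kern_test_fun[OF eps(1)]]] supp sub r(2) by (auto intro!: exI[of _ "cball x eps"])
  have "conv f (kern eps) x = (LBINT y. G y * ?phi y)" unfolding conv_def f_def using supp sub by (intro lint_cong refl) (fastforce simp: indicator_def)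
  thus ?thesis using z[OF t] by simp
  qed
  hence "(NN x. ennreal (abs (f x)) * indicator (ball x0 r) x) <= (NN x. ennreal (abs (conv f (kern eps) x - f x)))" by (intro nn_integral_mono) (auto simp: indicator_def)
  also have "... <= ennreal e" using d(2) eps by blast
  finally show ?thesis .
 qed
 hence "(NN x. ennreal (abs (f x)) * indicator (ball x0 r) x) <= 0 + ennreal e" if "e > 0" for e :: real using that by simp
 from ennreal_le_epsilon[OF this]
 have "(NN x. ennreal (abs (f x)) * indicator (ball x0 r) x) <= 0" by simp
 moreover have [measurable]: "ball x0 r : sets borel" by simp
 have m: "(%x. ennreal (abs (f x)) * indicator (ball x0 r) x) : borel_measurable lborel" by measurable
 ultimately have "AE x in lborel. ennreal (abs (f x)) * indicator (ball x0 r) x = 0" using nn_integral_0_iff_AE[OF m] by simp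
 thus ?thesis proof eventually_elim
  case (elim x)
  thus ?case using r(1) by (auto simp: f_def indicator_def split: if_splits)
 qed
qed

text \<open>By Lindelof countably many of the balls treated before cover \<open>U\<close>, so their
  exceptional null sets can be united.\<close>

lemma loc_int_zero_AE:
 fixes G :: "'a::euclidean_space => real"
 assumes "open U" "loc_int U G" "!!phi. test_fun U phi ==> (LBINT x. G x * phi x) = 0"
 shows "AE x in lborel. x : U --> G x = 0"
proof -
 define F where "F = {ball x0 r | x0 r. r > 0 & cball x0 (2 * r) <= U}"
 have op: "!!S. S : F ==> open S" by (auto simp: F_def)
 obtain F' where F': "F' <= F" "countable F'" "\<Union>F' = \<Union>F" using Lindelof[of F] op by blast
 have "U <= \<Union>F" proof
  fix x assume "x : U"
  then obtain r where r: "r > 0" "cball x r <= U" using assms(1) open_contains_cball by blast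
  hence "ball x (r / 2) : F" unfolding F_def by (auto intro!: exI[of _ x] exI[of _ "r / 2"])
  thus "x : \<Union>F" using r(1) by (auto intro!: bexI[of _ "ball x (r / 2)"])
 qed
 moreover have "AE x in lborel. \<forall>S\<in>F'. x : S --> G x = 0" proof (rule AE_ball_countable[THEN iffD2, OF F'(2)], rule ballI)
  fix S assume "S : F'"
  then obtain x0 r where "S = ball x0 r" "r > 0" "cball x0 (2 * r) <= U" using F'(1) by (auto simp: F_def)
  thus "AE x in lborel. x : S --> G x = 0" using loc_int_zero_AE_ball[OF assms(2,3)] by blast
 qed
 ultimately show ?thesis using F'(3) by (auto elim!: eventually_mono)
qed

lemma weak_dird_unique:
 assumes "open U" "weak_dird U e u G" "weak_dird U e u G'"
 shows "AE x in lborel. x : U --> G x = G' x"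
proof -
 have "AE x in lborel. x : U --> G x - G' x = 0" proof (rule loc_int_zero_AE[OF assms(1)])
  show "loc_int U (%x. G x - G' x)" using assms by (auto simp: weak_dird_def loc_int_def right_diff_distrib)
  show "(LBINT x. (G x - G' x) * phi x) = 0" if t: "test_fun U phi" for phi using weak_dirdD[OF assms(2) t] weak_dirdD[OF assms(3) t] by (simp add: left_diff_distrib)
 qed
 thus ?thesis by simp
qed

section \<open>Lipschitz functions and integration by parts\<close>

text \<open>A derivative along a single line: a Lipschitz function of the triple junction, for
  instance, has derivative 0 in every angle direction, even at points where it has no
  gradient.\<close>

definition has_dird :: "'a::real_normed_vector => ('a => real) => real => 'a => bool" where
 "has_dird e f d x \<longleftrightarrow> ((%t. f (x + t *\<^sub>R e)) has_real_derivative d) (at 0)"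

lemma has_derivative_imp_has_dird:
 assumes "(f has_derivative f') (at x)" shows "has_dird e f (f' e) x"
proof -
 have 1: "((%t::real. x + t *\<^sub>R e) has_derivative (%t. t *\<^sub>R e)) (at 0)" by (auto intro!: derivative_eq_intros)
 have "(f has_derivative f') (at (x + 0 *\<^sub>R e))" using assms by simp
 from has_derivative_compose[OF 1 this]
 have "((%t. f (x + t *\<^sub>R e)) has_derivative (%t. f' (t *\<^sub>R e))) (at 0)" .
 moreover have "f' (t *\<^sub>R e) = f' e * t" for t using linear_scale[OF has_derivative_linear[OF assms]] by simp
 ultimately show ?thesis by (simp add: has_dird_def has_field_derivative_def)
qed

lemma has_dird_mult:
 assumes "has_dird e f d x" "has_dird e g d' x"
 shows "has_dird e (%x. f x * g x) (d * g x + f x * d') x" using DERIV_mult[OF assms[unfolded has_dird_def]] by (simp add: has_dird_def add.commute mult.commute)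

lemma has_dird_cong_open:
 assumes "has_dird e f d x" "open S" "x : S" "!!y. y : S ==> f y = g y"
 shows "has_dird e g d x" unfolding has_dird_def
proof (rule has_field_derivative_transform_within_open[OF assms(1)[unfolded has_dird_def]])
 let ?S = "(%t. x + t *\<^sub>R e) -` S"
 show "open ?S" by (intro continuous_open_vimage assms continuous_intros)
 show "0 : ?S" using assms(3) by simp
qed (use assms in auto)

text \<open>These functions take the place of smooth test functions, since the Gibbs weight and some
  of the cutoffs are only Lipschitz. Carrying the derivative \<open>f'\<close> as a datum replaces
  an appeal to Rademacher's theorem.\<close>

definition lip_test ::
 "'a::euclidean_space set => 'a => ('a => real) => ('a => real) => bool" where "lip_test U e f f' \<longleftrightarrow> (EX L. ALL x y. abs (f x - f y) <= L * norm (x - y))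
  & (EX K. compact K & K <= U & (ALL x. x ~: K --> f x = 0)) & f' : borel_fun & (AE x in lborel. has_dird e f (f' x) x)"

lemma lip_test_mono: "lip_test U e f f' ==> U <= V ==> lip_test V e f f'"
 unfolding lip_test_def by blast

lemma continuous_on_of_lipschitz:
 fixes f :: "'a::real_normed_vector => real"
 assumes "!!x y. x : S ==> y : S ==> abs (f x - f y) <= L * norm (x - y)"
 shows "continuous_on S f"
proof -
 have "(max L 0)-lipschitz_on S f" proof (rule lipschitz_onI)
  fix x y assume "x : S" "y : S"
  hence "abs (f x - f y) <= max L 0 * norm (x - y)" using assms[of x y] mult_right_mono[of L "max L 0" "norm (x - y)"] by simp
  thus "dist (f x) (f y) <= max L 0 * dist x y" by (simp add: dist_norm)
 qed simp
 thus ?thesis by (rule lipschitz_on_continuous_on)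
qed

lemma lip_test_continuous: "lip_test U e f f' ==> continuous_on UNIV f"
 unfolding lip_test_def using continuous_on_of_lipschitz by blast

lemma lip_test_measurable:
 assumes "lip_test U e f f'"
 shows "f : borel_fun" "f' : borel_fun" using assms lip_test_continuous[OF assms] by (auto simp: lip_test_def intro: borel_measurable_continuous_onI)

lemma has_dird_bound:
 assumes "has_dird e f d x" "!!x y. abs (f x - f y) <= L * norm (x - y)"
 shows "abs d <= L * norm e"
proof -
 have lim: "((%h. abs ((f (x + h *\<^sub>R e) - f x) / h)) \<longlongrightarrow> (abs d)) (at 0)" using assms(1)[unfolded has_dird_def DERIV_def] by (intro tendsto_rabs) simp
 have "abs ((f (x + h *\<^sub>R e) - f x) / h) <= L * norm e" if "h ~= 0" for h using assms(2)[of "x + h *\<^sub>R e" x] that by (simp add: abs_divide field_simps)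
 hence "\<forall>\<^sub>F h in at 0. abs ((f (x + h *\<^sub>R e) - f x) / h) <= L * norm e" by (auto simp: eventually_at intro!: exI[of _ 1])
 thus ?thesis by (rule tendsto_upperbound[OF lim]) simp
qed

lemma lip_test_bounds:
 fixes f :: "'a::euclidean_space => real"
 assumes "lip_test U e f f'" obtains M K where "M >= 0" "compact K" "K <= U" "!!x. abs (f x) <= M" "AE x in lborel. abs (f' x) <= M" "!!x. x ~: K ==> f x = 0" "AE x in lborel. x ~: K --> f' x = 0"
proof -
 obtain L K where L: "!!x y. abs (f x - f y) <= L * norm (x - y)" and K: "compact K" "K <= U" "!!x. x ~: K ==> f x = 0" and d: "AE x in lborel. has_dird e f (f' x) x"
  using assms unfolding lip_test_def by blast
 obtain M where M: "M >= 0" "!!x. abs (f x) <= M" using bounded_of_compact_support[OF lip_test_continuous[OF assms] K(1,3)] by blast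
 show ?thesis proof (rule that[of "max M (L * norm e)" K])
  show "AE x in lborel. abs (f' x) <= max M (L * norm e)" using d by eventually_elim (use has_dird_bound[OF _ L] in fastforce)
  show "AE x in lborel. x ~: K --> f' x = 0" using d proof (eventually_elim, intro impI)
  fix x assume x: "has_dird e f (f' x) x" "x ~: K"
  have "has_dird e (%x. 0) (f' x) x" by (rule has_dird_cong_open[OF x(1), of "- K"]) (use K x compact_imp_closed in auto)
  thus "f' x = 0" by (auto simp: has_dird_def intro: DERIV_unique)
  qed
  show "abs (f x) <= max M (L * norm e)" for x using M(2)[of x] by simp
 qed (use M K in auto)
qed

lemma L2_space_bounded_support:
 fixes g :: "'a::euclidean_space => real"
 assumes "g : borel_fun" "compact K" "AE x in lborel. x ~: K --> g x = 0" "AE x in lborel. abs (g x) <= M"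
 shows "g : L2" "integrable lborel g"
proof -
 have [measurable]: "K : sets borel" using assms(2) by (simp add: borel_compact)
 have i: "integrable lborel (indicator K :: 'a => real)" using assms(2) by (simp add: integrable_indicator_iff emeasure_compact_finite[unfolded infinity_ennreal_def])
 moreover have "(%x. (indicator K x :: real)^2) = indicator K" by (auto simp: indicator_def fun_eq_iff)
 ultimately have "(indicator K :: 'a => real) : L2" by (intro L2_spaceI) auto
 moreover have b: "AE x in lborel. abs (g x) <= M * abs (indicator K x)" using assms(3,4) by eventually_elim (auto simp: indicator_def)
 ultimately show "g : L2" using assms(1) by (intro L2_space_dominated[of "indicator K" _ g M]) auto
 show "integrable lborel g" by (rule lintegrable_bound[OF integrable_mult_right[OF i, of M]]) (use assms(1) b in "auto elim!: eventually_mono intro: order.trans[OF _ abs_ge_self]")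
qed

lemma lip_test_L2:
 assumes "lip_test U e f f'"
 shows "f : L2" "f' : L2" "integrable lborel f" "integrable lborel f'"
proof -
 obtain M K where MK: "M >= 0" "compact K" "K <= U" "!!x. abs (f x) <= M" "AE x in lborel. abs (f' x) <= M" "!!x. x ~: K ==> f x = 0" "AE x in lborel. x ~: K --> f' x = 0"
  by (rule lip_test_bounds[OF assms]) (rule that)
 note m = lip_test_measurable[OF assms]
 show "f : L2" "integrable lborel f" using L2_space_bounded_support[OF m(1) MK(2), of M] MK by auto
 show "f' : L2" "integrable lborel f'" using L2_space_bounded_support[OF m(2) MK(2), of M] MK by auto
qed

text \<open>Translation invariance makes the integrals of the difference quotients vanish.\<close>

lemma integral_lip_test_derivative:
 fixes f :: "'a::euclidean_space => real"
 assumes "lip_test U e f f'"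
 shows "(LBINT x. f' x) = 0"
proof -
 obtain L K where L: "!!x y. abs (f x - f y) <= L * norm (x - y)" and K: "compact K" "!!x. x ~: K ==> f x = 0" and d: "AE x in lborel. has_dird e f (f' x) x"
  using assms unfolding lip_test_def by blast
 obtain R where R: "K <= cball 0 R" using bounded_subset_ballD[OF compact_imp_bounded[OF K(1)]] ball_subset_cball by (metis order.trans)
 note [measurable] = lip_test_measurable[OF assms]
 define h where "h n = inverse (real (Suc n))" for n
 have h: "h n > 0" "h n <= 1" for n by (auto simp: h_def divide_simps)
 define D where "D n x = (f (x + h n *\<^sub>R e) - f x) / h n" for n x
 have D0: "(LBINT x. D n x) = 0" for n using integral_lborel_translate[of f "h n *\<^sub>R e"] lip_test_L2(3)[OF assms] by (simp add: D_def[abs_def])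
 \<comment> \<open>As h n <= 1, the translates by \<open>h n *\<^sub>R e\<close> have their supports
   in the ball of radius R + norm e, so one integrable majorant serves for all difference
   quotients.\<close>
 let ?w = "%x. (abs L * norm e) * indicator (cball 0 (R + norm e)) x :: real"
 have "(%n. \<integral>x. D n x \<partial>lborel) ----> (LBINT x. f' x)" proof (rule integral_dominated_convergence[where w = ?w])
  show "integrable lborel ?w" by (simp add: integrable_indicator_iff emeasure_lborel_cball_finite[unfolded infinity_ennreal_def])
  show "D n : borel_measurable lborel" for n unfolding D_def by measurable
  show "AE x in lborel. (%n. D n x) ----> f' x" using d proof eventually_elim
  case (elim x)
  have "((%t. (f (x + t *\<^sub>R e) - f x) / t) \<longlongrightarrow> f' x) (at 0)" using elim by (simp add: has_dird_def DERIV_def)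
  moreover have "filterlim h (at 0) sequentially" unfolding filterlim_at using h(1) LIMSEQ_inverse_real_of_nat by (auto simp: h_def[abs_def] simp del: of_nat_Suc)
  ultimately show ?case unfolding D_def by (rule filterlim_compose)
  qed
  show "AE x in lborel. norm (D n x) <= ?w x" for n proof (rule AE_I2)
  fix x :: 'a
  have "norm (h n *\<^sub>R e) <= norm e" using h[of n] by (simp add: mult_left_le_one_le)
  show "norm (D n x) <= ?w x" proof (cases "x : cball 0 (R + norm e)")
  case True
  have "L * norm (h n *\<^sub>R e) <= abs L * norm (h n *\<^sub>R e)" by (intro mult_right_mono) auto
  hence "abs (f (x + h n *\<^sub>R e) - f x) <= (abs L * norm e) * h n" using L[of "x + h n *\<^sub>R e" x] h(1)[of n] by (simp add: mult_ac)
  thus ?thesis using True h(1)[of n] by (simp add: D_def abs_divide pos_divide_le_eq)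
  next
  case False
  have "norm x <= norm (x + h n *\<^sub>R e) + norm (h n *\<^sub>R e)" using norm_triangle_ineq4[of "x + h n *\<^sub>R e" "h n *\<^sub>R e"] by simp
  hence "R < norm (x + h n *\<^sub>R e)" using False \<open>norm (h n *\<^sub>R e) <= norm e\<close> unfolding mem_cball dist_0_norm by linarith
  hence "x + h n *\<^sub>R e ~: K" using R by auto
  moreover have "R < norm x" using False norm_ge_zero[of e] unfolding mem_cball dist_0_norm by linarith
  hence "x ~: K" using R by auto
  ultimately show ?thesis using K(2) False by (simp add: D_def)
  qed
  qed
 qed measurable
 thus ?thesis unfolding D0 using LIMSEQ_unique tendsto_const by metis
qed

lemma lip_test_of_test_fun:
 assumes "test_fun U phi" shows "lip_test U e phi (dird e phi)" unfolding lip_test_def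
proof (intro conjI)
 show "EX L. ALL x y. abs (phi x - phi y) <= L * norm (x - y)" using test_fun_lipschitz[OF assms] by metis
 show "EX K. compact K & K <= U & (ALL x. x ~: K --> phi x = 0)" using assms by (simp add: test_fun_def)
 show "dird e phi : borel_fun" by (rule test_fun_measurable[OF test_fun_dird[OF assms]])
 show "AE x in lborel. has_dird e phi (dird e phi x) x" by (intro AE_I2 has_derivative_imp_has_dird test_fun_has_derivative[OF assms])
qed

text \<open>\<open>w\<close> is controlled on \<open>U\<close> only. If one of two points lies
  outside \<open>U\<close>, then \<open>l\<close> vanishes there and the difference of
  \<open>l\<close> alone bounds the difference of the products, so the product is Lipschitz on the
  whole space.\<close>

lemma lip_test_mult_on:
 fixes w :: "'a::euclidean_space => real"
 assumes l: "lip_test U e l l'" and [measurable]: "w : borel_fun" "w' : borel_fun"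
  and M: "!!x. x : U ==> abs (w x) <= M" and L: "!!x y. x : U ==> y : U ==> abs (w x - w y) <= L * norm (x - y)" and d: "AE x in lborel. x : U --> has_dird e w (w' x) x"
 shows "lip_test U e (%x. w x * l x) (%x. w' x * l x + w x * l' x)"
proof -
 obtain L' K where L': "!!x y. abs (l x - l y) <= L' * norm (x - y)" and K: "compact K" "K <= U" "!!x. x ~: K ==> l x = 0" and dl: "AE x in lborel. has_dird e l (l' x) x"
  using l unfolding lip_test_def by blast
 obtain N where N: "N >= 0" "!!x. abs (l x) <= N" using bounded_of_compact_support[OF lip_test_continuous[OF l] K(1,3)] by blast
 note [measurable] = lip_test_measurable[OF l]
 have one: "abs (w x * l x - w y * l y) <= (abs M * abs L' + N * abs L) * norm (x - y)" if "x : U" for x y proof -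
  have a: "abs (w x) * abs (l x - l y) <= abs M * (abs L' * norm (x - y))" proof (rule mult_mono)
  show "abs (w x) <= abs M" using M[OF that] by simp
  have "L' * norm (x - y) <= abs L' * norm (x - y)" by (intro mult_right_mono) auto
  thus "abs (l x - l y) <= abs L' * norm (x - y)" using L'[of x y] by simp
  qed auto
  have b: "abs (w x - w y) * abs (l y) <= (abs L * norm (x - y)) * N" proof (cases "y : U")
  case True
  show ?thesis proof (rule mult_mono)
  have "L * norm (x - y) <= abs L * norm (x - y)" by (intro mult_right_mono) auto
  thus "abs (w x - w y) <= abs L * norm (x - y)" using L[OF that True] by simp
  qed (use N in auto)
  next
  case False
  hence "l y = 0" using K by blast
  thus ?thesis using N(1) by simp
  qed
  have "w x * l x - w y * l y = w x * (l x - l y) + (w x - w y) * l y" by (simp add: algebra_simps)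
  also have "abs (...) <= abs (w x) * abs (l x - l y) + abs (w x - w y) * abs (l y)" using abs_triangle_ineq[of "w x * (l x - l y)" "(w x - w y) * l y"] by (simp only: abs_mult)
  also have "... <= abs M * (abs L' * norm (x - y)) + (abs L * norm (x - y)) * N" using a b by (rule add_mono)
  also have "... = (abs M * abs L' + N * abs L) * norm (x - y)" by (simp add: algebra_simps)
  finally show ?thesis .
 qed
 have lip: "abs (w x * l x - w y * l y) <= (abs M * abs L' + N * abs L) * norm (x - y)" for x y proof (cases "x : U")
  case True
  thus ?thesis by (rule one)
 next
  case x: False
  show ?thesis proof (cases "y : U")
  case True
  thus ?thesis using one[of y x] by (simp add: abs_minus_commute norm_minus_commute)
  next
  case False
  have "x ~: K" "y ~: K" using K(2) False x by auto
  thus ?thesis using N(1) by (simp add: K(3))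
  qed
 qed
 have z: "AE x in lborel. x ~: K --> l' x = 0" using lip_test_bounds[OF lip_test_mono[OF l subset_UNIV]] dl proof -
  show ?thesis using dl proof (eventually_elim, intro impI)
  fix x assume x: "has_dird e l (l' x) x" "x ~: K"
  have "has_dird e (%x. 0) (l' x) x" by (rule has_dird_cong_open[OF x(1), of "- K"]) (use K x compact_imp_closed in auto)
  thus "l' x = 0" by (auto simp: has_dird_def intro: DERIV_unique)
  qed
 qed
 show ?thesis unfolding lip_test_def proof (intro conjI)
  show "EX L. ALL x y. abs (w x * l x - w y * l y) <= L * norm (x - y)" using lip by blast
  show "EX K. compact K & K <= U & (ALL x. x ~: K --> w x * l x = 0)" by (rule exI[of _ K]) (simp add: K)
  show "(%x. w' x * l x + w x * l' x) : borel_fun" by measurable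
  show "AE x in lborel. has_dird e (%x. w x * l x) (w' x * l x + w x * l' x) x" using d dl z proof eventually_elim
  case (elim x)
  show ?case proof (cases "x : U")
  case True
  thus ?thesis using elim by (intro has_dird_mult) auto
  next
  case False
  hence x: "x ~: K" using K by auto
  have "has_dird e (%x. 0) 0 x" by (simp add: has_dird_def)
  hence "has_dird e (%x. w x * l x) 0 x" by (rule has_dird_cong_open[of _ _ _ _ "- K"]) (use K x compact_imp_closed in auto)
  thus ?thesis using elim x K(3) by simp
  qed
  qed
 qed
qed

lemma lip_test_mult:
 assumes "lip_test V e w w'" "lip_test U e l l'"
 shows "lip_test U e (%x. w x * l x) (%x. w' x * l x + w x * l' x)"
proof -
 obtain M K where M: "M >= 0" "compact K" "K <= V" "!!x. abs (w x) <= M" "AE x in lborel. abs (w' x) <= M" "!!x. x ~: K ==> w x = 0" "AE x in lborel. x ~: K --> w' x = 0"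
  by (rule lip_test_bounds[OF assms(1)]) (rule that)
 obtain L where L: "!!x y. abs (w x - w y) <= L * norm (x - y)" using assms(1) unfolding lip_test_def by blast
 have "AE x in lborel. has_dird e w (w' x) x" using assms(1) by (simp add: lip_test_def)
 hence d: "AE x in lborel. x : U --> has_dird e w (w' x) x" by (auto elim: eventually_mono)
 show ?thesis by (rule lip_test_mult_on[OF assms(2) lip_test_measurable[OF assms(1)] M(4) L d])
qed

lemma L2_space_mult_bounded:
 assumes "f : L2_space M" "g : borel_measurable M" "AE x in M. abs (g x) <= B"
 shows "(%x. f x * g x) : L2_space M"
proof (rule L2_space_dominated[OF assms(1), where C = "abs B"])
 show "(%x. f x * g x) : borel_measurable M" using L2D[OF assms(1)] assms(2) by measurable
 show "AE x in M. abs (f x * g x) <= abs B * abs (f x)" using assms(3) proof eventually_elim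
  case (elim x)
  have "abs (f x) * abs (g x) <= abs (f x) * abs B" using elim by (intro mult_left_mono) auto
  thus ?case by (simp add: abs_mult mult.commute)
 qed
qed

lemma L2_space_mult_lip_test:
 assumes "f : L2" "lip_test U e l l'"
 shows "(%x. f x * l x) : L2" "(%x. f x * l' x) : L2"
proof -
 obtain M K where M: "M >= 0" "compact K" "K <= U" "!!x. abs (l x) <= M" "AE x in lborel. abs (l' x) <= M" "!!x. x ~: K ==> l x = 0" "AE x in lborel. x ~: K --> l' x = 0"
  by (rule lip_test_bounds[OF assms(2)]) (rule that)
 show "(%x. f x * l x) : L2" by (rule L2_space_mult_bounded[OF assms(1), where B = M]) (use M lip_test_measurable[OF assms(2)] in auto)
 show "(%x. f x * l' x) : L2" by (rule L2_space_mult_bounded[OF assms(1), where B = M]) (use M lip_test_measurable[OF assms(2)] in auto)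
qed

lemma weak_dird_lip_test:
 fixes l :: "'a::euclidean_space => real"
 assumes "lip_test U e l l'"
 shows "weak_dird UNIV e l l'" unfolding weak_dird_def
proof (intro conjI allI impI)
 note L2 = lip_test_L2[OF assms]
 show "loc_int UNIV l" "loc_int UNIV l'" using L2 loc_int_integrable by blast+
 fix phi :: "'a => real" assume t: "test_fun UNIV phi"
 note lphi = lip_test_of_test_fun[OF t, of e]
 have "(LBINT x. l' x * phi x + l x * dird e phi x) = 0" by (rule integral_lip_test_derivative[OF lip_test_mult[OF assms lphi]])
 moreover have "integrable lborel (%x. l' x * phi x)" "integrable lborel (%x. l x * dird e phi x)" using L2_mult_integrable L2 lip_test_L2[OF lphi] by blast+
 ultimately show "(LBINT x. l x * dird e phi x) = - (LBINT x. l' x * phi x)" by simp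
qed

lemma kern_shift_test_fun:
 assumes "eps > 0" "cball x eps <= U"
 shows "test_fun U (%y. kern eps (x - y))"
proof -
 have "kern eps (x - y) = 0" if "y ~: cball x eps" for y using that by (intro kern_zero assms) (simp add: dist_norm)
 thus ?thesis unfolding test_fun_def using test_fun_smooth[OF test_fun_reflect(1)[OF kern_test_fun[OF assms(1)], of x]] assms(2) by (intro conjI exI[of _ "cball x eps"]) auto
qed

text \<open>Once the ball around \<open>x\<close> fits into \<open>U\<close>, the reflected kernel
  is an admissible test function; the sign from the reflection and the sign in the weak derivative
  cancel.\<close>

lemma dird_conv_kern:
 assumes "weak_dird U e u G" "integrable lborel u" "eps > 0" "cball x eps <= U"
 shows "dird e (conv u (kern eps)) x = conv G (kern eps) x"
proof -
 note k = kern_test_fun[OF assms(3)]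
 have "dird e (conv u (kern eps)) x = (LBINT y. u y * dird e (kern eps) (x - y))" using fun_cong[OF dird_conv[OF assms(2) k, of e], of x] by (simp add: conv_def)
 also have "... = - (LBINT y. u y * dird e (%y. kern eps (x - y)) y)" unfolding test_fun_reflect(2)[OF k] by simp
 also have "... = (LBINT y. G y * kern eps (x - y))" using weak_dirdD(1)[OF assms(1) kern_shift_test_fun[OF assms(3,4)]] by simp
 finally show ?thesis by (simp add: conv_def)
qed

lemma test_fun_conv:
 assumes "open U" "compact K" "K <= U" "!!x. x ~: K ==> f x = 0" "integrable lborel f"
 shows "\<exists>d>0. ALL eps. 0 < eps & eps < d --> test_fun U (conv f (kern eps))"
proof (cases "K = {}")
 case True
 hence "conv f (kern eps) = (%x. 0)" for eps using assms(4) by (simp add: conv_def fun_eq_iff)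
 moreover have "test_fun U (%x. 0)" unfolding test_fun_def using smooth_on_const by (auto intro!: exI[of _ "{}"])
 ultimately show ?thesis by (auto intro: exI[of _ 1])
next
 case False
 obtain d where d: "d > 0" "{x. infdist x K <= d} <= U" using compact_in_open_separated[OF False assms(2,1,3)] by blast
 have "test_fun U (conv f (kern eps))" if eps: "0 < eps" "eps < d" for eps unfolding test_fun_def proof (intro conjI exI)
  show "smooth_on UNIV (conv f (kern eps))" by (rule smooth_on_conv[OF assms(5) kern_test_fun[OF eps(1)]])
  show "compact {x. infdist x K <= d}" using compact_infdist_le[OF False assms(2) d(1)] .
  show "{x. infdist x K <= d} <= U" by (rule d(2))
  show "ALL x. x ~: {x. infdist x K <= d} --> conv f (kern eps) x = 0" proof (intro allI impI)
  fix x assume x: "x ~: {x. infdist x K <= d}"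
  have z: "f y * kern eps (x - y) = 0" for y proof (cases "y : K")
  case True
  hence "eps < dist x y" using infdist_le[of y K x] x eps by simp
  thus ?thesis using kern_zero[OF eps(1), of "x - y"] by (simp add: dist_norm)
  qed (simp add: assms(4))
  show "conv f (kern eps) x = 0" unfolding conv_def z by simp
  qed
 qed
 thus ?thesis using d(1) by blast
qed

text \<open>\<open>a\<close> may only be paired with smooth test functions, so \<open>b\<close> is
  mollified. The compact support of \<open>b\<close> inside \<open>U\<close> keeps the
  mollifications admissible, and the L^2 convergence of both \<open>b\<close> and \<open>B\<close>
  carries the identity to the limit.\<close>

lemma weak_dird_by_parts:
 assumes U: "open U" and a: "weak_dird U e a A" "a : L2" "A : L2"
  and b: "weak_dird UNIV e b B" "b : L2" "B : L2" "integrable lborel b" "integrable lborel B" and K: "compact K" "K <= U" "!!x. x ~: K ==> b x = 0"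
 shows "(LBINT x. a x * B x + A x * b x) = 0"
proof -
 let ?P = "%n eps. test_fun U (conv b (kern eps)) & conv b (kern eps) : L2 & nrm2 (%x. conv b (kern eps) x - b x) <= inverse (real (Suc n))
  & conv B (kern eps) : L2 & nrm2 (%x. conv B (kern eps) x - B x) <= inverse (real (Suc n))"
 have "\<exists>eps>0. ?P n eps" for n proof -
  have n: "inverse (real (Suc n)) > 0" by simp
  obtain d1 where d1: "d1 > 0" "!!eps. 0 < eps & eps < d1 ==> test_fun U (conv b (kern eps))" using test_fun_conv[OF U K b(4)] by blast
  obtain d2 where d2: "d2 > 0" "!!eps. 0 < eps & eps < d2 ==> conv b (kern eps) : L2 & nrm2 (%x. conv b (kern eps) x - b x) <= inverse (real (Suc n))" using mollify_L2[OF b(4,2) n] by blast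
  obtain d3 where d3: "d3 > 0" "!!eps. 0 < eps & eps < d3 ==> conv B (kern eps) : L2 & nrm2 (%x. conv B (kern eps) x - B x) <= inverse (real (Suc n))" using mollify_L2[OF b(5,3) n] by blast
  define eps where "eps = min d1 (min d2 d3) / 2"
  have "0 < eps & eps < d1" "0 < eps & eps < d2" "0 < eps & eps < d3" using d1(1) d2(1) d3(1) by (auto simp: eps_def)
  thus ?thesis using d1(2) d2(2) d3(2) by blast
 qed
 hence ex: "EX eps. eps > 0 & ?P n eps" for n by blast
 define eps where "eps n = (SOME eps. eps > 0 & ?P n eps)" for n
 have P: "eps n > 0 & ?P n (eps n)" for n unfolding eps_def by (rule someI_ex[OF ex])
 hence eps: "eps n > 0" and t: "test_fun U (conv b (kern (eps n)))" and b': "conv b (kern (eps n)) : L2" "nrm2 (%x. conv b (kern (eps n)) x - b x) <= inverse (real (Suc n))"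
  and B': "conv B (kern (eps n)) : L2" "nrm2 (%x. conv B (kern (eps n)) x - B x) <= inverse (real (Suc n))" for n by (simp_all only: simp_thms)
 have 0: "(%n. nrm2 (%x. conv b (kern (eps n)) x - b x)) ----> 0" by (rule tendsto_sandwich[OF _ _ tendsto_const LIMSEQ_inverse_real_of_nat]) (auto simp: L2_norm_nonneg b'(2) simp del: of_nat_Suc)
 have 1: "(%n. nrm2 (%x. conv B (kern (eps n)) x - B x)) ----> 0" by (rule tendsto_sandwich[OF _ _ tendsto_const LIMSEQ_inverse_real_of_nat]) (auto simp: L2_norm_nonneg B'(2) simp del: of_nat_Suc)
 have "(LBINT x. conv B (kern (eps n)) x * a x) = - (LBINT x. conv b (kern (eps n)) x * A x)" for n proof -
  have "dird e (conv b (kern (eps n))) x = conv B (kern (eps n)) x" for x by (rule dird_conv_kern[OF b(1,4) eps]) simp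
  thus ?thesis using weak_dirdD(1)[OF a(1) t[of n]] by (simp add: mult.commute)
 qed
 moreover have "(%n. \<integral>x. conv B (kern (eps n)) x * a x \<partial>lborel) ----> (LBINT x. B x * a x)" by (rule L2_inner_tendsto[OF B'(1) b(3) a(2) 1])
 moreover have "(%n. - (LBINT x. conv b (kern (eps n)) x * A x)) ----> - (LBINT x. b x * A x)" by (rule tendsto_minus[OF L2_inner_tendsto[OF b'(1) b(2) a(3) 0]])
 ultimately have "(LBINT x. B x * a x) = - (LBINT x. b x * A x)" using LIMSEQ_unique by simp
 thus ?thesis using L2_mult_integrable[OF a(2) b(3)] L2_mult_integrable[OF a(3) b(2)] by (simp add: mult.commute)
qed

text \<open>The derivative of the product is found by testing \<open>b\<close> with
  \<open>phi * l\<close>, again a Lipschitz function of compact support in \<open>U\<close>. This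
  support is also the reason why the rule holds on the whole space although \<open>b\<close> is only
  differentiable on \<open>U\<close>.\<close>

lemma weak_dird_mult_lip_test:
 fixes l :: "'a::euclidean_space => real"
 assumes U: "open U" and b: "weak_dird U e b B" "b : L2" "B : L2"
  and l: "lip_test U e l l'"
 shows "weak_dird UNIV e (%x. b x * l x) (%x. B x * l x + b x * l' x)" unfolding weak_dird_def
proof (intro conjI allI impI)
 note L2 = lip_test_L2[OF l]
 have "integrable lborel (%x. b x * l x)" "integrable lborel (%x. B x * l x + b x * l' x)" using L2_mult_integrable[OF b(2) L2(1)] L2_mult_integrable[OF b(3) L2(1)]
  L2_mult_integrable[OF b(2) L2(2)] by auto
 thus "loc_int UNIV (%x. b x * l x)" "loc_int UNIV (%x. B x * l x + b x * l' x)" by (auto intro: loc_int_integrable)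
 fix phi :: "'a => real" assume t: "test_fun UNIV phi"
 let ?d = "dird e phi"
 have lt: "lip_test U e (%x. phi x * l x) (%x. ?d x * l x + phi x * l' x)" by (rule lip_test_mult[OF lip_test_of_test_fun[OF t] l])
 obtain K where K: "compact K" "K <= U" "!!x. x ~: K ==> phi x * l x = 0" using lt unfolding lip_test_def by blast
 have 0: "(LBINT x. b x * (?d x * l x + phi x * l' x) + B x * (phi x * l x)) = 0" by (rule weak_dird_by_parts[OF U b weak_dird_lip_test[OF lt] lip_test_L2[OF lt] K])
 have 1: "integrable lborel (%x. (b x * l x) * ?d x)" by (rule L2_mult_integrable[OF L2_space_mult_lip_test(1)[OF b(2) l] lip_test_L2(2)[OF lip_test_of_test_fun[OF t]]])
 have 2: "integrable lborel (%x. (B x * l x + b x * l' x) * phi x)" by (rule L2_mult_integrable[OF L2_space_add[OF L2_space_mult_lip_test(1)[OF b(3) l]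
  L2_space_mult_lip_test(2)[OF b(2) l]] lip_test_L2(1)[OF lip_test_of_test_fun[OF t, of e]]])
 have "b x * (?d x * l x + phi x * l' x) + B x * (phi x * l x) = (b x * l x) * ?d x + (B x * l x + b x * l' x) * phi x" for x by (simp add: algebra_simps)
 hence "(LBINT x. (b x * l x) * ?d x) + (LBINT x. (B x * l x + b x * l' x) * phi x) = 0" using 0 lint_add[OF 1 2] by simp
 thus "(LBINT x. (b x * l x) * ?d x) = - (LBINT x. (B x * l x + b x * l' x) * phi x)" by simp
qed

lemma weak_dird_by_parts_lip_test:
 assumes U: "open U" and a: "weak_dird U e a A" "a : L2" "A : L2"
  and b: "weak_dird U e b B" "b : L2" "B : L2" and l: "lip_test U e l l'"
 shows "(LBINT x. a x * (B x * l x + b x * l' x) + A x * (b x * l x)) = 0"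
proof -
 obtain K where K: "compact K" "K <= U" "!!x. x ~: K ==> l x = 0" using l unfolding lip_test_def by blast
 note L2 = lip_test_L2[OF l]
 show ?thesis proof (rule weak_dird_by_parts[OF U a weak_dird_mult_lip_test[OF U b l] _ _ _ _ K(1,2)])
  show "(%x. b x * l x) : L2" by (rule L2_space_mult_lip_test(1)[OF b(2) l])
  show "(%x. B x * l x + b x * l' x) : L2" by (intro L2_space_add L2_space_mult_lip_test(1)[OF b(3) l] L2_space_mult_lip_test(2)[OF b(2) l])
  show "integrable lborel (%x. b x * l x)" by (rule L2_mult_integrable[OF b(2) L2(1)])
  show "integrable lborel (%x. B x * l x + b x * l' x)" by (intro lintegrable_add L2_mult_integrable[OF b(3) L2(1)] L2_mult_integrable[OF b(2) L2(2)])
  show "b x * l x = 0" if "x ~: K" for x using K(3) that by simp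
 qed
qed

text \<open>Here the factor \<open>w\<close> has no compact support, so the rule is claimed on
  \<open>U\<close> only, and the smooth test function supplies the support in
  \<open>U\<close>.\<close>

lemma weak_dird_mult_on:
 assumes U: "open U" and b: "weak_dird U e b B" "b : L2" "B : L2"
  and w: "w : borel_fun" "w' : borel_fun" and M: "!!x. x : U ==> abs (w x) <= M" and L: "!!x y. x : U ==> y : U ==> abs (w x - w y) <= L * norm (x - y)"
  and d: "AE x in lborel. x : U --> has_dird e w (w' x) x" and M': "AE x in lborel. x : U --> abs (w' x) <= M'"
 shows "weak_dird U e (%x. b x * w x) (%x. B x * w x + b x * w' x)" unfolding weak_dird_def
proof (intro conjI allI impI)
 have li: "integrable lborel (%x. indicator K x * (f x * v x))" if "compact K" "K <= U" "f : L2" "v : borel_fun" "AE x in lborel. x : U --> abs (v x) <= N" for K f v N proof -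
  have [measurable]: "K : sets borel" "v : borel_fun" using that by (auto simp: borel_compact)
  have "(%x. indicator K x * v x) : L2" proof (rule L2_space_bounded_support(1)[OF _ that(1), where M = "abs N"])
  show "AE x in lborel. abs (indicator K x * v x) <= abs N" using that(5) by eventually_elim (use that(2) in "auto simp: indicator_def")
  qed auto
  from L2_mult_integrable[OF that(3) this] show ?thesis by (simp add: mult_ac)
 qed
 have M1: "AE x in lborel. x : U --> abs (w x) <= M" using M by simp
 show "loc_int U (%x. b x * w x)" unfolding loc_int_def using li[OF _ _ b(2) w(1) M1] by blast
 show "loc_int U (%x. B x * w x + b x * w' x)" unfolding loc_int_def distrib_left proof (intro allI impI lintegrable_add)
  fix K assume K: "compact K & K <= U"
  show "integrable lborel (%x. indicator K x * (B x * w x))" using K by (intro li[OF _ _ b(3) w(1) M1]) auto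
  show "integrable lborel (%x. indicator K x * (b x * w' x))" using K by (intro li[OF _ _ b(2) w(2) M']) auto
 qed
 fix phi assume t: "test_fun U phi"
 let ?d = "dird e phi"
 have lt: "lip_test U e (%x. w x * phi x) (%x. w' x * phi x + w x * ?d x)" by (rule lip_test_mult_on[OF lip_test_of_test_fun[OF t] w M L d])
 obtain K where K: "compact K" "K <= U" "!!x. x ~: K ==> phi x = 0" using t unfolding test_fun_def by blast
 have Kd: "?d x = 0" if "x ~: K" for x by (rule dird_zero_off_closed[OF compact_imp_closed[OF K(1)] K(3) that])
 have K': "w x * phi x = 0" if "x ~: K" for x using K(3) that by simp
 have 0: "(LBINT x. b x * (w' x * phi x + w x * ?d x) + B x * (w x * phi x)) = 0" by (rule weak_dird_by_parts[OF U b weak_dird_lip_test[OF lt] lip_test_L2[OF lt] K(1,2) K'])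
 have mult: "integrable lborel (%x. f x * v x * psi x)" if h: "f : L2" "v : borel_fun" "AE x in lborel. x : U --> abs (v x) <= N" "test_fun U psi" "!!x. x ~: K ==> psi x = 0" for f v N psi proof -
  obtain R where R: "!!x. abs (psi x) <= R" using test_fun_bounded[OF h(4)] by metis
  have "integrable lborel (%x. (indicator K x * (f x * v x)) * psi x)" by (rule integrable_mult_bounded[OF li[OF K(1,2) h(1,2,3)], where B = R]) (use R test_fun_measurable[OF h(4)] in auto)
  also have "(%x. (indicator K x * (f x * v x)) * psi x) = (%x. f x * v x * psi x)" using h(5) by (auto simp: fun_eq_iff indicator_def)
  finally show ?thesis .
 qed
 have 1: "integrable lborel (%x. (b x * w x) * ?d x)" by (rule mult[OF b(2) w(1) M1 test_fun_dird[OF t] Kd])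
 have 2: "integrable lborel (%x. B x * w x * phi x)" by (rule mult[OF b(3) w(1) M1 t K(3)])
 have 3: "integrable lborel (%x. b x * w' x * phi x)" by (rule mult[OF b(2) w(2) M' t K(3)])
 have eq: "b x * (w' x * phi x + w x * ?d x) + B x * (w x * phi x) = (b x * w x) * ?d x + (B x * w x * phi x + b x * w' x * phi x)" for x by (simp add: algebra_simps)
 have "(LBINT x. (b x * w x) * ?d x) + (LBINT x. (B x * w x + b x * w' x) * phi x) = 0" using 0 lint_add[OF 1 lintegrable_add[OF 2 3]] unfolding eq by (simp add: distrib_right)
 thus "(LBINT x. (b x * w x) * ?d x) = - (LBINT x. (B x * w x + b x * w' x) * phi x)" by simp
qed

section \<open>Density of smooth functions\<close>

text \<open>Mollifying the indicator of the closed d-neighbourhood of \<open>K\<close> at a radius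
  below d keeps the value 1 on \<open>K\<close>, because from there the kernel only sees the
  neighbourhood.\<close>

lemma smooth_cutoff_exists:
 fixes K :: "'a::euclidean_space set"
 assumes "compact K" "open V" "K <= V"
 shows "EX c. test_fun V c & (\<forall>x\<in>K. c x = 1)"
proof (cases "K = {}")
 case True
 have "test_fun V (%x::'a. 0)" unfolding test_fun_def using smooth_on_const by (auto intro!: exI[of _ "{}"])
 thus ?thesis using True by blast
next
 case False
 obtain d where d: "d > 0" "{x. infdist x K <= d} <= V" using compact_in_open_separated[OF False assms] by blast
 let ?K = "{x. infdist x K <= d}"
 have cK: "compact ?K" using compact_infdist_le[OF False assms(1) d(1)] .
 have int: "integrable lborel (indicator ?K :: 'a => real)" using cK by (simp add: integrable_indicator_iff emeasure_compact_finite[unfolded infinity_ennreal_def] borel_compact)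
 obtain d' where d': "d' > 0" "!!eps. 0 < eps & eps < d' ==> test_fun V (conv (indicator ?K) (kern eps))" using test_fun_conv[OF assms(2) cK d(2) _ int] by auto
 define eps where "eps = min d d' / 2"
 have eps: "eps > 0" "eps < d" "0 < eps & eps < d'" using d(1) d'(1) by (auto simp: eps_def)
 have "conv (indicator ?K) (kern eps) x = 1" if "x : K" for x proof -
  have z: "indicator ?K y * kern eps (x - y) = kern eps (x - y)" for y proof (cases "norm (x - y) <= eps")
  case True
  hence "infdist y K <= d" using infdist_le[OF that, of y] eps by (simp add: dist_norm norm_minus_commute)
  thus ?thesis by simp
  qed (simp add: kern_zero[OF eps(1)])
  have "conv (indicator ?K) (kern eps) x = (LBINT y. kern eps (x - y))" unfolding conv_def z ..
  also have "... = 1" using integral_lborel_reflect(1)[OF test_fun_measurable[OF kern_test_fun[OF eps(1)]], of x] kern(3)[OF eps(1)] by simp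
  finally show ?thesis .
 qed
 thus ?thesis using d'(2)[OF eps(3)] by blast
qed

lemma smooth_on_UN:
 assumes "!!n::nat. open (A n)" "!!n. smooth_on (A n) f"
 shows "smooth_on (\<Union>n. A n) f"
proof -
 have "Ck_on k (\<Union>n. A n) f" if "!!n. Ck_on k (A n) f" for k using that proof (induction k arbitrary: f)
  case 0
  thus ?case using assms(1) by (simp add: continuous_on_open_UN)
 next
  case (Suc k)
  thus ?case by auto
 qed
 thus ?thesis using assms(2) by (simp add: smooth_on_def)
qed

lemma dird_sum:
 assumes "!!i. i : I ==> f i differentiable (at x)"
 shows "dird v (%x. \<Sum>i\<in>I. f i x) x = (\<Sum>i\<in>I. dird v (f i) x)"
proof -
 have "((%x. \<Sum>i\<in>I. f i x) has_derivative (%v. \<Sum>i\<in>I. dird v (f i) x)) (at x)" by (rule has_derivative_sum) (use assms frechet_derivative_works in blast)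
 thus ?thesis by (simp add: frechet_derivative_at[symmetric])
qed

text \<open>The \<open>p j\<close> are consecutive differences of cutoffs along a compact
  exhaustion, so partial sums telescope to a single cutoff, which is 1 on a large compact set. Near
  a point of \<open>A n\<close> only the indices below n + 2 matter.\<close>

lemma smooth_partition_exhaustion:
 fixes U :: "'a::euclidean_space set"
 assumes "open U" obtains A :: "nat => 'a set" and V :: "nat => 'a set" and p :: "nat => 'a => real" where "!!n. open (A n)" "!!n. A n <= A (Suc n)" "(\<Union>n. A n) = U"
  "!!j. open (V j)" "!!j. V j <= U" "!!j. test_fun (V j) (p j)" "!!j n. n + 2 <= j ==> A n \<inter> V j = {}" "!!n x. x : A n ==> (\<Sum>j<n + 2. p j x) = 1" proof -
 obtain C :: "nat => 'a set" where C: "!!n. compact (C n)" "!!n. C n <= U" "!!n. C n <= interior (C (Suc n))" "\<Union>(range C) = U" using open_Union_compact_subsets[OF assms] by metis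
 have Cmono: "C n <= C (Suc n)" for n using C(3) interior_subset by blast
 have "EX c. test_fun (interior (C (Suc n))) c & (\<forall>x\<in>C n. c x = 1)" for n by (rule smooth_cutoff_exists) (use C in auto)
 then obtain c where c: "!!n. test_fun (interior (C (Suc n))) (c n)" "!!n x. x : C n ==> c n x = 1" by metis
 define p where "p j = (case j of 0 => c 0 | Suc i => (%x. c (Suc i) x - c i x))" for j
 \<comment> \<open>For j >= 2 the function \<open>p j\<close> vanishes on \<open>C (j - 1)\<close>,
   whose interior contains \<open>C (j - 2)\<close>. Removing only the latter set leaves room for a
   compact support inside the open set \<open>V j\<close>.\<close>
 define V where "V j = (if j < 2 then U else U - C (j - 2))" for j
 define A where "A n = interior (C n)" for n
 have sum: "(\<Sum>j<Suc n. p j x) = c n x" for n x by (induction n) (auto simp: p_def)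
 have intU: "interior (C n) <= U" for n using C(2) interior_subset by blast
 show ?thesis proof (rule that[of A V p])
  show "open (A n)" for n by (simp add: A_def)
  show "A n <= A (Suc n)" for n unfolding A_def by (rule interior_mono[OF Cmono])
  show "(\<Union>n. A n) = U" proof
  show "(\<Union>n. A n) <= U" using intU by (auto simp: A_def)
  show "U <= (\<Union>n. A n)" proof
  fix x assume "x : U"
  then obtain n where "x : C n" using C(4) by blast
  thus "x : (\<Union>n. A n)" using C(3)[of n] by (auto simp: A_def)
  qed
  qed
  show "open (V j)" for j using assms C(1) by (auto simp: V_def compact_imp_closed intro: open_Diff)
  show "V j <= U" for j by (auto simp: V_def)
  show "test_fun (V j) (p j)" for j proof (cases j)
  case 0
  thus ?thesis using test_fun_mono[OF c(1) intU] by (simp add: p_def V_def)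
  next
  case (Suc i)
  have t: "test_fun U (p j)" using test_fun_add[OF test_fun_mono[OF c(1)[of "Suc i"] intU] test_fun_cmult[OF test_fun_mono[OF c(1)[of i] intU], of "-1"]] by (simp add: p_def Suc)
  show ?thesis proof (cases "j < 2")
  case True
  thus ?thesis using t by (simp add: V_def)
  next
  case False
  then obtain k where k: "i = Suc k" using Suc by (cases i) auto
  obtain K where K: "compact K" "K <= U" "!!x. x ~: K ==> p j x = 0" using t by (auto simp: test_fun_def)
  have z: "p j x = 0" if "x : interior (C i)" for x proof -
  have "x : C i" "x : C (Suc i)" using that Cmono[of i] interior_subset[of "C i"] by auto
  thus ?thesis by (simp add: p_def Suc c(2))
  qed
  have "compact (K - interior (C i))" using K(1) by (intro compact_diff) auto
  moreover have "K - interior (C i) <= V j" using K(2) C(3)[of k] by (auto simp: V_def Suc k)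
  moreover have "ALL x. x ~: K - interior (C i) --> p j x = 0" using K(3) z by auto
  ultimately show ?thesis using test_fun_smooth[OF t] unfolding test_fun_def by blast
  qed
  qed
  show "A n \<inter> V j = {}" if "n + 2 <= j" for n j proof -
  have "C n <= C (j - 2)" by (rule lift_Suc_mono_le[of C, OF Cmono]) (use that in auto)
  thus ?thesis using that interior_subset[of "C n"] by (auto simp: A_def V_def)
  qed
  show "(\<Sum>j<n + 2. p j x) = 1" if "x : A n" for n x using sum[of x "Suc n"] c(2)[of x "Suc n"] that Cmono[of n] interior_subset[of "C n"] by (auto simp: A_def)
 qed
qed

text \<open>Each piece \<open>u * p j\<close> is mollified at its own radius, small enough to stay
  inside \<open>V j\<close> and to keep all the errors below \<open>eta j\<close>. The sum is
  locally finite, hence smooth, and the derivatives falling on the partition cancel because it sums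
  to 1. The errors are measured by nonnegative integrals, so integrability of the sum is not
  presupposed.\<close>

lemma meyers_serrin:
 fixes U :: "'a::euclidean_space set" and u :: "'a => real"
 assumes U: "open U" and I: "finite I"
  and u: "u : L2" and G: "!!i. i : I ==> G i : L2" and wd: "!!i. i : I ==> weak_dird U (e i) u (G i)" and "delta > 0"
 shows "EX v. smooth_on U v & (\<integral>\<^sup>+x\<in>U. ennreal ((v x - u x)^2) \<partial>lborel) <= ennreal (delta^2)
  & (\<forall>i\<in>I. (\<integral>\<^sup>+x\<in>U. ennreal ((dird (e i) v x - G i x)^2) \<partial>lborel) <= ennreal (delta^2))" proof -
 obtain A V p where A: "!!n. open (A n)" "!!n. A n <= A (Suc n)" "(\<Union>n. A n) = U" and V: "!!j. open (V j)" "!!j. V j <= U" "!!j. test_fun (V j) (p j)"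
  and AV: "!!j n. n + 2 <= j ==> A n \<inter> V j = {}" and one: "!!n x. x : A n ==> (\<Sum>j<n + 2. p j x) = 1" using smooth_partition_exhaustion[OF U] by metis
 have AU: "A n <= U" for n using A(3) by blast
 have lp: "lip_test (V j) d (p j) (dird d (p j))" for j d by (rule lip_test_of_test_fun[OF V(3)])
 have lpU: "lip_test U d (p j) (dird d (p j))" for j d by (rule lip_test_mono[OF lp V(2)])
 define f where "f j x = u x * p j x" for j x
 define g where "g i j x = G i x * p j x + u x * dird (e i) (p j) x" for i j x
 have f: "f j : L2" "integrable lborel (f j)" for j unfolding f_def using L2_space_mult_lip_test(1)[OF u lp] L2_mult_integrable[OF u lip_test_L2(1)[OF lp]] by blast+
 have g: "g i j : L2" "integrable lborel (g i j)" if "i : I" for i j unfolding g_def using L2_space_add[OF L2_space_mult_lip_test(1)[OF G[OF that] lp] L2_space_mult_lip_test(2)[OF u lp]]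
  lintegrable_add[OF L2_mult_integrable[OF G[OF that] lip_test_L2(1)[OF lp]] L2_mult_integrable[OF u lip_test_L2(2)[OF lp]]] by blast+
 have wf: "weak_dird UNIV (e i) (f j) (g i j)" if "i : I" for i j unfolding f_def[abs_def] g_def[abs_def] by (rule weak_dird_mult_lip_test[OF U wd[OF that] u G[OF that] lpU])
 \<comment> \<open>A geometric series with sum \<open>delta\<close>, so that the errors of all the
   pieces together stay within it.\<close>
 define eta where "eta j = delta * (1 / 2) ^ Suc j" for j
 have eta: "eta j > 0" for j using \<open>delta > 0\<close> by (simp add: eta_def)
 let ?P = "%j eps. test_fun (V j) (conv (f j) (kern eps)) & conv (f j) (kern eps) : L2 & nrm2 (%x. conv (f j) (kern eps) x - f j x) <= eta j & (\<forall>i\<in>I. conv (g i j) (kern eps) : L2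
  & nrm2 (%x. conv (g i j) (kern eps) x - g i j x) <= eta j)"
 have ex: "EX eps. eps > 0 & ?P j eps" for j proof -
  obtain K where K: "compact K" "K <= V j" "!!x. x ~: K ==> p j x = 0" using V(3)[of j] by (auto simp: test_fun_def)
  have Kf: "f j x = 0" if "x ~: K" for x using K(3)[OF that] by (simp add: f_def)
  obtain d1 where d1: "d1 > 0" "!!eps. 0 < eps & eps < d1 ==> test_fun (V j) (conv (f j) (kern eps))" using test_fun_conv[OF V(1) K(1,2) Kf f(2)] by blast
  obtain d2 where d2: "d2 > 0" "!!eps. 0 < eps & eps < d2 ==> conv (f j) (kern eps) : L2 & nrm2 (%x. conv (f j) (kern eps) x - f j x) <= eta j" using mollify_L2[OF f(2,1) eta] by blast
  have "\<exists>d>0. ALL eps. 0 < eps & eps < d --> conv (g i j) (kern eps) : L2 & nrm2 (%x. conv (g i j) (kern eps) x - g i j x) <= eta j" if "i : I" for i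
  by (rule mollify_L2[OF g(2,1)[OF that] eta])
  then obtain d3 where d3: "!!i. i : I ==> d3 i > 0" "!!i eps. i : I ==> 0 < eps & eps < d3 i ==> conv (g i j) (kern eps) : L2 & nrm2 (%x. conv (g i j) (kern eps) x - g i j x) <= eta j" by metis
  define m where "m = Min (insert d1 (insert d2 (d3 ` I)))"
  have m: "m > 0" unfolding m_def by (subst Min_gr_iff) (use I d1(1) d2(1) d3(1) in auto)
  have le: "m <= y" if "y : insert d1 (insert d2 (d3 ` I))" for y unfolding m_def by (rule Min_le) (use I that in auto)
  have m: "m > 0" "m <= d1" "m <= d2" "!!i. i : I ==> m <= d3 i" using m le by auto
  have "0 < m / 2 & m / 2 < d1" "0 < m / 2 & m / 2 < d2" using m by auto
  moreover have "0 < m / 2 & m / 2 < d3 i" if "i : I" for i using m(1) m(4)[OF that] by simp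
  ultimately have "?P j (m / 2)" using d1(2) d2(2) d3(2) by blast
  thus ?thesis using m(1) by (intro exI[of _ "m / 2"]) simp
 qed
 define eps where "eps j = (SOME eps. eps > 0 & ?P j eps)" for j
 have P: "eps j > 0 & ?P j (eps j)" for j unfolding eps_def by (rule someI_ex[OF ex])
 define w where "w j = conv (f j) (kern (eps j))" for j
 define w' where "w' i j = conv (g i j) (kern (eps j))" for i j
 have wt: "test_fun (V j) (w j)" and w2: "w j : L2" and wn: "nrm2 (%x. w j x - f j x) <= eta j" for j using P[of j] unfolding w_def by blast+
 have w'2: "w' i j : L2" and w'n: "nrm2 (%x. w' i j x - g i j x) <= eta j" if "i : I" for i j using P[of j] that unfolding w'_def by blast+
 have dw: "dird (e i) (w j) x = w' i j x" if "i : I" for i j x unfolding w_def w'_def using P[of j] by (intro dird_conv_kern[OF wf[OF that] f(2)]) auto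
 define v where "v x = (\<Sum>j. w j x)" for x
 have w0: "w j x = 0" if "x : A n" "n + 2 <= j" for x n j using wt[of j] AV[OF that(2)] that(1) unfolding test_fun_def by blast
 have v: "v x = (\<Sum>j<n + 2. w j x)" if "x : A n" for x n unfolding v_def by (rule suminf_finite) (use w0[OF that] in auto)
 have sw: "smooth_on UNIV (w j)" for j by (rule test_fun_smooth[OF wt])
 have sA: "smooth_on (A n) v" for n proof (rule smooth_on_cong[OF A(1)])
  show "smooth_on (A n) (%x. \<Sum>j<n + 2. w j x)" by (intro smooth_on_sum A(1) smooth_on_subset[OF sw]) auto
 qed (simp only: v)
 have sv: "smooth_on U v" using smooth_on_UN[of A v] A sA by simp
 have dv: "dird (e i) v x = (\<Sum>j<n + 2. w' i j x)" if "x : A n" "i : I" for x n i proof -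
  have wd: "w j differentiable (at x)" for j using smooth_onD[OF sw] by simp
  have "dird (e i) v x = dird (e i) (%x. \<Sum>j<n + 2. w j x) x" using frechet_derivative_cong_open(2)[OF A(1) that(1), of "%x. \<Sum>j<n + 2. w j x" v] v wd
  by (simp del: sum.lessThan_Suc add_2_eq_Suc add_2_eq_Suc')
  also have "... = (\<Sum>j<n + 2. dird (e i) (w j) x)" by (rule dird_sum) (rule wd)
  finally show ?thesis by (simp only: dw[OF that(2)])
 qed
 have dp: "(\<Sum>j<n + 2. dird d (p j) x) = 0" if "x : A n" for n x d proof -
  have pd: "p j differentiable (at x)" for j using smooth_onD[OF test_fun_smooth[OF V(3)]] by simp
  have "(\<Sum>j<n + 2. dird d (p j) x) = dird d (%x. \<Sum>j<n + 2. p j x) x" by (rule dird_sum[symmetric]) (rule pd)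
  also have "... = dird d (%x. 1) x" using frechet_derivative_cong_open(2)[OF A(1) that, of "%x. 1" "%x. \<Sum>j<n + 2. p j x"] one by simp
  finally show ?thesis by (simp add: frechet_derivative_const)
 qed
 have uf: "u x = (\<Sum>j<n + 2. f j x)" if "x : A n" for x n unfolding f_def sum_distrib_left[symmetric] one[OF that] by simp
 have Gg: "G i x = (\<Sum>j<n + 2. g i j x)" if "x : A n" for x n i unfolding g_def sum.distrib sum_distrib_left[symmetric] one[OF that] dp[OF that] by simp
 \<comment> \<open>On \<open>A n\<close> only the pieces below n + 2 contribute, so the bound there
   is a finite triangle inequality; monotone convergence along the exhaustion carries it to
   \<open>U\<close>. It is applied to the error of \<open>v\<close> and to the error of each
   derivative.\<close>
 have main: "(\<integral>\<^sup>+x\<in>U. ennreal ((h x)^2) \<partial>lborel) <= ennreal (delta^2)" if h: "!!n x. x : A n ==> h x = (\<Sum>j<n + 2. E j x)" "(%x. indicator U x * h x) : borel_fun"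
  "!!j. E j : L2" "!!j. nrm2 (E j) <= eta j" for h E proof -
  have [measurable]: "(%x. indicator U x * h x) : borel_fun" by fact
  have [measurable]: "A n : sets borel" for n using A(1) by simp
  have hU: "(\<integral>\<^sup>+x\<in>S. ennreal ((h x)^2) \<partial>lborel) = (NN x. ennreal ((indicator U x * h x)^2) * indicator S x)" if "S <= U" for S
  using that by (intro nn_integral_cong) (auto simp: indicator_def)
  have bound: "(\<integral>\<^sup>+x\<in>A n. ennreal ((h x)^2) \<partial>lborel) <= ennreal (delta^2)" for n proof -
  let ?S = "%x. \<Sum>j<n + 2. E j x"
  have S: "?S : L2" by (rule L2_space_sum) (rule h(3))
  have geo: "(\<Sum>j<m. eta j) <= delta" for m proof -
  have "(\<Sum>j<m. eta j) = delta * (1 - (1 / 2) ^ m)" by (induction m) (auto simp: eta_def algebra_simps)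
  also have "... <= delta * 1" using \<open>delta > 0\<close> by (intro mult_left_mono) auto
  finally show ?thesis by simp
  qed
  have "nrm2 ?S <= (\<Sum>j<n + 2. nrm2 (E j))" by (rule L2_norm_sum_le) (rule h(3))
  also have "... <= (\<Sum>j<n + 2. eta j)" by (rule sum_mono) (rule h(4))
  also have "... <= delta" by (rule geo)
  finally have "(nrm2 ?S)^2 <= delta^2" using L2_norm_nonneg by (intro power_mono)
  hence le: "(LBINT x. (?S x)^2) <= delta^2" by (simp only: L2_norm_sq)
  have "(\<integral>\<^sup>+x\<in>A n. ennreal ((h x)^2) \<partial>lborel) <= (NN x. ennreal ((?S x)^2))"
  by (intro nn_integral_mono) (auto simp: indicator_def h(1) simp del: sum.lessThan_Suc add_2_eq_Suc')
  also have "... = ennreal (LBINT x. (?S x)^2)" by (rule nn_integral_eq_integral) (use L2D[OF S] in auto)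
  also have "... <= ennreal (delta^2)" using le by (rule ennreal_leI)
  finally show ?thesis .
  qed
  have "(\<integral>\<^sup>+x\<in>U. ennreal ((h x)^2) \<partial>lborel) = (NN x. (SUP n. ennreal ((indicator U x * h x)^2) * indicator (A n) x))" proof (rule nn_integral_cong)
  fix x :: 'a
  show "ennreal ((h x)^2) * indicator U x = (SUP n. ennreal ((indicator U x * h x)^2) * indicator (A n) x)" proof (cases "x : U")
  case True
  then obtain n where n: "x : A n" using A(3) by blast
  show ?thesis proof (rule antisym)
  have "ennreal ((h x)^2) * indicator U x = ennreal ((indicator U x * h x)^2) * indicator (A n) x" using True n by simp
  also have "... <= (SUP n. ennreal ((indicator U x * h x)^2) * indicator (A n) x)" by (rule SUP_upper) simp
  finally show "ennreal ((h x)^2) * indicator U x <= (SUP n. ennreal ((indicator U x * h x)^2) * indicator (A n) x)" .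
  qed (auto intro!: SUP_least simp: True indicator_def)
  next
  case False
  hence "x ~: A n" for n using AU by blast
  thus ?thesis using False by simp
  qed
  qed
  also have "... = (SUP n. \<integral>\<^sup>+x. ennreal ((indicator U x * h x)^2) * indicator (A n) x \<partial>lborel)" proof (rule nn_integral_monotone_convergence_SUP)
  show "incseq (%n x. ennreal ((indicator U x * h x)^2) * indicator (A n) x)" using A(2) by (intro incseq_SucI le_funI) (auto simp: indicator_def)
  qed measurable
  also have "... <= ennreal (delta^2)" by (rule SUP_least) (use bound hU[OF AU] in simp)
  finally show ?thesis .
 qed
 have meas: "(%x. indicator U x * (r x - s x)) : borel_fun" if "smooth_on U r" "s : L2" for r s proof -
  have [measurable]: "(%x. indicator U x * r x) : borel_fun" using borel_measurable_continuous_on_indicator[OF _ smooth_on_continuous[OF that(1)]] U by simp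
  have [measurable]: "s : borel_fun" "U : sets borel" using L2D(1)[OF that(2)] U by auto
  have "(%x. indicator U x * r x - indicator U x * s x) : borel_fun" by measurable
  thus ?thesis by (simp add: right_diff_distrib)
 qed
 have "(\<integral>\<^sup>+x\<in>U. ennreal ((v x - u x)^2) \<partial>lborel) <= ennreal (delta^2)" proof (rule main[where E = "%j x. w j x - f j x"])
  show "v x - u x = (\<Sum>j<n + 2. w j x - f j x)" if "x : A n" for n x unfolding sum_subtractf v[OF that] uf[OF that] ..
 qed (use wn L2_space_diff[OF w2 f(1)] meas[OF sv u] in auto)
 moreover have "(\<integral>\<^sup>+x\<in>U. ennreal ((dird (e i) v x - G i x)^2) \<partial>lborel) <= ennreal (delta^2)" if i: "i : I" for i proof (rule main[where E = "%j x. w' i j x - g i j x"])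
  show "dird (e i) v x - G i x = (\<Sum>j<n + 2. w' i j x - g i j x)" if "x : A n" for n x unfolding sum_subtractf dv[OF that i] Gg[OF that] ..
 qed (use w'n[OF i] L2_space_diff[OF w'2[OF i] g(1)[OF i]] meas[OF smooth_on_frechet[OF sv] G[OF i]] in auto)
 ultimately show ?thesis using sv by blast
qed

section \<open>Coordinates on the plane\<close>

text \<open>The adjoint of \<open>plane_isometry\<close>: its inverse on the plane, preceded by the
  orthogonal projection elsewhere.\<close>

definition plane_coords :: "real^3 => real^2" where
 "plane_coords theta = vector [(theta $ 1 - theta $ 2) / sqrt 2, (theta $ 1 + theta $ 2 - 2 * theta $ 3) / sqrt 6]"

definition emb :: "coord => state" where
 "emb y = (plane_isometry (fst y), snd y)"

definition coords :: "state => coord" where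
 "coords p = (plane_coords (fst p), snd p)"

text \<open>The coordinate vector of the orthogonal projection of the \<open>k\<close>-th unit vector onto the plane.\<close>

definition cdir :: "3 => real^2" where
 "cdir k = plane_coords (axis k 1)"

lemma plane_isometry_nth [simp]:
 "plane_isometry u $ 1 = u $ 1 / sqrt 2 + u $ 2 / sqrt 6" "plane_isometry u $ 2 = - (u $ 1 / sqrt 2) + u $ 2 / sqrt 6" "plane_isometry u $ 3 = - (2 * u $ 2 / sqrt 6)"
 by (simp_all add: plane_isometry_def)

lemma plane_coords_nth [simp]:
 "plane_coords theta $ 1 = (theta $ 1 - theta $ 2) / sqrt 2" "plane_coords theta $ 2 = (theta $ 1 + theta $ 2 - 2 * theta $ 3) / sqrt 6" by (simp_all add: plane_coords_def)

lemma plane_isometry_sum: "plane_isometry u $ 1 + plane_isometry u $ 2 + plane_isometry u $ 3 = 0"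
 by simp

lemma sqrt_cancel: "x / sqrt 2 / sqrt 2 = x / 2" "x / sqrt 6 / sqrt 6 = x / 6"
 by (simp_all add: divide_divide_eq_left)

lemma plane_coords_plane_isometry [simp]: "plane_coords (plane_isometry u) = u"
 by (simp add: vec_eq_iff forall_2 diff_divide_distrib add_divide_distrib sqrt_cancel)

lemma plane_isometry_plane_coords:
 assumes "theta $ 1 + theta $ 2 + theta $ 3 = 0"
 shows "plane_isometry (plane_coords theta) = theta"
proof -
 have "theta $ 3 = - theta $ 1 - theta $ 2" using assms by linarith
 thus ?thesis by (simp add: vec_eq_iff forall_3 sqrt_cancel) (simp add: field_simps)
qed

lemma linear_plane_isometry: "linear plane_isometry"
 by (rule linearI) (simp_all add: vec_eq_iff forall_3 add_divide_distrib algebra_simps)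

lemma linear_plane_coords: "linear plane_coords"
 by (rule linearI) (simp_all add: vec_eq_iff forall_2 add_divide_distrib diff_divide_distrib algebra_simps)

lemma bounded_linear_embed: "bounded_linear emb"
proof -
 have "linear emb" by (rule linearI) (simp_all add: emb_def linear_add[OF linear_plane_isometry] linear_scale[OF linear_plane_isometry])
 thus ?thesis by (simp add: linear_conv_bounded_linear)
qed

lemma bounded_linear_coords: "bounded_linear coords"
proof -
 have "linear coords" by (rule linearI) (simp_all add: coords_def linear_add[OF linear_plane_coords] linear_scale[OF linear_plane_coords])
 thus ?thesis by (simp add: linear_conv_bounded_linear)
qed

lemma coords_embed [simp]: "coords (emb y) = y"
 by (simp add: coords_def emb_def)

lemma embed_coords: "p : Omega \<times> T ==> emb (coords p) = p"
 by (auto simp: coords_def emb_def Omega_def plane_isometry_plane_coords)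

lemma plane_isometry_cdir: "plane_isometry (cdir k) = (\<chi> j. (if j = k then 1 else 0) - 1 / 3)"
proof -
 have "axis k (1::real) $ j = (if j = k then 1 else 0)" for j by (simp add: axis_def)
 thus ?thesis using exhaust_3[of k] by (auto simp: vec_eq_iff forall_3 cdir_def sqrt_cancel)
qed

lemma embed_cdir: "emb (cdir k, 0) = (plane_isometry (cdir k), 0)"
 by (simp add: emb_def)

text \<open>In these coordinates the domain is open in the surrounding space, as
  \<open>Omega \<times> T\<close> is not, so weak derivatives on open sets of Euclidean spaces
  apply.\<close>

definition cdom :: "(real^2) set => (coord) set" where
 "cdom T = emb -` (Omega \<times> T)"

abbreviation ind where "ind T == indicator (cdom T)"

lemma mem_cdom: "y : cdom T \<longleftrightarrow> (ALL k. abs (plane_isometry (fst y) $ k) < pi / 4) & snd y : T"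
proof -
 have abs: "- (pi / 4) < a & a < pi / 4 \<longleftrightarrow> (abs a) < pi / 4" for a :: real by linarith
 show ?thesis unfolding cdom_def vimage_def emb_def Omega_def mem_Times_iff mem_Collect_eq fst_conv snd_conv abs using plane_isometry_sum by blast
qed

lemma continuous_on_embed: "continuous_on S emb"
 by (rule linear_continuous_on[OF bounded_linear_embed])

lemma continuous_on_coords: "continuous_on S coords"
 by (rule linear_continuous_on[OF bounded_linear_coords])

lemma open_cdom:
 assumes "open T" shows "open (cdom T)"
proof -
 have "cdom T = (\<Inter>k. {y. abs (fst (emb y) $ k) < pi / 4}) \<inter> {y. snd y : T}" by (auto simp: mem_cdom emb_def)
 moreover have "open {y. abs (fst (emb y) $ k) < pi / 4}" for k by (intro open_Collect_less continuous_intros continuous_on_embed)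
 moreover have "open {y :: coord. snd y : T}" using open_vimage[OF assms, of snd] by (simp add: vimage_def continuous_on_snd)
 ultimately show ?thesis by (auto intro!: open_INT)
qed

lemma embed_measurable [measurable]: "emb : borel_fun"
 by (rule borel_measurable_continuous_onI[OF continuous_on_embed])

lemma coords_measurable [measurable]: "coords : borel_fun"
 by (rule borel_measurable_continuous_onI[OF continuous_on_coords])

lemma Omega_measurable: "Omega : sets borel"
proof -
 have a: "closed {theta::real^3. theta $ 1 + theta $ 2 + theta $ 3 = 0}" by (intro closed_Collect_eq continuous_intros)
 have "open {theta::real^3. - (pi / 4) < theta $ k & theta $ k < pi / 4}" for k by (intro open_Collect_conj open_Collect_less continuous_intros)
 hence b: "open (\<Inter>k. {theta::real^3. - (pi / 4) < theta $ k & theta $ k < pi / 4})" by (intro open_INT) auto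
 have c: "Omega = (\<Inter>k. {theta::real^3. - (pi / 4) < theta $ k & theta $ k < pi / 4}) \<inter> {theta. theta $ 1 + theta $ 2 + theta $ 3 = 0}" by (auto simp: Omega_def)
 show ?thesis unfolding c by (intro sets.Int borel_open borel_closed a b)
qed

lemma dom_measurable: "open T ==> Omega \<times> T : sets borel"
 using Omega_measurable by (simp add: borel_Times)

lemma plane_lborel: "plane_measure \<Otimes>\<^sub>M lborel = distr lborel borel emb"
proof -
 have m: "plane_isometry : lborel \<rightarrow>\<^sub>M borel" using borel_measurable_continuous_onI[OF linear_continuous_on[OF linear_plane_isometry[unfolded linear_conv_bounded_linear]]] by simp
 have "plane_measure \<Otimes>\<^sub>M (lborel :: (real^2) measure) = distr lborel borel plane_isometry \<Otimes>\<^sub>M distr lborel borel (%x. x)" by (simp add: plane_measure_def distr_id2)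
 also have "... = distr (lborel \<Otimes>\<^sub>M lborel) (borel \<Otimes>\<^sub>M borel) (%(x, y). (plane_isometry x, y))"
  by (rule pair_measure_distr[OF m]) (simp_all add: distr_id2 sigma_finite_lborel)
 also have "... = distr lborel borel emb" by (simp add: lborel_prod borel_prod emb_def[abs_def] case_prod_beta')
 finally show ?thesis .
qed

lemma base_measure_eq: "base_measure T = restrict_space (distr lborel borel emb) (Omega \<times> T)"
 by (simp add: base_measure_def plane_lborel)

lemma space_base: "space (base_measure T) = Omega \<times> T"
 by (simp add: base_measure_eq space_restrict_space)

text \<open>Extension by zero makes integrals over \<open>base_measure T\<close> integrals against
  plain Lebesgue measure on the coordinate space.\<close>

definition pull :: "(real^2) set => (state => real) => coord => real" where
 "pull T f y = ind T y * f (emb y)"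

lemma indicator_cdom: "ind T y = indicator (Omega \<times> T) (emb y)"
 by (simp add: cdom_def indicator_def)

lemma measurable_base_iff:
 assumes "open T"
 shows "f : borel_measurable (base_measure T) \<longleftrightarrow> pull T f : borel_fun"
proof -
 have d: "Omega \<times> T : sets borel" by (rule dom_measurable[OF assms])
 have "f : borel_measurable (base_measure T) \<longleftrightarrow> (%p. indicator (Omega \<times> T) p * f p) : borel_fun"
  unfolding base_measure_eq using d by (subst borel_measurable_restrict_space_iff) auto
 also have "... \<longleftrightarrow> pull T f : borel_fun" proof
  assume [measurable]: "(%p. indicator (Omega \<times> T) p * f p) : borel_fun"
  have "(%y. indicator (Omega \<times> T) (emb y) * f (emb y)) : borel_fun" by measurable
  thus "pull T f : borel_fun" by (simp add: pull_def[abs_def] indicator_cdom)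
 next
  assume [measurable]: "pull T f : borel_fun"
  have [measurable]: "Omega \<times> T : sets borel" by (rule d)
  have "(%p. indicator (Omega \<times> T) p * pull T f (coords p)) : borel_fun" by measurable
  also have "(%p. indicator (Omega \<times> T) p * pull T f (coords p)) = (%p. indicator (Omega \<times> T) p * f p)" by (auto simp: fun_eq_iff pull_def indicator_def cdom_def embed_coords)
  finally show "(%p. indicator (Omega \<times> T) p * f p) : borel_fun" .
 qed
 finally show ?thesis .
qed

lemma nn_integral_base:
 assumes "open T" "f : borel_measurable (base_measure T)"
 shows "(\<integral>\<^sup>+p. f p \<partial>base_measure T) = (\<integral>\<^sup>+y\<in>cdom T. f (emb y) \<partial>lborel)"
proof -
 have d: "Omega \<times> T : sets borel" by (rule dom_measurable[OF assms(1)])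
 have m: "(%p. f p * indicator (Omega \<times> T) p) : borel_fun" using assms(2) d unfolding base_measure_eq by (subst (asm) borel_measurable_restrict_space_iff_ennreal) auto
 have "(\<integral>\<^sup>+p. f p \<partial>base_measure T) = (\<integral>\<^sup>+p. f p * indicator (Omega \<times> T) p \<partial>distr lborel borel emb)"
  unfolding base_measure_eq by (rule nn_integral_restrict_space) (use d in auto)
 also have "... = (NN y. f (emb y) * indicator (Omega \<times> T) (emb y))" by (rule nn_integral_distr) (use m in auto)
 finally show ?thesis by (simp add: cdom_def indicator_def vimage_def cong: if_cong)
qed

text \<open>Measurability of \<open>f\<close> need not be assumed: if it fails on one side it fails
  on the other, so neither function is integrable and both integrals have the default value
  0.\<close>

lemma integrable_base_iff:
 assumes "open T"
 shows "integrable (base_measure T) f \<longleftrightarrow> integrable lborel (pull T f)" "(\<integral>p. f p \<partial>base_measure T) = (LBINT y. pull T f y)"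
proof -
 have d: "Omega \<times> T : sets borel" by (rule dom_measurable[OF assms(1)])
 let ?F = "%p. indicator (Omega \<times> T) p * f p"
 have p: "pull T f = (%y. ?F (emb y))" by (auto simp: pull_def indicator_cdom)
 have 1: "integrable (base_measure T) f \<longleftrightarrow> integrable (distr lborel borel emb) ?F" unfolding base_measure_eq using d by (subst integrable_restrict_space) auto
 have 2: "(\<integral>p. f p \<partial>base_measure T) = (\<integral>p. ?F p \<partial>distr lborel borel emb)" unfolding base_measure_eq using d by (subst integral_restrict_space) auto
 have m: "?F : borel_fun \<longleftrightarrow> pull T f : borel_fun" using measurable_base_iff[OF assms, of f] d unfolding base_measure_eq by (subst (asm) borel_measurable_restrict_space_iff) auto
 show i: "integrable (base_measure T) f \<longleftrightarrow> integrable lborel (pull T f)" proof (cases "?F : borel_fun")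
  case True
  thus ?thesis unfolding 1 p by (intro integrable_distr_eq) auto
 next
  case False
  hence "\<not> integrable (distr lborel borel emb) ?F" "\<not> integrable lborel (pull T f)" using m borel_measurable_integrable[of "distr lborel borel emb" ?F]
  borel_measurable_integrable[of lborel "pull T f"] by auto
  thus ?thesis unfolding 1 by simp
 qed
 show "(\<integral>p. f p \<partial>base_measure T) = (LBINT y. pull T f y)" proof (cases "?F : borel_fun")
  case True
  thus ?thesis unfolding 2 p by (intro integral_distr) auto
 next
  case False
  hence "\<not> integrable (distr lborel borel emb) ?F" "\<not> integrable lborel (pull T f)" using m borel_measurable_integrable[of "distr lborel borel emb" ?F]
  borel_measurable_integrable[of lborel "pull T f"] by auto
  thus ?thesis unfolding 2 by (simp add: not_integrable_integral_eq)
 qed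
qed

lemma AE_base_iff:
 assumes "open T"
 shows "(AE p in base_measure T. P p) \<longleftrightarrow> (AE y in lborel. y : cdom T --> P (emb y))"
proof -
 have d: "Omega \<times> T : sets borel" by (rule dom_measurable[OF assms(1)])
 have "(AE p in base_measure T. P p) \<longleftrightarrow> (AE p in distr lborel borel emb. p : Omega \<times> T --> P p)" unfolding base_measure_eq by (rule AE_restrict_space_iff) (use d in simp)
 also have "... \<longleftrightarrow> (AE y in lborel. y : cdom T --> P (emb y))" proof
  assume "AE p in distr lborel borel emb. p : Omega \<times> T --> P p"
  hence "AE y in lborel. emb y : Omega \<times> T --> P (emb y)" by (rule AE_distrD[rotated]) simp
  thus "AE y in lborel. y : cdom T --> P (emb y)" by (simp add: cdom_def)
 next
  assume "AE y in lborel. y : cdom T --> P (emb y)"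
  then obtain N where N: "N : null_sets lborel" "!!y. y ~: N ==> y : cdom T ==> P (emb y)" by (force elim!: AE_E3)
  \<comment> \<open>\<open>coords\<close> is a left inverse of \<open>emb\<close>. Hence the
    preimage of \<open>N\<close> under \<open>coords\<close> has \<open>N\<close> itself as its
    preimage under \<open>emb\<close>, and is a null set of the image measure.\<close>
  let ?N = "coords -` N"
  have s: "?N : sets borel" using N(1) measurable_sets[OF coords_measurable, of N] by auto
  have "emeasure (distr lborel borel emb) ?N = emeasure lborel (emb -` ?N)" using s by (subst emeasure_distr) auto
  also have "emb -` ?N = N" unfolding vimage_def by simp
  finally have "?N : null_sets (distr lborel borel emb)" using N(1) s by (auto simp: null_sets_def)
  thus "AE p in distr lborel borel emb. p : Omega \<times> T --> P p" proof (rule AE_I')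
  show "{p : space (distr lborel borel emb). \<not> (p : Omega \<times> T --> P p)} <= ?N" proof
  fix p assume "p : {p : space (distr lborel borel emb). \<not> (p : Omega \<times> T --> P p)}"
  hence p: "p : Omega \<times> T" "\<not> P p" by auto
  have "coords p : cdom T" using p(1) by (simp add: cdom_def embed_coords)
  thus "p : ?N" using N(2)[of "coords p"] p embed_coords[OF p(1)] by auto
  qed
  qed
 qed
 finally show ?thesis .
qed

lemma loc_integrable_iff:
 assumes "open T"
 shows "loc_integrable T u \<longleftrightarrow> loc_int (cdom T) (%y. u (emb y))"
proof -
 have eq: "set_integrable (base_measure T) K u \<longleftrightarrow> integrable lborel (%y. indicator (coords ` K) y * u (emb y))" if "K <= Omega \<times> T" for K proof -
  have "y : cdom T & emb y : K \<longleftrightarrow> y : coords ` K" for y using that embed_coords by (auto simp: cdom_def image_iff) (metis coords_embed)+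
  hence "pull T (%p. indicator K p * u p) = (%y. indicator (coords ` K) y * u (emb y))" by (auto simp: fun_eq_iff pull_def indicator_def)
  thus ?thesis unfolding set_integrable_def using integrable_base_iff(1)[OF assms] by simp
 qed
 have 1: "compact (coords ` K)" if "compact K" for K by (intro compact_continuous_image continuous_on_coords that)
 have 2: "compact (emb ` K)" if "compact K" for K by (intro compact_continuous_image continuous_on_embed that)
 show ?thesis unfolding loc_integrable_def loc_int_def proof (intro iffI allI impI; elim conjE)
  fix K assume *: "ALL K. compact K & K <= Omega \<times> T --> set_integrable (base_measure T) K u" and K: "compact K" "K <= cdom T"
  have s: "emb ` K <= Omega \<times> T" using K(2) by (auto simp: cdom_def)
  have "coords ` emb ` K = K" by (simp add: image_image)
  thus "integrable lborel (%x. indicator K x * u (emb x))" using * 2[OF K(1)] s eq[OF s] by simp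
 next
  fix K assume *: "ALL K. compact K & K <= cdom T --> integrable lborel (%x. indicator K x * u (emb x))" and K: "compact K" "K <= Omega \<times> T"
  have "coords ` K <= cdom T" using K(2) embed_coords by (auto simp: cdom_def)
  thus "set_integrable (base_measure T) K u" using * 1[OF K(1)] eq[OF K(2)] by blast
 qed
qed

text \<open>Row \<open>k\<close> of the projection matrix I - J / 3 is the projection of the k-th
  unit vector onto the plane, which is \<open>plane_isometry (cdir k)\<close>. Pairing it with the
  partial derivatives gives a directional derivative.\<close>

lemma tgrad_nth:
 assumes "phi differentiable (at p)"
 shows "tgrad phi p $ k = dird (emb (cdir k, 0)) phi p"
proof -
 have lin: "linear (frechet_derivative phi (at p))" using assms frechet_derivative_works has_derivative_linear by blast
 let ?f = "frechet_derivative phi (at p)"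
 have "emb (cdir k, 0) = (SS j. ((if j = k then 1 else 0) - 1 / 3) *\<^sub>R (axis j 1, 0))" unfolding embed_cdir plane_isometry_cdir
  by (auto simp: prod_eq_iff vec_eq_iff fst_sum snd_sum sum_component axis_def if_distrib cong: if_cong)
 hence "dird (emb (cdir k, 0)) phi p = (SS j. ((if j = k then 1 else 0) - 1 / 3) * ?f (axis j 1, 0))" by (simp only: linear_sum[OF lin] linear_scale[OF lin] real_scaleR_def)
 thus ?thesis by (simp add: tgrad_def matrix_vector_mult_def mat_def eq_commute)
qed

lemma agrad_nth: "agrad phi p $ k = dird (emb (0, axis k 1)) phi p"
 by (simp add: agrad_def emb_def linear_0[OF linear_plane_isometry])

lemma dird_embed:
 assumes "phi differentiable (at (emb y))"
 shows "dird v (%y. phi (emb y)) y = dird (emb v) phi (emb y)" "(%y. phi (emb y)) differentiable (at y)"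
proof -
 have "((%y. phi (emb y)) has_derivative (%v. dird (emb v) phi (emb y))) (at y)" using has_derivative_compose[OF bounded_linear_imp_has_derivative[OF bounded_linear_embed]
  assms[unfolded frechet_derivative_works]] by simp
 thus "dird v (%y. phi (emb y)) y = dird (emb v) phi (emb y)" "(%y. phi (emb y)) differentiable (at y)" by (auto simp: frechet_derivative_at[symmetric] differentiable_def)
qed

lemma smooth_on_dom_embed:
 assumes "open T" "smooth_on_dom T phi"
 shows "smooth_on (cdom T) (%y. phi (emb y))" "y : cdom T ==> tgrad phi (emb y) $ k = dird (cdir k, 0) (%y. phi (emb y)) y"
  "y : cdom T ==> agrad phi (emb y) $ i = dird (0, axis i 1) (%y. phi (emb y)) y" proof -
 obtain W where W: "open W" "Omega \<times> T <= W" "smooth_on W phi" using assms(2) by (auto simp: smooth_on_dom_def smooth_on_def)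
 show "smooth_on (cdom T) (%y. phi (emb y))" by (rule smooth_on_compose_linear[OF bounded_linear_embed W(3) _ open_cdom[OF assms(1)]]) (use W(2) in "auto simp: cdom_def")
 show "tgrad phi (emb y) $ k = dird (cdir k, 0) (%y. phi (emb y)) y" "agrad phi (emb y) $ i = dird (0, axis i 1) (%y. phi (emb y)) y" if "y : cdom T" proof -
  have "emb y : W" using that W(2) by (auto simp: cdom_def)
  hence d: "phi differentiable (at (emb y))" by (rule smooth_onD[OF W(3)])
  show "tgrad phi (emb y) $ k = dird (cdir k, 0) (%y. phi (emb y)) y" by (simp only: tgrad_nth[OF d] dird_embed(1)[OF d])
  show "agrad phi (emb y) $ i = dird (0, axis i 1) (%y. phi (emb y)) y" by (simp only: agrad_nth dird_embed(1)[OF d])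
 qed
qed

lemma smooth_on_coords:
 assumes "open T" "smooth_on (cdom T) psi"
 shows "smooth_on_dom T (%p. psi (coords p))" "p : Omega \<times> T ==> tgrad (%p. psi (coords p)) p $ k = dird (cdir k, 0) psi (coords p)"
  "p : Omega \<times> T ==> agrad (%p. psi (coords p)) p $ i = dird (0, axis i 1) psi (coords p)" proof -
 let ?W = "coords -` cdom T"
 have oW: "open ?W" by (rule open_vimage[OF open_cdom[OF assms(1)] continuous_on_coords])
 have sW: "Omega \<times> T <= ?W" using embed_coords by (auto simp: cdom_def)
 have sm: "smooth_on ?W (%p. psi (coords p))" by (rule smooth_on_compose_linear[OF bounded_linear_coords assms(2) _ oW]) auto
 show s: "smooth_on_dom T (%p. psi (coords p))" unfolding smooth_on_dom_def using oW sW sm by (auto simp: smooth_on_def)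
 show "tgrad (%p. psi (coords p)) p $ k = dird (cdir k, 0) psi (coords p)" "agrad (%p. psi (coords p)) p $ i = dird (0, axis i 1) psi (coords p)" if "p : Omega \<times> T"
  using smooth_on_dom_embed(2,3)[OF assms(1) s, of "coords p"] that embed_coords[OF that] by (auto simp: cdom_def)
qed

lemma test_function_coords:
 assumes "open T" "test_fun (cdom T) psi"
 shows "test_function T (%p. psi (coords p))"
proof -
 obtain K where K: "compact K" "K <= cdom T" "!!y. y ~: K ==> psi y = 0" using assms(2) by (auto simp: test_fun_def)
 have "smooth_on_dom T (%p. psi (coords p))" by (rule smooth_on_coords(1)[OF assms(1) smooth_on_subset[OF test_fun_smooth[OF assms(2)]]]) simp
 moreover have "compact (emb ` K)" by (intro compact_continuous_image continuous_on_embed K(1))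
 moreover have "emb ` K <= Omega \<times> T" using K(2) by (auto simp: cdom_def)
 moreover have "psi (coords p) = 0" if "p : Omega \<times> T - emb ` K" for p proof (rule K(3), rule notI)
  assume "coords p : K"
  hence "emb (coords p) : emb ` K" by blast
  thus False using that embed_coords[of p T] by auto
 qed
 ultimately show ?thesis unfolding test_function_def by blast
qed

lemma test_function_embed:
 assumes "open T" "test_function T phi"
 shows "test_fun (cdom T) (%y. ind T y * phi (emb y))"
proof -
 let ?psi = "%y. ind T y * phi (emb y)"
 have s: "smooth_on_dom T phi" and ex: "EX K. compact K & K <= Omega \<times> T & (\<forall>p\<in>Omega \<times> T - K. phi p = 0)"
  using assms(2) unfolding test_function_def by (rule conjunct1, rule conjunct2)
 from ex obtain K where K: "compact K" "K <= Omega \<times> T" "\<forall>p\<in>Omega \<times> T - K. phi p = 0" by (elim exE conjE)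
 have cK: "compact (coords ` K)" by (intro compact_continuous_image continuous_on_coords K(1))
 have sK: "coords ` K <= cdom T" using K(2) embed_coords by (auto simp: cdom_def)
 have z: "?psi y = 0" if "y ~: coords ` K" for y proof (cases "y : cdom T")
  case True
  have "emb y ~: K" using that image_eqI[of y coords "emb y" K] by auto
  moreover have "emb y : Omega \<times> T" using True by (simp only: cdom_def vimage_eq)
  ultimately have "emb y : Omega \<times> T - K" by (rule DiffI[rotated])
  hence "phi (emb y) = 0" by (rule bspec[OF K(3)])
  thus ?thesis by (simp only: mult_zero_right)
 qed simp
 have "smooth_on (cdom T) ?psi" by (rule smooth_on_cong[OF open_cdom[OF assms(1)] smooth_on_dom_embed(1)[OF assms(1) s]]) simp
 moreover have "smooth_on (- coords ` K) ?psi" by (rule smooth_on_cong[OF _ smooth_on_const[of _ 0]]) (use cK compact_imp_closed z in auto)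
 ultimately have "smooth_on (cdom T \<union> - coords ` K) ?psi" using cK by (intro smooth_on_union open_cdom assms) (auto simp: compact_imp_closed open_Compl)
 moreover have "cdom T \<union> - coords ` K = UNIV" using sK by auto
 ultimately show ?thesis unfolding test_fun_def using cK sK z by auto
qed

text \<open>Covers a component of either gradient at once: \<open>D\<close> is the component and
  \<open>e\<close> its direction in coordinates. Test functions on both sides correspond by
  composition with \<open>coords\<close> and with \<open>emb\<close>, the latter extended by
  zero.\<close>

lemma has_weak_grad_iff_aux:
 assumes T: "open T" and gr: "!!phi y. smooth_on_dom T phi ==> y : cdom T ==> D phi (emb y) = dird e (%y. phi (emb y)) y"
 shows "(loc_integrable T u & loc_integrable T G & (ALL phi. test_function T phi --> (\<integral>p. u p * D phi p \<partial>base_measure T) = - (\<integral>p. G p * phi p \<partial>base_measure T)))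
  \<longleftrightarrow> weak_dird (cdom T) e (%y. u (emb y)) (%y. G (emb y))" proof -
 have conv: "((\<integral>p. u p * D phi p \<partial>base_measure T) = - (\<integral>p. G p * phi p \<partial>base_measure T))
  \<longleftrightarrow> ((LBINT y. u (emb y) * dird e psi y) = - (LBINT y. G (emb y) * psi y))"
  if t: "test_function T phi" "test_fun (cdom T) psi" "!!y. y : cdom T ==> psi y = phi (emb y)" for phi psi proof -
  have s: "smooth_on_dom T phi" using t(1) by (simp add: test_function_def)
  obtain K where K: "compact K" "K <= cdom T" "!!y. y ~: K ==> psi y = 0" using t(2) by (auto simp: test_fun_def)
  have dz: "dird e psi y = 0" if "y ~: K" for y by (rule dird_zero_off_closed[OF compact_imp_closed[OF K(1)] K(3) that])
  have d: "dird e psi y = D phi (emb y)" if "y : cdom T" for y using frechet_derivative_cong_open(2)[OF open_cdom[OF T] that, of psi "%y. phi (emb y)"] t(3)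
  smooth_onD[OF test_fun_smooth[OF t(2)], of y] gr[OF s that] by simp
  have "pull T (%p. u p * D phi p) = (%y. u (emb y) * dird e psi y)" proof (rule ext)
  fix y show "pull T (%p. u p * D phi p) y = u (emb y) * dird e psi y" using d[of y] dz[of y] K(2) by (cases "y : cdom T") (auto simp: pull_def)
  qed
  moreover have "pull T (%p. G p * phi p) = (%y. G (emb y) * psi y)" proof (rule ext)
  fix y show "pull T (%p. G p * phi p) y = G (emb y) * psi y" using t(3)[of y] K(3)[of y] K(2) by (cases "y : cdom T") (auto simp: pull_def)
  qed
  ultimately show ?thesis by (simp only: integrable_base_iff(2)[OF T])
 qed
 have "(ALL phi. test_function T phi --> (\<integral>p. u p * D phi p \<partial>base_measure T) = - (\<integral>p. G p * phi p \<partial>base_measure T))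
  \<longleftrightarrow> (ALL psi. test_fun (cdom T) psi --> (LBINT y. u (emb y) * dird e psi y) = - (LBINT y. G (emb y) * psi y))" proof (intro iffI allI impI)
  fix psi :: "coord => real" assume t: "test_fun (cdom T) psi"
  assume "ALL phi. test_function T phi --> (\<integral>p. u p * D phi p \<partial>base_measure T) = - (\<integral>p. G p * phi p \<partial>base_measure T)"
  thus "(LBINT y. u (emb y) * dird e psi y) = - (LBINT y. G (emb y) * psi y)" using conv[OF test_function_coords[OF T t] t] test_function_coords[OF T t] by simp
 next
  fix phi assume t: "test_function T phi"
  assume "ALL psi. test_fun (cdom T) psi --> (LBINT y. u (emb y) * dird e psi y) = - (LBINT y. G (emb y) * psi y)"
  thus "(\<integral>p. u p * D phi p \<partial>base_measure T) = - (\<integral>p. G p * phi p \<partial>base_measure T)"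
  using conv[OF t test_function_embed[OF T t]] test_function_embed[OF T t] by simp
 qed
 thus ?thesis by (simp only: weak_dird_def loc_integrable_iff[OF T])
qed

lemma has_weak_tgrad_iff:
 assumes "open T"
 shows "has_weak_tgrad T u G \<longleftrightarrow> (ALL k. weak_dird (cdom T) (cdir k, 0) (%y. u (emb y)) (%y. G (emb y) $ k))" unfolding has_weak_tgrad_def
 using has_weak_grad_iff_aux[OF assms smooth_on_dom_embed(2)[OF assms], of u "%p. G p $ _"] by blast

lemma has_weak_agrad_iff:
 assumes "open T"
 shows "has_weak_agrad T u A \<longleftrightarrow> (ALL k. weak_dird (cdom T) (0, axis k 1) (%y. u (emb y)) (%y. A (emb y) $ k))" unfolding has_weak_agrad_def
 using has_weak_grad_iff_aux[OF assms smooth_on_dom_embed(3)[OF assms], of u "%p. A p $ _"] by blast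

section \<open>Cutoffs and the boundary layer\<close>

lemma L2_indicator:
 assumes "f : L2" "S : sets borel"
 shows "(%x. indicator S x * f x) : L2"
proof (rule L2_space_dominated[OF assms(1), where C = 1])
 show "(%x. indicator S x * f x) : borel_measurable lborel" using L2D(1)[OF assms(1)] assms(2) by measurable
qed (auto simp: indicator_def)

text \<open>The value at \<open>x\<close> is minus the integral of the derivative along the ray up
  to the zero. Cauchy-Schwarz against the indicator of \<open>{0..s}\<close> produces the factor
  \<open>s\<close>.\<close>

lemma line_square_bound:
 fixes psi :: "'a::euclidean_space => real"
 assumes U: "open U" and psi: "smooth_on U psi" and s: "0 <= s"
  and ray: "!!t. 0 <= t ==> t <= s ==> x + t *\<^sub>R e : U" and z: "psi (x + s *\<^sub>R e) = 0"
 shows "ennreal ((psi x)^2) <= ennreal s * (\<integral>\<^sup>+t\<in>{0..s}. ennreal ((dird e psi (x + t *\<^sub>R e))^2) \<partial>lborel)"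
proof -
 let ?F = "%t. psi (x + t *\<^sub>R e)" and ?g = "%t. dird e psi (x + t *\<^sub>R e)"
 have cd: "continuous_on U (dird e psi)" by (rule smooth_on_continuous[OF smooth_on_frechet[OF psi]])
 have D: "DERIV ?F t :> ?g t" and C: "isCont ?g t" if "0 <= t" "t <= s" for t proof -
  have x: "x + t *\<^sub>R e : U" by (rule ray[OF that])
  have 1: "((%t::real. x + t *\<^sub>R e) has_derivative (%h. h *\<^sub>R e)) (at t)" by (auto intro!: derivative_eq_intros)
  from has_derivative_compose[OF 1 smooth_on_has_derivative[OF psi x]]
  have "(?F has_derivative (%h. dird (h *\<^sub>R e) psi (x + t *\<^sub>R e))) (at t)" .
  moreover have "dird (h *\<^sub>R e) psi (x + t *\<^sub>R e) = ?g t * h" for h using linear_scale[OF has_derivative_linear[OF smooth_on_has_derivative[OF psi x]]] by simp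
  ultimately show "DERIV ?F t :> ?g t" by (simp add: has_field_derivative_def)
  have "isCont (dird e psi) (x + t *\<^sub>R e)" using cd U x by (simp add: continuous_on_eq_continuous_at)
  moreover have "isCont (%t. x + t *\<^sub>R e) t" by (intro continuous_intros)
  ultimately show "isCont ?g t" by (rule isCont_o2[rotated])
 qed
 let ?h = "%t. indicator {0..s} t * ?g t"
 have cg: "continuous_on {0..s} ?g" using C by (auto intro: continuous_at_imp_continuous_on)
 have mh: "?h : borel_fun" using borel_measurable_continuous_on_indicator[OF _ cg] by simp
 obtain B where "\<forall>y \<in> ?g ` {0..s}. norm y <= B" using compact_imp_bounded[OF compact_continuous_image[OF cg compact_Icc]] unfolding bounded_iff by blast
 hence B: "abs (?g t) <= B" if "t : {0..s}" for t using that by simp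
 have h2: "?h : L2" by (rule L2_space_bounded_support(1)[OF mh compact_Icc, of 0 s "abs B"]) (use B in "auto intro!: AE_I2 simp: indicator_def intro: order.trans[OF _ abs_ge_self]")
 have i2: "indicator {0..s} : L2" by (rule L2_space_bounded_support(1)[OF _ compact_Icc, of _ 0 s 1]) (auto intro!: AE_I2)
 have "(LBINT t. ?g t * indicator {0..s} t) = ?F s - ?F 0" by (rule integral_FTC_Icc_real[OF s D C])
 moreover have "?h t * indicator {0..s} t = ?g t * indicator {0..s} t" for t by (simp add: indicator_def)
 ultimately have "(LBINT t. ?h t * indicator {0..s} t) = - psi x" using z by (simp only:) simp
 hence "abs (psi x) <= nrm2 ?h * nrm2 (indicator {0..s} :: real => real)" using L2_cauchy_schwarz[OF h2 i2] by simp
 hence "abs (psi x)^2 <= (nrm2 ?h * nrm2 (indicator {0..s} :: real => real))^2" by (rule power_mono) simp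
 also have "... = s * (LBINT t. (?h t)^2)" proof -
  have "(indicator {0..s} t :: real)^2 = indicator {0..s} t" for t :: real by (simp add: indicator_def)
  hence "(nrm2 (indicator {0..s} :: real => real))^2 = s" unfolding L2_norm_sq using s by simp
  thus ?thesis by (simp only: power_mult_distrib L2_norm_sq mult.commute)
 qed
 finally have "ennreal ((psi x)^2) <= ennreal (s * (LBINT t. (?h t)^2))" by (intro ennreal_leI) simp
 also have "... = ennreal s * (NN t. ennreal ((?h t)^2))" using nn_integral_eq_integral[OF L2D(2)[OF h2]] s by (simp add: ennreal_mult)
 also have "(NN t. ennreal ((?h t)^2)) = (\<integral>\<^sup>+t\<in>{0..s}. ennreal ((?g t)^2) \<partial>lborel)" by (intro nn_integral_cong) (simp add: indicator_def)
 finally show ?thesis .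
qed

text \<open>Time is counted in multiples of \<open>e\<close>, whose norm is arbitrary. The end point
  lies on the boundary, outside the open set on which the functions are controlled, hence the strict
  \<open>t < s\<close>.\<close>

definition rays_reach ::
 "'a::euclidean_space set => 'a set => 'a set => 'a => real => bool" where "rays_reach S S' B e L \<longleftrightarrow> (\<forall>x\<in>S. EX s. 0 < s & s <= L & x + s *\<^sub>R e : B
  & (ALL t. 0 <= t & t < s --> x + t *\<^sub>R e : S'))"

text \<open>Along each ray \<open>line_square_bound\<close> gives one factor \<open>L\<close>.
  Integrating over the starting points, Tonelli and translation invariance bound the inner integral
  for each t by the same integral over \<open>S'\<close>, and t in \<open>{0..L}\<close> gives the
  second factor.\<close>

lemma strip_poincare_smooth:
 fixes psi :: "'a::euclidean_space => real"
 assumes U: "open U" and psi: "smooth_on U psi" and SU: "S' <= U"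
  and S: "S : sets borel" "S' : sets borel" and L: "L > 0" and rr: "rays_reach S S' B e L" and W: "open W" "B <= W" "!!y. y : W \<inter> U ==> psi y = 0"
 shows "(\<integral>\<^sup>+x\<in>S. ennreal ((psi x)^2) \<partial>lborel) <= ennreal (L^2) * (\<integral>\<^sup>+x\<in>S'. ennreal ((dird e psi x)^2) \<partial>lborel)"
proof -
 define h where "h y = ennreal ((indicator U y * dird e psi y)^2) * indicator S' y" for y
 have m: "(%y. indicator U y * dird e psi y) : borel_fun" using borel_measurable_continuous_on_indicator[OF _ smooth_on_continuous[OF smooth_on_frechet[OF psi]]] U by simp
 have [measurable]: "S' : sets borel" "S : sets borel" "(%y. indicator U y * dird e psi y) : borel_fun" by fact+
 have [measurable]: "h : borel_fun" unfolding h_def by measurable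
 have heq: "h y = ennreal ((dird e psi y)^2) * indicator S' y" for y using SU by (auto simp: h_def indicator_def)
 have pt: "ennreal ((psi x)^2) * indicator S x <= ennreal L * (NN t. indicator {0..L} t * h (x + t *\<^sub>R e))" for x proof (cases "x : S")
  case True
  then obtain s where s: "0 < s" "s <= L" "x + s *\<^sub>R e : B" "!!t. 0 <= t ==> t < s ==> x + t *\<^sub>R e : S'" using rr unfolding rays_reach_def by blast
  have "((%t. x + t *\<^sub>R e) \<longlongrightarrow> x + s *\<^sub>R e) (at_left s)" by (intro tendsto_intros)
  hence "\<forall>\<^sub>F t in at_left s. x + t *\<^sub>R e : W" using topological_tendstoD W(1,2) s(3) by blast
  then obtain b where b: "b < s" "!!t. b < t ==> t < s ==> x + t *\<^sub>R e : W" unfolding eventually_at_left_field by blast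
  \<comment> \<open>The estimate stops shortly before the boundary: at \<open>r\<close> the ray is
    already in \<open>W\<close>, where \<open>psi\<close> vanishes, but still inside
    \<open>S'\<close>.\<close>
  define r where "r = (max 0 b + s) / 2"
  have r: "0 <= r" "r < s" "b < r" using s(1) b(1) by (auto simp: r_def max_def)
  have rayS: "x + t *\<^sub>R e : S'" if "0 <= t" "t <= r" for t using s(4)[of t] that r by simp
  have "x + r *\<^sub>R e : W \<inter> U" using b(2)[of r] r rayS[of r] SU by auto
  hence "psi (x + r *\<^sub>R e) = 0" by (rule W(3))
  hence "ennreal ((psi x)^2) <= ennreal r * (\<integral>\<^sup>+t\<in>{0..r}. ennreal ((dird e psi (x + t *\<^sub>R e))^2) \<partial>lborel)"
  using rayS SU by (intro line_square_bound[OF U psi r(1)]) auto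
  also have "... <= ennreal L * (NN t. indicator {0..L} t * h (x + t *\<^sub>R e))" proof (rule mult_mono)
  show "ennreal r <= ennreal L" using r s(2) by (intro ennreal_leI) simp
  show "(\<integral>\<^sup>+t\<in>{0..r}. ennreal ((dird e psi (x + t *\<^sub>R e))^2) \<partial>lborel) <= (NN t. indicator {0..L} t * h (x + t *\<^sub>R e))" proof (rule nn_integral_mono)
  fix t :: real
  show "ennreal ((dird e psi (x + t *\<^sub>R e))^2) * indicator {0..r} t <= indicator {0..L} t * h (x + t *\<^sub>R e)" using r s(2) rayS[of t] by (cases "t : {0..r}") (simp_all add: heq)
  qed
  qed simp_all
  finally show ?thesis using True by simp
 qed simp
 have "(\<integral>\<^sup>+x\<in>S. ennreal ((psi x)^2) \<partial>lborel) <= (NN x. ennreal L * (NN t. indicator {0..L} t * h (x + t *\<^sub>R e)))" by (rule nn_integral_mono) (rule pt)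
 also have "... = ennreal L * (NN x. (NN t. indicator {0..L} t * h (x + t *\<^sub>R e)))" by (rule nn_integral_cmult) measurable
 also have "(NN x. (NN t. indicator {0..L} t * h (x + t *\<^sub>R e))) = (NN t. (NN x. indicator {0..L} t * h (x + t *\<^sub>R e)))" by (rule lborel_pair.Fubini'[symmetric]) measurable
 also have "... = (NN t. indicator {0..L} t * (NN x. h x))" proof (rule nn_integral_cong)
  fix t :: real
  have "(NN x. indicator {0..L} t * h (x + t *\<^sub>R e)) = indicator {0..L} t * (NN x. h (x + t *\<^sub>R e))" by (rule nn_integral_cmult) measurable
  thus "(NN x. indicator {0..L} t * h (x + t *\<^sub>R e)) = indicator {0..L} t * (NN x. h x)" by (simp add: nn_integral_lborel_translate)
 qed
 also have "... = ennreal L * (NN x. h x)" using L by (subst nn_integral_multc) auto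
 finally show ?thesis using L by (simp add: heq power2_eq_square ennreal_mult mult.assoc)
qed

lemma nn_L2_norm:
 assumes "f : borel_measurable M" "(\<integral>\<^sup>+x. ennreal ((f x)^2) \<partial>M) <= ennreal (c^2)" "c >= 0"
 shows "f : L2_space M" "L2_norm M f <= c"
proof -
 have i: "integrable M (%x. (f x)^2)" using assms by (intro integrableI_bounded) (auto intro: le_less_trans)
 thus "f : L2_space M" using assms(1) by (rule L2_spaceI[rotated])
 have "(\<integral>x. (f x)^2 \<partial>M) <= c^2" using assms(2) nn_integral_eq_integral[OF i] by simp
 thus "L2_norm M f <= c" using assms(3) by (simp add: L2_norm_def real_le_lsqrt)
qed

lemma L2_norm_nn:
 assumes "f : L2_space M"
 shows "(\<integral>\<^sup>+x. ennreal ((f x)^2) \<partial>M) = ennreal ((L2_norm M f)^2)" using nn_integral_eq_integral[OF L2D(2)[OF assms]] by (simp add: L2_norm_sq)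

text \<open>The relevant content of a vanishing trace: \<open>q\<close> is an \<open>H\<^sup>1\<close> limit of smooth functions
 vanishing near \<open>B\<close>, as far as the derivative in direction \<open>e\<close> is concerned.\<close>

definition vanishing_near ::
 "'a::euclidean_space set => 'a set => 'a => ('a => real) => ('a => real) => bool" where
 "vanishing_near U B e q Q \<longleftrightarrow> (\<forall>eps>0. EX psi W. smooth_on U psi & open W & B <= W & (\<forall>y \<in> W \<inter> U. psi y = 0)
  & (%x. indicator U x * psi x) : L2 & (%x. indicator U x * dird e psi x) : L2 & nrm2 (%x. indicator U x * (q x - psi x)) <= eps & nrm2 (%x. indicator U x * (Q x - dird e psi x)) <= eps)"

lemma strip_poincare:
 fixes q Q :: "'a::euclidean_space => real"
 assumes U: "open U" and q: "q : L2" "Q : L2"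
  and SU: "S' <= U" "S <= U" and S: "S : sets borel" "S' : sets borel" and L: "L > 0" and rr: "rays_reach S S' B e L" and van: "vanishing_near U B e q Q"
 shows "nrm2 (%x. indicator S x * q x) <= L * nrm2 (%x. indicator S' x * Q x)"
proof (rule field_le_epsilon)
 fix d :: real assume "d > 0"
 \<comment> \<open>Approximating \<open>q\<close> costs eps on the left, approximating
   \<open>Q\<close> costs L * eps on the right; together they make d.\<close>
 define eps where "eps = d / (1 + L)"
 have "eps * (1 + L) = d" using L by (simp add: eps_def)
 hence "eps + L * eps = d" by (simp only: distrib_left mult_1_right mult.commute)
 moreover have "eps > 0" using \<open>d > 0\<close> L by (simp add: eps_def)
 ultimately have eps: "eps > 0" "eps + L * eps = d" by simp_all
 obtain psi W where psi: "smooth_on U psi" and W: "open W" "B <= W" "!!y. y : W \<inter> U ==> psi y = 0" and L2: "(%x. indicator U x * psi x) : L2" "(%x. indicator U x * dird e psi x) : L2"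
  and n: "nrm2 (%x. indicator U x * (q x - psi x)) <= eps" "nrm2 (%x. indicator U x * (Q x - dird e psi x)) <= eps" using van eps(1) unfolding vanishing_near_def by blast
 have Ub: "U : sets borel" using U by simp
 have ind: "(%x. indicator R x * f x) = (%x. indicator R x * (indicator U x * f x))" if "R <= U" for R and f :: "'a => real" using that by (auto simp: indicator_def fun_eq_iff)
 have split: "nrm2 (%x. indicator R x * f x) <= nrm2 (%x. indicator R x * g x) + eps" if R: "R <= U" "R : sets borel" and fg: "(%x. indicator U x * f x) : L2"
  "(%x. indicator U x * g x) : L2" "nrm2 (%x. indicator U x * (f x - g x)) <= eps" for R and f g :: "'a => real" proof -
  have R2: "(%x. indicator R x * f x) : L2" "(%x. indicator R x * g x) : L2" unfolding ind[OF R(1), of f] ind[OF R(1), of g] by (intro L2_indicator fg R)+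
  have d2: "(%x. indicator U x * (f x - g x)) : L2" using L2_space_diff[OF fg(1,2)] by (simp add: right_diff_distrib)
  have Rd: "(%x. indicator R x * (f x - g x)) : L2" using L2_space_diff[OF R2] by (simp add: right_diff_distrib)
  have "nrm2 (%x. indicator R x * f x) = nrm2 (%x. indicator R x * g x + indicator R x * (f x - g x))" by (simp add: algebra_simps)
  also have "... <= nrm2 (%x. indicator R x * g x) + nrm2 (%x. indicator R x * (f x - g x))" by (rule L2_norm_triangle[OF R2(2) Rd])
  also have "nrm2 (%x. indicator R x * (f x - g x)) <= nrm2 (%x. indicator U x * (f x - g x))" by (rule L2_norm_mono[OF d2 L2D(1)[OF Rd]]) (use R(1) in "auto simp: indicator_def")
  finally show ?thesis using fg(3) by simp
 qed
 note q' = L2_indicator[OF q(1) Ub] L2_indicator[OF q(2) Ub]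
 have n2: "nrm2 (%x. indicator U x * (dird e psi x - Q x)) <= eps" using n(2) by (simp add: right_diff_distrib L2_norm_minus[of _ "%x. indicator U x * Q x"])
 have S2: "(%x. indicator S x * psi x) : L2" "(%x. indicator S' x * dird e psi x) : L2" unfolding ind[OF SU(2), of psi] ind[OF SU(1), of "dird e psi"] by (intro L2_indicator L2 S)+
 have "(NN x. ennreal ((indicator S x * psi x)^2)) = (\<integral>\<^sup>+x\<in>S. ennreal ((psi x)^2) \<partial>lborel)" by (intro nn_integral_cong) (simp add: indicator_def)
 also have "... <= ennreal (L^2) * (\<integral>\<^sup>+x\<in>S'. ennreal ((dird e psi x)^2) \<partial>lborel)" by (rule strip_poincare_smooth[OF U psi SU(1) S L rr W])
 also have "(\<integral>\<^sup>+x\<in>S'. ennreal ((dird e psi x)^2) \<partial>lborel) = (NN x. ennreal ((indicator S' x * dird e psi x)^2))" by (intro nn_integral_cong) (simp add: indicator_def)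
 also have "ennreal (L^2) * ... = ennreal ((L * nrm2 (%x. indicator S' x * dird e psi x))^2)" unfolding L2_norm_nn[OF S2(2)] by (simp add: ennreal_mult power_mult_distrib)
 finally have "nrm2 (%x. indicator S x * psi x) <= L * nrm2 (%x. indicator S' x * dird e psi x)" by (rule nn_L2_norm(2)[OF L2D(1)[OF S2(1)]]) (use L L2_norm_nonneg in "simp add: L2_norm_nonneg")
 moreover have "L * nrm2 (%x. indicator S' x * dird e psi x) <= L * (nrm2 (%x. indicator S' x * Q x) + eps)" by (rule mult_left_mono[OF split[OF SU(1) S(2) L2(2) q'(2) n2]]) (use L in simp)
 moreover have "nrm2 (%x. indicator S x * q x) <= nrm2 (%x. indicator S x * psi x) + eps" by (rule split[OF SU(2) S(1) q'(1) L2(1) n(1)])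
 ultimately show "nrm2 (%x. indicator S x * q x) <= L * nrm2 (%x. indicator S' x * Q x) + d" using eps(2) by (simp add: distrib_left)
qed

text \<open>In Green's formula the boundary term is bounded by a constant times the norm of the
  second factor on the layer; this is what sends it to 0, since the layers shrink to the empty
  set.\<close>

lemma L2_indicator_vanish:
 fixes f :: "'a::euclidean_space => real"
 assumes f: "f : L2" and S: "!!m. S m : sets borel"
  and ev: "!!x. \<forall>\<^sub>F m in sequentially. x ~: S m"
 shows "(%m. nrm2 (%x. indicator (S m) x * f x)) ----> 0"
proof -
 have "(%m. \<integral>x. (indicator (S m) x * f x)^2 \<partial>lborel) ----> (\<integral>x. 0 \<partial>(lborel :: 'a measure))" proof (rule integral_dominated_convergence[where w = "%x. (f x)^2"])
  show "AE x in lborel. (%m. (indicator (S m) x * f x)^2) ----> 0" proof (rule AE_I2)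
  fix x show "(%m. (indicator (S m) x * f x)^2) ----> 0" using ev[of x] by (intro tendsto_eventually) (auto elim!: eventually_mono)
  qed
  show "AE x in lborel. norm ((indicator (S m) x * f x)^2) <= (f x)^2" for m by (auto simp: indicator_def)
  show "(%x. (indicator (S m) x * f x)^2) : borel_measurable lborel" for m using L2D(2)[OF L2_indicator[OF f S]] by auto
 qed (use L2D[OF f] in auto)
 hence "(%m. (nrm2 (%x. indicator (S m) x * f x))^2) ----> 0" by (simp add: L2_norm_sq)
 from tendsto_real_sqrt[OF this] show ?thesis by (simp add: L2_norm_nonneg)
qed

text \<open>A \<open>C\<^sup>1\<close> step from \<open>0\<close> on \<open>(-\<infinity>, 1]\<close> to \<open>1\<close> on \<open>[2, \<infinity>)\<close>.\<close>

definition pos_sq :: "real => real" where "pos_sq s = (max 0 s)^2"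
definition step :: "real => real" where "step s = pos_sq (1 - pos_sq (2 - s))"
definition step' :: "real => real" where "step' s = 4 * max 0 (1 - pos_sq (2 - s)) * max 0 (2 - s)"

lemma pos_sq_has_derivative: "(pos_sq has_real_derivative 2 * max 0 s) (at s)"
proof (cases s "0::real" rule: linorder_cases)
 case less
 have "((%s. 0) has_real_derivative 2 * max 0 s) (at s)" using less by simp
 thus ?thesis by (rule has_field_derivative_transform_within_open[where S = "{..<0}"]) (use less in "auto simp: pos_sq_def")
next
 case greater
 have "((%s. s^2) has_real_derivative 2 * max 0 s) (at s)" using greater by (auto intro!: derivative_eq_intros)
 thus ?thesis by (rule has_field_derivative_transform_within_open[where S = "{0<..}"]) (use greater in "auto simp: pos_sq_def")
next
 case equal
 have "((%h. abs h) \<longlongrightarrow> (0::real)) (at 0)" using tendsto_rabs[OF tendsto_ident_at[of "0::real" UNIV]] by simp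
 moreover have "norm (pos_sq h / h) <= abs h" if "h ~= 0" for h using that by (auto simp: pos_sq_def max_def power2_eq_square)
 hence "\<forall>\<^sub>F h in at 0. norm (pos_sq h / h) <= abs h" by (auto simp: eventually_at intro!: exI[of _ 1])
 ultimately have "((%h. pos_sq h / h) \<longlongrightarrow> 0) (at 0)" by (rule Lim_null_comparison[rotated])
 thus ?thesis using equal by (simp add: DERIV_def pos_sq_def)
qed

lemma step_has_derivative: "(step has_real_derivative step' s) (at s)"
proof -
 have 1: "((%s. pos_sq (2 - s)) has_real_derivative 2 * max 0 (2 - s) * (- 1)) (at s)" by (rule DERIV_chain2[OF pos_sq_has_derivative]) (auto intro!: derivative_eq_intros)
 have 2: "((%s. 1 - pos_sq (2 - s)) has_real_derivative - (2 * max 0 (2 - s) * (- 1))) (at s)" using DERIV_diff[OF DERIV_const 1, of 1] by simp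
 from DERIV_chain2[OF pos_sq_has_derivative 2] show ?thesis unfolding step_def[abs_def] step'_def by (rule DERIV_cong) simp
qed

lemma pos_sq_ge1: "1 <= s ==> 1 <= pos_sq s"
 unfolding pos_sq_def by (rule one_le_power) simp

lemma pos_sq_le1: "s <= 1 ==> 0 <= pos_sq s & pos_sq s <= 1"
 unfolding pos_sq_def by (auto intro!: power_le_one)

lemma step_eq_0: "s <= 1 ==> step s = 0"
 using pos_sq_ge1[of "2 - s"] by (simp add: step_def pos_sq_def[of "1 - _"])

lemma step_eq_1: "2 <= s ==> step s = 1"
 by (simp add: step_def pos_sq_def)

lemma step_bounds: "0 <= step s" "step s <= 1"
proof -
 have "0 <= pos_sq (2 - s)" by (simp add: pos_sq_def)
 thus "0 <= step s" "step s <= 1" using pos_sq_le1[of "1 - pos_sq (2 - s)"] by (simp_all add: step_def)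
qed

lemma step'_eq_0: "s <= 1 ==> step' s = 0" "2 <= s ==> step' s = 0"
 using pos_sq_ge1[of "2 - s"] by (auto simp: step'_def)

lemma step'_bounds: "0 <= step' s" "step' s <= 4"
proof -
 show "0 <= step' s" by (simp add: step'_def)
 show "step' s <= 4" proof (cases "s <= 1")
  case False
  have "0 <= pos_sq (2 - s)" by (simp add: pos_sq_def)
  hence "max 0 (1 - pos_sq (2 - s)) * max 0 (2 - s) <= 1 * 1" using False by (intro mult_mono) auto
  thus ?thesis by (simp add: step'_def)
 qed (simp add: step'_eq_0)
qed

lemma continuous_on_step': "continuous_on S step'"
 unfolding step'_def[abs_def] pos_sq_def[abs_def] by (intro continuous_intros)

lemma step_lipschitz: "abs (step s - step t) <= 4 * abs (s - t)"
 using field_differentiable_bound[of UNIV step step' 4 s t] step_has_derivative step'_bounds by (auto simp: has_field_derivative_at_within abs_of_nonneg)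

lemma continuous_on_step: "continuous_on S step"
 using step_has_derivative by (auto intro!: continuous_at_imp_continuous_on DERIV_isCont)

text \<open>Green's formula, tested with \<open>w v\<close> cut off by \<open>xi m\<close>, whose gradients are \<open>X i m\<close>.\<close>

lemma green_limit:
 fixes U :: "'a::euclidean_space set"
 assumes U: "open U" and I: "finite I"
  and A: "!!i. i : I ==> A i : L2" "!!i. i : I ==> M i : L2" "!!i. i : I ==> weak_dird U (e i) (A i) (M i)" and v: "v : L2" "!!i. i : I ==> V i : L2" "!!i. i : I ==> weak_dird U (e i) v (V i)"
  and w: "w : borel_fun" "!!i. W i : borel_fun" "!!x. x : U ==> abs (w x) <= C" "!!x y. x : U ==> y : U ==> abs (w x - w y) <= C * norm (x - y)"
  "!!i. i : I ==> AE x in lborel. x : U --> has_dird (e i) w (W i x) x" "!!i. i : I ==> AE x in lborel. x : U --> abs (W i x) <= C"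
  and xi: "!!i m. i : I ==> lip_test U (e i) (xi m) (X i m)" "!!m x. abs (xi m x) <= B" "!!x. x : U ==> (%m. xi m x) ----> xi' x" "xi' : borel_fun" "!!m. xi m : borel_fun"
  and r: "!!m. (\<integral>\<^sup>+x\<in>U. ennreal (abs (\<Sum>i\<in>I. A i x * X i m x) * abs (v x)) \<partial>lborel) <= ennreal (r m)" "r ----> 0"
 shows "(LBINT x. indicator U x * (xi' x * (w x * (\<Sum>i\<in>I. A i x * V i x) + v x * (\<Sum>i\<in>I. A i x * W i x) + v x * w x * (\<Sum>i\<in>I. M i x)))) = 0"
proof -
 have Ub [measurable]: "U : sets borel" using U by simp
 note [measurable] = w(1,2) xi(4,5)
 have vm [measurable]: "v : borel_fun" using L2D(1)[OF v(1)] by simp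
 have C: "AE x in lborel. abs (indicator U x * w x) <= abs C" using w(3) by (intro AE_I2) (auto simp: indicator_def intro: order.trans[OF _ abs_ge_self])
 have CW: "AE x in lborel. abs (indicator U x * W i x) <= abs C" if "i : I" for i using w(6)[OF that] by eventually_elim (auto simp: indicator_def)
 define F where "F i x = (A i x * V i x) * (indicator U x * w x) + (v x * A i x) * (indicator U x * W i x) + (v x * M i x) * (indicator U x * w x)" for i x
 have F: "integrable lborel (F i)" if "i : I" for i unfolding F_def by (intro lintegrable_add integrable_mult_bounded[OF _ _ C]
  integrable_mult_bounded[OF _ _ CW[OF that]] L2_mult_integrable A v that) measurable
 define H where "H x = (\<Sum>i\<in>I. F i x)" for x
 have H: "integrable lborel H" unfolding H_def by (rule lintegrable_sum) (rule F)
 have xi0: "xi m x = 0" if "x ~: U" "i : I" for m x i using xi(1)[OF that(2), of m] that(1) unfolding lip_test_def by blast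
 have X0: "AE x in lborel. x ~: U --> X i m x = 0" if i: "i : I" for i m proof -
  obtain N K where N: "N >= 0" "compact K" "K <= U" "!!x. abs (xi m x) <= N" "AE x in lborel. abs (X i m x) <= N" "!!x. x ~: K ==> xi m x = 0" "AE x in lborel. x ~: K --> X i m x = 0"
  by (rule lip_test_bounds[OF xi(1)[OF i, of m]]) (rule that)
  from N(7) show ?thesis by eventually_elim (use N(3) in auto)
 qed
 \<comment> \<open>The terms in which the derivative falls on the cutoff. Everything else is
   \<open>xi m\<close> times the fixed integrable function \<open>H\<close>, so dominated
   convergence deals with it.\<close>
 define R where "R m x = (indicator U x * w x) * (v x * (\<Sum>i\<in>I. A i x * X i m x))" for m x
 have Xm: "X i m : borel_fun" if "i : I" for i m using lip_test_measurable(2)[OF xi(1)[OF that]] .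
 have Am: "A i : borel_fun" if "i : I" for i using L2D(1)[OF A(1)[OF that]] by simp
 have Rm [measurable]: "R m : borel_fun" for m unfolding R_def using Xm Am by (intro borel_measurable_times borel_measurable_sum borel_measurable_indicator) (auto intro: vm w(1))
 have key: "(LBINT x. xi m x * H x) = - (LBINT x. R m x) & integrable lborel (R m)" for m proof -
  define P where "P i x = A i x * (V i x * (w x * xi m x) + v x * (W i x * xi m x + w x * X i m x)) + M i x * (v x * (w x * xi m x))" for i x
  have lt: "lip_test U (e i) (%x. w x * xi m x) (%x. W i x * xi m x + w x * X i m x)" if "i : I" for i by (rule lip_test_mult_on[OF xi(1)[OF that] w(1,2,3,4) w(5)[OF that]])
  have P0: "(LBINT x. P i x) = 0" if "i : I" for i unfolding P_def by (rule weak_dird_by_parts_lip_test[OF U A(3)[OF that] A(1)[OF that] A(2)[OF that] v(3)[OF that] v(1) v(2)[OF that] lt[OF that]])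
  have Pi: "integrable lborel (P i)" if "i : I" for i unfolding P_def by (intro lintegrable_add L2_mult_integrable L2_space_add A that
  L2_space_mult_lip_test[OF v(2)[OF that] lt[OF that]] L2_space_mult_lip_test[OF v(1) lt[OF that]])
  have PS: "(LBINT x. (\<Sum>i\<in>I. P i x)) = 0" "integrable lborel (%x. \<Sum>i\<in>I. P i x)" using P0 Pi by (auto simp: lint_sum)
  have xiH: "integrable lborel (%x. H x * xi m x)" by (rule integrable_mult_bounded[OF H, where B = B]) (use xi(2) in auto)
  \<comment> \<open>Outside \<open>U\<close> the derivative of the cutoff is known to be 0 only
    almost everywhere, hence an identity almost everywhere.\<close>
  have eq: "AE x in lborel. (\<Sum>i\<in>I. P i x) = H x * xi m x + R m x" proof -
  have "AE x in lborel. \<forall>i\<in>I. x ~: U --> X i m x = 0" by (rule AE_finite_allI[OF I X0])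
  thus ?thesis proof eventually_elim
  case (elim x)
  show ?case proof (cases "x : U")
  case True
  have "P i x = F i x * xi m x + w x * (v x * (A i x * X i m x))" for i using True by (simp add: P_def F_def algebra_simps)
  thus ?thesis using True by (simp add: H_def R_def sum.distrib sum_distrib_right sum_distrib_left)
  next
  case False
  have "P i x = 0" if "i : I" for i using xi0[OF False that, of m] elim that False by (simp add: P_def)
  moreover have "H x * xi m x = 0" proof (cases "I = {}")
  case False
  then obtain i where "i : I" by blast
  thus ?thesis using xi0[OF \<open>x ~: U\<close>, of i m] by simp
  qed (simp add: H_def)
  ultimately show ?thesis using False by (simp add: R_def)
  qed
  qed
  qed
  have "AE x in lborel. R m x = (\<Sum>i\<in>I. P i x) - H x * xi m x" using eq by eventually_elim simp
  hence Rint: "integrable lborel (R m)" using integrable_cong_AE[of "R m" lborel "%x. (\<Sum>i\<in>I. P i x) - H x * xi m x"] PS(2) xiH by (auto simp: borel_measurable_integrable)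
  have "(LBINT x. (\<Sum>i\<in>I. P i x)) = (LBINT x. H x * xi m x + R m x)" by (rule integral_cong_AE) (use PS(2) xiH Rint eq in auto)
  thus ?thesis using PS(1) xiH Rint by (simp add: mult.commute)
 qed
 have lim1: "(%m. \<integral>x. xi m x * H x \<partial>lborel) ----> (LBINT x. xi' x * H x)" proof (rule integral_dominated_convergence[where w = "%x. B * abs (H x)"])
  show "AE x in lborel. (%m. xi m x * H x) ----> xi' x * H x" proof (rule AE_I2)
  fix x show "(%m. xi m x * H x) ----> xi' x * H x" proof (cases "x : U")
  case True
  thus ?thesis by (intro tendsto_intros xi(3))
  qed (simp add: H_def F_def)
  qed
  show "AE x in lborel. norm (xi m x * H x) <= B * abs (H x)" for m using xi(2) by (intro AE_I2) (simp add: abs_mult mult_right_mono)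
 qed (use H in auto)
 have lim2: "(%m. \<integral>x. R m x \<partial>lborel) ----> 0" proof (rule tendsto_rabs_zero_cancel, rule tendsto_sandwich[OF _ _ tendsto_const])
  have "(%m. abs C * abs (r m)) ----> abs C * 0" by (intro tendsto_mult tendsto_const tendsto_rabs_zero r(2))
  thus "(%m. abs C * abs (r m)) ----> 0" by simp
  show "\<forall>\<^sub>F m in sequentially. abs (\<integral>x. R m x \<partial>lborel) <= abs C * abs (r m)" proof (rule always_eventually, rule allI)
  fix m
  have i: "integrable lborel (R m)" using key by blast
  let ?s = "%x. \<Sum>i\<in>I. A i x * X i m x"
  have [measurable]: "?s : borel_fun" using Xm Am by (intro borel_measurable_sum borel_measurable_times) auto
  have "ennreal (abs (\<integral>x. R m x \<partial>lborel)) <= ennreal (LBINT x. abs (R m x))" by (intro ennreal_leI integral_abs_bound)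
  also have "... = (NN x. ennreal (abs (R m x)))" by (rule nn_integral_eq_integral[symmetric]) (use i in auto)
  also have "... <= (NN x. ennreal (abs C) * (ennreal (abs (?s x) * abs (v x)) * indicator U x))" proof (rule nn_integral_mono)
  fix x
  show "ennreal (abs (R m x)) <= ennreal (abs C) * (ennreal (abs (?s x) * abs (v x)) * indicator U x)" proof (cases "x : U")
  case True
  have "abs (w x) <= abs C" using w(3)[OF True] by simp
  hence "abs (R m x) <= abs C * (abs (?s x) * abs (v x))" using True by (simp add: R_def abs_mult mult.commute[of "abs (v x)"] mult_right_mono)
  thus ?thesis using True by (simp add: ennreal_mult'[symmetric] ennreal_leI)
  qed (simp add: R_def)
  qed
  also have "... = ennreal (abs C) * (\<integral>\<^sup>+x\<in>U. ennreal (abs (?s x) * abs (v x)) \<partial>lborel)" by (rule nn_integral_cmult) measurable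
  also have "... <= ennreal (abs C) * ennreal (abs (r m))" by (intro mult_left_mono order.trans[OF r(1)] ennreal_leI) auto
  finally show "abs (\<integral>x. R m x \<partial>lborel) <= abs C * abs (r m)" by (simp add: ennreal_mult[symmetric])
  qed
 qed auto
 have "(%m. \<integral>x. xi m x * H x \<partial>lborel) ----> 0" using tendsto_minus[OF lim2] key by simp
 hence z: "(LBINT x. xi' x * H x) = 0" using lim1 LIMSEQ_unique by blast
 have eq: "indicator U x * (xi' x * (w x * (\<Sum>i\<in>I. A i x * V i x) + v x * (\<Sum>i\<in>I. A i x * W i x) + v x * w x * (\<Sum>i\<in>I. M i x))) = xi' x * H x" for x
  by (cases "x : U") (simp_all add: H_def F_def sum.distrib sum_distrib_left algebra_simps)
 show ?thesis unfolding eq by (rule z)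
qed

section \<open>Green's formula in the misorientations\<close>

definition ang :: "3 => coord => real" where
 "ang j y = plane_isometry (fst y) $ j"

lemma linear_ang: "linear (ang j)"
 unfolding ang_def[abs_def] by (rule linearI) (simp_all add: linear_add[OF linear_plane_isometry] linear_scale[OF linear_plane_isometry])

lemma continuous_on_ang: "continuous_on S (ang j)"
 using linear_continuous_on[OF linear_ang[unfolded linear_conv_bounded_linear]] .

lemma ang_measurable [measurable]: "ang j : borel_fun"
 by (rule borel_measurable_continuous_onI[OF continuous_on_ang])

lemma snd_measurable [measurable]: "(snd :: coord => real^2) : borel_fun"
 "(%x::real^2. x $ k) : borel_fun" by (intro borel_measurable_continuous_onI continuous_intros)+

lemma ang_sum: "ang 1 y + ang 2 y + ang 3 y = 0"
 unfolding ang_def by (rule plane_isometry_sum)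

lemma mem_cdom_ang: "y : cdom T \<longleftrightarrow> (ALL k. abs (ang k y) < pi / 4) & snd y : T"
 by (simp add: mem_cdom ang_def)

lemma ang_cdir: "ang j (cdir k, 0) = (if j = k then 1 else 0) - 1 / 3"
 by (simp add: ang_def plane_isometry_cdir)

lemma ang_snd: "ang j (0, h) = 0"
 by (simp add: ang_def linear_0[OF linear_plane_isometry])

lemma norm_plane_isometry: "norm (plane_isometry u) = norm u"
proof -
 have "(norm (plane_isometry u))^2 = (norm u)^2" unfolding power2_norm_eq_inner inner_vec_def sum_3 sum_2 by (simp add: field_simps power2_eq_square[symmetric] real_sqrt_mult[symmetric])
  (simp add: power2_eq_square algebra_simps)?
 thus ?thesis by simp
qed

lemma norm_fst_snd_le: "norm (fst z) <= norm z" "norm (snd z) <= norm z"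
 using norm_fst_le[of "fst z" "snd z"] norm_snd_le[of "snd z" "fst z"] by simp_all

lemma ang_lipschitz: "abs (ang j x - ang j y) <= norm (x - y)"
proof -
 have "abs (ang j x - ang j y) = abs (plane_isometry (fst (x - y)) $ j)" by (simp add: ang_def linear_diff[OF linear_plane_isometry])
 also have "... <= norm (plane_isometry (fst (x - y)))" by (rule component_le_norm_cart)
 also have "... <= norm (x - y)" unfolding norm_plane_isometry by (rule norm_fst_snd_le)
 finally show ?thesis .
qed

lemma has_dird_compose_linear:
 assumes "(f has_real_derivative d) (at (l y))" "linear (l :: 'a::real_normed_vector => real)"
 shows "has_dird e (%y. f (l y)) (d * l e) y"
proof -
 have l: "l (y + t *\<^sub>R e) = l y + t * l e" for t using linear_add[OF assms(2)] linear_scale[OF assms(2)] by simp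
 have "((%t. l y + t * l e) has_real_derivative l e) (at 0)" by (auto intro!: derivative_eq_intros)
 moreover have "(f has_real_derivative d) (at (l y + 0 * l e))" using assms(1) by simp
 ultimately show ?thesis unfolding has_dird_def l by (rule DERIV_chain2[rotated])
qed

text \<open>The \<open>n\<close>-th cutoff acts within distance \<open>2 / layer n\<close> of the boundary; \<open>layer n \<ge> 3\<close> keeps the layers at
 opposite edges disjoint.\<close>

definition layer :: "nat => real" where "layer n = real n + 3"

lemma layer: "layer n >= 3" "layer n > 0"
 by (simp_all add: layer_def)

lemma layer_pi: "2 / layer n < pi / 4"
proof -
 have "2 / layer n <= 2 / 3" using layer[of n] by (intro divide_left_mono) auto
 also have "... < pi / 4" using pi_gt3 by simp
 finally show ?thesis .
qed

lemma layer_tendsto: "(%n. c / layer n) ----> 0"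
proof -
 have "filterlim (%n. real n + 3) at_top sequentially" by (subst add.commute, rule filterlim_tendsto_add_at_top[OF tendsto_const filterlim_real_sequentially])
 thus ?thesis unfolding layer_def by (rule real_tendsto_divide_at_top[OF tendsto_const])
qed

lemma layer_eventually:
 assumes "0 < d" shows "\<forall>\<^sub>F n in sequentially. 2 / layer n < d" using order_tendstoD(2)[OF layer_tendsto assms] .

definition acut :: "nat => real => real" where
 "acut n t = step (layer n * (pi / 4 - abs t))"

definition acut' :: "nat => real => real" where
 "acut' n t = - sgn t * layer n * step' (layer n * (pi / 4 - abs t))"

text \<open>The kink of abs t at 0 is harmless: the layer is thinner than pi / 4, so the cutoff is
  constantly 1 near 0.\<close>

lemma acut_has_derivative: "(acut n has_real_derivative acut' n t) (at t)"
proof (cases t "0::real" rule: linorder_cases)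
 case less
 have "((%t. step (layer n * (pi / 4 + t))) has_real_derivative step' (layer n * (pi / 4 + t)) * layer n) (at t)" by (rule DERIV_chain2[OF step_has_derivative]) (auto intro!: derivative_eq_intros)
 hence "((%t. step (layer n * (pi / 4 + t))) has_real_derivative acut' n t) (at t)" using less by (simp add: acut'_def mult.commute)
 thus ?thesis by (rule has_field_derivative_transform_within_open[where S = "{..<0}"]) (use less in "auto simp: acut_def")
next
 case greater
 have "((%t. step (layer n * (pi / 4 - t))) has_real_derivative step' (layer n * (pi / 4 - t)) * (- layer n)) (at t)" by (rule DERIV_chain2[OF step_has_derivative]) (auto intro!: derivative_eq_intros)
 hence "((%t. step (layer n * (pi / 4 - t))) has_real_derivative acut' n t) (at t)" using greater by (simp add: acut'_def mult.commute)
 thus ?thesis by (rule has_field_derivative_transform_within_open[where S = "{0<..}"]) (use greater in "auto simp: acut_def")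
next
 case equal
 let ?r = "pi / 4 - 2 / layer n"
 have "((%t. 1) has_real_derivative 0) (at t)" by simp
 hence "(acut n has_real_derivative 0) (at t)" proof (rule has_field_derivative_transform_within_open[where S = "{- ?r<..<?r}"])
  show "t : {- ?r<..<?r}" using equal layer_pi[of n] by simp
  show "1 = acut n s" if "s : {- ?r<..<?r}" for s proof -
  have "2 / layer n <= pi / 4 - abs s" using that by (auto simp: abs_if)
  hence "2 <= layer n * (pi / 4 - abs s)" using layer(2)[of n] by (simp add: pos_divide_le_eq mult.commute)
  thus ?thesis by (simp add: acut_def step_eq_1)
  qed
 qed simp
 thus ?thesis using equal by (simp add: acut'_def)
qed

lemma acut_bounds: "0 <= acut n t" "acut n t <= 1" "abs (acut n t) <= 1"
 using step_bounds by (simp_all add: acut_def abs_of_nonneg)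

lemma acut_eq_0: "pi / 4 - 1 / layer n <= abs t ==> acut n t = 0"
 using layer(2)[of n] by (auto simp: acut_def field_simps intro!: step_eq_0)

lemma acut'_bound: "abs (acut' n t) <= 4 * layer n"
proof -
 have "abs (acut' n t) = abs (sgn t) * (layer n * step' (layer n * (pi / 4 - abs t)))" using layer(2)[of n] step'_bounds by (simp add: acut'_def abs_mult)
 also have "... <= 1 * (layer n * 4)" using layer(2)[of n] step'_bounds by (intro mult_mono) (auto simp: abs_sgn_eq)
 finally show ?thesis by simp
qed

lemma acut'_eq_0: "abs t <= pi / 4 - 2 / layer n ==> acut' n t = 0"
proof -
 assume "abs t <= pi / 4 - 2 / layer n"
 hence "2 / layer n <= pi / 4 - abs t" by simp
 hence "2 <= layer n * (pi / 4 - abs t)" using layer(2)[of n] by (simp add: pos_divide_le_eq mult.commute)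
 thus ?thesis by (simp add: acut'_def step'_eq_0)
qed

lemma acut_lipschitz: "abs (acut n s - acut n t) <= (4 * layer n) * abs (s - t)"
 using field_differentiable_bound[of UNIV "acut n" "acut' n" "4 * layer n" s t] acut_has_derivative acut'_bound by (auto simp: has_field_derivative_at_within)

lemma acut_tendsto:
 assumes "abs t < pi / 4" shows "(%n. acut n t) ----> 1"
proof (rule tendsto_eventually)
 have "\<forall>\<^sub>F n in sequentially. 2 / layer n < pi / 4 - abs t" by (rule layer_eventually) (use assms in simp)
 thus "\<forall>\<^sub>F n in sequentially. acut n t = 1" proof eventually_elim
  case (elim n)
  hence "2 < layer n * (pi / 4 - abs t)" using layer(2)[of n] by (simp add: pos_divide_less_eq mult.commute)
  thus ?case by (simp add: acut_def step_eq_1)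
 qed
qed

lemma acut_measurable [measurable]: "acut n : borel_fun" "acut' n : borel_fun"
proof -
 have c: "continuous_on UNIV step'" "continuous_on UNIV step" by (rule continuous_on_step' continuous_on_step)+
 have [measurable]: "step' : borel_fun" "step : borel_fun" using c by (auto intro: borel_measurable_continuous_onI)
 show "acut n : borel_fun" unfolding acut_def[abs_def] by measurable
 show "acut' n : borel_fun" unfolding acut'_def[abs_def] sgn_if by measurable
qed

text \<open>Each factor depends on one angle. When the derivative falls on the factor of angle
  \<open>j\<close>, the gradient is normal to the two edges where this angle is pi / 4 or - pi / 4,
  so only the normal component of the other gradient is met by the large derivative, also near the
  corners.\<close>

definition hexcut :: "nat => coord => real" where
 "hexcut n y = acut n (ang 1 y) * acut n (ang 2 y) * acut n (ang 3 y)"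

definition hexcut' :: "nat => coord => coord => real" where
 "hexcut' n e y = ang 1 e * (acut' n (ang 1 y) * (acut n (ang 2 y) * acut n (ang 3 y))) + ang 2 e * (acut' n (ang 2 y) * (acut n (ang 1 y) * acut n (ang 3 y)))
  + ang 3 e * (acut' n (ang 3 y) * (acut n (ang 1 y) * acut n (ang 2 y)))"

lemma hexcut_measurable [measurable]: "hexcut n : borel_fun" "hexcut' n e : borel_fun"
 unfolding hexcut_def[abs_def] hexcut'_def[abs_def] by measurable

lemma hexcut_has_dird: "has_dird e (hexcut n) (hexcut' n e y) y"
proof -
 have d: "has_dird e (%y. acut n (ang j y)) (acut' n (ang j y) * ang j e) y" for j by (rule has_dird_compose_linear[OF acut_has_derivative linear_ang])
 from has_dird_mult[OF has_dird_mult[OF d[of 1] d[of 2]] d[of 3]]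
 show ?thesis by (simp add: hexcut_def[abs_def] hexcut'_def algebra_simps)
qed

lemma prod_bounds: "abs a <= 1 ==> abs b <= 1 ==> abs (a * b) <= (1::real)"
 unfolding abs_mult by (rule mult_le_one) auto

lemma hexcut_bound: "abs (hexcut n y) <= 1"
 unfolding hexcut_def by (intro prod_bounds acut_bounds)

lemma lipschitz_mult_bounded:
 fixes f g :: "'a::real_normed_vector => real"
 assumes f: "!!x. abs (f x) <= M" "!!x y. abs (f x - f y) <= K * norm (x - y)"
  and g: "!!x. abs (g x) <= N" "!!x y. abs (g x - g y) <= L * norm (x - y)"
 shows "abs (f x * g x - f y * g y) <= (M * L + N * K) * norm (x - y)"
proof -
 have "f x * g x - f y * g y = f x * (g x - g y) + g y * (f x - f y)" by (simp add: algebra_simps)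
 also have "abs (...) <= abs (f x) * abs (g x - g y) + abs (g y) * abs (f x - f y)" using abs_triangle_ineq[of "f x * (g x - g y)" "g y * (f x - f y)"] by (simp only: abs_mult)
 also have "... <= M * (L * norm (x - y)) + N * (K * norm (x - y))" using f(1)[of x] g(1)[of y] abs_ge_zero[of "f x"] abs_ge_zero[of "g y"] by (intro add_mono mult_mono f g) linarith+
 finally show ?thesis by (simp add: algebra_simps)
qed

lemma hexcut_lipschitz: "EX L. ALL x y. abs (hexcut n x - hexcut n y) <= L * norm (x - y)"
proof -
 have l: "abs (acut n (ang j x) - acut n (ang j y)) <= (4 * layer n) * norm (x - y)" for j x y using order.trans[OF acut_lipschitz mult_left_mono[OF ang_lipschitz]] layer(2)[of n] by simp
 have b: "abs (acut n (ang j x)) <= 1" for j x by (rule acut_bounds)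
 have b2: "abs (acut n (ang 1 x) * acut n (ang 2 x)) <= 1" for x by (intro prod_bounds acut_bounds)
 show ?thesis unfolding hexcut_def using lipschitz_mult_bounded[OF b2 lipschitz_mult_bounded[OF b l b l] b l] by blast
qed

lemma hexcut_tendsto:
 assumes "y : cdom T" shows "(%n. hexcut n y) ----> 1"
proof -
 have "(%n. acut n (ang j y)) ----> 1" for j using assms by (intro acut_tendsto) (simp add: mem_cdom_ang)
 from tendsto_mult[OF tendsto_mult[OF this[of 1] this[of 2]] this[of 3]]
 show ?thesis by (simp add: hexcut_def)
qed

text \<open>A product of cutoffs in both groups of variables. It serves with \<open>h\<close> the
  distance cutoff \<open>tcut\<close> for derivatives in the angles, and with \<open>h\<close> a
  cutoff adapted to a chart for derivatives in the triple junction.\<close>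

lemma lip_test_hexcut_mult:
 fixes h :: "real^2 => real"
 assumes h: "!!a b. abs (h a - h b) <= L * norm (a - b)" and K: "compact K" "K <= T" "!!a. a ~: K ==> h a = 0"
  and h': "h' : borel_fun" "!!a. has_dird (snd e) h (h' a) a"
 shows "lip_test (cdom T) e (%y. hexcut n y * h (snd y)) (%y. hexcut' n e y * h (snd y) + hexcut n y * h' (snd y))" unfolding lip_test_def
proof (intro conjI)
 have ch: "continuous_on UNIV h" by (rule continuous_on_of_lipschitz[of _ _ L]) (rule h)
 obtain N where N: "N >= 0" "!!a. abs (h a) <= N" by (rule bounded_of_compact_support[OF ch K(1)], rule K(3), assumption, rule that)
 have mh: "h : borel_fun" by (rule borel_measurable_continuous_onI[OF ch])
 note [measurable] = mh h'(1)
 have hs: "abs (h (snd x) - h (snd y)) <= abs L * norm (x - y)" for x y :: "coord" proof -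
  have "L * norm (snd (x - y)) <= abs L * norm (x - y)" by (intro mult_mono norm_fst_snd_le) auto
  thus ?thesis using h[of "snd x" "snd y"] by simp
 qed
 obtain L' where "!!x y. abs (hexcut n x - hexcut n y) <= L' * norm (x - y)" using hexcut_lipschitz by blast
 from lipschitz_mult_bounded[OF hexcut_bound this N(2) hs]
 show "EX L. ALL x y. abs (hexcut n x * h (snd x) - hexcut n y * h (snd y)) <= L * norm (x - y)" by blast
 let ?c = "pi / 4 - 1 / layer n"
 let ?P = "cbox (\<chi> i. - ?c) (\<chi> i. ?c) \<times> K :: (state) set"
 let ?K = "emb -` ?P"
 have cP: "compact ?P" by (intro compact_Times compact_cbox K(1))
 have c0: "?c < pi / 4" using layer(2)[of n] by simp
 have mem: "y : ?K \<longleftrightarrow> (ALL j. abs (ang j y) <= ?c) & snd y : K" for y proof -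
  have "- ?c <= a & a <= ?c \<longleftrightarrow> (abs a) <= ?c" for a :: real by linarith
  thus ?thesis unfolding vimage_eq emb_def mem_Times_iff fst_conv snd_conv mem_box_cart vec_lambda_beta ang_def by (simp only:)
 qed
 show "EX K. compact K & K <= cdom T & (ALL y. y ~: K --> hexcut n y * h (snd y) = 0)" proof (intro exI conjI allI impI)
  have "closed ?K" by (rule closed_vimage[OF compact_imp_closed[OF cP] continuous_on_embed])
  moreover have "?K <= coords ` ?P" proof
  fix y assume "y : ?K"
  thus "y : coords ` ?P" by (intro image_eqI[of y coords "emb y"]) auto
  qed
  hence "bounded ?K" using bounded_subset compact_imp_bounded[OF compact_continuous_image[OF continuous_on_coords cP]] by blast
  ultimately show "compact ?K" by (simp only: compact_eq_bounded_closed)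
  show "?K <= cdom T" proof
  fix y assume "y : ?K"
  from \<open>y : ?K\<close> have a: "ALL j. abs (ang j y) <= ?c" and "snd y : K" unfolding mem by blast+
  hence "snd y : T" using K(2) by blast
  moreover have "abs (ang j y) < pi / 4" for j using spec[OF a, of j] c0 by (rule le_less_trans)
  ultimately show "y : cdom T" unfolding mem_cdom_ang by blast
  qed
  fix y assume "y ~: ?K"
  hence "(EX j. ?c < abs (ang j y)) \<or> snd y ~: K" unfolding mem not_all de_Morgan_conj not_le .
  then consider j where "?c < abs (ang j y)" | "snd y ~: K" by blast
  thus "hexcut n y * h (snd y) = 0" proof cases
  case (1 j)
  hence "acut n (ang j y) = 0" by (intro acut_eq_0) simp
  hence "hexcut n y = 0" using exhaust_3[of j] by (auto simp: hexcut_def)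
  thus ?thesis by simp
  qed (simp add: K(3))
 qed
 show "(%y. hexcut' n e y * h (snd y) + hexcut n y * h' (snd y)) : borel_fun" by measurable
 show "AE y in lborel. has_dird e (%y. hexcut n y * h (snd y)) (hexcut' n e y * h (snd y) + hexcut n y * h' (snd y)) y" proof (rule AE_I2)
  fix y
  have "has_dird e (%y. h (snd y)) (h' (snd y)) y" using h'(2)[of "snd y"] by (simp add: has_dird_def)
  thus "has_dird e (%y. hexcut n y * h (snd y)) (hexcut' n e y * h (snd y) + hexcut n y * h' (snd y)) y" by (rule has_dird_mult[OF hexcut_has_dird])
 qed
qed

text \<open>Truncates in the triple junction while one integrates by parts in the angles. It does
  not depend on the angles, so its derivative in those directions is 0 and the distance function may
  fail to have a gradient.\<close>

definition tcut :: "(real^2) set => nat => real^2 => real" where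
 "tcut T n a = step (layer n * infdist a (- T))"

lemma tcut:
 assumes T: "open T" "bounded T"
 shows "abs (tcut T n a) <= 1" "0 <= tcut T n a" "EX L. ALL a b. abs (tcut T n a - tcut T n b) <= L * norm (a - b)" "EX K. compact K & K <= T & (ALL a. a ~: K --> tcut T n a = 0)"
  "a : T ==> (%n. tcut T n a) ----> 1" "tcut T n : borel_fun" proof -
 have ne: "- T ~= {}" proof
  assume "- T = {}"
  hence "T = UNIV" by auto
  thus False using T(2) not_bounded_UNIV by simp
 qed
 have cl: "closed (- T)" using T(1) by (simp add: closed_def)
 show "abs (tcut T n a) <= 1" "0 <= tcut T n a" using step_bounds by (auto simp: tcut_def)
 have "abs (tcut T n a - tcut T n b) <= (4 * layer n) * norm (a - b)" for a b proof -
  have "abs (tcut T n a - tcut T n b) <= 4 * abs (layer n * infdist a (- T) - layer n * infdist b (- T))" unfolding tcut_def by (rule step_lipschitz)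
  also have "... = 4 * (layer n * abs (infdist a (- T) - infdist b (- T)))" using layer(2)[of n] by (simp add: right_diff_distrib[symmetric] abs_mult)
  also have "... <= 4 * (layer n * norm (a - b))" using infdist_triangle_abs[of a "- T" b] layer(2)[of n] by (intro mult_left_mono) (auto simp: dist_norm)
  finally show ?thesis by simp
 qed
 thus "EX L. ALL a b. abs (tcut T n a - tcut T n b) <= L * norm (a - b)" by blast
 have "continuous_on UNIV (tcut T n)" unfolding tcut_def[abs_def] by (intro continuous_on_compose2[OF continuous_on_step[of UNIV]] continuous_intros) auto
 thus "tcut T n : borel_fun" by (rule borel_measurable_continuous_onI)
 let ?K = "{a. 1 <= layer n * infdist a (- T)}"
 have KT: "?K <= T" proof
  fix a assume a: "a : ?K"
  show "a : T" proof (rule ccontr)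
  assume "a ~: T"
  hence "infdist a (- T) = 0" by (intro infdist_zero) simp
  thus False using a by simp
  qed
 qed
 have "closed ?K" by (intro closed_Collect_le continuous_intros)
 hence "compact ?K" using bounded_subset[OF T(2) KT] by (simp add: compact_eq_bounded_closed)
 thus "EX K. compact K & K <= T & (ALL a. a ~: K --> tcut T n a = 0)" using KT by (intro exI[of _ ?K]) (auto simp: tcut_def intro!: step_eq_0)
 show "(%n. tcut T n a) ----> 1" if "a : T" proof (rule tendsto_eventually)
  have "infdist a (- T) > 0" by (rule infdist_pos_not_in_closed[OF cl ne]) (use that in simp)
  from layer_eventually[OF this] show "\<forall>\<^sub>F n in sequentially. tcut T n a = 1" proof eventually_elim
  case (elim n)
  hence "2 < layer n * infdist a (- T)" using layer(2)[of n] by (simp add: pos_divide_less_eq mult.commute)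
  thus ?case by (simp add: tcut_def step_eq_1)
  qed
 qed
qed

definition hexlayer :: "(real^2) set => nat => 3 => (coord) set" where
 "hexlayer T n j = {y : cdom T. pi / 4 - 2 / layer n < abs (ang j y)}"

text \<open>\<open>s\<close> selects one of two opposite edges. Where angle \<open>i\<close> has the
  sign opposite to angle \<open>j\<close>, it can be held fixed while angle \<open>j\<close> moves
  to the edge at the expense of the third angle.\<close>

definition hexlayer_part :: "(real^2) set => nat => real => 3 => 3 => (coord) set" where
 "hexlayer_part T n s j i = {y : cdom T. pi / 4 - 2 / layer n < s * ang j y & s * ang i y < 0}"

definition edge :: "(real^2) set => real => 3 => (coord) set" where
 "edge T s j = {y. s * ang j y = pi / 4 & (ALL i. i ~= j --> abs (ang i y) < pi / 4) & snd y : T}"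

lemma hexlayer_measurable:
 assumes "open T"
 shows "hexlayer T n j : sets borel" "hexlayer_part T n s j i : sets borel"
proof -
 have "hexlayer T n j = cdom T \<inter> {y. pi / 4 - 2 / layer n < abs (ang j y)}" by (auto simp: hexlayer_def)
 moreover have "open {y. pi / 4 - 2 / layer n < abs (ang j y)}" by (intro open_Collect_less continuous_intros continuous_on_ang)
 ultimately show "hexlayer T n j : sets borel" using open_cdom[OF assms] by simp
 have "hexlayer_part T n s j i = cdom T \<inter> {y. pi / 4 - 2 / layer n < s * ang j y} \<inter> {y. s * ang i y < 0}" by (auto simp: hexlayer_part_def)
 moreover have "open {y. pi / 4 - 2 / layer n < s * ang j y}" "open {y. s * ang i y < 0}" by (intro open_Collect_less continuous_intros continuous_on_ang)+
 ultimately show "hexlayer_part T n s j i : sets borel" using open_cdom[OF assms] by simp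
qed

lemma three_indices: "i ~= j ==> i ~= l ==> j ~= l ==> ang i y + ang j y + ang l y = 0" "(k::3) : {i, j, l}"
 if "i ~= j" "i ~= l" "j ~= l" for i j l k :: 3 proof -
 show "ang i y + ang j y + ang l y = 0" using that exhaust_3[of i] exhaust_3[of j] exhaust_3[of l] ang_sum[of y] by auto
 show "k : {i, j, l}" using that exhaust_3[of i] exhaust_3[of j] exhaust_3[of l] exhaust_3[of k] by auto
qed

lemma other_indices: "EX i l. i ~= j & l ~= j & i ~= (l::3)"
proof -
 have "(1::3) ~= 2" "(1::3) ~= 3" "(2::3) ~= 3" by simp_all
 thus ?thesis using exhaust_3[of j] by metis
qed

text \<open>Within the layer at an edge one of the other two coordinates has the opposite sign; keeping
 it fixed and increasing the distinguished one, a ray reaches the open edge inside the domain.\<close>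

lemma rays_reach_edge:
 assumes s: "s = 1 \<or> s = -1" and ijl: "i ~= j" "i ~= l" "j ~= l"
 shows "rays_reach (hexlayer_part T n s j i) (hexlayer_part T n s j i) (edge T s j) (s *\<^sub>R (cdir j - cdir l), 0) (2 / layer n)" unfolding rays_reach_def
proof (intro ballI)
 fix y assume y: "y : hexlayer_part T n s j i"
 \<comment> \<open>Up to the sign \<open>s\<close> this direction raises angle \<open>j\<close>,
   lowers angle \<open>l\<close> by the same amount and fixes angle \<open>i\<close>: it is parallel
   to the edges on which angle \<open>i\<close> is constant.\<close>
 let ?e = "(s *\<^sub>R (cdir j - cdir l), 0) :: coord"
 have a_e: "ang k ?e = s * (ang k (cdir j, 0) - ang k (cdir l, 0))" for k unfolding ang_def by (simp add: linear_scale[OF linear_plane_isometry] linear_diff[OF linear_plane_isometry])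
 have e: "ang k ?e = s * ((if k = j then 1 else 0) - (if k = l then 1 else 0))" for k unfolding a_e ang_cdir by simp
 have ss: "s * s = 1" using s by auto
 have move: "s * ang k (y + t *\<^sub>R ?e) = s * ang k y + t * ((if k = j then 1 else 0) - (if k = l then 1 else 0))" for k t proof -
  have "s * (a + t * (s * d)) = s * a + (s * s) * (t * d)" for a d by (simp add: algebra_simps)
  thus ?thesis unfolding linear_add[OF linear_ang] linear_scale[OF linear_ang] e real_scaleR_def ss by simp
 qed
 have abs_s: "abs (ang k z) = abs (s * ang k z)" for k z using s by auto
 define p q r where "p = s * ang j y" "q = s * ang i y" "r = s * ang l y"
 have "s * (ang i y + ang j y + ang l y) = 0" using three_indices(1)[OF ijl ijl] by simp
 hence sum: "p + q + r = 0" by (simp add: p_q_r_def algebra_simps)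
 have "abs (s * ang k y) < pi / 4" for k using y unfolding hexlayer_part_def mem_Collect_eq mem_cdom_ang abs_s by blast
 hence b: "abs p < pi / 4" "abs q < pi / 4" "abs r < pi / 4" unfolding p_q_r_def by blast+
 have T: "snd y : T" and pl: "pi / 4 - 2 / layer n < p" and q0: "q < 0" using y unfolding hexlayer_part_def mem_Collect_eq mem_cdom_ang p_q_r_def by blast+
 have p0: "p > 0" using pl layer_pi[of n] by simp
 define tau where "tau = pi / 4 - p"
 have snd: "snd (y + t *\<^sub>R ?e) = snd y" for t by simp
 have mj: "s * ang j (y + t *\<^sub>R ?e) = p + t" and mi: "s * ang i (y + t *\<^sub>R ?e) = q" and ml: "s * ang l (y + t *\<^sub>R ?e) = r - t" for t using ijl unfolding move p_q_r_def by auto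
 show "EX tau. 0 < tau & tau <= 2 / layer n & y + tau *\<^sub>R ?e : edge T s j & (ALL t. 0 <= t & t < tau --> y + t *\<^sub>R ?e : hexlayer_part T n s j i)"
 proof (intro exI[of _ tau] conjI allI impI)
  show "0 < tau" "tau <= 2 / layer n" using b(1) pl by (auto simp: tau_def)
  have "abs (ang k (y + tau *\<^sub>R ?e)) < pi / 4" if "k ~= j" for k proof -
  have "k = i \<or> k = l" using three_indices(2)[OF ijl, of k] that by auto
  \<comment> \<open>As p + q + r = 0, the value \<open>r - tau\<close> is - q - pi / 4; it stays
    above - pi / 4 because q < 0.\<close>
  moreover have "abs q < pi / 4" "abs (r - tau) < pi / 4" using b sum q0 p0 unfolding tau_def abs_less_iff by linarith+
  ultimately show ?thesis unfolding abs_s using mi ml by auto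
  qed
  thus "y + tau *\<^sub>R ?e : edge T s j" using mj[of tau] T by (auto simp: edge_def tau_def)
  fix t assume t: "0 <= t & t < tau"
  have "abs (p + t) < pi / 4" "abs q < pi / 4" "abs (r - t) < pi / 4" using b sum q0 p0 t unfolding tau_def abs_less_iff by linarith+
  hence "abs (ang k (y + t *\<^sub>R ?e)) < pi / 4" for k unfolding abs_s using three_indices(2)[OF ijl, of k] mi ml mj by auto
  thus "y + t *\<^sub>R ?e : hexlayer_part T n s j i" using mj[of t] mi[of t] T q0 pl t by (simp add: hexlayer_part_def mem_cdom_ang)
 qed
qed

text \<open>The angles sum to 0 and angle \<open>j\<close> is not 0 in its layer, so one of the
  other two has the opposite sign.\<close>

lemma hexlayer_cover:
 assumes "y : hexlayer T n j" "i ~= j" "i ~= l" "j ~= l"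
 shows "\<exists>s\<in>{1, -1}. y : hexlayer_part T n s j i \<or> y : hexlayer_part T n s j l"
proof -
 have y: "y : cdom T" "pi / 4 - 2 / layer n < abs (ang j y)" using assms(1) by (auto simp: hexlayer_def)
 define s where "s = (if ang j y < 0 then - 1 else 1 :: real)"
 have p: "pi / 4 - 2 / layer n < s * ang j y" using y(2) by (auto simp: s_def)
 have "s * (ang i y + ang j y + ang l y) = 0" using three_indices(1)[OF assms(2-4) assms(2-4)] by simp
 hence "s * ang i y + s * ang j y + s * ang l y = 0" by (simp add: algebra_simps)
 hence "s * ang i y < 0 \<or> s * ang l y < 0" using p layer_pi[of n] by linarith
 moreover have "s : {1, -1}" by (simp add: s_def)
 ultimately show ?thesis using y(1) p by (auto simp: hexlayer_part_def)
qed

lemma nn_cauchy_schwarz: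
 assumes "f : L2_space M" "g : L2_space M"
 shows "(\<integral>\<^sup>+x. ennreal (abs (f x) * abs (g x)) \<partial>M) <= ennreal (L2_norm M f * L2_norm M g)"
proof -
 have a: "(%x. abs (f x)) : L2_space M" "(%x. abs (g x)) : L2_space M" using assms by (auto simp: L2_space_def)
 have "(\<integral>\<^sup>+x. ennreal (abs (f x) * abs (g x)) \<partial>M) = ennreal (\<integral>x. abs (f x) * abs (g x) \<partial>M)"
  by (rule nn_integral_eq_integral[OF L2_mult_integrable[OF a]]) simp
 also have "... <= ennreal (L2_norm M f * L2_norm M g)" using L2_cauchy_schwarz[OF a] by (intro ennreal_leI) (simp add: L2_norm_def)
 finally show ?thesis .
qed

text \<open>The layer splits into four parts, from the two opposite edges and the two choices of the
  angle that is kept fixed. On each of them the strip estimate holds with ray time 2 / layer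
  n.\<close>

lemma hexlayer_bound:
 assumes T: "open T" and q: "q : L2"
  and Q: "!!s i l. s = 1 \<or> s = -1 ==> i ~= j ==> i ~= l ==> j ~= l ==> EX Q. Q : L2 & vanishing_near (cdom T) (edge T s j) (s *\<^sub>R (cdir j - cdir l), 0) q Q"
 shows "\<exists>C\<ge>0. ALL n. nrm2 (%x. indicator (hexlayer T n j) x * q x) <= C / layer n"
proof -
 obtain i l where il: "i ~= j" "l ~= j" "i ~= l" using other_indices by blast
 note U = open_cdom[OF T]
 have part: "\<exists>C\<ge>0. ALL n. nrm2 (%x. indicator (hexlayer_part T n s j i) x * q x) <= C / layer n" if s: "s = 1 \<or> s = -1" and ijl: "i ~= j" "i ~= l" "j ~= l" for s i l proof -
  obtain Q where Q2: "Q : L2" and van: "vanishing_near (cdom T) (edge T s j) (s *\<^sub>R (cdir j - cdir l), 0) q Q" using Q[OF s ijl] by blast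
  have "nrm2 (%x. indicator (hexlayer_part T n s j i) x * q x) <= (2 * nrm2 Q) / layer n" for n proof -
  have sub: "hexlayer_part T n s j i <= cdom T" by (auto simp: hexlayer_part_def)
  note m = hexlayer_measurable(2)[OF T]
  have "nrm2 (%x. indicator (hexlayer_part T n s j i) x * q x) <= 2 / layer n * nrm2 (%x. indicator (hexlayer_part T n s j i) x * Q x)" using layer(2)[of n]
  by (intro strip_poincare[OF U q Q2 sub sub m m _ rays_reach_edge[OF s ijl] van]) simp
  also have "... <= 2 / layer n * nrm2 Q" proof (rule mult_left_mono)
  show "nrm2 (%x. indicator (hexlayer_part T n s j i) x * Q x) <= nrm2 Q" by (rule L2_norm_mono[OF Q2 L2D(1)[OF L2_indicator[OF Q2 m]]]) (auto simp: indicator_def)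
  qed (use layer(2)[of n] in simp)
  finally show ?thesis by simp
  qed
  thus ?thesis using L2_norm_nonneg by (intro exI[of _ "2 * nrm2 Q"]) (simp add: L2_norm_nonneg)
 qed
 have one: "(1::real) = 1 \<or> (1::real) = -1" and mone: "(-1::real) = 1 \<or> (-1::real) = -1" by simp_all
 obtain C1 where C1: "C1 >= 0" "!!n. nrm2 (%x. indicator (hexlayer_part T n 1 j i) x * q x) <= C1 / layer n" using part[OF one, of i l] il by blast
 obtain C2 where C2: "C2 >= 0" "!!n. nrm2 (%x. indicator (hexlayer_part T n (-1) j i) x * q x) <= C2 / layer n" using part[OF mone, of i l] il by blast
 obtain C3 where C3: "C3 >= 0" "!!n. nrm2 (%x. indicator (hexlayer_part T n 1 j l) x * q x) <= C3 / layer n" using part[OF one, of l i] il by blast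
 obtain C4 where C4: "C4 >= 0" "!!n. nrm2 (%x. indicator (hexlayer_part T n (-1) j l) x * q x) <= C4 / layer n" using part[OF mone, of l i] il by blast
 have "nrm2 (%x. indicator (hexlayer T n j) x * q x) <= (C1 + C2 + C3 + C4) / layer n" for n proof -
  let ?p = "%s i x. indicator (hexlayer_part T n s j i) x * abs (q x)"
  have q': "(%x. abs (q x)) : L2" using q by (auto simp: L2_space_def)
  have p2: "?p s i : L2" for s i by (rule L2_indicator[OF q' hexlayer_measurable(2)[OF T]])
  have pn: "nrm2 (?p s i) = nrm2 (%x. indicator (hexlayer_part T n s j i) x * q x)" for s i by (simp add: L2_norm_def power_mult_distrib)
  let ?S = "%x. ?p 1 i x + (?p (-1) i x + (?p 1 l x + ?p (-1) l x))"
  have S2: "?S : L2" by (intro L2_space_add p2)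
  have "nrm2 (%x. indicator (hexlayer T n j) x * q x) <= nrm2 ?S" proof (rule L2_norm_mono[OF S2 L2D(1)[OF L2_indicator[OF q hexlayer_measurable(1)[OF T]]]], rule AE_I2)
  fix x
  have nn: "?p s i x >= 0" for s i by simp
  show "abs (indicator (hexlayer T n j) x * q x) <= abs (?S x)" proof (cases "x : hexlayer T n j")
  case True
  then obtain s where "s : {1, -1}" "x : hexlayer_part T n s j i \<or> x : hexlayer_part T n s j l" using hexlayer_cover[of x T n j i l] il by auto
  hence "abs (q x) <= ?S x" using nn[of 1 i] nn[of "-1" i] nn[of 1 l] nn[of "-1" l] by auto
  thus ?thesis using True by simp
  qed simp
  qed
  also have "... <= nrm2 (?p 1 i) + (nrm2 (?p (-1) i) + (nrm2 (?p 1 l) + nrm2 (?p (-1) l)))" by (rule order.trans[OF L2_norm_triangle[OF p2 L2_space_add[OF p2 L2_space_add[OF p2 p2]]]],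
  rule add_left_mono, rule order.trans[OF L2_norm_triangle[OF p2 L2_space_add[OF p2 p2]]], rule add_left_mono, rule L2_norm_triangle[OF p2 p2])
  also have "... <= C1 / layer n + (C2 / layer n + (C3 / layer n + C4 / layer n))" unfolding pn by (intro add_mono C1 C2 C3 C4)
  finally show ?thesis by (simp add: add_divide_distrib)
 qed
 thus ?thesis using C1(1) C2(1) C3(1) C4(1) by (intro exI[of _ "C1 + C2 + C3 + C4"]) simp
qed

text \<open>The combination in the last hypothesis is the component of \<open>G\<close> across the
  edges of angle \<open>j\<close>. It is of order 1 / layer n on the layer, which balances the
  derivative of the cutoff, of order layer n; what remains is a constant times the norm of
  \<open>v\<close> on the layer.\<close>

lemma green_theta:
 assumes T: "open T" "bounded T"
  and G: "!!k. G k : L2" "!!k. M k : L2" "!!k. weak_dird (cdom T) (cdir k, 0) (G k) (M k)" and v: "v : L2" "!!k. V k : L2" "!!k. weak_dird (cdom T) (cdir k, 0) v (V k)"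
  and w: "w : borel_fun" "!!k. W k : borel_fun" "!!x. x : cdom T ==> abs (w x) <= C" "!!x y. x : cdom T ==> y : cdom T ==> abs (w x - w y) <= C * norm (x - y)"
  "!!k. AE x in lborel. x : cdom T --> has_dird (cdir k, 0) w (W k x) x" "!!k. AE x in lborel. x : cdom T --> abs (W k x) <= C"
  and Q: "!!j s i l. s = 1 \<or> s = -1 ==> i ~= j ==> i ~= l ==> j ~= l ==> EX Q. Q : L2 & vanishing_near (cdom T) (edge T s j) (s *\<^sub>R (cdir j - cdir l), 0)
  (%x. SS k. ang j (cdir k, 0) * G k x) Q"
 shows "(LBINT x. ind T x * (w x * (SS k. G k x * V k x) + v x * (SS k. G k x * W k x) + v x * w x * (SS k. M k x))) = 0"
proof -
 define q where "q j x = (SS k. ang j (cdir k, 0) * G k x)" for j x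
 have q2: "q j : L2" for j unfolding q_def by (intro L2_space_sum L2_space_cmult G(1))
 have qv: "EX Q. Q : L2 & vanishing_near (cdom T) (edge T s j) (s *\<^sub>R (cdir j - cdir l), 0) (q j) Q" if "s = 1 \<or> s = -1" "i ~= j" "i ~= l" "j ~= l" for j s i l
  unfolding q_def[abs_def] by (rule Q[OF that])
 have ex: "\<exists>C\<ge>0. ALL n. nrm2 (%x. indicator (hexlayer T n j) x * q j x) <= C / layer n" for j by (rule hexlayer_bound[OF T(1) q2 qv])
 define c where "c j = (SOME C. C >= 0 & (ALL n. nrm2 (%x. indicator (hexlayer T n j) x * q j x) <= C / layer n))" for j
 have "c j >= 0 & (ALL n. nrm2 (%x. indicator (hexlayer T n j) x * q j x) <= c j / layer n)" for j unfolding c_def by (rule someI_ex[OF ex])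
 hence c: "nrm2 (%x. indicator (hexlayer T n j) x * q j x) <= c j / layer n" "c j >= 0" for j n by blast+
 define xi where "xi n y = hexcut n y * tcut T n (snd y)" for n y
 define X where "X k n y = hexcut' n (cdir k, 0) y * tcut T n (snd y) + hexcut n y * 0" for k n y
 define nv where "nv n j = nrm2 (%x. indicator (hexlayer T n j) x * v x)" for n j
 define r where "r n = (SS j. 4 * c j * nv n j)" for n
 have "(LBINT x. ind T x * ((1::real) * (w x * (SS k. G k x * V k x) + v x * (SS k. G k x * W k x) + v x * w x * (SS k. M k x)))) = 0"
 proof (rule green_limit[where e = "%k. (cdir k, 0)" and B = 1 and r = r and xi = xi and X = X and C = C
  and I = UNIV and U = "cdom T" and A = G and M = M and V = V and W = W and v = v and w = w and xi' = "%x. 1"])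
  show "open (cdom T)" by (rule open_cdom[OF T(1)])
  fix k :: 3 and m :: nat
  obtain L K where LK: "!!a b. abs (tcut T m a - tcut T m b) <= L * norm (a - b)" "compact K" "K <= T" "!!a. a ~: K ==> tcut T m a = 0" using tcut(3,4)[OF T, of m] by blast
  show "lip_test (cdom T) (cdir k, 0) (xi m) (X k m)" unfolding xi_def[abs_def] X_def[abs_def] by (rule lip_test_hexcut_mult[where h' = "%a. 0", OF LK]) (auto simp: has_dird_def)
 next
  show "abs (xi m x) <= 1" for m x unfolding xi_def by (intro prod_bounds hexcut_bound tcut T)
  show "(%m. xi m x) ----> 1" if "x : cdom T" for x using tendsto_mult[OF hexcut_tendsto[OF that] tcut(5)[OF T, of "snd x"]] that by (simp add: xi_def mem_cdom_ang)
  have [measurable]: "tcut T m : borel_fun" for m by (rule tcut(6)[OF T])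
  show "xi m : borel_fun" for m unfolding xi_def by measurable
  show "(\<integral>\<^sup>+x\<in>cdom T. ennreal (abs (SS k. G k x * X k n x) * abs (v x)) \<partial>lborel) <= ennreal (r n)" for n proof -
  let ?I = "%j x. indicator (hexlayer T n j) x :: real"
  have pt: "abs (SS k. G k x * X k n x) <= (SS j. (4 * layer n) * abs (?I j x * q j x))" if "x : cdom T" for x proof -
  have bd: "abs (q j x * (acut' n (ang j x) * p)) <= (4 * layer n) * abs (?I j x * q j x)" if "abs p <= 1" for j p proof (cases "x : hexlayer T n j")
  case True
  have "abs (acut' n (ang j x)) * abs p <= (4 * layer n) * 1" using that layer(2)[of n] by (intro mult_mono acut'_bound) auto
  hence "abs (q j x) * (abs (acut' n (ang j x)) * abs p) <= abs (q j x) * (4 * layer n)" by (intro mult_left_mono) auto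
  thus ?thesis using True by (simp add: abs_mult mult.commute)
  next
  case False
  hence "acut' n (ang j x) = 0" using \<open>x : cdom T\<close> by (intro acut'_eq_0) (simp add: hexlayer_def not_less)
  moreover have "0 <= (4 * layer n) * abs (?I j x * q j x)" using layer(2)[of n] by (intro mult_nonneg_nonneg) auto
  ultimately show ?thesis by simp
  qed
  let ?p1 = "acut n (ang 2 x) * acut n (ang 3 x)"
  let ?p2 = "acut n (ang 1 x) * acut n (ang 3 x)"
  let ?p3 = "acut n (ang 1 x) * acut n (ang 2 x)"
  \<comment> \<open>Grouping the terms by the factor that is differentiated turns the sum over the
    directions into the normal components \<open>q j\<close>.\<close>
  have eqn: "(SS k. G k x * X k n x) = tcut T n (snd x) * (q 1 x * (acut' n (ang 1 x) * ?p1) + q 2 x * (acut' n (ang 2 x) * ?p2) + q 3 x * (acut' n (ang 3 x) * ?p3))"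
  unfolding X_def hexcut'_def q_def sum_3 by (simp add: algebra_simps)
  have "abs (SS k. G k x * X k n x) <= 1 * (abs (q 1 x * (acut' n (ang 1 x) * ?p1)) + abs (q 2 x * (acut' n (ang 2 x) * ?p2)) + abs (q 3 x * (acut' n (ang 3 x) * ?p3)))"
  unfolding eqn abs_mult[of "tcut T n (snd x)"] by (rule mult_mono[OF tcut(1)[OF T] order.trans[OF abs_triangle_ineq add_right_mono[OF abs_triangle_ineq]]]) simp_all
  also have "... <= (SS j. (4 * layer n) * abs (?I j x * q j x))" proof -
  have p: "abs ?p1 <= 1" "abs ?p2 <= 1" "abs ?p3 <= 1" by (rule prod_bounds[OF acut_bounds(3) acut_bounds(3)])+
  note t = bd[OF p(1), of 1] bd[OF p(2), of 2] bd[OF p(3), of 3]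
  show ?thesis unfolding sum_3 mult_1_left by (rule add_mono[OF add_mono[OF t(1) t(2)] t(3)])
  qed
  finally show ?thesis .
  qed
  have L2q: "(%x. ?I j x * q j x) : L2" and L2v: "(%x. ?I j x * v x) : L2" for j by (intro L2_indicator hexlayer_measurable(1) T q2 v(1))+
  have "(\<integral>\<^sup>+x\<in>cdom T. ennreal (abs (SS k. G k x * X k n x) * abs (v x)) \<partial>lborel)
  <= (NN x. (SS j. ennreal (4 * layer n) * ennreal (abs (?I j x * q j x) * abs (?I j x * v x))))" proof (rule nn_integral_mono)
  fix x
  show "ennreal (abs (SS k. G k x * X k n x) * abs (v x)) * ind T x <= (SS j. ennreal (4 * layer n) * ennreal (abs (?I j x * q j x) * abs (?I j x * v x)))" proof (cases "x : cdom T")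
  case True
  have "abs (SS k. G k x * X k n x) * abs (v x) <= (SS j. (4 * layer n) * abs (?I j x * q j x)) * abs (v x)" by (rule mult_right_mono[OF pt[OF True]]) simp
  also have "... = (SS j. (4 * layer n) * (abs (?I j x * q j x) * abs (?I j x * v x)))" unfolding sum_distrib_right by (intro sum.cong refl) (simp add: indicator_def abs_mult)
  finally have "ennreal (abs (SS k. G k x * X k n x) * abs (v x)) <= ennreal (SS j. (4 * layer n) * (abs (?I j x * q j x) * abs (?I j x * v x)))" by (rule ennreal_leI)
  also have "... = (SS j. ennreal (4 * layer n) * ennreal (abs (?I j x * q j x) * abs (?I j x * v x)))" using layer(2)[of n] by (subst sum_ennreal[symmetric]) (auto simp: ennreal_mult')
  finally show ?thesis using True by simp
  qed simp
  qed
  also have "... = (SS j. ennreal (4 * layer n) * (NN x. ennreal (abs (?I j x * q j x) * abs (?I j x * v x))))" proof -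
  have m: "(%x. ennreal (abs (?I j x * q j x) * abs (?I j x * v x))) : borel_measurable lborel" for j using L2D(1)[OF L2q[of j]] L2D(1)[OF L2v[of j]] by measurable
  show ?thesis by (subst nn_integral_sum) (use m in "auto simp: nn_integral_cmult")
  qed
  also have "... <= (SS j. ennreal (4 * c j * nv n j))" proof (rule sum_mono)
  fix j :: 3
  have "(NN x. ennreal (abs (?I j x * q j x) * abs (?I j x * v x))) <= ennreal (nrm2 (%x. ?I j x * q j x) * nv n j)" unfolding nv_def by (rule nn_cauchy_schwarz[OF L2q L2v])
  also have "... <= ennreal (c j / layer n * nv n j)" by (intro ennreal_leI mult_right_mono c) (simp add: nv_def L2_norm_nonneg)
  finally have "ennreal (4 * layer n) * (NN x. ennreal (abs (?I j x * q j x) * abs (?I j x * v x))) <= ennreal (4 * layer n) * ennreal (c j / layer n * nv n j)" by (rule mult_left_mono) simp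
  also have "... = ennreal (4 * c j * nv n j)" using layer(2)[of n] by (subst ennreal_mult'[symmetric]) (auto simp: field_simps)
  finally show "ennreal (4 * layer n) * (NN x. ennreal (abs (?I j x * q j x) * abs (?I j x * v x))) <= ennreal (4 * c j * nv n j)" .
  qed
  also have "... = ennreal (r n)" unfolding r_def by (rule sum_ennreal) (use c(2) in "simp add: nv_def L2_norm_nonneg")
  finally show ?thesis .
  qed
  have "(%n. nv n j) ----> 0" for j unfolding nv_def proof (rule L2_indicator_vanish[OF v(1) hexlayer_measurable(1)[OF T(1)]])
  fix y
  show "\<forall>\<^sub>F n in sequentially. y ~: hexlayer T n j" proof (cases "y : cdom T")
  case True
  hence "0 < pi / 4 - abs (ang j y)" by (simp add: mem_cdom_ang)
  from layer_eventually[OF this] show ?thesis by eventually_elim (simp add: hexlayer_def)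
  qed (simp add: hexlayer_def)
  qed
  hence "(%n. SS j. 4 * c j * nv n j) ----> (\<Sum>j\<in>(UNIV::3 set). 4 * c j * 0)" by (intro tendsto_sum tendsto_mult tendsto_const)
  thus "r ----> 0" by (simp add: r_def[abs_def])
 qed (simp_all only: G v w finite_code borel_measurable_const)
 thus ?thesis by simp
qed

section \<open>Green's formula in the triple junction\<close>

lemma Ck1_lipschitz_cball:
 fixes f :: "'a::euclidean_space => 'b::real_normed_vector"
 assumes f: "Ck_on 1 S f" and S: "cball p s <= S"
 shows "\<exists>L\<ge>0. \<forall>x\<in>cball p s. \<forall>y\<in>cball p s. norm (f x - f y) <= L * norm (x - y)"
proof -
 let ?f' = "%x. frechet_derivative f (at x)"
 have d: "(f has_derivative ?f' x) (at x)" if "x : S" for x using f that by (simp add: frechet_derivative_works[symmetric])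
 have "EX M. \<forall>x\<in>cball p s. norm (?f' x b) <= M" for b proof -
  have "continuous_on S (%x. ?f' x b)" using f by simp
  hence "continuous_on (cball p s) (%x. ?f' x b)" by (rule continuous_on_subset[OF _ S])
  from compact_imp_bounded[OF compact_continuous_image[OF this compact_cball]]
  obtain M where "\<forall>y\<in>(%x. ?f' x b) ` cball p s. norm y <= M" unfolding bounded_iff by blast
  thus ?thesis by blast
 qed
 then obtain M where M: "!!b x. x : cball p s ==> norm (?f' x b) <= M b" by metis
 define m where "m = (\<Sum>b\<in>(Basis::'a set). abs (M b))"
 have m0: "m >= 0" by (simp add: m_def sum_nonneg)
 have on: "onorm (?f' x) <= m" if x: "x : cball p s" for x proof (rule onorm_bound[OF m0])
  fix h :: 'a
  have lin: "linear (?f' x)" using d x S has_derivative_linear by blast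
  have "?f' x h = (\<Sum>b\<in>Basis. (h \<bullet> b) *\<^sub>R ?f' x b)" by (subst euclidean_representation[of h, symmetric]) (simp only: linear_sum[OF lin] linear_scale[OF lin])
  also have "norm ... <= (\<Sum>b\<in>(Basis::'a set). norm h * abs (M b))" proof (rule order.trans[OF norm_sum], rule sum_mono)
  fix b :: 'a assume "b : Basis"
  thus "norm ((h \<bullet> b) *\<^sub>R ?f' x b) <= norm h * abs (M b)" using M[OF x, of b] unfolding norm_scaleR by (intro mult_mono Basis_le_norm) auto
  qed
  finally show "norm (?f' x h) <= m * norm h" by (simp add: m_def sum_distrib_left mult.commute)
 qed
 have "norm (f x - f y) <= m * norm (x - y)" if "x : cball p s" "y : cball p s" for x y by (rule differentiable_bound[OF convex_cball _ on that, of f]) (use d S has_derivative_at_withinI in blast)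
 thus ?thesis using m0 by blast
qed

text \<open>Directions with negative product with \<open>n\<close> enter \<open>T\<close>, where
  \<open>rho\<close> is negative, so the derivative of \<open>rho\<close> along them is at most 0.
  The direction - n shows that \<open>g\<close> has a nonnegative component along \<open>n\<close>;
  the tangential part of \<open>g\<close>, tilted slightly inwards, shows that this part is
  0.\<close>

lemma outer_unit_normal_gradient:
 fixes rho :: "'a::euclidean_space => real"
 assumes n: "outer_unit_normal UNIV T b n" and B: "open B" "b : B" "T \<inter> B = {x : B. rho x < 0}"
  and d: "(rho has_derivative (%h. g \<bullet> h)) (at b)" and z: "rho b = 0"
 shows "g = norm g *\<^sub>R n"
proof -
 have n1: "n \<bullet> n = 1" using n by (simp add: outer_unit_normal_def power2_norm_eq_inner[symmetric])
 have le: "g \<bullet> v <= 0" if v: "v \<bullet> n < 0" for v proof -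
  have T: "\<forall>\<^sub>F t in at_right 0. b + t *\<^sub>R v : T" using n v by (auto simp: outer_unit_normal_def)
  have "((%t. b + t *\<^sub>R v) \<longlongrightarrow> b + 0 *\<^sub>R v) (at_right 0)" by (intro tendsto_intros)
  hence "\<forall>\<^sub>F t in at_right 0. b + t *\<^sub>R v : B" using B(1,2) topological_tendstoD by fastforce
  hence neg: "\<forall>\<^sub>F t in at_right 0. (rho (b + t *\<^sub>R v) - rho (b + 0 *\<^sub>R v)) / (t - 0) <= 0" using T eventually_at_right_less[of "0::real"] proof eventually_elim
  case (elim t)
  hence "rho (b + t *\<^sub>R v) < 0" using B(3) by blast
  thus ?case using elim z by (simp add: divide_le_0_iff)
  qed
  have "has_dird v rho (g \<bullet> v) b" by (rule has_derivative_imp_has_dird[OF d])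
  hence "((%t. rho (b + t *\<^sub>R v)) has_real_derivative g \<bullet> v) (at 0 within {0<..})" unfolding has_dird_def by (rule DERIV_subset) simp
  hence "((%t. (rho (b + t *\<^sub>R v) - rho (b + 0 *\<^sub>R v)) / (t - 0)) \<longlongrightarrow> g \<bullet> v) (at_right 0)" by (simp only: has_field_derivative_iff)
  thus ?thesis by (rule tendsto_upperbound[OF _ neg]) simp
 qed
 have gn: "g \<bullet> n >= 0" using le[of "- n"] n1 by simp
 have "g \<bullet> g <= (g \<bullet> n)^2 + e" if "e > 0" for e proof -
  define eps where "eps = e / (g \<bullet> n + 1)"
  have eps: "eps > 0" using that gn by (simp add: eps_def)
  have "eps * (g \<bullet> n + 1) = e" using gn by (simp add: eps_def)
  hence e: "eps * (g \<bullet> n) <= e" using eps by (simp add: distrib_left)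
  have "(g - (g \<bullet> n) *\<^sub>R n - eps *\<^sub>R n) \<bullet> n < 0" using eps n1 by (simp add: inner_diff_left)
  from le[OF this] have "g \<bullet> g - (g \<bullet> n) * (g \<bullet> n) - eps * (g \<bullet> n) <= 0" by (simp add: inner_diff_right)
  thus ?thesis using e by (simp add: power2_eq_square)
 qed
 hence "(norm g)^2 <= (g \<bullet> n)^2" unfolding power2_norm_eq_inner by (rule field_le_epsilon)
 hence "norm g <= g \<bullet> n" using gn by (rule power2_le_imp_le)
 moreover have "g \<bullet> n <= norm g * norm n" by (rule norm_cauchy_schwarz)
 ultimately have eq: "g \<bullet> n = norm g" using n by (simp add: outer_unit_normal_def)
 have "(g - norm g *\<^sub>R n) \<bullet> (g - norm g *\<^sub>R n) = 0" proof -
  have gg: "g \<bullet> g = norm g * norm g" by (simp add: dot_square_norm power2_eq_square)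
  show ?thesis unfolding inner_diff_left inner_diff_right inner_scaleR_left inner_scaleR_right inner_commute[of n g] eq n1 gg by simp
 qed
 thus ?thesis by simp
qed

lemma continuous_on_has_derivative_at:
 "(!!x. x : S ==> (f has_derivative f' x) (at x)) ==> continuous_on S f" by (rule has_derivative_continuous_on) (rule has_derivative_at_withinI)

definition C1_bounded :: "(real^2 => real) => (real^2 => real^2) => bool" where
 "C1_bounded phi phi' \<longleftrightarrow> (ALL a. (phi has_derivative (%h. phi' a \<bullet> h)) (at a)) & continuous_on UNIV phi' & (EX M. ALL a. abs (phi a) <= M & norm (phi' a) <= M)"

lemma C1_bounded_lipschitz:
 assumes "C1_bounded phi phi'" obtains M where "M >= 0" "!!a. abs (phi a) <= M" "!!a. norm (phi' a) <= M" "!!a b. abs (phi a - phi b) <= M * norm (a - b)"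
proof -
 obtain M where M: "!!a. abs (phi a) <= M & norm (phi' a) <= M" using assms unfolding C1_bounded_def by blast
 have M0: "M >= 0" using M[of 0] norm_ge_zero[of "phi' 0"] by linarith
 have d: "(phi has_derivative (%h. phi' a \<bullet> h)) (at a)" for a using assms unfolding C1_bounded_def by blast
 have "onorm (%h. phi' a \<bullet> h) <= M" for a proof (rule onorm_bound[OF M0])
  fix h show "norm (phi' a \<bullet> h) <= M * norm h" using Cauchy_Schwarz_ineq2[of "phi' a" h] mult_right_mono[of "norm (phi' a)" M "norm h"] M[of a] by simp
 qed
 hence "norm (phi a - phi b) <= M * norm (a - b)" for a b by (intro differentiable_bound[OF convex_UNIV, of phi "%a h. phi' a \<bullet> h"]) (use d has_derivative_at_withinI in auto)
 thus ?thesis using M M0 that[of M] by simp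
qed

lemma C1_bounded_const: "C1_bounded (%a. c) (%a. 0)"
proof -
 have z: "(\<bullet>) (0::real^2) = (%h. 0)" by auto
 show ?thesis unfolding C1_bounded_def z by (auto intro!: exI[of _ "abs c"])
qed

lemma C1_bounded_diff:
 assumes "C1_bounded phi phi'" "C1_bounded psi psi'"
 shows "C1_bounded (%a. phi a - psi a) (%a. phi' a - psi' a)" unfolding C1_bounded_def
proof (intro conjI allI)
 show "((%a. phi a - psi a) has_derivative (%h. (phi' a - psi' a) \<bullet> h)) (at a)" for a using has_derivative_diff[of phi "%h. phi' a \<bullet> h" "at a" psi "%h. psi' a \<bullet> h"] assms
  by (simp add: C1_bounded_def inner_diff_left)
 show "continuous_on UNIV (%a. phi' a - psi' a)" using assms by (intro continuous_intros) (auto simp: C1_bounded_def)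
 obtain M N where "!!a. abs (phi a) <= M & norm (phi' a) <= M" "!!a. abs (psi a) <= N & norm (psi' a) <= N" using assms unfolding C1_bounded_def by blast
 hence "abs (phi a - psi a) <= M + N & norm (phi' a - psi' a) <= M + N" for a using abs_triangle_ineq4[of "phi a" "psi a"] norm_triangle_ineq4[of "phi' a" "psi' a"] by (meson add_mono order.trans)
 thus "EX M. ALL a. abs (phi a - psi a) <= M & norm (phi' a - psi' a) <= M" by blast
qed

lemma C1_bounded_mult:
 assumes "C1_bounded phi phi'" "C1_bounded psi psi'"
 shows "C1_bounded (%a. phi a * psi a) (%a. psi a *\<^sub>R phi' a + phi a *\<^sub>R psi' a)" unfolding C1_bounded_def
proof (intro conjI allI)
 have d: "(phi has_derivative (%h. phi' a \<bullet> h)) (at a)" "(psi has_derivative (%h. psi' a \<bullet> h)) (at a)" for a using assms by (auto simp: C1_bounded_def)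
 show "((%a. phi a * psi a) has_derivative (%h. (psi a *\<^sub>R phi' a + phi a *\<^sub>R psi' a) \<bullet> h)) (at a)" for a
  using has_derivative_mult[OF d] by (simp add: inner_add_left algebra_simps)
 have "continuous_on UNIV phi" "continuous_on UNIV psi" by (rule continuous_on_has_derivative_at, rule d)+
 thus "continuous_on UNIV (%a. psi a *\<^sub>R phi' a + phi a *\<^sub>R psi' a)" using assms by (intro continuous_intros) (auto simp: C1_bounded_def)
 obtain M where M: "M >= 0" "!!a. abs (phi a) <= M" "!!a. norm (phi' a) <= M" "!!a b. abs (phi a - phi b) <= M * norm (a - b)" by (rule C1_bounded_lipschitz[OF assms(1)]) (rule that)
 obtain N where N: "N >= 0" "!!a. abs (psi a) <= N" "!!a. norm (psi' a) <= N" "!!a b. abs (psi a - psi b) <= N * norm (a - b)" by (rule C1_bounded_lipschitz[OF assms(2)]) (rule that)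
 have "abs (phi a * psi a) <= M * N" for a unfolding abs_mult by (intro mult_mono M N abs_ge_zero)
 moreover have "norm (psi a *\<^sub>R phi' a + phi a *\<^sub>R psi' a) <= N * M + M * N" for a
  by (rule order.trans[OF norm_triangle_ineq], unfold norm_scaleR, intro add_mono mult_mono M N norm_ge_zero)
 moreover have "0 <= M * N" "N * M = M * N" using M N by simp_all
 ultimately show "EX K. ALL a. abs (phi a * psi a) <= K & norm (psi a *\<^sub>R phi' a + phi a *\<^sub>R psi' a) <= K" by (intro exI[of _ "M * N + M * N"] allI conjI) (smt (verit, best))+
qed

text \<open>The offset 3 puts radius \<open>r\<close> at the argument 2, from which on
  \<open>step\<close> is 1, and radius \<open>2 * r\<close> at the argument -1, where it is
  0.\<close>

definition bmp :: "real^2 => real => real^2 => real" where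
 "bmp p r a = step (3 - ((a - p) \<bullet> (a - p)) / r^2)"

definition bmp' :: "real^2 => real => real^2 => real^2" where
 "bmp' p r a = (- step' (3 - ((a - p) \<bullet> (a - p)) / r^2) * 2 / r^2) *\<^sub>R (a - p)"

lemma bmp_eq_1: "r > 0 ==> a : cball p r ==> bmp p r a = 1"
proof -
 assume r: "r > 0" and a: "a : cball p r"
 have "(norm (a - p))^2 <= r^2" using a by (intro power_mono) (auto simp: dist_norm norm_minus_commute)
 hence "((a - p) \<bullet> (a - p)) / r^2 <= 1" using r by (simp add: power2_norm_eq_inner divide_le_eq)
 thus ?thesis unfolding bmp_def by (intro step_eq_1) linarith
qed

lemma bmp'_inside: "r > 0 ==> a : cball p r ==> bmp' p r a = 0"
proof -
 assume r: "r > 0" and a: "a : cball p r"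
 have "(norm (a - p))^2 <= r^2" using a by (intro power_mono) (auto simp: dist_norm norm_minus_commute)
 hence "((a - p) \<bullet> (a - p)) / r^2 <= 1" using r by (simp add: power2_norm_eq_inner divide_le_eq)
 hence "step' (3 - ((a - p) \<bullet> (a - p)) / r^2) = 0" by (intro step'_eq_0(2)) linarith
 thus ?thesis by (simp add: bmp'_def)
qed

lemma bmp_outside:
 assumes "r > 0" "a ~: ball p (2 * r)"
 shows "bmp p r a = 0" "bmp' p r a = 0"
proof -
 have "(2 * r)^2 <= (norm (a - p))^2" using assms by (intro power_mono) (auto simp: dist_norm norm_minus_commute)
 hence "4 <= ((a - p) \<bullet> (a - p)) / r^2" using assms(1) by (simp add: power2_norm_eq_inner le_divide_eq power_mult_distrib)
 hence le: "3 - ((a - p) \<bullet> (a - p)) / r^2 <= 1" by linarith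
 show "bmp p r a = 0" "bmp' p r a = 0" unfolding bmp_def bmp'_def by (simp_all add: step_eq_0[OF le] step'_eq_0(1)[OF le])
qed

lemma bmp_has_derivative: "(bmp p r has_derivative (%h. bmp' p r a \<bullet> h)) (at a)"
proof -
 have 1: "((%a. 3 - ((a - p) \<bullet> (a - p)) / r^2) has_derivative (%h. - (2 * ((a - p) \<bullet> h)) / r^2)) (at a)" proof -
  have "((%a. 3 - c * ((a - p) \<bullet> (a - p))) has_derivative (%h. - (c * (2 * ((a - p) \<bullet> h))))) (at a)" for c by (auto intro!: derivative_eq_intros simp: inner_commute)
  from this[of "1 / r^2"] show ?thesis by simp
 qed
 have "((%a. step (3 - ((a - p) \<bullet> (a - p)) / r^2)) has_derivative (%h. step' (3 - ((a - p) \<bullet> (a - p)) / r^2) * (- (2 * ((a - p) \<bullet> h)) / r^2))) (at a)"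
  by (rule has_derivative_compose[OF 1 step_has_derivative[unfolded has_field_derivative_def]])
 thus ?thesis by (simp add: bmp_def[abs_def] bmp'_def mult_ac)
qed

lemma C1_bounded_bmp:
 assumes "r > 0" shows "C1_bounded (bmp p r) (bmp' p r)" unfolding C1_bounded_def
proof (intro conjI allI)
 show "(bmp p r has_derivative (%h. bmp' p r a \<bullet> h)) (at a)" for a by (rule bmp_has_derivative)
 show c: "continuous_on UNIV (bmp' p r)" unfolding bmp'_def[abs_def] by (intro continuous_intros continuous_on_compose2[OF continuous_on_step'[of UNIV]]) (use assms in auto)
 have "bounded (bmp' p r ` cball p (2 * r))" by (intro compact_imp_bounded compact_continuous_image compact_cball continuous_on_subset[OF c]) simp
 then obtain M where M: "\<forall>y\<in>bmp' p r ` cball p (2 * r). norm y <= M" unfolding bounded_iff by blast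
 have "norm (bmp' p r a) <= max M 1" for a proof (cases "a : ball p (2 * r)")
  case True
  hence "bmp' p r a : bmp' p r ` cball p (2 * r)" by auto
  hence "norm (bmp' p r a) <= M" by (rule bspec[OF M])
  thus ?thesis by simp
 qed (simp add: bmp_outside[OF assms])
 moreover have "abs (bmp p r a) <= max M 1" for a using step_bounds by (auto simp: bmp_def intro: max.coboundedI2)
 ultimately show "EX M. ALL a. abs (bmp p r a) <= M & norm (bmp' p r a) <= M" by blast
qed

lemma inner_axis_1: "(v::real^'n) \<bullet> axis k 1 = v $ k"
 by (simp add: inner_axis)

lemma has_dird_snd:
 assumes "(phi has_derivative (%h. g \<bullet> h)) (at (snd y))"
 shows "has_dird (0, axis k 1) (%y. phi (snd y)) (g $ k) y"
proof -
 have "has_dird (axis k 1) phi (g \<bullet> axis k 1) (snd y)" by (rule has_derivative_imp_has_dird[OF assms])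
 thus ?thesis by (simp add: has_dird_def inner_axis_1)
qed

text \<open>The data of the localised Green formula; the last assumption is the vanishing of the boundary
 term in the chart \<open>rho\<close> near \<open>p\<close>.\<close>

lemma green_a_chart:
 fixes rho :: "real^2 => real"
 assumes T: "open T" "bounded T"
  and A: "!!k::2. A k : L2" "!!k. M k : L2" "!!k. weak_dird (cdom T) (0, axis k 1) (A k) (M k)" and v: "v : L2" "!!k. V k : L2" "!!k. weak_dird (cdom T) (0, axis k 1) v (V k)"
  and w: "w : borel_fun" "!!k. W k : borel_fun" "!!x. x : cdom T ==> abs (w x) <= C" "!!x y. x : cdom T ==> y : cdom T ==> abs (w x - w y) <= C * norm (x - y)"
  "!!k. AE x in lborel. x : cdom T --> has_dird (0, axis k 1) w (W k x) x" "!!k. AE x in lborel. x : cdom T --> abs (W k x) <= C"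
  and r1: "r1 > 0" and rho: "!!a. a : ball p (4 * r1) ==> (rho has_derivative (%h. g a \<bullet> h)) (at a)"
  "continuous_on (ball p (4 * r1)) g" "T \<inter> ball p (4 * r1) = {a : ball p (4 * r1). rho a < 0}" "!!a b. a : cball p (3 * r1) ==> b : cball p (3 * r1) ==> abs (rho a - rho b) <= R * norm (a - b)"
  and bd: "!!n. (\<integral>\<^sup>+x\<in>{y : cdom T. snd y : cball p r1 & - 2 / layer (n + n0) < rho (snd y)}.
  ennreal (layer (n + n0) * (abs (SS k. A k x * g (snd x) $ k) * abs (v x))) \<partial>lborel) <= ennreal (r n)" "r ----> 0" and phi: "C1_bounded phi phi'" "!!a. a ~: cball p r1 ==> phi a = 0"
 shows "(LBINT x. ind T x * (phi (snd x) * (w x * (SS k. A k x * V k x) + v x * (SS k. A k x * W k x) + v x * w x * (SS k. M k x)) + w x * v x * (SS k. A k x * phi' (snd x) $ k))) = 0"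
proof -
 note U = open_cdom[OF T(1)]
 have m_snd [measurable]: "(snd :: coord => real^2) : borel_fun" by (intro borel_measurable_continuous_onI continuous_intros)
 obtain P where P: "P >= 0" "!!a. abs (phi a) <= P" "!!a. norm (phi' a) <= P" "!!a b. abs (phi a - phi b) <= P * norm (a - b)" by (rule C1_bounded_lipschitz[OF phi(1)]) (rule that)
 have dphi: "(phi has_derivative (%h. phi' a \<bullet> h)) (at a)" for a using phi(1) by (simp add: C1_bounded_def)
 have cdphi: "continuous_on UNIV phi'" using phi(1) by (simp add: C1_bounded_def)
 have [measurable]: "phi : borel_fun" "phi' : borel_fun" by (rule borel_measurable_continuous_onI[OF continuous_on_has_derivative_at[OF dphi]], rule borel_measurable_continuous_onI[OF cdphi])
 have phi'0: "phi' a = 0" if "a ~: cball p r1" for a proof -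
  have "((%x. 0) has_derivative (%h. phi' a \<bullet> h)) (at a)" by (rule has_derivative_transform_within_open[OF dphi, of "- cball p r1"]) (use that phi(2) in auto)
  hence "(%h. phi' a \<bullet> h) = (%h. 0)" using has_derivative_unique has_derivative_const by blast
  hence "phi' a \<bullet> phi' a = 0" by (rule fun_cong)
  thus ?thesis by simp
 qed
 \<comment> \<open>The localising function goes into the test function and not into the cutoff: its
   gradient is bounded, and it yields the additional term with \<open>phi'\<close> in the
   conclusion.\<close>
 let ?v = "%x. v x * phi (snd x)" and ?V = "%k x. V k x * phi (snd x) + v x * phi' (snd x) $ k"
 have nth_le: "abs (phi' a $ k) <= P" for a k by (rule order.trans[OF component_le_norm_cart P(3)])
 have v2: "?v : L2" by (rule L2_space_mult_bounded[OF v(1), where B = P]) (use P in auto)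
 have V2: "?V k : L2" for k by (intro L2_space_add L2_space_mult_bounded[OF v(2), where B = P] L2_space_mult_bounded[OF v(1), where B = P]) (use P nth_le in auto)
 have wdv: "weak_dird (cdom T) (0, axis k 1) ?v (?V k)" for k proof (rule weak_dird_mult_on[OF U v(3) v(1) v(2), where M = P and L = P and M' = P])
  show "abs (phi (snd x) - phi (snd y)) <= P * norm (x - y)" for x y :: "coord" using P(4)[of "snd x" "snd y"] mult_left_mono[OF norm_fst_snd_le(2)[of "x - y"] P(1)] by simp
  show "AE x in lborel. x : cdom T --> has_dird (0, axis k 1) (%x. phi (snd x)) (phi' (snd x) $ k) x" by (intro AE_I2 impI has_dird_snd dphi)
 qed (use P nth_le in auto)
 \<comment> \<open>\<open>beta\<close> confines the cutoff to the chart. It is 1 on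
   \<open>cball p r1\<close>, which contains the support of \<open>phi\<close>, and its gradient
   vanishes there, so it disappears from the result.\<close>
 define beta where "beta = bmp p r1"
 note Cbeta = C1_bounded_bmp[OF r1, of p, folded beta_def]
 obtain Q where Q: "Q >= 0" "!!a. abs (beta a) <= Q" "!!a. norm (bmp' p r1 a) <= Q" "!!a b. abs (beta a - beta b) <= Q * norm (a - b)" by (rule C1_bounded_lipschitz[OF Cbeta]) (rule that)
 have beta0: "beta a = 0" "bmp' p r1 a = 0" if "a ~: ball p (2 * r1)" for a using bmp_outside[OF r1 that] by (simp_all add: beta_def)
 have mbeta [measurable]: "beta : borel_fun" "bmp' p r1 : borel_fun" unfolding beta_def by (rule borel_measurable_continuous_onI[OF continuous_on_has_derivative_at[OF bmp_has_derivative]],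
  rule borel_measurable_continuous_onI) (use Cbeta in "simp add: C1_bounded_def")
 let ?B = "ball p (4 * r1)"
 let ?N = "%n. layer (n + n0)"
 \<comment> \<open>Being a function of \<open>rho\<close>, \<open>s n\<close> has a gradient
   parallel to \<open>g\<close>, so only that component of \<open>A\<close> meets the large factor.
   Outside the chart the value 0 is a convention hidden by the support of
   \<open>beta\<close>.\<close>
 define s where "s n a = (if a : ?B then step (- ?N n * rho a) else 0)" for n a
 define s' where "s' n a = (if a : ?B then (- ?N n * step' (- ?N n * rho a)) *\<^sub>R g a else 0)" for n a
 define eta where "eta n a = beta a * s n a" for n a
 define eta' where "eta' n a = s n a *\<^sub>R bmp' p r1 a + beta a *\<^sub>R s' n a" for n a
 have sd: "(s n has_derivative (%h. s' n a \<bullet> h)) (at a)" if a: "a : ?B" for n a proof -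
  have 1: "((%a. - ?N n * rho a) has_derivative (%h. - ?N n * (g a \<bullet> h))) (at a)" by (rule has_derivative_mult_right[OF rho(1)[OF a]])
  have "((%a. step (- ?N n * rho a)) has_derivative (%h. step' (- ?N n * rho a) * (- ?N n * (g a \<bullet> h)))) (at a)"
  by (rule has_derivative_compose[OF 1 step_has_derivative[unfolded has_field_derivative_def]])
  moreover have "step' (- ?N n * rho a) * (- ?N n * (g a \<bullet> h)) = s' n a \<bullet> h" for h using a by (simp add: s'_def)
  ultimately have "((%a. step (- ?N n * rho a)) has_derivative (%h. s' n a \<bullet> h)) (at a)" by simp
  thus ?thesis by (rule has_derivative_transform_within_open[OF _ open_ball a]) (simp add: s_def)
 qed
 have etad: "(eta n has_derivative (%h. eta' n a \<bullet> h)) (at a)" for n a proof (cases "a : ?B")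
  case True
  have "(beta has_derivative (%h. bmp' p r1 a \<bullet> h)) (at a)" unfolding beta_def by (rule bmp_has_derivative)
  from has_derivative_mult[OF this sd[OF True]]
  show ?thesis by (simp add: eta_def[abs_def] eta'_def inner_add_left algebra_simps)
 next
  case False
  have a: "a : - cball p (2 * r1)" using False r1 by auto
  have "((%x. 0) has_derivative (%h. 0)) (at a)" by simp
  hence "(eta n has_derivative (%h. 0)) (at a)" by (rule has_derivative_transform_within_open[OF _ _ a]) (auto simp: eta_def intro!: beta0)
  moreover have "eta' n a = 0" using a by (simp add: eta'_def beta0)
  ultimately show ?thesis by simp
 qed
 have sb: "abs (s n a) <= 1" for n a using step_bounds by (auto simp: s_def)
 have crho: "continuous_on ?B rho" by (rule continuous_on_has_derivative_at[OF rho(1)])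
 have ms: "s n : borel_fun" for n proof -
  have "continuous_on ?B (%a. step (- ?N n * rho a))" by (intro continuous_on_compose2[OF continuous_on_step[of UNIV]] continuous_intros crho) auto
  hence "(%a. indicator ?B a *\<^sub>R step (- ?N n * rho a)) : borel_fun" by (rule borel_measurable_continuous_on_indicator[rotated]) simp
  moreover have "(%a. indicator ?B a *\<^sub>R step (- ?N n * rho a)) = s n" by (auto simp: s_def indicator_def fun_eq_iff)
  ultimately show ?thesis by simp
 qed
 have ms': "s' n : borel_fun" for n proof -
  have "continuous_on ?B (%a. (- ?N n * step' (- ?N n * rho a)) *\<^sub>R g a)" by (intro continuous_on_compose2[OF continuous_on_step'[of UNIV]] continuous_intros crho rho(2)) auto
  hence "(%a. indicator ?B a *\<^sub>R ((- ?N n * step' (- ?N n * rho a)) *\<^sub>R g a)) : borel_fun" by (rule borel_measurable_continuous_on_indicator[rotated]) simp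
  moreover have "(%a. indicator ?B a *\<^sub>R ((- ?N n * step' (- ?N n * rho a)) *\<^sub>R g a)) = s' n" by (auto simp: s'_def indicator_def fun_eq_iff)
  ultimately show ?thesis by (simp only:)
 qed
 note [measurable] = ms ms'
 have [measurable]: "eta' n : borel_fun" "eta n : borel_fun" for n unfolding eta'_def eta_def by measurable
 have etalip: "EX L. ALL a b. abs (eta n a - eta n b) <= L * norm (a - b)" for n proof -
  \<comment> \<open>The direction 0 is taken because only the Lipschitz bound contained in the
    conclusion is wanted here.\<close>
  have "lip_test (ball p (3 * r1)) 0 (%a. s n a * beta a) (%a. 0 * beta a + s n a * 0)" proof (rule lip_test_mult_on[where M = 1 and L = "4 * (?N n * R)"])
  show "lip_test (ball p (3 * r1)) 0 beta (%a. 0)" unfolding lip_test_def proof (intro conjI)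
  show "EX L. ALL x y. abs (beta x - beta y) <= L * norm (x - y)" using Q(4) by blast
  show "EX K. compact K & K <= ball p (3 * r1) & (ALL x. x ~: K --> beta x = 0)" using r1 by (intro exI[of _ "cball p (2 * r1)"]) (auto intro!: beta0)
  qed (auto simp: has_dird_def)
  show "abs (s n a - s n b) <= 4 * (?N n * R) * norm (a - b)" if "a : ball p (3 * r1)" "b : ball p (3 * r1)" for a b proof -
  have ab: "a : ?B" "b : ?B" "a : cball p (3 * r1)" "b : cball p (3 * r1)" using that r1 by auto
  have "abs (s n a - s n b) <= 4 * abs (- ?N n * rho a - - ?N n * rho b)" unfolding s_def if_P[OF ab(1)] if_P[OF ab(2)] by (rule step_lipschitz)
  also have "abs (- ?N n * rho a - - ?N n * rho b) = ?N n * abs (rho a - rho b)" proof -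
  have "- ?N n * rho a - - ?N n * rho b = - (?N n * (rho a - rho b))" by (simp add: algebra_simps)
  thus ?thesis using layer(2)[of "n + n0"] by (simp add: abs_mult)
  qed
  also have "4 * (?N n * abs (rho a - rho b)) <= 4 * (?N n * (R * norm (a - b)))" using layer(2)[of "n + n0"] rho(4)[OF ab(3,4)] by (intro mult_left_mono) auto
  finally show ?thesis by (simp add: mult.assoc)
  qed
  qed (use sb in "auto simp: has_dird_def")
  thus ?thesis unfolding lip_test_def eta_def by (simp add: mult.commute)
 qed
 have etasupp: "EX K. compact K & K <= T & (ALL a. a ~: K --> eta n a = 0)" for n proof -
  \<comment> \<open>\<open>step\<close> vanishes up to the argument 1, so the cutoff lives where
    \<open>rho\<close> is at most -1 / layer (n + n0); within the ball of radius
    \<open>2 * r1\<close> this is a compact subset of \<open>T\<close>.\<close>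
  let ?K = "cball p (2 * r1) \<inter> rho -` {.. - 1 / ?N n}"
  have sub: "cball p (2 * r1) <= ?B" using r1 by auto
  have "closed ?K" by (rule continuous_closed_preimage[OF continuous_on_subset[OF crho sub] closed_cball closed_atMost])
  hence "compact ?K" by (auto simp: compact_eq_bounded_closed intro: bounded_subset[OF bounded_cball])
  moreover have "?K <= T" proof
  fix a assume a: "a : ?K"
  have "0 < 1 / ?N n" using layer(2)[of "n + n0"] by simp
  moreover have "rho a <= - 1 / ?N n" using a by simp
  ultimately have "rho a < 0" by linarith
  thus "a : T" using rho(3) a sub by blast
  qed
  moreover have "eta n a = 0" if "a ~: ?K" for a proof (cases "a : cball p (2 * r1)")
  case True
  hence "- 1 / ?N n < rho a" using that by auto
  hence "- ?N n * rho a <= 1" using layer(2)[of "n + n0"] by (simp add: field_simps)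
  thus ?thesis by (simp add: eta_def s_def step_eq_0)
  next
  case False
  thus ?thesis by (simp add: eta_def beta0)
  qed
  ultimately show ?thesis by blast
 qed
 have mS: "(%x. ennreal (?N n * (abs (SS k. A k x * g (snd x) $ k) * abs (v x))) * indicator {y : cdom T. snd y : cball p r1 & - 2 / ?N n < rho (snd y)} x) : borel_measurable lborel" for n proof -
  let ?S = "{y : cdom T. snd y : cball p r1 & - 2 / ?N n < rho (snd y)}"
  let ?D = "(%y. snd y) -` cball p r1 :: (coord) set"
  have "open {a : ?B. - 2 / ?N n < rho a}" using continuous_open_preimage[OF crho open_ball, of "{- 2 / ?N n <..}"] by (simp add: Int_def vimage_def)
  hence o: "open (snd -` {a : ?B. - 2 / ?N n < rho a} :: (coord) set)" by (rule open_vimage) (intro continuous_intros)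
  have c: "closed ?D" by (rule closed_vimage[OF closed_cball]) (intro continuous_intros)
  have "?S = cdom T \<inter> snd -` {a : ?B. - 2 / ?N n < rho a} \<inter> ?D" using r1 by auto
  hence [measurable]: "?S : sets borel" using o c U by simp
  have [measurable]: "v : borel_fun" "A k : borel_fun" for k using L2D(1)[OF v(1)] L2D(1)[OF A(1)] by simp_all
  have "(%a. indicator ?B a *\<^sub>R g a) : borel_fun" by (rule borel_measurable_continuous_on_indicator[OF _ rho(2)]) simp
  hence [measurable]: "(%x. indicator ?B (snd x) *\<^sub>R g (snd x)) : borel_measurable (borel :: (coord) measure)" by measurable
  have "(%x. ennreal (?N n * (abs (SS k. A k x * (indicator ?B (snd x) *\<^sub>R g (snd x)) $ k) * abs (v x))) * indicator ?S x) : borel_measurable lborel" by measurable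
  also have "(%x. ennreal (?N n * (abs (SS k. A k x * (indicator ?B (snd x) *\<^sub>R g (snd x)) $ k) * abs (v x))) * indicator ?S x)
  = (%x. ennreal (?N n * (abs (SS k. A k x * g (snd x) $ k) * abs (v x))) * indicator ?S x)" using r1 by (auto simp: fun_eq_iff indicator_def)
  finally show ?thesis .
 qed
 define xi where "xi n y = hexcut (n + n0) y * eta n (snd y)" for n y
 define X where "X k n y = hexcut' (n + n0) (0, axis k 1) y * eta n (snd y) + hexcut (n + n0) y * (eta' n (snd y) $ k)" for k n y
 have "(LBINT x. ind T x * (beta (snd x) * (w x * (SS k. A k x * ?V k x) + ?v x * (SS k. A k x * W k x) + ?v x * w x * (SS k. M k x)))) = 0"
 proof (rule green_limit[where e = "%k. (0, axis k 1)" and B = Q and r = "%n. 4 * P * r n" and xi = xi and X = X and C = C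
  and I = UNIV and U = "cdom T" and A = A and M = M and V = ?V and W = W and v = ?v and w = w and xi' = "%x. beta (snd x)"])
  show "open (cdom T)" by (rule U)
  fix k :: 2 and m :: nat
  obtain L where L: "!!a b. abs (eta m a - eta m b) <= L * norm (a - b)" using etalip by blast
  obtain K where K: "compact K" "K <= T" "!!a. a ~: K ==> eta m a = 0" using etasupp by blast
  show "lip_test (cdom T) (0, axis k 1) (xi m) (X k m)" unfolding xi_def[abs_def] X_def[abs_def] proof (rule lip_test_hexcut_mult[OF L K(1,2)])
  show "eta m a = 0" if "a ~: K" for a by (rule K(3)[OF that])
  show "(%a. eta' m a $ k) : borel_fun" by measurable
  show "has_dird (snd (0, axis k 1)) (eta m) (eta' m a $ k) a" for a using has_derivative_imp_has_dird[OF etad, of "axis k 1"] by (simp add: inner_axis_1)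
  qed
 next
  show "abs (xi m x) <= Q" for m x proof -
  have "abs (beta (snd x)) * abs (s m (snd x)) <= Q * 1" by (intro mult_mono Q sb) auto
  hence "abs (hexcut (m + n0) x) * (abs (beta (snd x)) * abs (s m (snd x))) <= 1 * Q" by (intro mult_mono hexcut_bound) auto
  thus ?thesis by (simp add: xi_def eta_def abs_mult)
  qed
  show "(%m. xi m x) ----> beta (snd x)" if x: "x : cdom T" for x proof -
  have "(%m. eta m (snd x)) ----> beta (snd x)" proof (cases "snd x : ?B")
  case True
  hence "rho (snd x) < 0" using rho(3) x by (auto simp: mem_cdom_ang)
  hence "\<forall>\<^sub>F m in sequentially. 2 / layer m < - rho (snd x)" by (intro layer_eventually) simp
  hence "\<forall>\<^sub>F m in sequentially. 2 / layer (m + n0) < - rho (snd x)" by (simp only: eventually_sequentially_seg[of "%m. 2 / layer m < - rho (snd x)"])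
  hence "\<forall>\<^sub>F m in sequentially. eta m (snd x) = beta (snd x)" proof eventually_elim
  case (elim m)
  hence "2 <= - ?N m * rho (snd x)" using layer(2)[of "m + n0"] by (simp add: pos_divide_less_eq mult.commute)
  thus ?case using True by (simp add: eta_def s_def step_eq_1)
  qed
  thus ?thesis by (rule tendsto_eventually)
  next
  case False
  hence "snd x ~: ball p (2 * r1)" using r1 by auto
  thus ?thesis by (simp add: eta_def beta0)
  qed
  from tendsto_mult[OF LIMSEQ_ignore_initial_segment[OF hexcut_tendsto[OF x], of n0] this]
  show ?thesis by (simp add: xi_def)
  qed
  show "xi m : borel_fun" for m unfolding xi_def by measurable
  show "(%x::coord. beta (snd x)) : borel_fun" by (rule measurable_compose[OF m_snd mbeta(1)])
  have "(%n. 4 * P * r n) ----> 4 * P * 0" by (intro tendsto_mult tendsto_const bd(2))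
  thus "(%n. 4 * P * r n) ----> 0" by simp
  fix n
  let ?S = "{y : cdom T. snd y : cball p r1 & - 2 / ?N n < rho (snd y)}"
  let ?h = "%x. ?N n * (abs (SS k. A k x * g (snd x) $ k) * abs (v x))"
  have pt: "ennreal (abs (SS k. A k x * X k n x) * abs (?v x)) * ind T x <= ennreal (4 * P) * (ennreal (?h x) * indicator ?S x)" for x proof (cases "x : cdom T & snd x : cball p r1")
  case True
  let ?a = "snd x"
  have a: "?a : ?B" "?a : cball p r1" using True r1 by auto
  \<comment> \<open>On \<open>cball p r1\<close> the gradient of \<open>beta\<close> is 0, and
    \<open>hexcut'\<close> vanishes in the directions of the triple junction, so only the derivative
    of \<open>step\<close> remains.\<close>
  have "X k n x = hexcut (n + n0) x * (beta ?a * (- ?N n * step' (- ?N n * rho ?a) * g ?a $ k))" for k using a by (simp add: X_def hexcut'_def ang_snd eta'_def bmp'_inside[OF r1 a(2)] s'_def)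
  hence eqn: "(SS k. A k x * X k n x) = (hexcut (n + n0) x * beta ?a) * (- ?N n * step' (- ?N n * rho ?a)) * (SS k. A k x * g ?a $ k)" by (simp add: sum_2 algebra_simps)
  have eq: "abs (SS k. A k x * X k n x) = abs (hexcut (n + n0) x * beta ?a) * (?N n * step' (- ?N n * rho ?a)) * abs (SS k. A k x * g ?a $ k)"
  unfolding eqn using layer(2)[of "n + n0"] step'_bounds(1) by (simp add: abs_mult)
  have "abs (beta ?a) <= 1" using step_bounds by (simp add: beta_def bmp_def)
  hence hb: "abs (hexcut (n + n0) x * beta ?a) <= 1" by (intro prod_bounds hexcut_bound)
  show ?thesis proof (cases "- 2 / ?N n < rho ?a")
  case in_S: True
  have "abs (hexcut (n + n0) x * beta ?a) * (?N n * step' (- ?N n * rho ?a)) <= 1 * (?N n * 4)" using layer(2)[of "n + n0"] step'_bounds by (intro mult_mono hb) auto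
  hence "abs (SS k. A k x * X k n x) <= (?N n * 4) * abs (SS k. A k x * g ?a $ k)" unfolding eq by (intro mult_right_mono) auto
  hence "abs (SS k. A k x * X k n x) * abs (?v x) <= ((?N n * 4) * abs (SS k. A k x * g ?a $ k)) * (abs (v x) * P)" unfolding abs_mult[of "v x"] using P layer(2)[of "n + n0"] by (intro mult_mono) auto
  also have "... = (4 * P) * ?h x" by (simp add: mult_ac)
  finally have "ennreal (abs (SS k. A k x * X k n x) * abs (?v x)) <= ennreal ((4 * P) * ?h x)" by (rule ennreal_leI)
  thus ?thesis using True in_S P(1) by (simp add: ennreal_mult')
  next
  case False
  hence "2 <= - ?N n * rho ?a" using layer(2)[of "n + n0"] by (simp add: field_simps)
  thus ?thesis unfolding eq by (simp add: step'_eq_0)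
  qed
  next
  case False
  thus ?thesis using phi(2)[of "snd x"] by (cases "x : cdom T") auto
  qed
  have "(\<integral>\<^sup>+x\<in>cdom T. ennreal (abs (SS k. A k x * X k n x) * abs (?v x)) \<partial>lborel) <= (NN x. ennreal (4 * P) * (ennreal (?h x) * indicator ?S x))"
  by (rule nn_integral_mono) (rule pt)
  also have "... = ennreal (4 * P) * (\<integral>\<^sup>+x\<in>?S. ennreal (?h x) \<partial>lborel)" by (rule nn_integral_cmult) (use mS[of n] in measurable)
  also have "... <= ennreal (4 * P) * ennreal (r n)" by (intro mult_left_mono bd(1)) simp
  also have "... = ennreal (4 * P * r n)" using P(1) by (simp add: ennreal_mult')
  finally show "(\<integral>\<^sup>+x\<in>cdom T. ennreal (abs (SS k. A k x * X k n x) * abs (?v x)) \<partial>lborel) <= ennreal (4 * P * r n)" .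
 qed (simp_all only: A w v2 V2 wdv finite_code)
 moreover have "ind T x * (beta (snd x) * (w x * (SS k. A k x * ?V k x) + ?v x * (SS k. A k x * W k x) + ?v x * w x * (SS k. M k x)))
  = ind T x * (phi (snd x) * (w x * (SS k. A k x * V k x) + v x * (SS k. A k x * W k x) + v x * w x * (SS k. M k x)) + w x * v x * (SS k. A k x * phi' (snd x) $ k))" for x
 proof (cases "snd x : cball p r1")
  case True
  hence "beta (snd x) = 1" unfolding beta_def by (rule bmp_eq_1[OF r1])
  thus ?thesis by (simp add: sum_2 algebra_simps)
 next
  case False
  thus ?thesis by (simp add: phi(2) phi'0)
 qed
 ultimately show ?thesis by (simp only:)
qed

lemma chart_layer_measurable:
 fixes rho :: "real^2 => real"
 assumes "open T" "continuous_on (ball p (4 * r1)) rho" "r1 > 0"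
 shows "{y : cdom T. snd y : cball p r1 & c < rho (snd y)} : sets borel"
proof -
 have "open {a : ball p (4 * r1). c < rho a}" using continuous_open_preimage[OF assms(2) open_ball, of "{c <..}"] by (simp add: Int_def vimage_def)
 hence o: "open (snd -` {a : ball p (4 * r1). c < rho a} :: (coord) set)" by (rule open_vimage) (intro continuous_intros)
 have c: "closed (snd -` cball p r1 :: (coord) set)" by (rule closed_vimage[OF closed_cball]) (intro continuous_intros)
 have "{y : cdom T. snd y : cball p r1 & c < rho (snd y)} = cdom T \<inter> snd -` {a : ball p (4 * r1). c < rho a} \<inter> snd -` cball p r1" using assms(3) by auto
 thus ?thesis using o c open_cdom[OF assms(1)] by simp
qed

definition tj_frontier :: "(real^2) set => (coord) set" where
 "tj_frontier T = {y. (ALL j. abs (ang j y) < pi / 4) & snd y : frontier T}"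

text \<open>Along \<open>nu\<close> the function \<open>rho\<close> grows at speed at least
  \<open>c\<close>, so from above - c L it reaches 0 within time \<open>L\<close>. Until then it is
  negative, which keeps the ray in \<open>T\<close>.\<close>

lemma ray_to_frontier:
 fixes rho :: "real^2 => real"
 assumes T: "open T" and r1: "r1 > 0"
  and rho: "!!a. a : ball p (4 * r1) ==> (rho has_derivative (%h. g a \<bullet> h)) (at a)" "T \<inter> ball p (4 * r1) = {a : ball p (4 * r1). rho a < 0}"
  and nu: "norm nu = 1" "c > 0" "!!a. a : cball p (3 * r1) ==> c <= g a \<bullet> nu" and L: "L <= r1" "L > 0" and a: "a : T" "a : cball p r1" "- (c * L) < rho a"
 shows "\<exists>tau>0. tau <= L & a + tau *\<^sub>R nu : frontier T & rho (a + tau *\<^sub>R nu) = 0 & (ALL t. 0 <= t & t < tau --> a + t *\<^sub>R nu : T)"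
proof -
 have inb: "a + t *\<^sub>R nu : cball p (2 * r1)" if "0 <= t" "t <= L" for t proof -
  have "dist p (a + t *\<^sub>R nu) <= dist p a + norm (t *\<^sub>R nu)" using norm_triangle_ineq[of "p - a" "- (t *\<^sub>R nu)"] by (simp add: dist_norm algebra_simps)
  also have "norm (t *\<^sub>R nu) = t" using nu(1) that by simp
  finally show ?thesis using a(2) that L by simp
 qed
 have sub: "cball p (2 * r1) <= ball p (4 * r1)" "cball p (2 * r1) <= cball p (3 * r1)" using r1 by auto
 define h where "h t = rho (a + t *\<^sub>R nu)" for t
 have hd: "(h has_real_derivative g (a + t *\<^sub>R nu) \<bullet> nu) (at t)" if "0 <= t" "t <= L" for t proof -
  have "((%t::real. a + t *\<^sub>R nu) has_derivative (%s. s *\<^sub>R nu)) (at t)" by (auto intro!: derivative_eq_intros)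
  moreover have "a + t *\<^sub>R nu : ball p (4 * r1)" using inb[OF that] sub by blast
  ultimately have "((%t. rho (a + t *\<^sub>R nu)) has_derivative (%s. g (a + t *\<^sub>R nu) \<bullet> (s *\<^sub>R nu))) (at t)" using has_derivative_compose rho(1) by blast
  moreover have "(%s. g (a + t *\<^sub>R nu) \<bullet> (s *\<^sub>R nu)) = (*) (g (a + t *\<^sub>R nu) \<bullet> nu)" by (simp add: fun_eq_iff)
  ultimately show ?thesis by (simp only: h_def[abs_def] has_field_derivative_def)
 qed
 have inc: "c * (t - s) <= h t - h s" if "0 <= s" "s < t" "t <= L" for s t proof -
  have "EX z. s < z & z < t & h t - h s = (t - s) * (g (a + z *\<^sub>R nu) \<bullet> nu)" by (rule MVT2[OF that(2)]) (use hd that in auto)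
  then obtain z where z: "s < z" "z < t" "h t - h s = (t - s) * (g (a + z *\<^sub>R nu) \<bullet> nu)" by blast
  have "c <= g (a + z *\<^sub>R nu) \<bullet> nu" using nu(3) inb[of z] sub z that by auto
  hence "(t - s) * c <= (t - s) * (g (a + z *\<^sub>R nu) \<bullet> nu)" using that by (intro mult_left_mono) auto
  thus ?thesis using z(3) by (simp add: mult.commute)
 qed
 have aB: "a : ball p (4 * r1)" using a(2) r1 by auto
 hence "rho a < 0" using a(1) rho(2) by blast
 hence h0: "h 0 < 0" by (simp add: h_def)
 have "h L - h 0 >= c * L" using inc[of 0 L] L by simp
 hence hL: "h L >= 0" using a(3) by (simp add: h_def)
 have "continuous_on {0..L} h" using hd by (auto intro!: continuous_at_imp_continuous_on DERIV_isCont)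
 then obtain tau where tau: "0 <= tau" "tau <= L" "h tau = 0" using IVT'[of h 0 0 L] h0 hL L by auto
 have tau0: "tau > 0" using tau h0 by (cases "tau = 0") auto
 have inT: "a + t *\<^sub>R nu : T" if "0 <= t" "t < tau" for t proof -
  have "0 < c * (tau - t)" using nu(2) that by simp
  hence "h t < 0" using inc[of t tau] that tau by simp
  moreover have "a + t *\<^sub>R nu : ball p (4 * r1)" using inb[of t] sub that tau by auto
  ultimately show ?thesis using rho(2) unfolding h_def by blast
 qed
 have bB: "a + tau *\<^sub>R nu : ball p (4 * r1)" using inb[of tau] sub tau by auto
 have "a + tau *\<^sub>R nu ~: T" proof
  assume "a + tau *\<^sub>R nu : T"
  hence "rho (a + tau *\<^sub>R nu) < 0" using bB rho(2) by blast
  thus False using tau(3) by (simp add: h_def)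
 qed
 moreover have "a + tau *\<^sub>R nu : closure T" unfolding closure_approachable proof (intro allI impI)
  fix e :: real assume "e > 0"
  define t where "t = max 0 (tau - e / 2)"
  have t: "0 <= t" "t < tau" "tau - t < e" using \<open>e > 0\<close> tau0 by (auto simp: t_def)
  have "dist (a + t *\<^sub>R nu) (a + tau *\<^sub>R nu) = norm ((t - tau) *\<^sub>R nu)" by (simp add: dist_norm scaleR_diff_left)
  also have "... < e" using t nu(1) by simp
  finally show "\<exists>y\<in>T. dist y (a + tau *\<^sub>R nu) < e" using inT t by blast
 qed
 ultimately have "a + tau *\<^sub>R nu : frontier T" using T by (simp add: frontier_def interior_open)
 thus ?thesis using tau tau0 inT by (auto simp: h_def)
qed

text \<open>The cutoff produces the component of \<open>A\<close> along \<open>g\<close>, the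
  Neumann condition concerns the one along \<open>N\<close>. At the frontier g = |g| N; by Lipschitz
  continuity this persists at depth \<open>Ln n\<close> up to an error of that order. The component
  along \<open>N\<close> is itself of this order by the strip estimate, so both contributions absorb
  the factor layer (n + n0).\<close>

lemma boundary_layer_bound:
 fixes rho :: "real^2 => real" and A :: "2 => coord => real"
 assumes T: "open T" and r1: "r1 > 0"
  and rho: "!!a. a : ball p (4 * r1) ==> (rho has_derivative (%h. g a \<bullet> h)) (at a)" "T \<inter> ball p (4 * r1) = {a : ball p (4 * r1). rho a < 0}"
  and nu: "norm nu = 1" "c > 0" "!!a. a : cball p (3 * r1) ==> c <= g a \<bullet> nu" and n0: "2 / layer n0 <= c * r1"
  and g: "!!a b. a : cball p (3 * r1) ==> b : cball p (3 * r1) ==> norm (g a - g b) <= K * norm (a - b)" "!!a. a : cball p (3 * r1) ==> norm (g a) <= K"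
  and N: "!!b. b : frontier T ==> outer_unit_normal UNIV T b (N b)" "!!a b. a : cball p (3 * r1) ==> b : cball p (3 * r1) ==> norm (N a - N b) <= K * norm (a - b)"
  and A: "!!k. A k : L2" and v: "v : L2" and q: "(%y. SS k. A k y * N (snd y) $ k) : L2" "Q : L2" "vanishing_near (cdom T) (tj_frontier T) (0, nu) (%y. SS k. A k y * N (snd y) $ k) Q"
 shows "EX r. r ----> 0 & (ALL n. (\<integral>\<^sup>+x\<in>{y : cdom T. snd y : cball p r1 & - 2 / layer (n + n0) < rho (snd y)}.
  ennreal (layer (n + n0) * (abs (SS k. A k x * g (snd x) $ k) * abs (v x))) \<partial>lborel) <= ennreal (r n))" proof -
 let ?N = "%n. layer (n + n0)"
 define q' where "q' y = (SS k. A k y * N (snd y) $ k)" for y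
 define a1 where "a1 y = (SS k. abs (A k y))" for y
 \<comment> \<open>The time for \<open>rho\<close> to climb from -2 / layer (n + n0) to 0 at speed
   \<open>c\<close>. Multiplied by layer (n + n0) it is the constant 2 / c.\<close>
 define Ln where "Ln n = 2 / (?N n * c)" for n
 define S where "S n = {y : cdom T. snd y : cball p r1 & - 2 / ?N n < rho (snd y)}" for n
 \<comment> \<open>Rays starting in \<open>S n\<close> may leave \<open>cball p r1\<close>, but not
   this larger set, on which the derivative along the rays is measured.\<close>
 define S' where "S' = {y : cdom T. snd y : ball p (3 * r1)}"
 \<comment> \<open>The three summands bound the change of \<open>g\<close>, the size of
   \<open>g\<close> times the change of \<open>N\<close>, and the change of the norm of
   \<open>g\<close>.\<close>
 define K2 where "K2 = K + K * K + K"
 have p3: "p : cball p (3 * r1)" using r1 by simp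
 have K0: "K >= 0" using order.trans[OF norm_ge_zero g(2)[OF p3]] .
 have K20: "K2 >= 0" using K0 by (simp add: K2_def)
 have Ln: "Ln n <= r1" "Ln n > 0" "c * Ln n = 2 / ?N n" "?N n * Ln n = 2 / c" for n proof -
  have "2 / ?N n <= 2 / layer n0" by (intro divide_left_mono) (auto simp: layer_def)
  also have "... <= c * r1" by (rule n0)
  finally have "2 / ?N n <= c * r1" .
  thus "Ln n <= r1" using nu(2) layer(2)[of "n + n0"] by (simp add: Ln_def field_simps)
  show "Ln n > 0" "c * Ln n = 2 / ?N n" "?N n * Ln n = 2 / c" using nu(2) layer(2)[of "n + n0"] by (simp_all add: Ln_def field_simps)
 qed
 note U = open_cdom[OF T]
 have crho: "continuous_on (ball p (4 * r1)) rho" by (rule continuous_on_has_derivative_at[OF rho(1)])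
 have mS: "S n : sets borel" for n unfolding S_def by (rule chart_layer_measurable[OF T crho r1])
 have "open (snd -` ball p (3 * r1) :: (coord) set)" by (rule open_vimage[OF open_ball]) (intro continuous_intros)
 moreover have "S' = cdom T \<inter> snd -` ball p (3 * r1)" by (auto simp: S'_def)
 ultimately have mS': "S' : sets borel" using U by simp
 have ray: "\<exists>tau>0. tau <= Ln n & snd y + tau *\<^sub>R nu : frontier T & rho (snd y + tau *\<^sub>R nu) = 0 & (ALL t. 0 <= t & t < tau --> snd y + t *\<^sub>R nu : T)" if "y : S n" for y n
  by (rule ray_to_frontier[OF T r1 rho nu Ln(1,2)]) (use that Ln(3)[of n] in "auto simp: S_def mem_cdom_ang")
 have move: "snd y + t *\<^sub>R nu : ball p (3 * r1)" if "y : S n" "0 <= t" "t <= Ln n" for y t n proof -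
  have "dist p (snd y + t *\<^sub>R nu) <= dist p (snd y) + norm (t *\<^sub>R nu)" using norm_triangle_ineq[of "p - snd y" "- (t *\<^sub>R nu)"] by (simp add: dist_norm algebra_simps)
  also have "norm (t *\<^sub>R nu) = t" using nu(1) that by simp
  finally show ?thesis using that Ln(1)[of n] r1 by (simp add: S_def)
 qed
 have rr: "rays_reach (S n) S' (tj_frontier T) (0, nu) (Ln n)" for n unfolding rays_reach_def proof
  fix y assume y: "y : S n"
  obtain tau where tau: "tau > 0" "tau <= Ln n" "snd y + tau *\<^sub>R nu : frontier T" "!!t. 0 <= t ==> t < tau ==> snd y + t *\<^sub>R nu : T" using ray[OF y] by blast
  have an: "ang j (y + t *\<^sub>R (0, nu)) = ang j y" for j t by (simp add: linear_add[OF linear_ang] ang_snd)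
  have yU: "ALL j. abs (ang j y) < pi / 4" using y by (auto simp: S_def mem_cdom_ang)
  have "y + tau *\<^sub>R (0, nu) : tj_frontier T" unfolding tj_frontier_def mem_Collect_eq an using yU tau(3) by simp
  moreover have "y + t *\<^sub>R (0, nu) : S'" if "0 <= t" "t < tau" for t unfolding S'_def mem_Collect_eq mem_cdom_ang an using yU tau(4)[OF that] move[OF y, of t] that tau(2) by simp
  ultimately show "\<exists>s>0. s <= Ln n & y + s *\<^sub>R (0, nu) : tj_frontier T & (ALL t. 0 <= t & t < s --> y + t *\<^sub>R (0, nu) : S')" using tau(1,2) by blast
 qed
 have strip: "nrm2 (%x. indicator (S n) x * q' x) <= Ln n * nrm2 Q" for n proof -
  have "nrm2 (%x. indicator (S n) x * q' x) <= Ln n * nrm2 (%x. indicator S' x * Q x)" unfolding q'_def by (rule strip_poincare[OF U q(1,2) _ _ mS mS' Ln(2) rr q(3)]) (auto simp: S_def S'_def)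
  also have "... <= Ln n * nrm2 Q" proof (rule mult_left_mono)
  show "nrm2 (%x. indicator S' x * Q x) <= nrm2 Q" by (rule L2_norm_mono[OF q(2) L2D(1)[OF L2_indicator[OF q(2) mS']]]) (auto simp: indicator_def)
  qed (use Ln(2)[of n] in simp)
  finally show ?thesis .
 qed
 have pt: "abs (SS k. A k y * g (snd y) $ k) <= K * abs (q' y) + (K2 * Ln n) * a1 y" if y: "y : S n" for y n proof -
  let ?a = "snd y"
  obtain tau where tau: "tau > 0" "tau <= Ln n" "?a + tau *\<^sub>R nu : frontier T" "rho (?a + tau *\<^sub>R nu) = 0" using ray[OF y] by blast
  define b where "b = ?a + tau *\<^sub>R nu"
  have ab: "norm (?a - b) <= Ln n" using tau nu(1) by (simp add: b_def)
  have aB: "?a : cball p (3 * r1)" using y r1 by (auto simp: S_def)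
  have bB: "b : cball p (3 * r1)" "b : ball p (4 * r1)" using move[OF y, of tau] tau r1 by (auto simp: b_def)
  have nb: "outer_unit_normal UNIV T b (N b)" by (rule N(1)) (use tau(3) b_def in simp)
  hence Nb: "norm (N b) = 1" by (simp add: outer_unit_normal_def)
  have gb: "g b = norm (g b) *\<^sub>R N b" by (rule outer_unit_normal_gradient[OF nb open_ball bB(2) rho(2) rho(1)[OF bB(2)]]) (use tau(4) b_def in simp)
  let ?X = "g ?a - norm (g ?a) *\<^sub>R N ?a"
  have eX: "?X = (g ?a - g b) - norm (g ?a) *\<^sub>R (N ?a - N b) - (norm (g ?a) - norm (g b)) *\<^sub>R N b" by (simp add: algebra_simps gb[symmetric])
  have "norm ?X <= norm (g ?a - g b) + norm (g ?a) * norm (N ?a - N b) + abs (norm (g ?a) - norm (g b)) * norm (N b)" unfolding eX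
  using order.trans[OF norm_triangle_ineq4 add_right_mono[OF norm_triangle_ineq4], of "g ?a - g b" "norm (g ?a) *\<^sub>R (N ?a - N b)" "(norm (g ?a) - norm (g b)) *\<^sub>R N b"]
  by (simp only: norm_scaleR abs_norm_cancel)
  also have "... <= K * norm (?a - b) + K * (K * norm (?a - b)) + (K * norm (?a - b)) * 1" proof (intro add_mono mult_mono g N(2) aB bB)
  show "abs (norm (g ?a) - norm (g b)) <= K * norm (?a - b)" using order.trans[OF norm_triangle_ineq3 g(1)[OF aB bB(1)]] .
  qed (use K0 Nb in auto)
  also have "... = K2 * norm (?a - b)" by (simp add: K2_def algebra_simps)
  also have "... <= K2 * Ln n" by (rule mult_left_mono[OF ab K20])
  finally have X: "norm ?X <= K2 * Ln n" .
  have "(SS k. A k y * g ?a $ k) = norm (g ?a) * q' y + (SS k. A k y * ?X $ k)" by (simp add: q'_def sum_2 algebra_simps)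
  hence "abs (SS k. A k y * g ?a $ k) <= abs (norm (g ?a) * q' y) + abs (SS k. A k y * ?X $ k)" using abs_triangle_ineq by simp
  also have "... <= K * abs (q' y) + (K2 * Ln n) * a1 y" proof (rule add_mono)
  show "abs (norm (g ?a) * q' y) <= K * abs (q' y)" unfolding abs_mult by (intro mult_right_mono) (use g(2)[OF aB] in auto)
  have "abs (SS k. A k y * ?X $ k) <= (SS k. abs (A k y) * (K2 * Ln n))" proof (rule order.trans[OF sum_abs], rule sum_mono)
  fix k :: 2
  show "abs (A k y * ?X $ k) <= abs (A k y) * (K2 * Ln n)" unfolding abs_mult by (rule mult_left_mono[OF order.trans[OF component_le_norm_cart X]]) simp
  qed
  thus "abs (SS k. A k y * ?X $ k) <= (K2 * Ln n) * a1 y" by (simp only: a1_def sum_distrib_right[symmetric] mult.commute)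
  qed
  finally show ?thesis .
 qed
 have a12: "a1 : L2" unfolding a1_def proof (rule L2_space_sum)
  show "(%x. abs (A k x)) : L2" for k using L2D[OF A[of k]] by (auto simp: L2_space_def intro!: borel_measurable_abs)
 qed
 have q2: "q' : L2" unfolding q'_def by (rule q(1))
 define nv where "nv n = nrm2 (%x. indicator (S n) x * v x)" for n
 have nv0: "nv n >= 0" for n by (simp add: nv_def L2_norm_nonneg)
 define R where "R = K * (2 / c) * nrm2 Q + K2 * (2 / c) * nrm2 a1"
 have "(\<integral>\<^sup>+x\<in>S n. ennreal (?N n * (abs (SS k. A k x * g (snd x) $ k) * abs (v x))) \<partial>lborel) <= ennreal (R * nv n)" for n proof -
  let ?I = "%x. indicator (S n) x :: real"
  have Iq: "(%x. ?I x * q' x) : L2" and Ia: "(%x. ?I x * a1 x) : L2" and Iv: "(%x. ?I x * v x) : L2" by (intro L2_indicator mS q2 a12 v)+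
  have e: "ennreal a * ennreal b + ennreal c' * ennreal d = ennreal (a * b + c' * d)" if "0 <= a" "0 <= b" "0 <= c'" "0 <= d" for a b c' d using that by (simp add: ennreal_mult ennreal_plus)
  have Nn: "?N n >= 0" using layer(2)[of "n + n0"] by simp
  have m1: "(%x. ennreal (abs (?I x * q' x) * abs (?I x * v x))) : borel_measurable lborel" using L2D(1)[OF Iq] L2D(1)[OF Iv] by measurable
  have m2: "(%x. ennreal (abs (?I x * a1 x) * abs (?I x * v x))) : borel_measurable lborel" using L2D(1)[OF Ia] L2D(1)[OF Iv] by measurable
  have "(\<integral>\<^sup>+x\<in>S n. ennreal (?N n * (abs (SS k. A k x * g (snd x) $ k) * abs (v x))) \<partial>lborel) <= (NN x. ennreal (?N n * K) * ennreal (abs (?I x * q' x) * abs (?I x * v x))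
  + ennreal (K2 * (2 / c)) * ennreal (abs (?I x * a1 x) * abs (?I x * v x)))" proof (rule nn_integral_mono)
  fix x
  show "ennreal (?N n * (abs (SS k. A k x * g (snd x) $ k) * abs (v x))) * indicator (S n) x <= ennreal (?N n * K) * ennreal (abs (?I x * q' x) * abs (?I x * v x))
  + ennreal (K2 * (2 / c)) * ennreal (abs (?I x * a1 x) * abs (?I x * v x))" proof (cases "x : S n")
  case True
  have a10: "abs (a1 x) = a1 x" by (simp add: a1_def abs_of_nonneg sum_nonneg)
  have "?N n * (abs (SS k. A k x * g (snd x) $ k) * abs (v x)) <= ?N n * ((K * abs (q' x) + (K2 * Ln n) * a1 x) * abs (v x))" by (intro mult_left_mono mult_right_mono pt[OF True] Nn) simp
  also have "... = (?N n * K) * (abs (q' x) * abs (v x)) + (K2 * (?N n * Ln n)) * (a1 x * abs (v x))" by (simp add: algebra_simps)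
  finally have "?N n * (abs (SS k. A k x * g (snd x) $ k) * abs (v x)) <= (?N n * K) * (abs (q' x) * abs (v x)) + (K2 * (2 / c)) * (abs (a1 x) * abs (v x))" unfolding Ln(4) a10 .
  hence "ennreal (?N n * (abs (SS k. A k x * g (snd x) $ k) * abs (v x))) <= ennreal ((?N n * K) * (abs (q' x) * abs (v x)) + (K2 * (2 / c)) * (abs (a1 x) * abs (v x)))" by (rule ennreal_leI)
  also have "... = ennreal (?N n * K) * ennreal (abs (q' x) * abs (v x)) + ennreal (K2 * (2 / c)) * ennreal (abs (a1 x) * abs (v x))" by (rule e[symmetric]) (use Nn K0 K20 nu(2) in auto)
  finally have le: "ennreal (?N n * (abs (SS k. A k x * g (snd x) $ k) * abs (v x))) <= ..." .
  have I1: "?I x = 1" "indicator (S n) x = (1 :: ennreal)" using True by simp_all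
  show ?thesis unfolding I1 mult_1_left mult_1_right by (rule le)
  qed simp
  qed
  also have "... = ennreal (?N n * K) * (NN x. ennreal (abs (?I x * q' x) * abs (?I x * v x))) + ennreal (K2 * (2 / c)) * (NN x. ennreal (abs (?I x * a1 x) * abs (?I x * v x)))"
  using m1 m2 by (simp only: nn_integral_add nn_integral_cmult borel_measurable_times_ennreal borel_measurable_const)
  also have "... <= ennreal (?N n * K) * ennreal (Ln n * nrm2 Q * nv n) + ennreal (K2 * (2 / c)) * ennreal (nrm2 a1 * nv n)" proof (intro add_mono mult_left_mono)
  show "(NN x. ennreal (abs (?I x * q' x) * abs (?I x * v x))) <= ennreal (Ln n * nrm2 Q * nv n)" using nn_cauchy_schwarz[OF Iq Iv] unfolding nv_def[symmetric]
  by (rule order.trans) (intro ennreal_leI mult_right_mono strip nv0)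
  have "nrm2 (%x. ?I x * a1 x) <= nrm2 a1" by (rule L2_norm_mono[OF a12 L2D(1)[OF Ia]]) (auto simp: indicator_def)
  thus "(NN x. ennreal (abs (?I x * a1 x) * abs (?I x * v x))) <= ennreal (nrm2 a1 * nv n)"
  using order.trans[OF nn_cauchy_schwarz[OF Ia Iv, folded nv_def] ennreal_leI[OF mult_right_mono[OF _ nv0]]] by blast
  qed simp_all
  also have "... = ennreal (?N n * K * (Ln n * nrm2 Q * nv n) + K2 * (2 / c) * (nrm2 a1 * nv n))" proof -
  show ?thesis by (rule e) (use Nn K0 K20 nu(2) Ln(2)[of n] nv0[of n] L2_norm_nonneg[of lborel Q] L2_norm_nonneg[of lborel a1] in auto)
  qed
  also have "?N n * K * (Ln n * nrm2 Q * nv n) + K2 * (2 / c) * (nrm2 a1 * nv n) = R * nv n" proof -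
  have "?N n * K * (Ln n * nrm2 Q * nv n) = K * (?N n * Ln n) * nrm2 Q * nv n" by (simp add: mult_ac)
  thus ?thesis unfolding Ln(4) R_def by (simp add: algebra_simps)
  qed
  finally show ?thesis .
 qed
 moreover have "(%n. R * nv n) ----> 0" proof -
  have "nv ----> 0" unfolding nv_def[abs_def] proof (rule L2_indicator_vanish[OF v mS])
  fix y
  show "\<forall>\<^sub>F n in sequentially. y ~: S n" proof (cases "y : cdom T & snd y : cball p r1")
  case True
  hence "snd y : T \<inter> ball p (4 * r1)" using r1 by (auto simp: mem_cdom_ang)
  hence "rho (snd y) < 0" using rho(2) by blast
  hence "\<forall>\<^sub>F m in sequentially. 2 / layer m < - rho (snd y)" by (intro layer_eventually) simp
  hence "\<forall>\<^sub>F m in sequentially. 2 / layer (m + n0) < - rho (snd y)" by (simp only: eventually_sequentially_seg[of "%m. 2 / layer m < - rho (snd y)"])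
  thus ?thesis by eventually_elim (simp add: S_def)
  qed (auto simp: S_def)
  qed
  from tendsto_mult[OF tendsto_const this, of R] show ?thesis by simp
 qed
 ultimately show ?thesis unfolding S_def by (intro exI[of _ "%n. R * nv n"]) blast
qed

text \<open>Near each point of the closure a localised formula holds, with an additional term for
  the gradient of the localising function. The expression \<open>D\<close> is linear in the pair of
  function and gradient, so by compactness finitely many localised pieces account for the constant
  function 1.\<close>

lemma green_a:
 assumes T: "open T" "bounded T" "C2_boundary T"
  and A: "!!k::2. A k : L2" "!!k. M k : L2" "!!k. weak_dird (cdom T) (0, axis k 1) (A k) (M k)" and v: "v : L2" "!!k. V k : L2" "!!k. weak_dird (cdom T) (0, axis k 1) v (V k)"
  and w: "w : borel_fun" "!!k. W k : borel_fun" "!!x. x : cdom T ==> abs (w x) <= C" "!!x y. x : cdom T ==> y : cdom T ==> abs (w x - w y) <= C * norm (x - y)"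
  "!!k. AE x in lborel. x : cdom T --> has_dird (0, axis k 1) w (W k x) x" "!!k. AE x in lborel. x : cdom T --> abs (W k x) <= C"
  and N: "Ck_on 1 UNIV N" "!!b. b : frontier T ==> outer_unit_normal UNIV T b (N b)" and q: "(%y. SS k. A k y * N (snd y) $ k) : L2" "!!nu. EX Q. Q : L2
  & vanishing_near (cdom T) (tj_frontier T) (0, nu) (%y. SS k. A k y * N (snd y) $ k) Q"
 shows "(LBINT x. ind T x * (w x * (SS k. A k x * V k x) + v x * (SS k. A k x * W k x) + v x * w x * (SS k. M k x))) = 0"
proof -
 let ?F = "%x. w x * (SS k. A k x * V k x) + v x * (SS k. A k x * W k x) + v x * w x * (SS k. M k x)"
 define D where "D phi phi' x = ind T x * (phi (snd x) * ?F x + w x * v x * (SS k. A k x * phi' (snd x) $ k))" for phi :: "real^2 => real" and phi' :: "real^2 => real^2" and x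
 have local: "\<exists>r>0. ALL phi phi'. C1_bounded phi phi' --> (ALL a. a ~: cball p r --> phi a = 0) --> (LBINT x. D phi phi' x) = 0" if p: "p : closure T" for p proof (cases "p : T")
  case True
  then obtain r where r: "r > 0" "ball p r <= T" using T(1) open_contains_ball by blast
  define r1 where "r1 = r / 4"
  have r1: "r1 > 0" "4 * r1 = r" using r by (auto simp: r1_def)
  \<comment> \<open>An interior point is given the constant chart function -1 with gradient 0, so
    that its boundary term is 0.\<close>
  have "(LBINT x. D phi phi' x) = 0" if C: "C1_bounded phi phi'" "!!a. a ~: cball p r1 ==> phi a = 0" for phi phi' unfolding D_def
  proof (rule green_a_chart[where rho = "%a. - 1" and g = "%a. 0" and R = 0 and ?n0.0 = 0 and r = "%n. 0", OF T(1,2) A v w r1(1)])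
  show "((%a. - 1) has_derivative (%h. 0 \<bullet> h)) (at a)" for a using has_derivative_const[of "-1::real" "at a"] by simp
  show "T \<inter> ball p (4 * r1) = {a : ball p (4 * r1). (- 1 :: real) < 0}" using r(2) r1(2) by auto
  show "phi a = 0" if "a ~: cball p r1" for a by (rule C(2)[OF that])
  qed (use C(1) in auto)
  thus ?thesis using r1(1) by blast
 next
  case False
  hence pf: "p : frontier T" using p T(1) by (simp add: frontier_def interior_open)
  obtain r and rho :: "real^2 => real" where r: "r > 0" and rho: "Ck_on 2 (ball p r) rho" "\<forall>x\<in>ball p r. frechet_derivative rho (at x) ~= (%_. 0)"
  "T \<inter> ball p r = {x : ball p r. rho x < 0}" using T(3) pf unfolding C2_boundary_def by blast
  define g where "g a = (\<chi> k. dird (axis k 1) rho a)" for a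
  have C2: "Ck_on (Suc (Suc 0)) (ball p r) rho" using rho(1) by (simp add: numeral_2_eq_2)
  have rd: "(rho has_derivative (%h. g a \<bullet> h)) (at a)" if "a : ball p r" for a proof -
  have d: "(rho has_derivative frechet_derivative rho (at a)) (at a)" using C2 that by (simp add: frechet_derivative_works[symmetric])
  have lin: "linear (frechet_derivative rho (at a))" by (rule has_derivative_linear[OF d])
  have "frechet_derivative rho (at a) h = g a \<bullet> h" for h proof -
  have "h = (SS k. h $ k *\<^sub>R axis k 1)" by (simp add: vec_eq_iff sum_2 forall_2 axis_def)
  hence "frechet_derivative rho (at a) h = frechet_derivative rho (at a) (SS k. h $ k *\<^sub>R axis k 1)" by (rule arg_cong)
  also have "... = (SS k. h $ k * dird (axis k 1) rho a)" by (simp only: linear_sum[OF lin] linear_scale[OF lin] real_scaleR_def)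
  finally show ?thesis by (simp add: g_def inner_vec_def mult.commute)
  qed
  hence "frechet_derivative rho (at a) = (%h. g a \<bullet> h)" by (rule ext)
  thus ?thesis using d by simp
  qed
  have gk: "Ck_on 1 (ball p r) (%a. g a $ k)" for k using C2 unfolding g_def vec_lambda_beta One_nat_def Ck_on.simps(2)[of "Suc 0"] by blast
  have cg: "continuous_on (ball p r) g" proof -
  have "continuous_on (ball p r) (%a. g a $ k)" for k by (rule Ck_on_SucD[OF gk[unfolded One_nat_def], unfolded Ck_on.simps(1)])
  thus ?thesis using continuous_on_vec_lambda[of "ball p r" "%k a. g a $ k"] by simp
  qed
  have pB: "p : ball p r" using r by simp
  have gp: "g p ~= 0" proof
  assume "g p = 0"
  hence "(rho has_derivative (%h. 0)) (at p)" using rd[OF pB] by simp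
  hence "frechet_derivative rho (at p) = (%h. 0)" by (metis frechet_derivative_at)
  thus False using rho(2) pB by blast
  qed
  define nu where "nu = g p /\<^sub>R norm (g p)"
  \<comment> \<open>Half of the slope of \<open>rho\<close> at \<open>p\<close> in the direction
    \<open>nu\<close>: by continuity the slope stays above it in a neighbourhood.\<close>
  define c where "c = norm (g p) / 2"
  have nu: "norm nu = 1" and c: "c > 0" using gp by (auto simp: nu_def c_def)
  have gpn: "g p \<bullet> nu = norm (g p)" using gp by (simp add: nu_def dot_square_norm power2_eq_square)
  have "isCont (%a. g a \<bullet> nu) p" using cg pB by (intro continuous_intros) (simp add: continuous_on_eq_continuous_at)
  hence "\<forall>\<^sub>F a in at p. c < g a \<bullet> nu" unfolding isCont_def by (rule order_tendstoD(1)) (simp add: gpn c_def gp)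
  then obtain d where d: "d > 0" "!!a. a ~= p ==> dist a p < d ==> c < g a \<bullet> nu" unfolding eventually_at by blast
  define r1 where "r1 = min d r / 4"
  have r1: "r1 > 0" "4 * r1 <= r" "4 * r1 <= d" using r d(1) by (auto simp: r1_def)
  have sub: "ball p (4 * r1) <= ball p r" "cball p (3 * r1) <= ball p r" using r1 by auto
  have gc: "c <= g a \<bullet> nu" if "a : cball p (3 * r1)" for a proof (cases "a = p")
  case True
  thus ?thesis using gpn by (simp add: c_def)
  next
  case False
  thus ?thesis using d(2)[of a] that r1 by (simp add: dist_commute)
  qed
  define Lg where "Lg k = (SOME L. 0 <= L & (\<forall>x\<in>cball p (3 * r1). \<forall>y\<in>cball p (3 * r1). norm (g x $ k - g y $ k) <= L * norm (x - y)))" for k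
  have "0 <= Lg k & (\<forall>x\<in>cball p (3 * r1). \<forall>y\<in>cball p (3 * r1). norm (g x $ k - g y $ k) <= Lg k * norm (x - y))" for k
  unfolding Lg_def by (rule someI_ex, rule Ck1_lipschitz_cball[OF gk sub(2)])
  hence Lg: "Lg k >= 0" "x : cball p (3 * r1) ==> y : cball p (3 * r1) ==> abs (g x $ k - g y $ k) <= Lg k * norm (x - y)" for k x y by simp_all
  have glip: "norm (g x - g y) <= (Lg 1 + Lg 2) * norm (x - y)" if "x : cball p (3 * r1)" "y : cball p (3 * r1)" for x y proof -
  have "norm (g x - g y) <= (SS k. abs ((g x - g y) $ k))" by (rule norm_le_l1_cart)
  also have "... <= (SS k. Lg k * norm (x - y))" by (rule sum_mono) (use Lg(2)[OF that] in simp)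
  finally show ?thesis by (simp add: sum_2 algebra_simps)
  qed
  obtain LN where LN: "LN >= 0" "!!x y. x : cball p (3 * r1) ==> y : cball p (3 * r1) ==> norm (N x - N y) <= LN * norm (x - y)" using Ck1_lipschitz_cball[OF N(1) subset_UNIV] by blast
  obtain Rr where Rr: "!!x y. x : cball p (3 * r1) ==> y : cball p (3 * r1) ==> norm (rho x - rho y) <= Rr * norm (x - y)"
  using Ck1_lipschitz_cball[OF Ck_on_SucD[OF C2, folded One_nat_def] sub(2)] by blast
  have "bounded (g ` cball p (3 * r1))" by (intro compact_imp_bounded compact_continuous_image compact_cball continuous_on_subset[OF cg sub(2)])
  then obtain Gb where Gb: "\<forall>y\<in>g ` cball p (3 * r1). norm y <= Gb" unfolding bounded_iff by blast
  define K where "K = max Gb (max LN (Lg 1 + Lg 2))"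
  have Km: "Lg 1 + Lg 2 <= K" "LN <= K" "Gb <= K" by (auto simp: K_def)
  have "\<forall>\<^sub>F n in sequentially. 2 / layer n < c * r1" by (rule layer_eventually) (use c r1 in simp)
  \<comment> \<open>Starting the sequence of cutoffs at \<open>n0\<close> makes the ray time at most
    \<open>r1\<close>, so that no ray leaves the chart.\<close>
  then obtain n0 where n0: "2 / layer n0 < c * r1" using eventually_happens'[OF sequentially_bot] by blast
  obtain Q where Q: "Q : L2" "vanishing_near (cdom T) (tj_frontier T) (0, nu) (%y. SS k. A k y * N (snd y) $ k) Q" using q(2) by blast
  have rd': "(rho has_derivative (%h. g a \<bullet> h)) (at a)" if "a : ball p (4 * r1)" for a by (rule rd) (use that sub in blast)
  have rhoT: "T \<inter> ball p (4 * r1) = {x : ball p (4 * r1). rho x < 0}" using rho(3) sub(1) by blast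
  have mono: "x <= L * norm z ==> L <= K ==> x <= K * norm z" for x L and z :: "real^2" using mult_right_mono[of L K "norm z"] by simp
  have "EX r. r ----> 0 & (ALL n. (\<integral>\<^sup>+x\<in>{y : cdom T. snd y : cball p r1 & - 2 / layer (n + n0) < rho (snd y)}.
  ennreal (layer (n + n0) * (abs (SS k. A k x * g (snd x) $ k) * abs (v x))) \<partial>lborel) <= ennreal (r n))"
  proof (rule boundary_layer_bound[OF T(1) r1(1) rd' rhoT nu c gc _ _ _ N(2) _ A(1) v(1) q(1) Q])
  show "2 / layer n0 <= c * r1" using n0 by simp
  show "norm (g a - g b) <= K * norm (a - b)" if "a : cball p (3 * r1)" "b : cball p (3 * r1)" for a b by (rule mono[OF glip[OF that] Km(1)])
  show "norm (g a) <= K" if "a : cball p (3 * r1)" for a by (rule order.trans[OF bspec[OF Gb imageI[OF that]] Km(3)])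
  show "norm (N a - N b) <= K * norm (a - b)" if "a : cball p (3 * r1)" "b : cball p (3 * r1)" for a b by (rule mono[OF LN(2)[OF that] Km(2)])
  qed
  then obtain rr where rr: "rr ----> 0" "!!n. (\<integral>\<^sup>+x\<in>{y : cdom T. snd y : cball p r1 & - 2 / layer (n + n0) < rho (snd y)}.
  ennreal (layer (n + n0) * (abs (SS k. A k x * g (snd x) $ k) * abs (v x))) \<partial>lborel) <= ennreal (rr n)" by blast
  have "(LBINT x. D phi phi' x) = 0" if "C1_bounded phi phi'" "!!a. a ~: cball p r1 ==> phi a = 0" for phi phi' unfolding D_def
  proof (rule green_a_chart[OF T(1,2) A v w r1(1) rd' continuous_on_subset[OF cg sub(1)] rhoT _ rr(2,1) that])
  show "abs (rho a - rho b) <= Rr * norm (a - b)" if "a : cball p (3 * r1)" "b : cball p (3 * r1)" for a b using Rr[OF that] by simp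
  qed
  thus ?thesis using r1(1) by blast
 qed
 have Dint: "integrable lborel (D phi phi')" if C1: "C1_bounded phi phi'" for phi phi' proof -
  obtain P where P: "P >= 0" "!!a. abs (phi a) <= P" "!!a. norm (phi' a) <= P" "!!a b. abs (phi a - phi b) <= P * norm (a - b)" by (rule C1_bounded_lipschitz[OF C1]) (rule that)
  have [measurable]: "cdom T : sets borel" using open_cdom[OF T(1)] by simp
  note [measurable] = w(1,2)
  have [measurable]: "phi : borel_fun" by (rule borel_measurable_continuous_onI[OF continuous_on_has_derivative_at]) (use C1 in "auto simp: C1_bounded_def")
  have [measurable]: "phi' : borel_fun" by (rule borel_measurable_continuous_onI) (use C1 in "auto simp: C1_bounded_def")
  have 1: "AE x in lborel. abs (ind T x * w x * f x) <= abs C * P" if "!!x. abs (f x) <= P" for f proof (rule AE_I2)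
  fix x
  have "abs (ind T x * w x) <= abs C" using w(3)[of x] by (auto simp: indicator_def)
  thus "abs (ind T x * w x * f x) <= abs C * P" unfolding abs_mult[of _ "f x"] using that by (intro mult_mono) auto
  qed
  have 2: "AE x in lborel. abs (ind T x * W k x * phi (snd x)) <= abs C * P" for k using w(6)[of k] proof eventually_elim
  case (elim x)
  hence "abs (ind T x * W k x) <= abs C" by (auto simp: indicator_def)
  thus ?case unfolding abs_mult[of _ "phi (snd x)"] using P by (intro mult_mono) auto
  qed
  have nth_le: "abs (phi' a $ k) <= P" for a k by (rule order.trans[OF component_le_norm_cart P(3)])
  have "integrable lborel (%x. SS k. (A k x * V k x) * (ind T x * w x * phi (snd x)) + (v x * A k x) * (ind T x * W k x * phi (snd x)) + (v x * M k x) * (ind T x * w x * phi (snd x))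
  + (v x * A k x) * (ind T x * w x * phi' (snd x) $ k))" by (intro lintegrable_sum lintegrable_add integrable_mult_bounded[OF _ _ 1[of "%x. phi (snd x)"]] integrable_mult_bounded[OF _ _ 2]
  integrable_mult_bounded[OF _ _ 1[of "%x. phi' (snd x) $ _"]] L2_mult_integrable A v P nth_le) measurable
  thus ?thesis by (simp add: D_def[abs_def] sum_2 algebra_simps)
 qed
 have "\<forall>p\<in>closure T. \<exists>r>0. ALL phi phi'. C1_bounded phi phi' --> (ALL a. a ~: cball p r --> phi a = 0) --> (LBINT x. D phi phi' x) = 0" using local by blast
 from bchoice[OF this] obtain r where r: "!!p. p : closure T ==> r p > 0"
  "!!p phi phi'. p : closure T ==> C1_bounded phi phi' ==> (!!a. a ~: cball p (r p) ==> phi a = 0) ==> (LBINT x. D phi phi' x) = 0" by blast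
 have cT: "compact (closure T)" using T(2) by (simp add: compact_closure)
 obtain F where F: "F <= closure T" "finite F" "closure T <= (\<Union>p\<in>F. ball p (r p / 2))" proof (rule compactE_image[OF cT, of "closure T" "%p. ball p (r p / 2)"])
  show "closure T <= (\<Union>p\<in>closure T. ball p (r p / 2))" using r(1) by auto
 qed auto
 let ?b = "%p. bmp p (r p / 2)" and ?b' = "%p. bmp' p (r p / 2)"
 \<comment> \<open>From the constant 1 on, each step replaces \<open>phi\<close> by
   \<open>phi\<close> minus its product with a bump, which makes it vanish on one more ball of the
   cover. The subtracted product is supported where the local formula gives integral 0, so the
   integral never changes and no normalised partition of unity is formed.\<close>
 have "EX phi phi'. C1_bounded phi phi' & (\<forall>p\<in>G. \<forall>a\<in>ball p (r p / 2). phi a = 0)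
  & (LBINT x. D phi phi' x) = (LBINT x. D (%a. 1) (%a. 0) x)" if "finite G" "G <= closure T" for G using that proof (induction G rule: finite_induct)
  case empty
  thus ?case using C1_bounded_const by (intro exI[of _ "%a. 1"] exI[of _ "%a. 0"]) auto
 next
  case (insert p G)
  then obtain phi phi' where IH: "C1_bounded phi phi'" "\<forall>p\<in>G. \<forall>a\<in>ball p (r p / 2). phi a = 0" "(LBINT x. D phi phi' x) = (LBINT x. D (%a. 1) (%a. 0) x)" by auto
  have p: "p : closure T" "r p > 0" using insert.prems r(1) by auto
  let ?psi = "%a. phi a * ?b p a" and ?psi' = "%a. ?b p a *\<^sub>R phi' a + phi a *\<^sub>R ?b' p a"
  have Cpsi: "C1_bounded ?psi ?psi'" using p(2) by (intro C1_bounded_mult IH(1) C1_bounded_bmp) simp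
  have z: "(LBINT x. D ?psi ?psi' x) = 0" proof (rule r(2)[OF p(1) Cpsi])
  show "?psi a = 0" if "a ~: cball p (r p)" for a proof -
  have "?b p a = 0" by (rule bmp_outside(1)) (use that p(2) in auto)
  thus ?thesis by simp
  qed
  qed
  have C: "C1_bounded (%a. phi a - ?psi a) (%a. phi' a - ?psi' a)" by (rule C1_bounded_diff[OF IH(1) Cpsi])
  have "D (%a. phi a - ?psi a) (%a. phi' a - ?psi' a) = (%x. D phi phi' x - D ?psi ?psi' x)" by (rule ext) (simp add: D_def sum_2 algebra_simps)
  hence "(LBINT x. D (%a. phi a - ?psi a) (%a. phi' a - ?psi' a) x) = (LBINT x. D (%a. 1) (%a. 0) x)" using lint_diff[OF Dint[OF IH(1)] Dint[OF Cpsi]] z IH(3) by simp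
  moreover have "phi a - ?psi a = 0" if "q : insert p G" "a : ball q (r q / 2)" for q a proof (cases "q = p")
  case True
  have "?b p a = 1" by (rule bmp_eq_1) (use p(2) that True in auto)
  thus ?thesis by simp
  next
  case False
  thus ?thesis using IH(2) that by auto
  qed
  ultimately show ?case using C by blast
 qed
 from this[OF F(2,1)] obtain phi phi' where phi: "C1_bounded phi phi'" "\<forall>p\<in>F. \<forall>a\<in>ball p (r p / 2). phi a = 0"
  "(LBINT x. D phi phi' x) = (LBINT x. D (%a. 1) (%a. 0) x)" by blast
 have phi0: "phi a = 0" if "a : T" for a proof -
  have "a : closure T" using that closure_subset by blast
  then obtain p where "p : F" "a : ball p (r p / 2)" using F(3) by blast
  thus ?thesis using phi(2) by blast
 qed
 have phi'0: "phi' a = 0" if "a : T" for a proof -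
  have "(phi has_derivative (%h. phi' a \<bullet> h)) (at a)" using phi(1) by (simp add: C1_bounded_def)
  hence "((%x. 0) has_derivative (%h. phi' a \<bullet> h)) (at a)" by (rule has_derivative_transform_within_open[OF _ T(1) that]) (rule phi0)
  hence "(%h. phi' a \<bullet> h) = (%h. 0)" using has_derivative_unique has_derivative_const by blast
  hence "phi' a \<bullet> phi' a = 0" by (rule fun_cong)
  thus ?thesis by simp
 qed
 have "D phi phi' x = 0" for x by (cases "x : cdom T") (auto simp: D_def mem_cdom_ang phi0 phi'0)
 hence "(LBINT x. D (%a. 1) (%a. 0) x) = 0" using phi(3) by simp
 thus ?thesis by (simp add: D_def[abs_def])
qed

section \<open>Bounds for the Gibbs weight and comparison of the weighted and unweighted
  spaces\<close>

lemma exp_lipschitz_below: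
 fixes a b c :: real
 assumes "a <= c" "b <= c" shows "abs (exp a - exp b) <= exp c * abs (a - b)"
proof -
 have *: "exp b - exp a <= exp c * abs (a - b)" if "b <= c" for a b :: real proof -
  have "exp b - exp a = exp b * (1 - exp (a - b))" by (simp add: right_diff_distrib exp_diff)
  also have "... <= exp b * abs (a - b)" proof (rule mult_left_mono)
  show "1 - exp (a - b) <= abs (a - b)" using exp_ge_add_one_self[of "a - b"] by linarith
  qed simp
  also have "... <= exp c * abs (a - b)" using that by (intro mult_right_mono) auto
  finally show ?thesis .
 qed
 show ?thesis using *[OF assms(1), of b] *[OF assms(2), of a] unfolding abs_minus_commute[of b a] by (simp add: abs_le_iff)
qed

lemma abs_mult_diff_le:
 fixes a b c d :: real
 assumes "abs (a - c) <= p" "abs b <= q" "abs c <= r" "abs (b - d) <= s"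
 shows "abs (a * b - c * d) <= p * q + r * s"
proof -
 have "a * b - c * d = (a - c) * b + c * (b - d)" by (simp add: algebra_simps)
 hence "abs (a * b - c * d) <= abs (a - c) * abs b + abs c * abs (b - d)" using abs_triangle_ineq[of "(a - c) * b" "c * (b - d)"] by (simp add: abs_mult)
 also have "... <= p * q + r * s" by (intro add_mono mult_mono) (use assms abs_ge_zero order.trans in blast)+
 finally show ?thesis .
qed

locale gibbs_domain =
 fixes sigma :: "real => real" and x :: "3 => real^2" and D :: real and T :: "(real^2) set"
 assumes T: "open T" "bounded T" "T ~= {}" and sigma_C1: "sigma C1_differentiable_on UNIV" and D: "D > 0"
begin

abbreviation wt :: "state => real" where "wt p \<equiv> exp (- energy sigma x p / D)"

definition sigma' :: "real => real" where
 "sigma' = (SOME s. (ALL t. (sigma has_real_derivative s t) (at t)) & continuous_on UNIV s)"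

lemma sigma': "(sigma has_real_derivative sigma' t) (at t)" "continuous_on UNIV sigma'" "continuous_on UNIV sigma"
proof -
 have "EX s. (ALL t. (sigma has_real_derivative s t) (at t)) & continuous_on UNIV s" using sigma_C1 by (simp add: C1_differentiable_on_def has_real_derivative_iff_has_vector_derivative)
 from someI_ex[OF this, folded sigma'_def]
 have *: "!!t. (sigma has_real_derivative sigma' t) (at t)" "continuous_on UNIV sigma'" by auto
 show "(sigma has_real_derivative sigma' t) (at t)" "continuous_on UNIV sigma'" by (rule *)+
 show "continuous_on UNIV sigma" using * by (auto intro!: continuous_at_imp_continuous_on DERIV_isCont)
qed

definition E :: "coord => real" where
 "E y = (SS j. sigma (ang j y) * norm (snd y - x j))"

text \<open>At a node \<open>sgn\<close> has the value 0, so \<open>dE\<close> is defined everywhere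
  and stays bounded; it is the derivative of \<open>E\<close> off the nodes, hence almost
  everywhere.\<close>

definition dE :: "coord => coord => real" where
 "dE e y = (SS j. sigma' (ang j y) * ang j e * norm (snd y - x j) + sigma (ang j y) * (sgn (snd y - x j) \<bullet> snd e))"

lemma cdom_sets [measurable]: "cdom T : sets borel"
 using open_cdom[OF T(1)] by simp

lemma energy_embed: "energy sigma x (emb y) = E y"
 by (simp add: energy_def emb_def ang_def E_def)

lemma energy_has_derivative:
 assumes "snd p ~: range x"
 shows "(energy sigma x has_derivative (%h. SS j. sigma' (fst p $ j) * (fst h $ j) * norm (snd p - x j) + sigma (fst p $ j) * (sgn (snd p - x j) \<bullet> snd h))) (at p)"
proof -
 have "((%p. sigma (fst p $ j) * norm (snd p - x j)) has_derivative (%h. sigma (fst p $ j) * (sgn (snd p - x j) \<bullet> snd h) + sigma' (fst p $ j) * (fst h $ j) * norm (snd p - x j))) (at p)" for j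
 proof (rule has_derivative_mult)
  have l: "((%p. fst p $ j) has_derivative (%h. fst h $ j)) (at p)" by (intro bounded_linear_imp_has_derivative bounded_linear_compose[OF bounded_linear_vec_nth bounded_linear_fst])
  show "((%p. sigma (fst p $ j)) has_derivative (%h. sigma' (fst p $ j) * (fst h $ j))) (at p)" by (rule has_derivative_compose[OF l sigma'(1)[unfolded has_field_derivative_def]])
  have "((%p. snd p - x j) has_derivative snd) (at p)" by (auto intro!: derivative_eq_intros)
  moreover have "snd p - x j ~= 0" using assms by auto
  ultimately show "((%p. norm (snd p - x j)) has_derivative (%h. sgn (snd p - x j) \<bullet> snd h)) (at p)"
  unfolding inner_commute[of "sgn _"] by (rule has_derivative_compose[OF _ has_derivative_norm])
 qed
 hence "((%p. SS j. sigma (fst p $ j) * norm (snd p - x j)) has_derivative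
  (%h. SS j. sigma (fst p $ j) * (sgn (snd p - x j) \<bullet> snd h) + sigma' (fst p $ j) * (fst h $ j) * norm (snd p - x j))) (at p)" by (rule has_derivative_sum)
 thus ?thesis by (simp add: energy_def[abs_def] add.commute)
qed

lemma dird_energy:
 assumes "snd y ~: range x"
 shows "energy sigma x differentiable (at (emb y))" "dird (emb e) (energy sigma x) (emb y) = dE e y"
proof -
 have "snd (emb y) ~: range x" using assms by (simp add: emb_def)
 note d = energy_has_derivative[OF this]
 show "energy sigma x differentiable (at (emb y))" using d by (auto simp: differentiable_def)
 show "dird (emb e) (energy sigma x) (emb y) = dE e y" unfolding frechet_derivative_at[OF d, symmetric] by (simp add: dE_def emb_def ang_def)
qed

lemma grad_energy:
 assumes "snd y ~: range x"
 shows "tgrad (energy sigma x) (emb y) $ k = dE (cdir k, 0) y" "agrad (energy sigma x) (emb y) $ i = dE (0, axis i 1) y"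
 by (simp_all only: tgrad_nth[OF dird_energy(1)[OF assms]] agrad_nth dird_energy(2)[OF assms])

text \<open>All points over one node have the same first coordinate of the triple junction, so they
  lie in a hyperplane.\<close>

lemma AE_off_nodes: "AE y in lborel. snd (y :: coord) ~: range x"
proof -
 have "AE y in lborel. snd (y :: coord) ~= x j" for j proof -
  let ?b = "(0, axis 1 1) :: coord"
  have "?b : Basis" by (simp add: Basis_prod_def axis_in_Basis_iff)
  hence "negligible {y. y \<bullet> ?b = x j $ 1}" by (rule negligible_standard_hyperplane)
  hence "{y. y \<bullet> ?b = x j $ 1} : null_sets lebesgue" by (simp add: negligible_iff_null_sets)
  from AE_not_in[OF this] have "AE y in lborel. y ~: {y. y \<bullet> ?b = x j $ 1}" by (simp only: AE_completion_iff)
  thus ?thesis by eventually_elim (auto simp: inner_prod_def inner_axis)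
 qed
 hence "AE y in lborel. ALL j. snd (y :: coord) ~= x j" by (rule AE_all_countable[THEN iffD2, rule_format])
 thus ?thesis by eventually_elim auto
qed

definition w :: "coord => real" where "w y = exp (- E y / D)"

definition W :: "coord => coord => real" where "W e y = - (w y * dE e y / D)"

lemma w_pos: "w y > 0" by (simp add: w_def)

lemma has_dird_w:
 assumes "snd y ~: range x" shows "has_dird e w (W e y) y"
proof -
 have "((%y. energy sigma x (emb y)) has_derivative frechet_derivative (%y. energy sigma x (emb y)) (at y)) (at y)"
  using dird_embed(2)[OF dird_energy(1)[OF assms]] by (simp add: frechet_derivative_works)
 from has_derivative_imp_has_dird[OF this, of e]
 have "((%t. E (y + t *\<^sub>R e)) has_real_derivative dE e y) (at 0)" unfolding dird_embed(1)[OF dird_energy(1)[OF assms]] dird_energy(2)[OF assms] by (simp add: has_dird_def energy_embed)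
 hence "((%t. exp (- E (y + t *\<^sub>R e) / D)) has_real_derivative exp (- E (y + 0 *\<^sub>R e) / D) * (- dE e y / D)) (at 0)" by (intro DERIV_fun_exp DERIV_cdivide DERIV_minus)
 thus ?thesis by (simp add: has_dird_def w_def[abs_def] W_def w_def)
qed

lemma E_measurable [measurable]: "E : borel_fun" "dE e : borel_fun"
 "w : borel_fun" "W e : borel_fun"
proof -
 have [measurable]: "sigma : borel_fun" "sigma' : borel_fun" using sigma' by (auto intro: borel_measurable_continuous_onI)
 show 1: "E : borel_fun" "dE e : borel_fun" unfolding E_def[abs_def] dE_def[abs_def] sgn_div_norm by measurable
 note [measurable] = 1
 show 2: "w : borel_fun" unfolding w_def[abs_def] by measurable
 note [measurable] = 2
 show "W e : borel_fun" unfolding W_def[abs_def] by measurable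
qed

text \<open>The angles lie in \<open>{-1..1}\<close> and \<open>T\<close> is bounded, so one
  constant \<open>K\<close> bounds \<open>E\<close> and its derivatives. The Lipschitz bound of
  \<open>E\<close> is obtained factor by factor and not by integrating \<open>dE\<close>, because
  \<open>cdom T\<close> need not be convex and a segment may pass through a node.\<close>

lemma weight_bounds:
 "\<exists>C\<ge>1. (\<forall>y\<in>cdom T. 1 / C <= w y & w y <= C) & (\<forall>y\<in>cdom T. \<forall>z\<in>cdom T. abs (w y - w z) <= C * norm (y - z))
  & (\<forall>y\<in>cdom T. ALL e. norm e <= 1 --> abs (W e y) <= C)" proof -
 have "bounded (sigma ` {-1..1} \<union> sigma' ` {-1..1})" by (intro bounded_Un[THEN iffD2] conjI compact_imp_bounded compact_continuous_image compact_Icc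
  continuous_on_subset[OF sigma'(2)] continuous_on_subset[OF sigma'(3)]) auto
 then obtain S where S': "\<forall>v\<in>sigma ` {-1..1} \<union> sigma' ` {-1..1}. norm v <= S" unfolding bounded_iff by blast
 have S: "abs (sigma t) <= S" "abs (sigma' t) <= S" if "t : {-1..1}" for t using S' that by auto
 obtain R0 where R0: "!!a. a : T ==> norm a <= R0" using T(2) unfolding bounded_iff by blast
 define R where "R = R0 + (SS j. norm (x j))"
 have R: "norm (snd y - x j) <= R" if "y : cdom T" for y j proof -
  have "norm (snd y - x j) <= norm (snd y) + norm (x j)" by (rule norm_triangle_ineq4)
  also have "norm (x j) <= (SS j. norm (x j))" by (rule member_le_sum) auto
  finally show ?thesis using R0[of "snd y"] that by (simp add: R_def mem_cdom_ang)
 qed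
 have ai: "ang j y : {-1..1}" if "y : cdom T" for y j proof -
  have "abs (ang j y) < pi / 4" using that by (simp add: mem_cdom_ang)
  thus ?thesis using pi_less_4 by auto
 qed
 have S0: "S >= 0" using S(1)[of 0] by auto
 define K where "K = (\<Sum>j\<in>(UNIV::3 set). S * R + S)"
 show ?thesis proof (cases "cdom T = {}")
  case True
  thus ?thesis by (intro exI[of _ 1]) auto
 next
  case False
  then obtain y0 where "y0 : cdom T" by blast
  hence R00: "R >= 0" using order.trans[OF norm_ge_zero R] by blast
  have K0: "K >= 0" using S0 R00 by (simp add: K_def)
  have bE: "abs (E y) <= K" if y: "y : cdom T" for y unfolding E_def K_def proof (rule order.trans[OF sum_abs], rule sum_mono)
  fix j
  have "abs (sigma (ang j y)) * norm (snd y - x j) <= S * R" by (intro mult_mono S ai R y S0) auto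
  thus "abs (sigma (ang j y) * norm (snd y - x j)) <= S * R + S" using S0 by (simp add: abs_mult)
  qed
  have bdE: "abs (dE e y) <= K" if y: "y : cdom T" and e: "norm e <= 1" for e y unfolding dE_def K_def proof (rule order.trans[OF sum_abs], rule sum_mono)
  fix j
  have "abs (ang j e) <= 1" using ang_lipschitz[of j e 0] e linear_0[OF linear_ang, of j] by simp
  hence "abs (sigma' (ang j y)) * abs (ang j e) * norm (snd y - x j) <= S * 1 * R" using S(2)[OF ai[OF y]] R[OF y] S0 by (intro mult_mono) auto
  moreover have "abs (sgn (snd y - x j) \<bullet> snd e) <= 1" proof -
  have "abs (sgn (snd y - x j) \<bullet> snd e) <= norm (sgn (snd y - x j)) * norm (snd e)" by (rule Cauchy_Schwarz_ineq2)
  also have "... <= 1 * 1" by (intro mult_mono) (use norm_fst_snd_le(2)[of e] e in "auto simp: norm_sgn")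
  finally show ?thesis by simp
  qed
  hence "abs (sigma (ang j y)) * abs (sgn (snd y - x j) \<bullet> snd e) <= S * 1" using S(1)[OF ai[OF y]] S0 by (intro mult_mono) auto
  ultimately show "abs (sigma' (ang j y) * ang j e * norm (snd y - x j) + sigma (ang j y) * (sgn (snd y - x j) \<bullet> snd e)) <= S * R + S"
  using abs_triangle_ineq[of "sigma' (ang j y) * ang j e * norm (snd y - x j)" "sigma (ang j y) * (sgn (snd y - x j) \<bullet> snd e)"] by (simp add: abs_mult)
  qed
  have lE: "abs (E y - E z) <= K * norm (y - z)" if y: "y : cdom T" and z: "z : cdom T" for y z unfolding E_def K_def sum_subtractf[symmetric] sum_distrib_right
  proof (rule order.trans[OF sum_abs], rule sum_mono)
  fix j
  have "norm (sigma (ang j y) - sigma (ang j z)) <= S * norm (ang j y - ang j z)" by (rule field_differentiable_bound[where S = "{-1..1}"])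
  (use sigma'(1) S(2) ai y z in "auto intro: has_field_derivative_at_within")
  also have "... <= S * norm (y - z)" using ang_lipschitz[of j y z] S0 by (intro mult_left_mono) auto
  finally have 1: "abs (sigma (ang j y) - sigma (ang j z)) <= S * norm (y - z)" by simp
  have "abs (norm (snd y - x j) - norm (snd z - x j)) <= norm (snd y - x j - (snd z - x j))" by (rule norm_triangle_ineq3)
  also have "... <= norm (y - z)" using norm_fst_snd_le(2)[of "y - z"] by simp
  finally have 2: "abs (norm (snd y - x j) - norm (snd z - x j)) <= norm (y - z)" .
  have "abs (norm (snd y - x j)) <= R" using R[OF y] by simp
  from abs_mult_diff_le[OF 1 this S(1)[OF ai[OF z]] 2]
  show "abs (sigma (ang j y) * norm (snd y - x j) - sigma (ang j z) * norm (snd z - x j)) <= (S * R + S) * norm (y - z)" by (simp add: algebra_simps)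
  qed
  define C where "C = exp (K / D) + exp (K / D) * K / D"
  have eK: "exp (K / D) * K / D >= 0" "exp (K / D) >= 1" using K0 D by auto
  have C1: "C >= 1" "exp (K / D) <= C" "exp (K / D) * K / D <= C" unfolding C_def using eK by linarith+
  have up: "- E y / D <= K / D" "- (K / D) <= - E y / D" if "y : cdom T" for y using bE[OF that] D by (simp_all add: field_simps abs_le_iff)
  have wu: "w y <= exp (K / D)" if "y : cdom T" for y using up[OF that] by (simp add: w_def)
  have "1 / C <= w y" if "y : cdom T" for y proof -
  have "1 / C <= 1 / exp (K / D)" using C1 by (intro divide_left_mono) auto
  also have "... = exp (- (K / D))" by (simp add: exp_minus field_simps)
  also have "... <= w y" using up(2)[OF that] by (simp add: w_def)
  finally show ?thesis .
  qed
  moreover have "abs (w y - w z) <= C * norm (y - z)" if "y : cdom T" "z : cdom T" for y z proof -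
  have "abs (w y - w z) <= exp (K / D) * abs (- E y / D - - E z / D)" unfolding w_def by (rule exp_lipschitz_below[OF up(1)[OF that(1)] up(1)[OF that(2)]])
  also have "abs (- E y / D - - E z / D) = abs (E y - E z) / D" proof -
  have "- E y / D - - E z / D = - ((E y - E z) / D)" by (simp add: diff_divide_distrib)
  thus ?thesis using D by (simp add: abs_divide)
  qed
  also have "exp (K / D) * (abs (E y - E z) / D) <= exp (K / D) * (K * norm (y - z) / D)" using lE[OF that] D by (intro mult_left_mono divide_right_mono) auto
  also have "... = (exp (K / D) * K / D) * norm (y - z)" by simp
  also have "... <= C * norm (y - z)" by (rule mult_right_mono[OF C1(3)]) simp
  finally show ?thesis .
  qed
  moreover have "abs (W e y) <= C" if "y : cdom T" "norm e <= 1" for e y proof -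
  have "abs (W e y) = w y * abs (dE e y) / D" using D w_pos[of y] by (simp add: W_def abs_mult)
  also have "... <= exp (K / D) * K / D" using wu[OF that(1)] bdE[OF that] D by (intro divide_right_mono mult_mono) auto
  finally show ?thesis using C1(3) by linarith
  qed
  moreover have "w y <= C" if "y : cdom T" for y using wu[OF that] C1(2) by linarith
  ultimately show ?thesis using C1(1) by (intro exI[of _ C]) blast
 qed
qed

definition bnd :: real where
 "bnd = (SOME C. C >= 1 & (\<forall>y\<in>cdom T. 1 / C <= w y & w y <= C) & (\<forall>y\<in>cdom T. \<forall>z\<in>cdom T. abs (w y - w z) <= C * norm (y - z))
  & (\<forall>y\<in>cdom T. ALL e. norm e <= 1 --> abs (W e y) <= C))"

lemma bnd: "bnd >= 1" "y : cdom T ==> 1 / bnd <= w y" "y : cdom T ==> w y <= bnd"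
 "y : cdom T ==> z : cdom T ==> abs (w y - w z) <= bnd * norm (y - z)" "y : cdom T ==> norm e <= 1 ==> abs (W e y) <= bnd" using someI_ex[OF weight_bounds, folded bnd_def] by blast+

lemma w_abs: "y : cdom T ==> abs (w y) <= bnd"
 using bnd(3)[of y] w_pos[of y] by simp

lemma norm_dirs: "norm ((cdir k, 0) :: coord) <= 1" "norm ((0, axis i 1) :: coord) <= 1"
proof -
 have "(norm (cdir k))^2 = (norm (plane_isometry (cdir k)))^2" by (simp add: norm_plane_isometry)
 also have "... = (SS j. (ang j (cdir k, 0))^2)" by (simp add: norm_vec_def L2_set_def ang_def sum_nonneg)
 also have "... <= 1^2" using exhaust_3[of k] by (auto simp: ang_cdir sum_3 power2_eq_square)
 finally have "norm (cdir k) <= 1" by (rule power2_le_imp_le) simp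
 thus "norm ((cdir k, 0) :: coord) <= 1" by (simp add: norm_Pair)
 show "norm ((0, axis i 1) :: coord) <= 1" by (simp add: norm_Pair norm_axis_1)
qed

abbreviation B where "B \<equiv> base_measure T"
abbreviation m where "m \<equiv> gibbs_measure sigma x D T"

lemma L2_base: "u : L2_space B \<longleftrightarrow> pull T u : L2"
proof -
 have "pull T (%p. (u p)^2) = (%y. (pull T u y)^2)" by (auto simp: fun_eq_iff pull_def indicator_def)
 thus ?thesis by (simp add: L2_space_def measurable_base_iff[OF T(1)] integrable_base_iff(1)[OF T(1)])
qed

lemma wt_measurable [measurable]: "(%p. wt p) : borel_measurable B"
proof -
 have "pull T (%p. wt p) = (%y. ind T y * w y)" by (simp add: fun_eq_iff pull_def w_def energy_embed)
 thus ?thesis by (simp add: measurable_base_iff[OF T(1)])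
qed

lemma wt_bounds:
 assumes "p : Omega \<times> T"
 shows "wt p <= bnd" "1 / bnd <= wt p"
proof -
 have "coords p : cdom T" using assms embed_coords[OF assms] by (simp add: cdom_def)
 moreover have "w (coords p) = wt p" using energy_embed[of "coords p"] embed_coords[OF assms] by (simp add: w_def)
 ultimately show "wt p <= bnd" "1 / bnd <= wt p" using bnd(2,3)[of "coords p"] by auto
qed

lemma AE_gibbs: "(AE p in m. P p) \<longleftrightarrow> (AE p in B. P p)"
 unfolding gibbs_measure_def by (subst AE_density[OF measurable_compose[OF wt_measurable measurable_ennreal]]) simp

lemma sets_gibbs [measurable_cong]: "sets m = sets B" by (simp add: gibbs_measure_def)

lemma measurable_gibbs: "u : borel_measurable m \<longleftrightarrow> u : borel_measurable B"
 by (simp add: measurable_def gibbs_measure_def)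

lemma integral_gibbs:
 assumes "u : borel_measurable B"
 shows "integrable m u \<longleftrightarrow> integrable B (%p. wt p * u p)" "(\<integral>p. u p \<partial>m) = (\<integral>p. wt p * u p \<partial>B)" unfolding gibbs_measure_def
 by (rule integrable_real_density integral_real_density; rule wt_measurable AE_I2[OF exp_ge_zero] assms)+

text \<open>The weight lies between \<open>1 / bnd\<close> and \<open>bnd\<close>, so membership
  does not depend on it; the norms remain different, and the sharp comparison of them comes later
  with supremum and infimum.\<close>

lemma L2_gibbs: "L2_space m = L2_space B"
proof -
 have "integrable m (%p. (u p)^2) \<longleftrightarrow> integrable B (%p. (u p)^2)" if u [measurable]: "u : borel_measurable B" for u :: "state => real" proof
  have AEB: "AE p in B. p : Omega \<times> T" by (rule AE_I2) (simp add: space_base)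
  have m: "(%p. (u p)^2) : borel_measurable B" by measurable
  show "integrable B (%p. (u p)^2)" if "integrable m (%p. (u p)^2)" proof (rule lintegrable_bound[OF integrable_mult_right[of bnd, OF that[unfolded integral_gibbs(1)[OF m]]] m])
  show "AE p in B. norm ((u p)^2) <= norm (bnd * (wt p * (u p)^2))" using AEB proof eventually_elim
  case (elim p)
  let ?e = "wt p"
  have "bnd * (1 / bnd) <= bnd * ?e" using wt_bounds(2)[OF elim] bnd(1) by (intro mult_left_mono) auto
  hence "1 <= bnd * ?e" using bnd(1) by simp
  from mult_right_mono[OF this, of "(u p)^2"] have "(u p)^2 <= bnd * ?e * (u p)^2" by simp
  also have "... <= abs (bnd * (?e * (u p)^2))" unfolding mult.assoc by (rule abs_ge_self)
  finally show ?case by simp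
  qed
  qed
  show "integrable m (%p. (u p)^2)" if i: "integrable B (%p. (u p)^2)" unfolding integral_gibbs(1)[OF m] proof (rule lintegrable_bound[OF integrable_mult_right[of bnd, OF i]])
  show "AE p in B. norm (wt p * (u p)^2) <= norm (bnd * (u p)^2)" using AEB proof eventually_elim
  case (elim p)
  have "wt p * (u p)^2 <= bnd * (u p)^2" by (rule mult_right_mono[OF wt_bounds(1)[OF elim]]) simp
  thus ?case using bnd(1) by (simp add: abs_mult)
  qed
  qed measurable
 qed
 thus ?thesis by (auto simp: L2_space_def measurable_gibbs)
qed

lemma L2_iff: "u : L2_space m \<longleftrightarrow> pull T u : L2"
 by (simp add: L2_gibbs L2_base)

lemma integral_gibbs_pull:
 assumes "u : borel_measurable m"
 shows "(\<integral>p. u p \<partial>m) = (LBINT y. w y * pull T u y)"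
proof -
 have "pull T (%p. wt p * u p) = (%y. w y * pull T u y)" by (simp add: fun_eq_iff pull_def w_def energy_embed)
 thus ?thesis using assms by (simp add: measurable_gibbs integral_gibbs(2) integrable_base_iff(2)[OF T(1)])
qed

lemma norm_sq_compare:
 assumes u: "u : L2_space m"
 shows "(LBINT y. (pull T u y)^2) <= bnd * (L2_norm m u)^2" "nrm2 (pull T u) = L2_norm B u"
proof -
 have pu: "pull T u : L2" using u by (simp add: L2_iff)
 have sq: "pull T (%p. (u p)^2) = (%y. (pull T u y)^2)" by (auto simp: fun_eq_iff pull_def indicator_def)
 have mu: "(%p. (u p)^2) : borel_measurable m" using L2D(1)[OF u] by measurable
 show "nrm2 (pull T u) = L2_norm B u" by (simp add: L2_norm_def integrable_base_iff(2)[OF T(1)] sq)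
 have b: "abs (ind T y * w y) <= bnd" for y using bnd(1) w_abs[of y] by (simp add: indicator_def)
 have i: "integrable lborel (%y. (pull T u y)^2 * (ind T y * w y))" by (rule integrable_mult_bounded[OF L2D(2)[OF pu] _ AE_I2[OF b]]) simp
 have "(LBINT y. (pull T u y)^2) <= (LBINT y. bnd * ((pull T u y)^2 * (ind T y * w y)))" proof (rule integral_mono[OF L2D(2)[OF pu] integrable_mult_right[OF i]])
  fix y
  show "(pull T u y)^2 <= bnd * ((pull T u y)^2 * (ind T y * w y))" proof (cases "y : cdom T")
  case True
  have "1 <= bnd * w y" using bnd(2)[OF True] bnd(1) by (simp add: field_simps)
  from mult_right_mono[OF this, of "(pull T u y)^2"] show ?thesis using True by (simp add: mult_ac)
  qed (simp add: pull_def)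
 qed
 also have "... = bnd * (LBINT y. w y * (pull T u y)^2)" proof -
  have "(%y. bnd * ((pull T u y)^2 * (ind T y * w y))) = (%y. bnd * (w y * (pull T u y)^2))" by (simp add: pull_def indicator_def fun_eq_iff)
  thus ?thesis by (simp only: integral_mult_right_zero)
 qed
 also have "(LBINT y. w y * (pull T u y)^2) = (L2_norm m u)^2" by (simp add: L2_norm_sq integral_gibbs_pull[OF mu] sq)
 finally show "(LBINT y. (pull T u y)^2) <= bnd * (L2_norm m u)^2" .
qed

lemma finite_measure_base: "finite_measure B"
proof
 have "bounded (cdom T)" proof -
  obtain R0 where R0: "!!a. a : T ==> norm a <= R0" using T(2) unfolding bounded_iff by blast
  have "norm y <= 3 + R0" if "y : cdom T" for y proof -
  have "norm (fst y) = norm (plane_isometry (fst y))" by (simp add: norm_plane_isometry)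
  also have "... <= (SS j. abs (ang j y))" unfolding ang_def by (rule norm_le_l1_cart)
  also have "... <= (\<Sum>j\<in>(UNIV::3 set). 1)" proof (rule sum_mono)
  fix j
  have "abs (ang j y) < pi / 4" using that unfolding mem_cdom_ang by blast
  thus "abs (ang j y) <= 1" using pi_less_4 by linarith
  qed
  finally have "norm (fst y) <= 3" by simp
  thus ?thesis using norm_Pair_le[of "fst y" "snd y"] R0[of "snd y"] that by (simp add: mem_cdom_ang)
  qed
  thus ?thesis unfolding bounded_iff by blast
 qed
 hence "emeasure lborel (cdom T) < \<infinity>" by (rule emeasure_bounded_finite)
 moreover have "emeasure B (space B) = (\<integral>\<^sup>+p. 1 \<partial>B)" by simp
 moreover have "(\<integral>\<^sup>+p. 1 \<partial>B) = (\<integral>\<^sup>+y\<in>cdom T. 1 \<partial>lborel)" using nn_integral_base[OF T(1), of "%p. 1"] by simp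
 moreover have "... = emeasure lborel (cdom T)" using open_cdom[OF T(1)] by simp
 ultimately show "emeasure B (space B) ~= \<infinity>" by simp
qed

lemma L2_const: "(%p. c) : L2_space m"
 by (simp add: L2_gibbs L2_space_const finite_measure_base)

lemma finite_measure_gibbs: "finite_measure m"
proof
 have "integrable m (%p. 1 :: real)" using L2D(2)[OF L2_const[of 1]] by simp
 thus "emeasure m (space m) ~= \<infinity>" by (simp add: integrable_iff_bounded)
qed

end

section \<open>Weak gradients on the domain, outer normals of the hexagon, and vanishing traces in
  coordinates\<close>

lemma weak_dird_cong_on:
 assumes "!!y. y : U ==> u y = u' y" "!!y. y : U ==> G y = G' y"
 shows "weak_dird U e u G \<longleftrightarrow> weak_dird U e u' G'"
proof -
 have l: "loc_int U f \<longleftrightarrow> loc_int U f'" if f: "!!y. y : U ==> f y = f' y" for f f' proof -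
  have "(%x. indicator K x * f x) = (%x. indicator K x * f' x)" if "K <= U" for K using that f by (auto simp: indicator_def fun_eq_iff)
  thus ?thesis unfolding loc_int_def by (intro all_cong1 imp_cong refl arg_cong[where f = "integrable lborel"]) blast
 qed
 have t: "(%x. u x * dird e phi x) = (%x. u' x * dird e phi x)" "(%x. G x * phi x) = (%x. G' x * phi x)" if t: "test_fun U phi" for phi proof -
  obtain K where K: "compact K" "K <= U" "!!x. x ~: K ==> phi x = 0" using t by (auto simp: test_fun_def)
  have dz: "dird e phi x = 0" if "x ~: K" for x by (rule dird_zero_off_closed[OF compact_imp_closed[OF K(1)] K(3) that])
  show "(%x. u x * dird e phi x) = (%x. u' x * dird e phi x)" proof
  show "u x * dird e phi x = u' x * dird e phi x" for x using K(2) assms(1) dz by (cases "x : K") auto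
  qed
  show "(%x. G x * phi x) = (%x. G' x * phi x)" proof
  show "G x * phi x = G' x * phi x" for x using K(2,3) assms(2) by (cases "x : K") auto
  qed
 qed
 have "(ALL phi. test_fun U phi --> (LBINT x. u x * dird e phi x) = - (LBINT x. G x * phi x))
  \<longleftrightarrow> (ALL phi. test_fun U phi --> (LBINT x. u' x * dird e phi x) = - (LBINT x. G' x * phi x))" by (intro all_cong1 imp_cong refl) (simp only: t)
 thus ?thesis unfolding weak_dird_def using l[of u u'] l[of G G'] assms by simp
qed

lemma loc_int_continuous:
 assumes "continuous_on U f" shows "loc_int U f" unfolding loc_int_def using borel_integrable_compact[OF _ continuous_on_subset[OF assms]] by simp

text \<open>Along a compact exhaustion the function is a pointwise limit of integrable, hence
  measurable, functions.\<close>

lemma loc_int_measurable: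
 assumes "open U" "loc_int U f"
 shows "(%x. indicator U x * f x) : borel_fun"
proof -
 obtain C where C: "!!n. compact (C n)" "!!n. C n <= U" "!!n. C n <= interior (C (Suc n))" "\<Union>(range C) = U"
  "!!K. compact K ==> K <= U ==> EX N. \<forall>n\<ge>N. K <= C n" by (rule open_Union_compact_subsets[OF assms(1)]) (rule that)
 show ?thesis proof (rule borel_measurable_LIMSEQ_real)
  show "(%x. indicator (C n) x * f x) : borel_fun" for n using assms(2) C(1,2)[of n] unfolding loc_int_def by (auto dest: borel_measurable_integrable)
  show "(%n. indicator (C n) x * f x) ----> indicator U x * f x" for x proof (cases "x : U")
  case True
  then obtain N where N: "\<forall>n\<ge>N. {x} <= C n" using C(5)[of "{x}"] by auto
  have "\<forall>\<^sub>F n in sequentially. indicator (C n) x * f x = indicator U x * f x" using eventually_ge_at_top[of N] proof eventually_elim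
  case (elim n)
  hence "x : C n" using N by blast
  thus ?case using True by simp
  qed
  thus ?thesis by (rule tendsto_eventually)
  next
  case False
  hence "indicator (C n) x = (0::real)" for n using C(2)[of n] by (auto simp: indicator_def)
  thus ?thesis using False by simp
  qed
 qed
qed

text \<open>\<open>psi\<close> may be unbounded near the boundary of \<open>U\<close>. Its product
  with a test function is again a test function, whose directional derivative has integral
  0.\<close>

lemma weak_dird_smooth:
 assumes U: "open U" and s: "smooth_on U psi"
 shows "weak_dird U e psi (dird e psi)"
proof -
 have l: "loc_int U psi" "loc_int U (dird e psi)" by (intro loc_int_continuous smooth_on_continuous smooth_on_frechet s)+
 have "(LBINT x. psi x * dird e phi x) = - (LBINT x. dird e psi x * phi x)" if t: "test_fun U phi" for phi proof -
  let ?f = "%x. psi x * phi x"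
  have f: "test_fun U ?f" by (rule test_fun_mult_smooth[OF t U s])
  obtain K where K: "compact K" "K <= U" "!!x. x ~: K ==> phi x = 0" using t by (auto simp: test_fun_def)
  have "dird e ?f x = psi x * dird e phi x + dird e psi x * phi x" for x proof (cases "x : K")
  case True
  hence "x : U" using K(2) by blast
  from has_derivative_mult[OF smooth_on_has_derivative[OF s this] test_fun_has_derivative[OF t]]
  have "(?f has_derivative (%h. psi x * dird h phi x + dird h psi x * phi x)) (at x)" .
  from frechet_derivative_at[OF this] show ?thesis by (rule fun_cong[OF sym])
  next
  case False
  thus ?thesis using dird_zero_off_closed[OF compact_imp_closed[OF K(1)] K(3) False] dird_zero_off_closed[OF compact_imp_closed[OF K(1)], of ?f, OF _ False] K(3) by simp
  qed
  moreover have "(LBINT x. dird e ?f x) = 0" by (rule integral_lip_test_derivative[OF lip_test_of_test_fun[OF f]])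
  ultimately have "(LBINT x. psi x * dird e phi x + dird e psi x * phi x) = 0" by simp
  thus ?thesis using lint_add[OF loc_int_test_fun[OF l(1) test_fun_dird[OF t]] loc_int_test_fun[OF l(2) t]] by simp
 qed
 thus ?thesis unfolding weak_dird_def using l by blast
qed

lemma mem_Omega: "theta : Omega \<longleftrightarrow> (ALL k. abs (theta $ k) < pi / 4) & theta $ 1 + theta $ 2 + theta $ 3 = 0"
proof -
 have "- (pi / 4) < a & a < pi / 4 \<longleftrightarrow> (abs a) < pi / 4" for a :: real by linarith
 thus ?thesis unfolding Omega_def mem_Collect_eq by simp
qed

lemma inner_cdir:
 assumes "v $ 1 + v $ 2 + v $ 3 = 0" shows "v \<bullet> plane_isometry (cdir j) = v $ j"
proof -
 have "v \<bullet> plane_isometry (cdir j) = v $ j - (v $ 1 + v $ 2 + v $ 3) / 3" using exhaust_3[of j] by (auto simp: inner_vec_def sum_3 ang_cdir[unfolded ang_def, simplified] add_divide_distrib)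
 thus ?thesis using assms by simp
qed

text \<open>On the plane, taking component \<open>j\<close> is the inner product with
  \<open>plane_isometry (cdir j)\<close>, which is therefore normal to the edges of angle
  \<open>j\<close>. Its norm is sqrt (2 / 3), whence the normalising factor.\<close>

lemma edge_normal:
 assumes s: "s = 1 \<or> s = -1" and theta: "theta $ 1 + theta $ 2 + theta $ 3 = 0" "s * theta $ j = pi / 4" "!!i. i ~= j ==> abs (theta $ i) < pi / 4"
 shows "theta : rel_frontier Omega" "outer_unit_normal {w. w $ 1 + w $ 2 + w $ 3 = 0} Omega theta ((s * sqrt (3 / 2)) *\<^sub>R plane_isometry (cdir j))"
proof -
 have abs_s: "abs (s * a) = abs a" for a using s by auto
 have tj: "abs (theta $ j) = pi / 4" using abs_s[of "theta $ j"] theta(2) by simp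
 have le: "abs (theta $ k) <= pi / 4" for k using tj theta(3)[of k] by (cases "k = j") auto
 have "theta : closure Omega" unfolding closure_approachable proof (intro allI impI)
  fix e :: real assume e: "e > 0"
  \<comment> \<open>Shrinking towards 0 by the factor 1 - r moves the boundary point into
    \<open>Omega\<close>; the 1 added to the norm excludes a zero denominator.\<close>
  define r where "r = min (1 / 2) (e / (2 * (norm theta + 1)))"
  have n: "norm theta + 1 > 0" by (simp add: add_nonneg_pos)
  have r: "0 < r" "r <= 1 / 2" "r <= e / (2 * (norm theta + 1))" unfolding r_def using e n by (simp, intro min.cobounded1, intro min.cobounded2)
  have "abs (((1 - r) *\<^sub>R theta) $ k) < pi / 4" for k proof -
  have "abs (((1 - r) *\<^sub>R theta) $ k) = (1 - r) * abs (theta $ k)" using r by (simp add: abs_mult)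
  also have "... <= (1 - r) * (pi / 4)" using r le by (intro mult_left_mono) auto
  also have "... < 1 * (pi / 4)" using r by (intro mult_strict_right_mono) auto
  finally show ?thesis by simp
  qed
  moreover have "((1 - r) *\<^sub>R theta) $ 1 + ((1 - r) *\<^sub>R theta) $ 2 + ((1 - r) *\<^sub>R theta) $ 3 = (1 - r) * (theta $ 1 + theta $ 2 + theta $ 3)" by (simp add: algebra_simps)
  ultimately have "(1 - r) *\<^sub>R theta : Omega" using theta(1) by (simp add: mem_Omega)
  moreover have "dist ((1 - r) *\<^sub>R theta) theta < e" proof -
  have "(1 - r) *\<^sub>R theta - theta = - (r *\<^sub>R theta)" by (simp add: algebra_simps)
  hence "dist ((1 - r) *\<^sub>R theta) theta = r * norm theta" using r by (simp add: dist_norm)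
  also have "... <= e / (2 * (norm theta + 1)) * (norm theta + 1)" using r n by (intro mult_mono) auto
  also have "... = e / 2" using n by (simp add: field_simps)
  finally show ?thesis using e by simp
  qed
  ultimately show "\<exists>y\<in>Omega. dist y theta < e" by blast
 qed
 moreover have "theta ~: Omega" proof
  assume "theta : Omega"
  hence "abs (theta $ j) < pi / 4" unfolding mem_Omega by blast
  thus False using tj by simp
 qed
 ultimately show "theta : rel_frontier Omega" using rel_interior_subset unfolding rel_frontier_def by blast
 let ?n = "(s * sqrt (3 / 2)) *\<^sub>R plane_isometry (cdir j)"
 have inn: "v \<bullet> ?n = sqrt (3 / 2) * (s * v $ j)" if "v $ 1 + v $ 2 + v $ 3 = 0" for v using inner_cdir[OF that, of j] by simp
 show "outer_unit_normal {w. w $ 1 + w $ 2 + w $ 3 = 0} Omega theta ?n" unfolding outer_unit_normal_def proof (intro conjI ballI impI)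
  have pj: "plane_isometry (cdir j) $ 1 + plane_isometry (cdir j) $ 2 + plane_isometry (cdir j) $ 3 = 0" by (rule plane_isometry_sum)
  have "?n $ 1 + ?n $ 2 + ?n $ 3 = s * sqrt (3 / 2) * (plane_isometry (cdir j) $ 1 + plane_isometry (cdir j) $ 2 + plane_isometry (cdir j) $ 3)"
  by (simp only: vector_scaleR_component real_scaleR_def distrib_left)
  thus "?n : {w. w $ 1 + w $ 2 + w $ 3 = 0}" unfolding pj by simp
  have "(norm (plane_isometry (cdir j)))^2 = 2 / 3" unfolding power2_norm_eq_inner inner_cdir[OF pj] using ang_cdir[of j j] by (simp add: ang_def)
  from real_sqrt_unique[OF this norm_ge_zero] have "norm (plane_isometry (cdir j)) = sqrt (2 / 3)" by (rule sym)
  hence "norm ?n = abs s * (sqrt (3 / 2) * sqrt (2 / 3))" by (simp add: abs_mult)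
  also have "sqrt (3 / 2) * sqrt (2 / 3) = 1" by (simp add: real_sqrt_mult[symmetric])
  finally show "norm ?n = 1" using s by auto
 next
  fix v :: "real^3" assume v: "v : {w. w $ 1 + w $ 2 + w $ 3 = 0}" and neg: "v \<bullet> ?n < 0"
  have lt: "sqrt (3 / 2) * (s * v $ j) < 0" using inn[of v] v neg by (simp only: mem_Collect_eq)
  have neg': "s * v $ j < 0" proof (rule ccontr)
  assume "\<not> s * v $ j < 0"
  hence "0 <= s * v $ j" by linarith
  hence "0 <= sqrt (3 / 2) * (s * v $ j)" by (rule mult_nonneg_nonneg[rotated]) simp
  thus False using lt by linarith
  qed
  have tend: "((%t::real. abs (a + t * b)) \<longlongrightarrow> (abs (a + 0 * b))) (at_right 0)" for a b :: real by (intro tendsto_intros)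
  have "\<forall>\<^sub>F t in at_right 0. abs (theta $ k + t * v $ k) < pi / 4" for k proof (cases "k = j")
  case False
  thus ?thesis using theta(3)[of k] by (intro order_tendstoD(2)[OF tend]) simp
  next
  case True
  have "\<forall>\<^sub>F t in at_right 0. abs (0 + t * (s * v $ j)) < pi / 4" by (rule order_tendstoD(2)[OF tend]) simp
  thus ?thesis using eventually_at_right_less[of "0::real"] proof eventually_elim
  case (elim t)
  have "t * (s * v $ j) < 0" using neg' elim(2) by (simp add: mult_less_0_iff)
  hence "abs (pi / 4 + t * (s * v $ j)) < pi / 4" using elim(1) by linarith
  moreover have "pi / 4 + t * (s * v $ j) = s * (theta $ j + t * v $ j)" using theta(2) by (simp add: algebra_simps)
  ultimately show ?case using True abs_s by simp
  qed
  qed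
  hence "\<forall>\<^sub>F t in at_right 0. ALL k. abs (theta $ k + t * v $ k) < pi / 4" by (rule eventually_all_finite)
  thus "\<forall>\<^sub>F t in at_right 0. theta + t *\<^sub>R v : Omega" proof eventually_elim
  case (elim t)
  have "(theta + t *\<^sub>R v) $ 1 + (theta + t *\<^sub>R v) $ 2 + (theta + t *\<^sub>R v) $ 3 = (theta $ 1 + theta $ 2 + theta $ 3) + t * (v $ 1 + v $ 2 + v $ 3)" by (simp add: algebra_simps)
  thus ?case using elim v theta(1) by (simp add: mem_Omega)
  qed
 next
  fix v :: "real^3" assume v: "v : {w. w $ 1 + w $ 2 + w $ 3 = 0}" and "0 < v \<bullet> ?n"
  hence "sqrt (3 / 2) * (s * v $ j) > 0" using inn[of v] by (simp only: mem_Collect_eq)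
  hence p: "s * v $ j > 0" by (rule zero_less_mult_pos) simp
  show "\<forall>\<^sub>F t in at_right 0. theta + t *\<^sub>R v ~: Omega" using eventually_at_right_less[of "0::real"] proof eventually_elim
  case (elim t)
  have "s * (theta $ j + t * v $ j) = pi / 4 + t * (s * v $ j)" using theta(2) by (simp add: algebra_simps)
  moreover have "t * (s * v $ j) > 0" using p elim by simp
  ultimately have "abs (s * (theta $ j + t * v $ j)) > pi / 4" by simp
  hence "\<not> (abs ((theta + t *\<^sub>R v) $ j)) < pi / 4" unfolding abs_s by simp
  thus ?case unfolding mem_Omega by blast
  qed
 qed
qed

text \<open>The five directions in which derivatives are taken, in the coordinates of \<open>cdom\<close>.\<close>

definition dir :: "3 + 2 => coord" where
 "dir i = (case i of Inl k => (cdir k, 0) | Inr k => (0, axis k 1))"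

lemma dir_simps [simp]: "dir (Inl k) = (cdir k, 0)" "dir (Inr l) = (0, axis l 1)"
 by (simp_all add: dir_def)

definition wd :: "(real^2) set => (state => real) => 3 + 2 => state => real" where
 "wd T u i p = (case i of Inl k => weak_tgrad T u p $ k | Inr k => weak_agrad T u p $ k)"

lemma wd_simps [simp]: "wd T u (Inl k) = (%p. weak_tgrad T u p $ k)" "wd T u (Inr l) = (%p. weak_agrad T u p $ l)"
 by (simp_all add: wd_def fun_eq_iff)

lemma sum_dirs: "(\<Sum>i\<in>(UNIV :: (3 + 2) set). f i) = (SS k. f (Inl k)) + (SS k. f (Inr k))"
 by (simp add: UNIV_Plus_UNIV[symmetric] sum.Plus del: UNIV_Plus_UNIV)

lemma all_dirs: "(\<forall>i :: 3 + 2. P i) \<longleftrightarrow> (ALL k. P (Inl k)) & (ALL k. P (Inr k))"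
proof (intro iffI allI)
 fix i :: "3 + 2" assume "(ALL k. P (Inl k)) & (ALL k. P (Inr k))"
 thus "P i" by (cases i) auto
qed auto

text \<open>The five directions span a space of dimension four, so coefficients are not unique; the
  angles themselves are one possible choice for the first three.\<close>

definition cf :: "coord => 3 + 2 => real" where
 "cf e i = (case i of Inl k => ang k e | Inr k => snd e $ k)"

lemma dir_expand: "e = (SS i. cf e i *\<^sub>R dir i)"
proof -
 have "fst e = plane_coords (plane_isometry (fst e))" by simp
 also have "plane_isometry (fst e) = (SS k. ang k e *\<^sub>R axis k 1)" by (simp add: ang_def vec_eq_iff sum_3 forall_3 axis_def)
 also have "plane_coords ... = (SS k. ang k e *\<^sub>R cdir k)" by (simp only: linear_sum[OF linear_plane_coords] linear_scale[OF linear_plane_coords] cdir_def)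
 finally have 1: "fst e = (SS k. ang k e *\<^sub>R cdir k)" .
 have 2: "snd e = (SS k. snd e $ k *\<^sub>R axis k 1)" by (simp add: vec_eq_iff sum_2 forall_2 axis_def)
 show ?thesis by (rule prod_eqI) (simp_all add: sum_dirs cf_def fst_sum snd_sum 1[symmetric] 2[symmetric])
qed

context gibbs_domain begin

text \<open>\<open>wd\<close> picks unspecified representatives of the weak derivatives.
  \<open>W1\<close> allows an explicit candidate \<open>G\<close> instead, which
  \<open>W1_AE\<close> then identifies with \<open>wd\<close> almost everywhere.\<close>

definition W1 :: "(state => real) => (3 + 2 => state => real) => bool" where
 "W1 u G \<longleftrightarrow> (ALL i. weak_dird (cdom T) (dir i) (pull T u) (pull T (G i)))"

lemma pull_eq: "y : cdom T ==> pull T f y = f (emb y)" by (simp add: pull_def)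

lemma W1_grad:
 "has_weak_tgrad T u G ==> has_weak_agrad T u A ==> W1 u (%i p. case i of Inl k => G p $ k | Inr k => A p $ k)" "W1 u H ==> has_weak_tgrad T u (%p. vec_lambda (%k. H (Inl k) p))"
 "W1 u H ==> has_weak_agrad T u (%p. vec_lambda (%k. H (Inr k) p))"
proof -
 have c: "weak_dird (cdom T) e (pull T u) (pull T f) \<longleftrightarrow> weak_dird (cdom T) e (%y. u (emb y)) (%y. f (emb y))" for e f by (rule weak_dird_cong_on) (simp_all add: pull_eq)
 show "W1 u (%i p. case i of Inl k => G p $ k | Inr k => A p $ k)" if "has_weak_tgrad T u G" "has_weak_agrad T u A"
  using that unfolding W1_def c all_dirs has_weak_tgrad_iff[OF T(1)] has_weak_agrad_iff[OF T(1)] by simp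
 show "has_weak_tgrad T u (%p. vec_lambda (%k. H (Inl k) p))" "has_weak_agrad T u (%p. vec_lambda (%k. H (Inr k) p))" if "W1 u H"
  using that unfolding W1_def c all_dirs has_weak_tgrad_iff[OF T(1)] has_weak_agrad_iff[OF T(1)] by simp_all
qed

lemma W1_wd: "weakly_differentiable T u ==> W1 u (wd T u)"
proof -
 assume "weakly_differentiable T u"
 hence "has_weak_tgrad T u (weak_tgrad T u)" "has_weak_agrad T u (weak_agrad T u)" unfolding weakly_differentiable_def weak_tgrad_def weak_agrad_def
  by (blast intro: someI_ex[of "has_weak_tgrad T u"], blast intro: someI_ex[of "has_weak_agrad T u"])
 from W1_grad(1)[OF this] show ?thesis by (simp add: wd_def[abs_def])
qed

lemma W1_weakly_differentiable: "W1 u G ==> weakly_differentiable T u"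
 using W1_grad(2,3) unfolding weakly_differentiable_def by blast

lemma W1_AE:
 assumes "W1 u G" shows "AE p in m. ALL i. wd T u i p = G i p"
proof -
 have "AE p in m. wd T u i p = G i p" for i using weak_dird_unique[OF open_cdom[OF T(1)] W1_wd[OF W1_weakly_differentiable[OF assms], unfolded W1_def, rule_format]
  assms[unfolded W1_def, rule_format], of i] unfolding AE_gibbs AE_base_iff[OF T(1)] by eventually_elim (simp add: pull_eq)
 hence "AE p in m. (ALL k. wd T u (Inl k) p = G (Inl k) p) & (ALL k. wd T u (Inr k) p = G (Inr k) p)" by (intro AE_conjI AE_all_countable[THEN iffD2] allI)
 thus ?thesis unfolding all_dirs .
qed

lemma W1_measurable:
 assumes "W1 u G" shows "G i : borel_measurable m"
proof -
 have "loc_int (cdom T) (pull T (G i))" using assms by (simp add: W1_def weak_dird_def)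
 from loc_int_measurable[OF open_cdom[OF T(1)] this]
 have "(%y. ind T y * pull T (G i) y) : borel_fun" .
 moreover have "(%y. ind T y * pull T (G i) y) = pull T (G i)" by (auto simp: fun_eq_iff pull_def indicator_def)
 ultimately have "pull T (G i) : borel_fun" by simp
 thus ?thesis by (simp add: measurable_gibbs measurable_base_iff[OF T(1)])
qed

lemma W1_diff:
 assumes "W1 u G" "W1 v H"
 shows "W1 (%p. u p - v p) (%i p. G i p - H i p)" unfolding W1_def
proof
 fix i
 have p: "pull T (%p. f p - g p) = (%y. pull T f y + (-1) * pull T g y)" for f g by (simp add: fun_eq_iff pull_def algebra_simps)
 show "weak_dird (cdom T) (dir i) (pull T (%p. u p - v p)) (pull T (%p. G i p - H i p))" unfolding p using assms by (intro weak_dird_add weak_dird_cmult) (auto simp: W1_def)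
qed

lemma W1_smooth:
 assumes "smooth_on (cdom T) psi"
 shows "W1 (%p. psi (coords p)) (%i p. dird (dir i) psi (coords p))" unfolding W1_def
proof
 fix i
 show "weak_dird (cdom T) (dir i) (pull T (%p. psi (coords p))) (pull T (%p. dird (dir i) psi (coords p)))"
  by (rule weak_dird_cong_on[THEN iffD1, OF _ _ weak_dird_smooth[OF open_cdom[OF T(1)] assms]]) (simp_all add: pull_eq)
qed

lemma W1_const: "W1 (%p. c) (%i p. 0)"
 using W1_smooth[OF smooth_on_const[of _ c]] by (simp add: frechet_derivative_const)

lemma H1_iff: "u : H1_space T m \<longleftrightarrow> u : L2_space m & weakly_differentiable T u & (ALL i. wd T u i : L2_space m)"
 by (simp add: H1_space_def all_dirs)

lemma H1D:
 assumes "u : H1_space T m"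
 shows "u : L2_space m" "W1 u (wd T u)" "wd T u i : L2_space m" "pull T u : L2" "pull T (wd T u i) : L2" "weak_dird (cdom T) (dir i) (pull T u) (pull T (wd T u i))"
proof -
 show 1: "u : L2_space m" "W1 u (wd T u)" "wd T u i : L2_space m" using assms W1_wd by (simp_all add: H1_iff)
 show "pull T u : L2" "pull T (wd T u i) : L2" using 1 by (simp_all add: L2_iff[symmetric])
 show "weak_dird (cdom T) (dir i) (pull T u) (pull T (wd T u i))" using 1(2) by (simp add: W1_def)
qed

lemma H1_I:
 assumes "u : L2_space m" "W1 u G" "!!i. G i : L2_space m"
 shows "u : H1_space T m"
proof -
 have w: "weakly_differentiable T u" by (rule W1_weakly_differentiable[OF assms(2)])
 have "wd T u i : L2_space m" for i proof (rule L2_space_cong_AE[OF assms(3)[of i] W1_measurable[OF W1_wd[OF w]]])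
  show "AE p in m. G i p = wd T u i p" using W1_AE[OF assms(2)] by eventually_elim simp
 qed
 thus ?thesis using assms(1) w by (simp add: H1_iff)
qed

lemma H1_diff:
 assumes "u : H1_space T m" "v : H1_space T m"
 shows "(%p. u p - v p) : H1_space T m" "AE p in m. ALL i. wd T (%p. u p - v p) i p = wd T u i p - wd T v i p"
proof -
 have d: "W1 (%p. u p - v p) (%i p. wd T u i p - wd T v i p)" by (intro W1_diff H1D(2) assms)
 show "(%p. u p - v p) : H1_space T m" by (rule H1_I[OF _ d]) (intro L2_space_diff H1D assms)+
 show "AE p in m. ALL i. wd T (%p. u p - v p) i p = wd T u i p - wd T v i p" by (rule W1_AE[OF d])
qed

lemma H1_const: "(%p. c) : H1_space T m" "AE p in m. ALL i. wd T (%p. c) i p = 0"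
 by (rule H1_I[OF L2_const W1_const L2_const], rule W1_AE[OF W1_const])

lemma H1_norm_eq: "H1_norm T m u = sqrt ((L2_norm m u)^2 + (SS i. (L2_norm m (wd T u i))^2))"
 by (simp add: H1_norm_def sum_dirs add.assoc)

lemma H1_norm_ge: "L2_norm m u <= H1_norm T m u" "L2_norm m (wd T u i) <= H1_norm T m u"
proof -
 have "(L2_norm m (wd T u i))^2 <= (SS i. (L2_norm m (wd T u i))^2)" by (rule member_le_sum) auto
 hence "(L2_norm m (wd T u i))^2 <= (L2_norm m u)^2 + (SS i. (L2_norm m (wd T u i))^2)" using zero_le_power2[of "L2_norm m u"] by linarith
 thus "L2_norm m (wd T u i) <= H1_norm T m u" unfolding H1_norm_eq by (rule real_le_rsqrt)
 show "L2_norm m u <= H1_norm T m u" unfolding H1_norm_eq by (rule real_le_rsqrt) (simp add: sum_nonneg)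
qed

lemma L2_pull_le:
 assumes "u : L2_space m" shows "nrm2 (pull T u) <= sqrt bnd * L2_norm m u" using real_sqrt_le_mono[OF norm_sq_compare(1)[OF assms]] by (simp add: real_sqrt_mult L2_norm_nonneg L2_norm_def[of lborel])

text \<open>The approximation in the definition of the trace is in the weighted norm of all five
  derivatives. Up to a constant this controls the unweighted norms of the function and of its
  derivative in an arbitrary direction \<open>e\<close>, a combination of the five.\<close>

lemma zero_trace_vanishing:
 assumes z: "zero_trace T m \<Gamma> q" and B: "emb ` B0 <= \<Gamma>"
  and q': "!!y. y : cdom T ==> q' y = c * q (emb y)"
 shows "EX Q. Q : L2 & vanishing_near (cdom T) B0 e q' Q"
proof -
 have q: "q : H1_space T m" using z by (simp add: zero_trace_def)
 define Q where "Q y = c * (SS i. cf e i * pull T (wd T q i) y)" for y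
 have U: "open (cdom T)" by (rule open_cdom[OF T(1)])
 have Q2: "Q : L2" unfolding Q_def by (intro L2_space_cmult L2_space_sum H1D q)
 \<comment> \<open>\<open>sqrt bnd\<close> passes to the unweighted norm, the coefficients of
   \<open>e\<close> bound the derivative in its direction and \<open>c\<close> rescales; the last
   summand makes \<open>M\<close> positive.\<close>
 define M where "M = abs c * (1 + (SS i. abs (cf e i))) * sqrt bnd + 1"
 have s0: "(SS i. abs (cf e i)) >= 0" by (rule sum_nonneg) simp
 have M0: "M > 0" using s0 bnd(1) by (simp add: M_def add_nonneg_pos)
 have "vanishing_near (cdom T) B0 e q' Q" unfolding vanishing_near_def proof (intro allI impI)
  fix eps :: real assume "eps > 0"
  hence "eps / M > 0" using M0 by simp
  then obtain psi V where psi: "psi : H1_space T m" "smooth_on_dom T psi" "open V" "\<Gamma> <= V" "\<forall>p\<in>V \<inter> (Omega \<times> T). psi p = 0" "H1_norm T m (%p. q p - psi p) < eps / M"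
  using z unfolding zero_trace_def by blast
  let ?psi = "%y. psi (emb y)" and ?phi = "%y. c * psi (emb y)"
  have spsi: "smooth_on (cdom T) ?psi" by (rule smooth_on_dom_embed(1)[OF T(1) psi(2)])
  have ae: "AE p in m. ALL i. wd T psi i p = dird (dir i) ?psi (coords p)" proof (rule W1_AE)
  have "pull T (%p. ?psi (coords p)) = pull T psi" by (simp add: pull_def fun_eq_iff)
  thus "W1 psi (%i p. dird (dir i) ?psi (coords p))" using W1_smooth[OF spsi] by (simp add: W1_def)
  qed
  have ae': "AE y in lborel. y : cdom T --> (ALL i. pull T (wd T psi i) y = dird (dir i) ?psi y & pull T (wd T (%p. q p - psi p) i) y = pull T (wd T q i) y - dird (dir i) ?psi y)" proof -
  have "AE p in m. ALL i. wd T psi i p = dird (dir i) ?psi (coords p) & wd T (%p. q p - psi p) i p = wd T q i p - dird (dir i) ?psi (coords p)" using ae H1_diff(2)[OF q psi(1)] by eventually_elim simp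
  thus ?thesis unfolding AE_gibbs AE_base_iff[OF T(1)] by eventually_elim (simp add: pull_eq)
  qed
  have dir: "dird e ?phi y = c * (SS i. cf e i * dird (dir i) ?psi y)" if "y : cdom T" for y proof -
  note d = smooth_on_has_derivative[OF spsi that]
  have "dird e ?phi y = c * dird e ?psi y" by (rule fun_cong[OF frechet_derivative_at[OF has_derivative_mult_right[OF d], symmetric]])
  also have "dird e ?psi y = (SS i. cf e i * dird (dir i) ?psi y)" using arg_cong[OF dir_expand[of e], of "%v. dird v ?psi y"]
  by (simp only: linear_sum[OF has_derivative_linear[OF d]] linear_scale[OF has_derivative_linear[OF d]] real_scaleR_def)
  finally show ?thesis .
  qed
  have sm: "smooth_on (cdom T) ?phi" by (rule smooth_on_cmult[OF U spsi])
  have [measurable]: "cdom T : sets borel" using U by simp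
  have mD: "(%y. ind T y * dird e ?phi y) : borel_measurable lborel" using borel_measurable_continuous_on_indicator[OF _ smooth_on_continuous[OF smooth_on_frechet[OF sm]], of e] by simp
  let ?S = "%y. c * (SS i. cf e i * pull T (wd T psi i) y)"
  have aS: "AE y in lborel. ?S y = ind T y * dird e ?phi y" using ae' by eventually_elim (auto simp: indicator_def dir pull_def)
  have aR: "AE y in lborel. c * (SS i. cf e i * pull T (wd T (%p. q p - psi p) i) y) = ind T y * (Q y - dird e ?phi y)"
  using ae' by eventually_elim (auto simp: indicator_def dir pull_def Q_def right_diff_distrib sum_subtractf)
  let ?h = "H1_norm T m (%p. q p - psi p)"
  note hd = H1_diff(1)[OF q psi(1)]
  have nrm: "nrm2 (pull T f) <= sqrt bnd * ?h" if "f : L2_space m" "L2_norm m f <= ?h" for f by (rule order.trans[OF L2_pull_le[OF that(1)] mult_left_mono[OF that(2)]]) (use bnd(1) in simp)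
  have h0: "?h >= 0" using order.trans[OF L2_norm_nonneg H1_norm_ge(1)] .
  have fin: "M * ?h <= eps" using psi(6) M0 by (simp add: field_simps)
  have le1: "abs c * (sqrt bnd * ?h) <= eps" proof -
  have "abs c * sqrt bnd <= M" using mult_left_mono[of 1 "1 + (SS i. abs (cf e i))" "abs c * sqrt bnd"] s0 bnd(1) by (simp add: M_def mult_ac)
  from mult_right_mono[OF this h0] show ?thesis using fin by (simp add: mult.assoc)
  qed
  have le2: "abs c * ((SS i. abs (cf e i)) * (sqrt bnd * ?h)) <= eps" proof -
  have "abs c * (SS i. abs (cf e i)) * sqrt bnd <= M" using bnd(1) by (simp add: M_def algebra_simps)
  from mult_right_mono[OF this h0] show ?thesis using fin by (simp add: mult.assoc)
  qed
  have "(%x. ind T x * ?phi x) : L2" using L2_space_cmult[OF H1D(4)[OF psi(1)], of c] by (simp add: pull_def[abs_def] mult_ac)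
  moreover have "(%x. ind T x * dird e ?phi x) : L2" by (rule L2_space_cong_AE[OF _ mD aS]) (intro L2_space_cmult L2_space_sum H1D psi)
  moreover have "nrm2 (%x. ind T x * (q' x - ?phi x)) <= eps" proof -
  have "(%x. ind T x * (q' x - ?phi x)) = (%y. c * pull T (%p. q p - psi p) y)" by (auto simp: fun_eq_iff pull_def indicator_def q' algebra_simps)
  hence "nrm2 (%x. ind T x * (q' x - ?phi x)) = abs c * nrm2 (pull T (%p. q p - psi p))" by (simp only: L2_norm_cmult)
  also have "... <= abs c * (sqrt bnd * ?h)" by (intro mult_left_mono nrm H1D(1)[OF hd] H1_norm_ge) simp
  finally show ?thesis by (rule order.trans[OF _ le1])
  qed
  moreover have "nrm2 (%x. ind T x * (Q x - dird e ?phi x)) <= eps" proof -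
  let ?R = "%y. SS i. cf e i * pull T (wd T (%p. q p - psi p) i) y"
  have R2: "(%y. cf e i * pull T (wd T (%p. q p - psi p) i) y) : L2" for i by (intro L2_space_cmult H1D hd)
  have mR: "(%x. ind T x * (Q x - dird e ?phi x)) : borel_measurable lborel" unfolding right_diff_distrib by (rule borel_measurable_diff[OF L2D(1)[OF L2_indicator[OF Q2]] mD]) simp
  have "nrm2 (%x. ind T x * (Q x - dird e ?phi x)) = nrm2 (%y. c * ?R y)" proof (rule L2_norm_cong_AE[OF mR L2D(1)[OF L2_space_cmult[OF L2_space_sum[OF R2]]]])
  show "AE x in lborel. ind T x * (Q x - dird e ?phi x) = c * ?R x" using aR by eventually_elim (rule sym)
  qed
  also have "... = abs c * nrm2 ?R" by (rule L2_norm_cmult)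
  also have "... <= abs c * (SS i. nrm2 (%y. cf e i * pull T (wd T (%p. q p - psi p) i) y))" by (intro mult_left_mono L2_norm_sum_le R2) simp
  also have "... <= abs c * (SS i. abs (cf e i) * (sqrt bnd * ?h))" unfolding L2_norm_cmult by (intro mult_left_mono sum_mono nrm H1D(3)[OF hd] H1_norm_ge) simp_all
  finally show ?thesis using le2 by (simp only: sum_distrib_right)
  qed
  moreover have "open (emb -` V)" by (rule open_vimage[OF psi(3) continuous_on_embed])
  moreover have "B0 <= emb -` V" using order.trans[OF B psi(4)] by (simp only: image_subset_iff_subset_vimage)
  moreover have "\<forall>y\<in>(emb -` V) \<inter> cdom T. ?phi y = 0" using psi(5) by (auto simp: cdom_def)
  ultimately show "EX psi W. smooth_on (cdom T) psi & open W & B0 <= W & (\<forall>y\<in>W \<inter> cdom T. psi y = 0) & (%x. ind T x * psi x) : L2 & (%x. ind T x * dird e psi x) : L2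
  & nrm2 (%x. ind T x * (q' x - psi x)) <= eps & nrm2 (%x. ind T x * (Q x - dird e psi x)) <= eps" using sm by (intro exI[of _ ?phi] exI[of _ "emb -` V"] conjI)
 qed
 thus ?thesis using Q2 by blast
qed

end

section \<open>Green's formula for the Fokker-Planck generator\<close>

context gibbs_domain begin

definition kap :: "real => real => 3 + 2 => real" where
 "kap gamma eta i = (case i of Inl _ => 3 * gamma * D | Inr _ => eta * D)"

lemma kap_simps [simp]: "kap gamma eta (Inl k) = 3 * gamma * D" "kap gamma eta (Inr l) = eta * D"
 by (simp_all add: kap_def)

lemma fp_domainD:
 assumes "g : fp_domain sigma x D T"
 shows "g : H1_space T m" "wd T g i : H1_space T m" "neumann_theta T m g" "neumann_a T m g"
proof -
 have "g : H2_space T m" using assms by (simp add: fp_domain_def)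
 hence "g : H1_space T m" "ALL i. wd T g i : H1_space T m" by (simp_all add: H2_space_def all_dirs)
 thus "g : H1_space T m" "wd T g i : H1_space T m" by simp_all
 show "neumann_theta T m g" "neumann_a T m g" using assms by (simp_all add: fp_domain_def)
qed

lemma AE_has_dird_w: "AE y in lborel. y : cdom T --> has_dird e w (W e y) y"
 using AE_off_nodes by eventually_elim (simp add: has_dird_w)

lemma neumann_theta_vanishing:
 assumes n: "neumann_theta T m g" and s: "s = 1 \<or> s = -1"
 shows "EX Q. Q : L2 & vanishing_near (cdom T) (edge T s j) e (%y. SS k. ang j (cdir k, 0) * pull T (wd T g (Inl k)) y) Q"
proof -
 let ?n = "(s * sqrt (3 / 2)) *\<^sub>R plane_isometry (cdir j)"
 let ?\<Gamma> = "{theta : rel_frontier Omega. outer_unit_normal {w. w $ 1 + w $ 2 + w $ 3 = 0} Omega theta ?n}"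
 have ss: "s * s = 1" using s by auto
 have sub: "emb ` edge T s j <= ?\<Gamma> \<times> T" proof
  fix p assume "p : emb ` edge T s j"
  then obtain y where y: "y : edge T s j" "p = emb y" by blast
  have "plane_isometry (fst y) : ?\<Gamma>" using edge_normal[OF s plane_isometry_sum, of "fst y" j] y(1) by (simp add: edge_def ang_def)
  thus "p : ?\<Gamma> \<times> T" using y by (simp add: emb_def edge_def)
 qed
 obtain a0 where a0: "a0 : T" using T(3) by blast
 \<comment> \<open>The midpoint of the edge: angle \<open>j\<close> is s pi / 4 and the other two
   are - s pi / 8. It shows that the set of boundary points with this normal is not empty, as the
   Neumann condition requires before it says anything.\<close>
 let ?y = "((s * (3 * pi / 8)) *\<^sub>R cdir j, a0)"
 have an: "ang k ?y = s * (3 * pi / 8) * ang k (cdir j, 0)" for k by (simp add: ang_def linear_scale[OF linear_plane_isometry])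
 have "?y : edge T s j" unfolding edge_def mem_Collect_eq an using a0 s ss by (auto simp: ang_cdir abs_mult)
 hence "?\<Gamma> ~= {}" using sub by (auto simp: emb_def)
 hence z: "zero_trace T m (?\<Gamma> \<times> T) (%p. weak_tgrad T g p \<bullet> ?n)" using n unfolding neumann_theta_def Let_def by blast
 \<comment> \<open>This factor undoes the sign and the normalisation of the unit normal, so that the
   plain inner product with \<open>plane_isometry (cdir j)\<close> is recovered.\<close>
 show ?thesis proof (rule zero_trace_vanishing[OF z sub, where c = "s * sqrt (2 / 3)"])
  fix y assume y: "y : cdom T"
  have sq: "sqrt (2 / 3) * sqrt (3 / 2) = 1" by (simp add: real_sqrt_mult[symmetric])
  have "s * sqrt (2 / 3) * (weak_tgrad T g (emb y) \<bullet> ?n) = (s * s) * (sqrt (2 / 3) * sqrt (3 / 2)) * (weak_tgrad T g (emb y) \<bullet> plane_isometry (cdir j))"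
  by (simp only: inner_scaleR_right mult_ac)
  also have "... = weak_tgrad T g (emb y) \<bullet> plane_isometry (cdir j)" unfolding ss sq by simp
  also have "... = (SS k. ang j (cdir k, 0) * pull T (wd T g (Inl k)) y)" unfolding inner_vec_def proof (rule sum.cong[OF refl])
  fix k :: 3
  have "plane_isometry (cdir j) $ k = ang k (cdir j, 0)" by (simp add: ang_def)
  also have "... = ang j (cdir k, 0)" unfolding ang_cdir by auto
  finally have "plane_isometry (cdir j) $ k = ang j (cdir k, 0)" .
  thus "weak_tgrad T g (emb y) $ k \<bullet> plane_isometry (cdir j) $ k = ang j (cdir k, 0) * pull T (wd T g (Inl k)) y" using y by (simp add: pull_eq)
  qed
  finally show "(SS k. ang j (cdir k, 0) * pull T (wd T g (Inl k)) y) = s * sqrt (2 / 3) * (weak_tgrad T g (emb y) \<bullet> ?n)" by (rule sym)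
 qed
qed

lemma green_theta_H1:
 assumes g: "g : fp_domain sigma x D T" and v: "v : H1_space T m"
 shows "(LBINT y. ind T y * (w y * (SS k. pull T (wd T g (Inl k)) y * pull T (wd T v (Inl k)) y) + pull T v y * (SS k. pull T (wd T g (Inl k)) y * W (dir (Inl k)) y)
  + pull T v y * w y * (SS k. pull T (wd T (wd T g (Inl k)) (Inl k)) y))) = 0" unfolding dir_simps proof (rule green_theta[OF T(1,2), where C = bnd])
 note gD = fp_domainD[OF g]
 show "pull T (wd T g (Inl k)) : L2" "pull T (wd T (wd T g (Inl k)) (Inl k)) : L2" "pull T (wd T v (Inl k)) : L2" "pull T v : L2" for k by (rule H1D gD v)+
 show "weak_dird (cdom T) (cdir k, 0) (pull T (wd T g (Inl k))) (pull T (wd T (wd T g (Inl k)) (Inl k)))" for k using H1D(6)[OF gD(2)[of "Inl k"], of "Inl k"] unfolding dir_simps .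
 show "weak_dird (cdom T) (cdir k, 0) (pull T v) (pull T (wd T v (Inl k)))" for k using H1D(6)[OF v, of "Inl k"] unfolding dir_simps .
 show "w : borel_fun" "W (cdir k, 0) : borel_fun" for k by (rule E_measurable)+
 show "abs (w y) <= bnd" if "y : cdom T" for y by (rule w_abs[OF that])
 show "abs (w y - w z) <= bnd * norm (y - z)" if "y : cdom T" "z : cdom T" for y z by (rule bnd(4)[OF that])
 show "AE y in lborel. y : cdom T --> has_dird (cdir k, 0) w (W (cdir k, 0) y) y" for k by (rule AE_has_dird_w)
 show "AE y in lborel. y : cdom T --> abs (W (cdir k, 0) y) <= bnd" for k by (intro AE_I2 impI bnd(5) norm_dirs)
 show "EX Q. Q : L2 & vanishing_near (cdom T) (edge T s j) (s *\<^sub>R (cdir j - cdir l), 0) (%y. SS k. ang j (cdir k, 0) * pull T (wd T g (Inl k)) y) Q" if "s = 1 \<or> s = -1" for s j l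
  by (rule neumann_theta_vanishing[OF gD(3) that])
qed

lemma green_a_H1:
 assumes "C2_boundary T" and g: "g : fp_domain sigma x D T" and v: "v : H1_space T m"
 shows "(LBINT y. ind T y * (w y * (SS k. pull T (wd T g (Inr k)) y * pull T (wd T v (Inr k)) y) + pull T v y * (SS k. pull T (wd T g (Inr k)) y * W (dir (Inr k)) y)
  + pull T v y * w y * (SS k. pull T (wd T (wd T g (Inr k)) (Inr k)) y))) = 0" proof -
 note gD = fp_domainD[OF g]
 obtain N where N: "Ck_on 1 UNIV N" "\<forall>a\<in>frontier T. outer_unit_normal UNIV T a (N a)" "zero_trace T m (Omega \<times> frontier T) (%p. weak_agrad T g p \<bullet> N (snd p))"
  using gD(4) unfolding neumann_a_def by blast
 let ?q = "%y. SS k. pull T (wd T g (Inr k)) y * N (snd y) $ k"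
 have q: "?q y = 1 * (%p. weak_agrad T g p \<bullet> N (snd p)) (emb y)" if "y : cdom T" for y using that by (simp add: pull_eq inner_vec_def) (simp add: emb_def)
 have "pull T (%p. weak_agrad T g p \<bullet> N (snd p)) = ?q" by (simp add: fun_eq_iff pull_def inner_vec_def sum_2 algebra_simps) (simp add: emb_def)
 moreover have "pull T (%p. weak_agrad T g p \<bullet> N (snd p)) : L2" using N(3) unfolding zero_trace_def by (intro H1D(4)) blast
 ultimately have q2: "?q : L2" by simp
 have "emb ` tj_frontier T <= Omega \<times> frontier T" by (auto simp: tj_frontier_def emb_def mem_Omega ang_def plane_isometry_sum)
 note van = zero_trace_vanishing[OF N(3) this q]
 show ?thesis unfolding dir_simps proof (rule green_a[OF T(1,2) assms(1), where C = bnd and N = N])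
  show "pull T (wd T g (Inr k)) : L2" "pull T (wd T (wd T g (Inr k)) (Inr k)) : L2" "pull T (wd T v (Inr k)) : L2" "pull T v : L2" for k by (rule H1D gD v)+
  show "weak_dird (cdom T) (0, axis k 1) (pull T (wd T g (Inr k))) (pull T (wd T (wd T g (Inr k)) (Inr k)))" for k using H1D(6)[OF gD(2)[of "Inr k"], of "Inr k"] unfolding dir_simps .
  show "weak_dird (cdom T) (0, axis k 1) (pull T v) (pull T (wd T v (Inr k)))" for k using H1D(6)[OF v, of "Inr k"] unfolding dir_simps .
  show "w : borel_fun" "W (0, axis k 1) : borel_fun" for k by (rule E_measurable)+
  show "abs (w y) <= bnd" if "y : cdom T" for y by (rule w_abs[OF that])
  show "abs (w y - w z) <= bnd * norm (y - z)" if "y : cdom T" "z : cdom T" for y z by (rule bnd(4)[OF that])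
  show "AE y in lborel. y : cdom T --> has_dird (0, axis k 1) w (W (0, axis k 1) y) y" for k by (rule AE_has_dird_w)
  show "AE y in lborel. y : cdom T --> abs (W (0, axis k 1) y) <= bnd" for k by (intro AE_I2 impI bnd(5) norm_dirs)
  show "Ck_on 1 UNIV N" by (rule N(1))
  show "outer_unit_normal UNIV T b (N b)" if "b : frontier T" for b using N(2) that by blast
  show "?q : L2" by (rule q2)
  show "EX Q. Q : L2 & vanishing_near (cdom T) (tj_frontier T) (0, nu) ?q Q" for nu :: "real^2" by (rule van)
 qed
qed

text \<open>The divergence form of the generator: \<open>W\<close> is the derivative of the weight
  and equals - w dE / D, so \<open>kap\<close> times \<open>W\<close> reproduces the drift terms
  multiplied by \<open>w\<close>.\<close>

lemma fp_operator_weighted: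
 assumes "y : cdom T" "snd y ~: range x"
 shows "w y * fp_operator sigma x gamma eta D T g (emb y) = (SS i. kap gamma eta i * (w y * pull T (wd T (wd T g i) i) y + W (dir i) y * pull T (wd T g i) y))"
proof -
 have D0: "D ~= 0" using D by simp
 have 1: "3 * gamma * D * (w y * M + - (w y * d / D) * G) = w y * (3 * gamma * D * M - 3 * gamma * (d * G))" "eta * D * (w y * M + - (w y * d / D) * G) = w y * (eta * D * M - eta * (d * G))" for M d G
  using D0 by (simp_all add: field_simps)
 have "(SS i. kap gamma eta i * (w y * pull T (wd T (wd T g i) i) y + W (dir i) y * pull T (wd T g i) y)) = w y * ((SS k. 3 * gamma * D * weak_tgrad T (%q. weak_tgrad T g q $ k) (emb y) $ k
  - 3 * gamma * (dE (cdir k, 0) y * weak_tgrad T g (emb y) $ k)) + (SS k. eta * D * weak_agrad T (%q. weak_agrad T g q $ k) (emb y) $ k - eta * (dE (0, axis k 1) y * weak_agrad T g (emb y) $ k)))"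
  unfolding sum_dirs kap_simps pull_eq[OF assms(1)] W_def 1 wd_simps dir_simps by (simp only: sum_distrib_left[symmetric] distrib_left[symmetric])
 also have "... = w y * fp_operator sigma x gamma eta D T g (emb y)" by (simp add: fp_operator_def weak_tlaplacian_def weak_alaplacian_def inner_vec_def grad_energy[OF assms(2)]
  sum_3 sum_2 algebra_simps)
 finally show ?thesis by (rule sym)
qed

lemma integrable_pull_weight:
 assumes "integrable lborel f" "e : borel_fun" "!!y. y : cdom T ==> abs (e y) <= bnd"
 shows "integrable lborel (%y. f y * (ind T y * e y))"
proof (rule integrable_mult_bounded[OF assms(1)])
 show "(%y. ind T y * e y) : borel_measurable lborel" using assms(2) by measurable
 show "AE y in lborel. abs (ind T y * e y) <= bnd" by (rule AE_I2) (use assms(3) bnd(1) in "auto simp: indicator_def")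
qed

lemma green:
 assumes C2: "C2_boundary T" and g: "g : fp_domain sigma x D T"
  and g': "g' : L2_space m" "AE p in m. g' p = fp_operator sigma x gamma eta D T g p" and v: "v : H1_space T m"
 shows "(\<integral>p. g' p * v p \<partial>m) = - (SS i. kap gamma eta i * (\<integral>p. wd T g i p * wd T v i p \<partial>m))"
proof -
 note gD = fp_domainD[OF g]
 define G where "G i = pull T (wd T g i)" for i
 define M where "M i = pull T (wd T (wd T g i) i)" for i
 define V where "V i = pull T (wd T v i)" for i
 define u where "u = pull T v"
 have L: "G i : L2" "M i : L2" "V i : L2" "u : L2" for i unfolding G_def M_def V_def u_def by (rule H1D gD v)+
 define F where "F i y = ind T y * (w y * (G i y * V i y) + u y * (G i y * W (dir i) y) + u y * w y * M i y)" for i y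
 have nd: "norm (dir i) <= 1" for i using norm_dirs by (cases i) auto
 have iF: "integrable lborel (F i)" for i proof -
  have "integrable lborel (%y. (G i y * V i y) * (ind T y * w y) + (u y * G i y) * (ind T y * W (dir i) y) + (u y * M i y) * (ind T y * w y))"
  by (intro lintegrable_add integrable_pull_weight L2_mult_integrable L E_measurable w_abs bnd(5) nd)
  moreover have "F i = (%y. (G i y * V i y) * (ind T y * w y) + (u y * G i y) * (ind T y * W (dir i) y) + (u y * M i y) * (ind T y * w y))" by (simp add: F_def fun_eq_iff algebra_simps)
  ultimately show ?thesis by simp
 qed
 have z: "(SS k. (LBINT y. F (Inl k) y)) = 0" "(SS k. (LBINT y. F (Inr k) y)) = 0" proof -
  have "(SS k. (LBINT y. F (Inl k) y)) = (LBINT y. (SS k. F (Inl k) y))" by (rule lint_sum[symmetric]) (rule iF)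
  also have "(%y. SS k. F (Inl k) y) = (%y. ind T y * (w y * (SS k. G (Inl k) y * V (Inl k) y) + u y * (SS k. G (Inl k) y * W (dir (Inl k)) y) + u y * w y * (SS k. M (Inl k) y)))"
  by (rule ext) (simp only: F_def sum_distrib_left[symmetric] sum.distrib)
  also have "(LBINT y. ... y) = 0" unfolding G_def V_def M_def u_def by (rule green_theta_H1[OF g v])
  finally show "(SS k. (LBINT y. F (Inl k) y)) = 0" .
  have "(SS k. (LBINT y. F (Inr k) y)) = (LBINT y. (SS k. F (Inr k) y))" by (rule lint_sum[symmetric]) (rule iF)
  also have "(%y. SS k. F (Inr k) y) = (%y. ind T y * (w y * (SS k. G (Inr k) y * V (Inr k) y) + u y * (SS k. G (Inr k) y * W (dir (Inr k)) y) + u y * w y * (SS k. M (Inr k) y)))"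
  by (rule ext) (simp only: F_def sum_distrib_left[symmetric] sum.distrib)
  also have "(LBINT y. ... y) = 0" unfolding G_def V_def M_def u_def by (rule green_a_H1[OF C2 g v])
  finally show "(SS k. (LBINT y. F (Inr k) y)) = 0" .
 qed
 have "(LBINT y. (SS i. kap gamma eta i * F i y)) = (SS i. kap gamma eta i * (LBINT y. F i y))" using iF by (subst lint_sum) simp_all
 also have "... = 0" unfolding sum_dirs kap_simps sum_distrib_left[symmetric] z by simp
 finally have zero: "(LBINT y. (SS i. kap gamma eta i * F i y)) = 0" .
 define P where "P y = w y * pull T (%p. g' p * v p) y" for y
 define R where "R i y = w y * pull T (%p. wd T g i p * wd T v i p) y" for i y
 have g'2: "pull T g' : L2" using g'(1) by (simp add: L2_iff)
 have iP: "integrable lborel P" proof -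
  have "integrable lborel (%y. (pull T g' y * u y) * (ind T y * w y))" by (intro integrable_pull_weight L2_mult_integrable L g'2 E_measurable w_abs)
  moreover have "P = (%y. (pull T g' y * u y) * (ind T y * w y))" by (auto simp: fun_eq_iff P_def u_def pull_def indicator_def)
  ultimately show ?thesis by simp
 qed
 have iR: "integrable lborel (R i)" for i proof -
  have "integrable lborel (%y. (G i y * V i y) * (ind T y * w y))" by (intro integrable_pull_weight L2_mult_integrable L E_measurable w_abs)
  moreover have "R i = (%y. (G i y * V i y) * (ind T y * w y))" by (auto simp: fun_eq_iff R_def G_def V_def pull_def indicator_def)
  ultimately show ?thesis by simp
 qed
 \<comment> \<open>In \<open>F\<close> the terms with \<open>W\<close> and with second derivatives
   add up to \<open>w\<close> times the operator, that is, to \<open>w\<close> times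
   \<open>g'\<close>; the remaining terms form the bilinear form \<open>R\<close>.\<close>
 have ae: "AE y in lborel. (SS i. kap gamma eta i * F i y) = P y + (SS i. kap gamma eta i * R i y)" using AE_off_nodes g'(2)[unfolded AE_gibbs AE_base_iff[OF T(1)]] proof eventually_elim
  case (elim y)
  show ?case proof (cases "y : cdom T")
  case True
  have "P y = u y * (w y * fp_operator sigma x gamma eta D T g (emb y))" using True elim(2) by (simp add: P_def u_def pull_eq)
  also have "... = (SS i. kap gamma eta i * (u y * (w y * M i y + W (dir i) y * G i y)))" unfolding fp_operator_weighted[OF True elim(1)] M_def[symmetric] G_def[symmetric] sum_distrib_left
  by (intro sum.cong refl mult.left_commute)
  finally have "P y + (SS i. kap gamma eta i * R i y) = (SS i. kap gamma eta i * (u y * (w y * M i y + W (dir i) y * G i y)) + kap gamma eta i * R i y)" by (simp only: sum.distrib)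
  also have "... = (SS i. kap gamma eta i * F i y)" proof (rule sum.cong[OF refl])
  fix i
  have "R i y = w y * (G i y * V i y)" using True by (simp add: R_def G_def V_def pull_eq)
  thus "kap gamma eta i * (u y * (w y * M i y + W (dir i) y * G i y)) + kap gamma eta i * R i y = kap gamma eta i * F i y" using True by (simp add: F_def algebra_simps)
  qed
  finally show ?thesis by (rule sym)
  next
  case False
  thus ?thesis by (simp add: F_def P_def R_def pull_def)
  qed
 qed
 have "(LBINT y. P y + (SS i. kap gamma eta i * R i y)) = 0" proof -
  have m1: "(%y. SS i. kap gamma eta i * F i y) : borel_measurable lborel" "(%y. P y + (SS i. kap gamma eta i * R i y)) : borel_measurable lborel"
  using iF iP iR by (auto intro!: borel_measurable_integrable)
  show ?thesis using integral_cong_AE[OF m1 ae] zero by simp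
 qed
 hence "(LBINT y. P y) + (SS i. kap gamma eta i * (LBINT y. R i y)) = 0" using iP iR by (simp add: lint_add lint_sum)
 moreover have "(\<integral>p. g' p * v p \<partial>m) = (LBINT y. P y)" unfolding P_def by (rule integral_gibbs_pull) (intro borel_measurable_times L2D(1) g' H1D(1) v)
 moreover have "(\<integral>p. wd T g i p * wd T v i p \<partial>m) = (LBINT y. R i y)" for i unfolding R_def by (rule integral_gibbs_pull) (intro borel_measurable_times L2D(1) H1D(3) gD v)
 ultimately show ?thesis by simp
qed

section \<open>Weighted Poincare inequality, and the energy of the difference to the
  equilibrium\<close>

lemma norm_compare:
 assumes u: "u : L2_space m"
 shows "(!!p. p : Omega \<times> T ==> wt p <= S) ==> (L2_norm m u)^2 <= S * (L2_norm B u)^2" "(!!p. p : Omega \<times> T ==> s <= wt p) ==> s * (L2_norm B u)^2 <= (L2_norm m u)^2"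
proof -
 have i: "integrable B (%p. (u p)^2)" using L2D(2)[of u B] u by (simp add: L2_gibbs)
 have mu: "(%p. (u p)^2) : borel_measurable B" using i by (rule borel_measurable_integrable)
 have i': "integrable B (%p. wt p * (u p)^2)" using L2D(2)[OF u] unfolding integral_gibbs(1)[OF mu] .
 have e: "(L2_norm m u)^2 = (\<integral>p. wt p * (u p)^2 \<partial>B)" by (simp only: L2_norm_sq integral_gibbs(2)[OF mu])
 show "(L2_norm m u)^2 <= S * (L2_norm B u)^2" if b: "!!p. p : Omega \<times> T ==> wt p <= S" unfolding e L2_norm_sq[of B] integral_mult_right_zero[symmetric]
  by (rule integral_mono[OF i' integrable_mult_right[OF i]]) (use b in "auto simp: space_base intro!: mult_right_mono")
 show "s * (L2_norm B u)^2 <= (L2_norm m u)^2" if b: "!!p. p : Omega \<times> T ==> s <= wt p" unfolding e L2_norm_sq[of B] integral_mult_right_zero[symmetric]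
  by (rule integral_mono[OF integrable_mult_right[OF i] i']) (use b in "auto simp: space_base intro!: mult_right_mono")
qed

lemma L2_approx:
 assumes c: "continuous_on (cdom T) psi" and u: "u : L2_space B"
  and le: "(\<integral>\<^sup>+y\<in>cdom T. ennreal ((psi y - pull T u y)^2) \<partial>lborel) <= ennreal (delta^2)" and delta: "delta >= 0"
 shows "(%p. psi (coords p)) : L2_space B" "L2_norm B (%p. psi (coords p) - u p) <= delta" "L2_norm B (%p. psi (coords p)) <= L2_norm B u + delta"
proof -
 have m1: "(%p. psi (coords p)) : borel_measurable B" using loc_int_measurable[OF open_cdom[OF T(1)] loc_int_continuous[OF c]] by (simp add: measurable_base_iff[OF T(1)] pull_def[abs_def])
 note mu = L2D(1)[OF u]
 have md: "(%p. psi (coords p) - u p) : borel_measurable B" using m1 mu by (rule borel_measurable_diff)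
 have "(\<integral>\<^sup>+p. ennreal ((psi (coords p) - u p)^2) \<partial>B) = (\<integral>\<^sup>+y\<in>cdom T. ennreal ((psi y - u (emb y))^2) \<partial>lborel)"
  using md by (subst nn_integral_base[OF T(1)]) simp_all
 also have "... = (\<integral>\<^sup>+y\<in>cdom T. ennreal ((psi y - pull T u y)^2) \<partial>lborel)" by (rule nn_integral_cong) (simp add: pull_def indicator_def)
 finally have *: "(\<integral>\<^sup>+p. ennreal ((psi (coords p) - u p)^2) \<partial>B) <= ennreal (delta^2)" using le by simp
 note d = nn_L2_norm[OF md * delta]
 show "L2_norm B (%p. psi (coords p) - u p) <= delta" by (rule d(2))
 show "(%p. psi (coords p)) : L2_space B" using L2_space_add[OF d(1) u] by simp
 show "L2_norm B (%p. psi (coords p)) <= L2_norm B u + delta" using L2_norm_triangle[OF d(1) u] d(2) by simp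
qed

lemma norm_sq_vec: "(norm (v :: real^'n))^2 = (SS k. (v $ k)^2)"
 unfolding power2_norm_eq_inner inner_vec_def by (simp add: power2_eq_square)

text \<open>The inequality is applied to smooth functions within \<open>delta\<close> of
  \<open>v\<close>, and \<open>delta\<close> tends to 0 at the end. Weighted and unweighted norms
  are compared twice, by \<open>S\<close> for the function and by \<open>s\<close> for the gradient,
  which produces the quotient in \<open>C\<^sub>W\<close>.\<close>

lemma poincare_H1:
 assumes PW: "poincare_wirtinger T CP" "CP > 0" and v: "v : H1_space T m" and mean: "(\<integral>p. v p \<partial>m) = 0"
  and S: "!!p. p : Omega \<times> T ==> wt p <= S" and s: "!!p. p : Omega \<times> T ==> s <= wt p" "s > 0" and S0: "S >= 0"
 shows "(L2_norm m v)^2 <= S / s * CP * (SS i. (L2_norm m (wd T v i))^2)"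
proof -
 define n where "n i = L2_norm B (wd T v i)" for i
 have n0: "n i >= 0" for i by (simp add: n_def L2_norm_nonneg)
 have vB: "v : L2_space B" "wd T v i : L2_space B" for i using H1D(1,3)[OF v] by (simp_all add: L2_gibbs)
 have est: "L2_norm m v <= sqrt S * (delta + sqrt CP * sqrt (SS i. (n i + delta)^2))" if delta: "delta > 0" for delta proof -
  have "EX psi. smooth_on (cdom T) psi & (\<integral>\<^sup>+y\<in>cdom T. ennreal ((psi y - pull T v y)^2) \<partial>lborel) <= ennreal (delta^2)
  & (\<forall>i\<in>UNIV. (\<integral>\<^sup>+y\<in>cdom T. ennreal ((dird (dir i) psi y - pull T (wd T v i) y)^2) \<partial>lborel) <= ennreal (delta^2))"
  by (rule meyers_serrin[OF open_cdom[OF T(1)] finite H1D(4)[OF v] H1D(5)[OF v] H1D(6)[OF v] delta])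
  then obtain psi where psi: "smooth_on (cdom T) psi" "(\<integral>\<^sup>+y\<in>cdom T. ennreal ((psi y - pull T v y)^2) \<partial>lborel) <= ennreal (delta^2)"
  "!!i. (\<integral>\<^sup>+y\<in>cdom T. ennreal ((dird (dir i) psi y - pull T (wd T v i) y)^2) \<partial>lborel) <= ennreal (delta^2)" by blast
  note a0 = L2_approx[OF smooth_on_continuous[OF psi(1)] vB(1) psi(2) less_imp_le[OF delta]]
  note ai = L2_approx[OF smooth_on_continuous[OF smooth_on_frechet[OF psi(1)]] vB(2) psi(3) less_imp_le[OF delta]]
  let ?phi = "%p. psi (coords p)" and ?f = "%i p. dird (dir i) psi (coords p)"
  define c where "c = (\<integral>p. ?phi p \<partial>B) / measure B (Omega \<times> T)"
  define A where "A = (SS i. (L2_norm B (?f i))^2)"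
  have A0: "A >= 0" by (simp add: A_def sum_nonneg)
  have iA: "integrable B (%p. (?f i p)^2)" for i by (rule L2D(2)[OF ai(1)])
  have "(\<integral>\<^sup>+p. ennreal ((norm (tgrad ?phi p))^2 + (norm (agrad ?phi p))^2) \<partial>B) = (\<integral>\<^sup>+p. ennreal (SS i. (?f i p)^2) \<partial>B)" proof (rule nn_integral_cong)
  fix p assume "p : space B"
  hence p: "p : Omega \<times> T" by (simp add: space_base)
  show "ennreal ((norm (tgrad ?phi p))^2 + (norm (agrad ?phi p))^2) = ennreal (SS i. (?f i p)^2)" by (simp only: norm_sq_vec smooth_on_coords(2,3)[OF T(1) psi(1) p] sum_dirs dir_simps)
  qed
  also have "... = ennreal (\<integral>p. (SS i. (?f i p)^2) \<partial>B)" by (rule nn_integral_eq_integral) (use iA in "auto intro!: lintegrable_sum sum_nonneg")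
  also have "(\<integral>p. (SS i. (?f i p)^2) \<partial>B) = A" unfolding A_def L2_norm_sq by (rule lint_sum) (rule iA)
  finally have g: "(\<integral>\<^sup>+p. ennreal ((norm (tgrad ?phi p))^2 + (norm (agrad ?phi p))^2) \<partial>B) = ennreal A" .
  have "smooth_on_dom T ?phi & integrable B ?phi" using smooth_on_coords(1)[OF T(1) psi(1)] L2_space_integrable[OF finite_measure_base a0(1)] by simp
  hence "(\<integral>\<^sup>+p. ennreal ((?phi p - c)^2) \<partial>B) <= ennreal CP * ennreal A" using PW(1)[unfolded poincare_wirtinger_def Let_def, rule_format, of ?phi] unfolding c_def g by blast
  also have "... = ennreal ((sqrt (CP * A))^2)" using PW(2) A0 by (simp add: ennreal_mult)
  finally have pw: "(\<integral>\<^sup>+p. ennreal ((?phi p - c)^2) \<partial>B) <= ennreal ((sqrt (CP * A))^2)" .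
  have mphi: "(%p. ?phi p - c) : borel_measurable B" using L2D(1)[OF a0(1)] by measurable
  have "sqrt (CP * A) >= 0" using PW(2) A0 by simp
  note pw2 = nn_L2_norm[OF mphi pw this]
  have "A <= (SS i. (n i + delta)^2)" unfolding A_def n_def by (intro sum_mono power_mono ai(3) L2_norm_nonneg)
  hence le: "sqrt (CP * A) <= sqrt CP * sqrt (SS i. (n i + delta)^2)" using PW(2) by (simp add: real_sqrt_mult)
  have "L2_norm B (%p. v p - c) <= L2_norm B (%p. v p - ?phi p) + L2_norm B (%p. ?phi p - c)" using L2_norm_triangle[OF L2_space_diff[OF vB(1) a0(1)] pw2(1)] by simp
  also have "... <= delta + sqrt CP * sqrt (SS i. (n i + delta)^2)" using a0(2) pw2(2) le L2_norm_minus[of B v ?phi] by linarith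
  finally have vc: "L2_norm B (%p. v p - c) <= delta + sqrt CP * sqrt (SS i. (n i + delta)^2)" .
  have cm: "(%p. v p - c) : L2_space m" by (intro L2_space_diff H1D(1)[OF v] L2_const)
  \<comment> \<open>\<open>c\<close> is the mean for the unweighted measure, whereas
    \<open>v\<close> has mean 0 for \<open>m\<close>. The latter mean is the best constant
    approximation in the weighted norm, so subtracting \<open>c\<close> can only increase that
    norm.\<close>
  have "(L2_norm m v)^2 <= (L2_norm m (%p. v p - c))^2" proof -
  have iv: "integrable m v" by (rule L2_space_integrable[OF finite_measure_gibbs H1D(1)[OF v]])
  have ic: "integrable m (%p. c^2)" using L2D(2)[OF L2_const[of c]] by simp
  have "(\<integral>p. (v p - c)^2 \<partial>m) = (\<integral>p. ((v p)^2 - (2 * c) * v p) + c^2 \<partial>m)" by (rule lint_cong) (auto simp: power2_diff algebra_simps)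
  also have "... = (\<integral>p. (v p)^2 \<partial>m) - (2 * c) * (\<integral>p. v p \<partial>m) + (\<integral>p. c^2 \<partial>m)" using L2D(2)[OF H1D(1)[OF v]] iv ic
  by (subst lint_add, simp, simp, subst lint_diff) auto
  also have "... >= (\<integral>p. (v p)^2 \<partial>m)" unfolding mean by (simp add: integral_nonneg)
  finally show ?thesis by (simp add: L2_norm_sq)
  qed
  also have "... <= S * (L2_norm B (%p. v p - c))^2" by (rule norm_compare(1)[OF cm S])
  also have "... = (sqrt S * L2_norm B (%p. v p - c))^2" using S0 by (simp add: power_mult_distrib)
  finally have "L2_norm m v <= sqrt S * L2_norm B (%p. v p - c)" by (rule power2_le_imp_le) (simp add: S0 L2_norm_nonneg)
  also have "... <= sqrt S * (delta + sqrt CP * sqrt (SS i. (n i + delta)^2))" by (rule mult_left_mono[OF vc]) (simp add: S0)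
  finally show ?thesis .
 qed
 have "((%delta. sqrt S * (delta + sqrt CP * sqrt (SS i. (n i + delta)^2))) \<longlongrightarrow> sqrt S * (0 + sqrt CP * sqrt (SS i. (n i + 0)^2))) (at_right 0)" by (intro tendsto_intros)
 moreover have "\<forall>\<^sub>F delta in at_right 0. L2_norm m v <= sqrt S * (delta + sqrt CP * sqrt (SS i. (n i + delta)^2))"
  using eventually_at_right_less[of "0::real"] by eventually_elim (rule est)
 ultimately have "L2_norm m v <= sqrt S * (0 + sqrt CP * sqrt (SS i. (n i + 0)^2))" by (rule tendsto_lowerbound) simp
 hence "(L2_norm m v)^2 <= (sqrt S * (0 + sqrt CP * sqrt (SS i. (n i + 0)^2)))^2" by (rule power_mono) (rule L2_norm_nonneg)
 also have "... = S * CP * (SS i. (n i)^2)" using S0 PW(2) by (simp add: power_mult_distrib sum_nonneg)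
 also have "... <= S * CP * (SS i. (L2_norm m (wd T v i))^2 / s)" proof (intro mult_left_mono sum_mono)
  fix i
  have "s * (n i)^2 <= (L2_norm m (wd T v i))^2" unfolding n_def by (rule norm_compare(2)[OF H1D(3)[OF v] s(1)])
  thus "(n i)^2 <= (L2_norm m (wd T v i))^2 / s" using s(2) by (simp add: field_simps)
 qed (use S0 PW(2) in simp)
 also have "... = S / s * CP * (SS i. (L2_norm m (wd T v i))^2)" by (simp add: sum_divide_distrib[symmetric])
 finally show ?thesis .
qed

lemma W1_weighted:
 assumes h: "h : H1_space T m"
 shows "W1 (%p. h p * wt p) (%i p. wd T h i p * wt p + h p * W (dir i) (coords p))" unfolding W1_def
proof
 fix i
 have nd: "norm (dir i) <= 1" using norm_dirs by (cases i) auto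
 have "weak_dird (cdom T) (dir i) (%y. pull T h y * w y) (%y. pull T (wd T h i) y * w y + pull T h y * W (dir i) y)"
 proof (rule weak_dird_mult_on[OF open_cdom[OF T(1)] H1D(6)[OF h] H1D(4)[OF h] H1D(5)[OF h], where M = bnd and L = bnd and M' = bnd])
  show "abs (w y) <= bnd" if "y : cdom T" for y by (rule w_abs[OF that])
  show "AE y in lborel. y : cdom T --> abs (W (dir i) y) <= bnd" by (intro AE_I2 impI bnd(5) nd)
 qed (intro E_measurable AE_has_dird_w bnd(4); assumption)+
 moreover have "(%y. pull T h y * w y) = pull T (%p. h p * wt p)" "(%y. pull T (wd T h i) y * w y + pull T h y * W (dir i) y) = pull T (%p. wd T h i p * wt p + h p * W (dir i) (coords p))"
  by (simp_all add: fun_eq_iff pull_def w_def energy_embed algebra_simps)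
 ultimately show "weak_dird (cdom T) (dir i) (pull T (%p. h p * wt p)) (pull T (%p. wd T h i p * wt p + h p * W (dir i) (coords p)))" by simp
qed

text \<open>The gradient of \<open>h * wt\<close> consists of wt grad h and h grad wt. Its square is
  multiplied by exp (E / D) = 1 / wt, and the bounds on the weight leave one factor wt in front of
  both contributions, so they integrate to norms in \<open>m\<close>.\<close>

lemma weighted_energy_bound:
 assumes h: "h : H1_space T m" and F: "!!p. p : Omega \<times> T ==> F p = h p * wt p"
  and pos: "gamma > 0" "eta > 0"
 shows "weakly_differentiable T F" "(\<integral>\<^sup>+p. ennreal ((3 * gamma * D * (norm (weak_tgrad T F p))^2 + eta * D * (norm (weak_agrad T F p))^2) * exp (energy sigma x p / D)) \<partial>B)
  <= ennreal (2 * (SS i. kap gamma eta i * (L2_norm m (wd T h i))^2) + 2 * bnd ^ 4 * (SS i. kap gamma eta i) * (L2_norm m h)^2)" (is ?I) proof -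
 let ?G = "%p. 3 * gamma * D * (norm (weak_tgrad T F p))^2 + eta * D * (norm (weak_agrad T F p))^2"
 let ?e = "%p. wt p"
 have nd: "norm (dir i) <= 1" for i using norm_dirs by (cases i) auto
 have k0: "kap gamma eta i >= 0" for i using pos D by (cases i) auto
 have "pull T F = pull T (%p. h p * ?e p)" using F by (auto simp: fun_eq_iff pull_def indicator_def cdom_def)
 hence W1F: "W1 F (%i p. wd T h i p * ?e p + h p * W (dir i) (coords p))" using W1_weighted[OF h] by (simp add: W1_def)
 show "weakly_differentiable T F" by (rule W1_weakly_differentiable[OF W1F])
 let ?R = "%p. SS i. kap gamma eta i * (2 * (wd T h i p)^2 + 2 * bnd ^ 4 * (h p)^2)"
 have i: "integrable m (%p. (h p)^2)" "integrable m (%p. (wd T h i p)^2)" for i by (intro L2D(2) H1D h)+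
 have iR: "integrable m ?R" using i by (intro lintegrable_sum integrable_mult_right lintegrable_add)
 have mR: "?R : borel_measurable B" using borel_measurable_integrable[OF iR] by (simp add: measurable_gibbs)
 have R0: "?R p >= 0" for p using k0 bnd(1) by (intro sum_nonneg mult_nonneg_nonneg add_nonneg_nonneg) auto
 have ae: "AE p in B. ?G p * exp (energy sigma x p / D) <= ?e p * ?R p" using W1_AE[OF W1F, unfolded AE_gibbs] AE_space proof eventually_elim
  case (elim p)
  hence p: "p : Omega \<times> T" by (simp add: space_base)
  hence cp: "coords p : cdom T" using embed_coords[OF p] by (simp add: cdom_def)
  have inv: "exp (energy sigma x p / D) = inverse (?e p)" by (simp add: exp_minus)
  have "?G p = (SS i. kap gamma eta i * (wd T F i p)^2)" by (simp add: norm_sq_vec sum_dirs sum_distrib_left)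
  hence "?G p * exp (energy sigma x p / D) = (SS i. kap gamma eta i * ((wd T F i p)^2 * inverse (?e p)))" by (simp only: inv sum_distrib_right mult.assoc)
  also have "... <= (SS i. kap gamma eta i * (?e p * (2 * (wd T h i p)^2 + 2 * bnd ^ 4 * (h p)^2)))" proof (intro sum_mono mult_left_mono k0)
  fix i
  define a b q where "a = wd T h i p" and "b = W (dir i) (coords p)" and "q = ?e p"
  have q: "q > 0" "1 / bnd <= q" using wt_bounds(2)[OF p] by (simp_all add: q_def)
  have q1: "1 <= bnd * q" using mult_left_mono[OF q(2), of bnd] bnd(1) by simp
  \<comment> \<open>The bound on the derivative of the weight is enlarged by the factor bnd q >= 1,
    so that its square contains q^2: one q cancels 1 / q and the other is the density of
    \<open>m\<close>. This is the origin of \<open>bnd ^ 4\<close>.\<close>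
  have "abs b <= bnd" unfolding b_def by (rule bnd(5)[OF cp nd])
  also have "bnd = bnd * 1" by simp
  also have "bnd * 1 <= bnd * (bnd * q)" by (rule mult_left_mono[OF q1]) (use bnd(1) in simp)
  finally have "abs b <= abs (bnd * (bnd * q))" by simp
  hence b2: "b^2 <= (bnd * (bnd * q))^2" by (simp only: abs_le_square_iff)
  have "(a * q + h p * b)^2 <= 2 * (a * q)^2 + 2 * (h p * b)^2" using zero_le_power2[of "a * q - h p * b"] unfolding power2_sum power2_diff by linarith
  also have "... <= 2 * (a * q)^2 + 2 * ((h p)^2 * (bnd * (bnd * q))^2)" unfolding power_mult_distrib[of "h p" b] by (intro add_left_mono mult_left_mono b2) auto
  also have "... = (q * (2 * a^2 + 2 * bnd ^ 4 * (h p)^2)) * q" by (simp add: power2_eq_square power4_eq_xxxx algebra_simps)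
  finally have "(a * q + h p * b)^2 / q <= q * (2 * a^2 + 2 * bnd ^ 4 * (h p)^2)" using q(1) by (simp only: pos_divide_le_eq)
  moreover have "wd T F i p = a * q + h p * b" using elim(1) by (simp add: a_def b_def q_def)
  ultimately show "(wd T F i p)^2 * inverse (?e p) <= ?e p * (2 * (wd T h i p)^2 + 2 * bnd ^ 4 * (h p)^2)" unfolding a_def[symmetric] q_def[symmetric] by (simp only: divide_inverse)
  qed
  also have "... = ?e p * ?R p" by (simp only: sum_distrib_left mult.left_commute)
  finally show ?case .
 qed
 have "(\<integral>\<^sup>+p. ennreal (?G p * exp (energy sigma x p / D)) \<partial>B) <= (\<integral>\<^sup>+p. ennreal (?e p * ?R p) \<partial>B)" proof (rule nn_integral_mono_AE)
  show "AE p in B. ennreal (?G p * exp (energy sigma x p / D)) <= ennreal (?e p * ?R p)" using ae by eventually_elim (rule ennreal_leI)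
 qed
 also have "... = ennreal (\<integral>p. ?e p * ?R p \<partial>B)" by (rule nn_integral_eq_integral[OF iR[unfolded integral_gibbs(1)[OF mR]]]) (use R0 in simp)
 also have "(\<integral>p. ?e p * ?R p \<partial>B) = (\<integral>p. ?R p \<partial>m)" by (rule integral_gibbs(2)[OF mR, symmetric])
 also have "... = (SS i. kap gamma eta i * (2 * (L2_norm m (wd T h i))^2 + 2 * bnd ^ 4 * (L2_norm m h)^2))" using i by (simp add: L2_norm_sq lint_sum lint_add)
 also have "... = 2 * (SS i. kap gamma eta i * (L2_norm m (wd T h i))^2) + 2 * bnd ^ 4 * (SS i. kap gamma eta i) * (L2_norm m h)^2"
  by (simp add: distrib_left sum.distrib sum_distrib_left sum_distrib_right mult_ac)
 finally show ?I .
qed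

end

section \<open>Weak solutions: differentiation of the norm, conservation of mass, and decay\<close>

lemma exp_decay:
 fixes y :: "real => real"
 assumes y: "!!t. t > 0 ==> (y has_real_derivative y' t) (at t)" "!!t. t > 0 ==> y' t <= - c * y t" and s: "0 < s" "s <= t"
 shows "y t <= exp (- c * (t - s)) * y s"
proof -
 have "exp (c * t) * y t <= exp (c * s) * y s" proof (rule DERIV_nonpos_imp_nonincreasing[OF s(2)])
  fix r assume r: "s <= r" "r <= t"
  have "((%r. c * r) has_real_derivative c) (at r)" using DERIV_cmult_Id by blast
  from DERIV_mult[OF DERIV_fun_exp[OF this] y(1)[of r]]
  have "((%r. exp (c * r) * y r) has_real_derivative exp (c * r) * c * y r + y' r * exp (c * r)) (at r)" using r s by simp
  moreover have "exp (c * r) * c * y r + y' r * exp (c * r) = exp (c * r) * (c * y r + y' r)" by (simp add: algebra_simps)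
  moreover have "... <= 0" using y(2)[of r] r s by (simp add: mult_nonneg_nonpos)
  ultimately show "EX z. ((%r. exp (c * r) * y r) has_real_derivative z) (at r) & z <= 0" by metis
 qed
 hence "exp (- (c * t)) * (exp (c * t) * y t) <= exp (- (c * t)) * (exp (c * s) * y s)" by (rule mult_left_mono) simp
 moreover have "exp (- (c * t)) * (exp (c * t) * y t) = y t" unfolding mult.assoc[symmetric] exp_add[symmetric] by simp
 moreover have "exp (- (c * t)) * (exp (c * s) * y s) = exp (- c * (t - s)) * y s" unfolding mult.assoc[symmetric] exp_add[symmetric] by (simp add: algebra_simps)
 ultimately show ?thesis by simp
qed

text \<open>Write u s = u t + (s - t) (u' + r s), where the norm of r s tends to 0. Pairing with
  \<open>v\<close> leaves an error of the order of that norm; in the expanded square there is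
  besides a term of order abs (s - t).\<close>

lemma L2_derivative:
 assumes u: "!!s. s > 0 ==> u s : L2_space M" and u': "u' : L2_space M" and t: "t > (0::real)"
  and lim: "((%s. L2_norm M (%p. (u s p - u t p) / (s - t) - u' p)) \<longlongrightarrow> 0) (at t)"
 shows "v : L2_space M ==> ((%s. \<integral>p. u s p * v p \<partial>M) has_real_derivative (\<integral>p. u' p * v p \<partial>M)) (at t)"
  "((%s. (L2_norm M (u s))^2) has_real_derivative 2 * (\<integral>p. u' p * u t p \<partial>M)) (at t)" proof -
 let ?r = "%s p. (u s p - u t p) / (s - t) - u' p"
 have r2: "?r s : L2_space M" if "s > 0" for s using L2_space_diff[OF L2_space_cmult[OF L2_space_diff[OF u[OF that] u[OF t]], of "1 / (s - t)"] u'] by simp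
 have ev: "\<forall>\<^sub>F s in at t. s > 0 & s ~= t" by (intro eventually_conj order_tendstoD(1)[OF tendsto_ident_at t]) (simp add: eventually_at_filter)
 have dec: "u s p = u t p + (s - t) * (u' p + ?r s p)" if "s ~= t" for s p using that by simp
 show "((%s. \<integral>p. u s p * v p \<partial>M) has_real_derivative (\<integral>p. u' p * v p \<partial>M)) (at t)" if v: "v : L2_space M" unfolding has_field_derivative_iff
 proof (rule Lim_transform[OF tendsto_const])
  have "((%s. L2_norm M (?r s) * L2_norm M v) \<longlongrightarrow> 0 * L2_norm M v) (at t)" by (intro tendsto_mult lim tendsto_const)
  hence g0: "((%s. L2_norm M (?r s) * L2_norm M v) \<longlongrightarrow> 0) (at t)" by simp
  show "((%s. ((\<integral>p. u s p * v p \<partial>M) - (\<integral>p. u t p * v p \<partial>M)) / (s - t) - (\<integral>p. u' p * v p \<partial>M)) \<longlongrightarrow> 0) (at t)"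
  proof (rule Lim_null_comparison[OF _ g0])
  show "\<forall>\<^sub>F s in at t. norm (((\<integral>p. u s p * v p \<partial>M) - (\<integral>p. u t p * v p \<partial>M)) / (s - t) - (\<integral>p. u' p * v p \<partial>M))
  <= L2_norm M (?r s) * L2_norm M v" using ev proof eventually_elim
  case (elim s)
  have i: "integrable M (%p. u t p * v p)" "integrable M (%p. u' p * v p)" "integrable M (%p. ?r s p * v p)"
  using elim by (intro L2_mult_integrable[OF u[OF t] v] L2_mult_integrable[OF u' v] L2_mult_integrable[OF r2 v]; simp)+
  have "(\<integral>p. u s p * v p \<partial>M) = (\<integral>p. u t p * v p + (s - t) * (u' p * v p + ?r s p * v p) \<partial>M)"
  by (rule lint_cong[OF refl], subst dec[of s]) (use elim in "auto simp: algebra_simps")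
  also have "... = (\<integral>p. u t p * v p \<partial>M) + (s - t) * ((\<integral>p. u' p * v p \<partial>M) + (\<integral>p. ?r s p * v p \<partial>M))"
  by (simp only: lint_add i integrable_mult_right lintegrable_add integral_mult_right_zero)
  finally have "((\<integral>p. u s p * v p \<partial>M) - (\<integral>p. u t p * v p \<partial>M)) / (s - t) - (\<integral>p. u' p * v p \<partial>M) = (\<integral>p. ?r s p * v p \<partial>M)"
  using elim by simp
  thus ?case using L2_cauchy_schwarz[OF r2 v, of s] elim by simp
  qed
  qed
 qed
 show "((%s. (L2_norm M (u s))^2) has_real_derivative 2 * (\<integral>p. u' p * u t p \<partial>M)) (at t)" unfolding has_field_derivative_iff proof (rule Lim_transform[OF tendsto_const])
  let ?g = "%s. 2 * (L2_norm M (?r s) * L2_norm M (u t)) + abs (s - t) * (L2_norm M u' + L2_norm M (?r s))^2"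
  have "(?g \<longlongrightarrow> 2 * (0 * L2_norm M (u t)) + abs (t - t) * (L2_norm M u' + 0)^2) (at t)" by (intro tendsto_intros lim)
  hence g0: "(?g \<longlongrightarrow> 0) (at t)" by simp
  show "((%s. ((L2_norm M (u s))^2 - (L2_norm M (u t))^2) / (s - t) - 2 * (\<integral>p. u' p * u t p \<partial>M)) \<longlongrightarrow> 0) (at t)" proof (rule Lim_null_comparison[OF _ g0])
  show "\<forall>\<^sub>F s in at t. norm (((L2_norm M (u s))^2 - (L2_norm M (u t))^2) / (s - t) - 2 * (\<integral>p. u' p * u t p \<partial>M)) <= ?g s" using ev proof eventually_elim
  case (elim s)
  have r: "?r s : L2_space M" using r2 elim by simp
  define q where "q p = u' p + ?r s p" for p
  have q: "q : L2_space M" unfolding q_def[abs_def] by (rule L2_space_add[OF u' r])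
  have i: "integrable M (%p. (u t p)^2)" "integrable M (%p. u' p * u t p)" "integrable M (%p. ?r s p * u t p)" "integrable M (%p. (q p)^2)" by (intro L2_mult_integrable L2D(2) u u' r q t)+
  have "(\<integral>p. (u s p)^2 \<partial>M) = (\<integral>p. (u t p)^2 + (2 * (s - t)) * (u' p * u t p + ?r s p * u t p) + (s - t)^2 * (q p)^2 \<partial>M)"
  by (rule lint_cong[OF refl], subst dec[of s], use elim in simp, simp only: q_def[symmetric]) (simp add: q_def power2_eq_square algebra_simps)
  also have "... = (\<integral>p. (u t p)^2 \<partial>M) + (2 * (s - t)) * ((\<integral>p. u' p * u t p \<partial>M) + (\<integral>p. ?r s p * u t p \<partial>M)) + (s - t)^2 * (\<integral>p. (q p)^2 \<partial>M)"
  by (simp only: lint_add i integrable_mult_right lintegrable_add integral_mult_right_zero)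
  finally have eq: "(\<integral>p. (u s p)^2 \<partial>M) = ..." .
  have gen: "(a - b) / d - 2 * A = 2 * R + d * Q" if "a = b + (2 * d) * (A + R) + d^2 * Q" "d ~= 0" for a b d A R Q :: real using that by (simp add: field_simps power2_eq_square)
  have "((L2_norm M (u s))^2 - (L2_norm M (u t))^2) / (s - t) - 2 * (\<integral>p. u' p * u t p \<partial>M) = 2 * (\<integral>p. ?r s p * u t p \<partial>M) + (s - t) * (L2_norm M q)^2"
  unfolding L2_norm_sq by (rule gen[OF eq]) (use elim in simp)
  hence "norm (((L2_norm M (u s))^2 - (L2_norm M (u t))^2) / (s - t) - 2 * (\<integral>p. u' p * u t p \<partial>M))
  = abs (2 * (\<integral>p. ?r s p * u t p \<partial>M) + (s - t) * (L2_norm M q)^2)" by (simp only: real_norm_def)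
  also have "... <= 2 * abs (\<integral>p. ?r s p * u t p \<partial>M) + abs (s - t) * (L2_norm M q)^2"
  using abs_triangle_ineq[of "2 * (\<integral>p. ?r s p * u t p \<partial>M)" "(s - t) * (L2_norm M q)^2"] by (simp add: abs_mult)
  also have "... <= ?g s" unfolding q_def[abs_def] by (intro add_mono mult_left_mono power_mono L2_cauchy_schwarz r u t L2_norm_triangle u' L2_norm_nonneg) auto
  finally show ?case .
  qed
  qed
 qed
qed

context gibbs_domain begin

text \<open>The decay argument lives on the weak form alone. Unlike the strong form, with its
  Neumann conditions and second derivatives, it passes directly to differences, time shifts and
  constants.\<close>

definition flow :: "real => real => (real => state => real) => (real => state => real) => bool" where
 "flow gamma eta u u' \<longleftrightarrow> (\<forall>t>0. u t : H1_space T m & u' t : L2_space m & ((%s. L2_norm m (%p. (u s p - u t p) / (s - t) - u' t p)) \<longlongrightarrow> 0) (at t)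
  & (\<forall>v\<in>H1_space T m. (\<integral>p. u' t p * v p \<partial>m) = - (SS i. kap gamma eta i * (\<integral>p. wd T (u t) i p * wd T v i p \<partial>m))))"

lemma flowD:
 assumes "flow gamma eta u u'" "t > 0"
 shows "u t : H1_space T m" "u' t : L2_space m" "u t : L2_space m" "((%s. L2_norm m (%p. (u s p - u t p) / (s - t) - u' t p)) \<longlongrightarrow> 0) (at t)"
  "v : H1_space T m ==> (\<integral>p. u' t p * v p \<partial>m) = - (SS i. kap gamma eta i * (\<integral>p. wd T (u t) i p * wd T v i p \<partial>m))" using assms H1D(1) unfolding flow_def by blast+

lemma flow_energy:
 assumes "flow gamma eta u u'" "t > 0"
 shows "(\<integral>p. u' t p * u t p \<partial>m) = - (SS i. kap gamma eta i * (L2_norm m (wd T (u t) i))^2)"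
 unfolding flowD(5)[OF assms flowD(1)[OF assms]] L2_norm_sq by (simp only: power2_eq_square)

lemma flow_diff:
 assumes "flow gamma eta u u'" "flow gamma eta v v'"
 shows "flow gamma eta (%t p. u t p - v t p) (%t p. u' t p - v' t p)" unfolding flow_def
proof (intro allI impI conjI ballI)
 fix t :: real assume t: "t > 0"
 note U = flowD[OF assms(1) t] and V = flowD[OF assms(2) t]
 show h: "(%p. u t p - v t p) : H1_space T m" by (rule H1_diff(1)[OF U(1) V(1)])
 show "(%p. u' t p - v' t p) : L2_space m" by (rule L2_space_diff[OF U(2) V(2)])
 have q: "(%p. (u s p - u t p) / (s - t) - u' t p) : L2_space m" if "s > 0" "flow gamma eta u u'" for u u' s
  using L2_space_diff[OF L2_space_cmult[OF L2_space_diff[OF flowD(3)[OF that(2,1)] flowD(3)[OF that(2) t]], of "1 / (s - t)"] flowD(2)[OF that(2) t]] by simp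
 have s0: "((%s. L2_norm m (%p. (u s p - u t p) / (s - t) - u' t p) + L2_norm m (%p. (v s p - v t p) / (s - t) - v' t p)) \<longlongrightarrow> 0) (at t)" using tendsto_add[OF U(4) V(4)] by simp
 show "((%s. L2_norm m (%p. (u s p - v s p - (u t p - v t p)) / (s - t) - (u' t p - v' t p))) \<longlongrightarrow> 0) (at t)" proof (rule Lim_null_comparison[OF _ s0])
  have "\<forall>\<^sub>F s in at t. s > 0" by (rule order_tendstoD(1)[OF tendsto_ident_at t])
  thus "\<forall>\<^sub>F s in at t. norm (L2_norm m (%p. (u s p - v s p - (u t p - v t p)) / (s - t) - (u' t p - v' t p)))
  <= L2_norm m (%p. (u s p - u t p) / (s - t) - u' t p) + L2_norm m (%p. (v s p - v t p) / (s - t) - v' t p)" proof eventually_elim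
  case (elim s)
  have "(%p. (u s p - v s p - (u t p - v t p)) / (s - t) - (u' t p - v' t p)) = (%p. ((u s p - u t p) / (s - t) - u' t p) + (-1) * ((v s p - v t p) / (s - t) - v' t p))"
  by (simp add: fun_eq_iff diff_divide_distrib)
  thus ?case using L2_norm_triangle[OF q[OF elim assms(1)] L2_space_cmult[OF q[OF elim assms(2)], of "-1"]] by (simp only: L2_norm_cmult) (simp add: L2_norm_nonneg)
  qed
 qed
 fix f assume f: "f : H1_space T m"
 have e: "(\<integral>p. wd T (%p. u t p - v t p) i p * wd T f i p \<partial>m) = (\<integral>p. wd T (u t) i p * wd T f i p \<partial>m) - (\<integral>p. wd T (v t) i p * wd T f i p \<partial>m)" for i
 proof -
  have i: "integrable m (%p. wd T (u t) i p * wd T f i p)" "integrable m (%p. wd T (v t) i p * wd T f i p)" "integrable m (%p. wd T (%p. u t p - v t p) i p * wd T f i p)"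
  by (intro L2_mult_integrable H1D(3) U V f h)+
  have "(\<integral>p. wd T (%p. u t p - v t p) i p * wd T f i p \<partial>m) = (\<integral>p. wd T (u t) i p * wd T f i p - wd T (v t) i p * wd T f i p \<partial>m)" proof (rule integral_cong_AE)
  show "AE p in m. wd T (%p. u t p - v t p) i p * wd T f i p = wd T (u t) i p * wd T f i p - wd T (v t) i p * wd T f i p"
  using H1_diff(2)[OF U(1) V(1)] by eventually_elim (simp add: left_diff_distrib)
  qed (use i in "auto intro: borel_measurable_integrable lintegrable_diff")
  thus ?thesis using lint_diff[OF i(1,2)] by simp
 qed
 have "(\<integral>p. (u' t p - v' t p) * f p \<partial>m) = (\<integral>p. u' t p * f p \<partial>m) - (\<integral>p. v' t p * f p \<partial>m)"
  using lint_diff[OF L2_mult_integrable[OF U(2) H1D(1)[OF f]] L2_mult_integrable[OF V(2) H1D(1)[OF f]]] by (simp only: left_diff_distrib)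
 thus "(\<integral>p. (u' t p - v' t p) * f p \<partial>m) = - (SS i. kap gamma eta i * (\<integral>p. wd T (%p. u t p - v t p) i p * wd T f i p \<partial>m))"
  unfolding e U(5)[OF f] V(5)[OF f] by (simp add: right_diff_distrib sum_subtractf)
qed

lemma flow_shift:
 assumes "flow gamma eta u u'" "delta >= 0"
 shows "flow gamma eta (%t. u (t + delta)) (%t. u' (t + delta))" unfolding flow_def
proof (intro allI impI conjI ballI)
 fix t :: real assume "t > 0"
 hence t: "t + delta > 0" using assms(2) by simp
 note U = flowD[OF assms(1) t]
 show "u (t + delta) : H1_space T m" "u' (t + delta) : L2_space m" by (rule U)+
 show "((%s. L2_norm m (%p. (u (s + delta) p - u (t + delta) p) / (s - t) - u' (t + delta) p)) \<longlongrightarrow> 0) (at t)" using LIM_offset[OF U(4), of delta] by simp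
 show "(\<integral>p. u' (t + delta) p * v p \<partial>m) = - (SS i. kap gamma eta i * (\<integral>p. wd T (u (t + delta)) i p * wd T v i p \<partial>m))"
  if "v : H1_space T m" for v by (rule U(5)[OF that])
qed

lemma wd_const_zero:
 "(\<integral>p. wd T (%p. c) i p * f p \<partial>m) = 0" "(\<integral>p. f p * wd T (%p. c) i p \<partial>m) = 0"
proof -
 have "AE p in m. wd T (%p. c) i p * f p = 0" using H1_const(2)[of c] by eventually_elim simp
 thus "(\<integral>p. wd T (%p. c) i p * f p \<partial>m) = 0" by (rule integral_eq_zero_AE)
 thus "(\<integral>p. f p * wd T (%p. c) i p \<partial>m) = 0" by (simp only: mult.commute)
qed

lemma flow_const: "flow gamma eta (%t p. c) (%t p. 0)"
 unfolding flow_def by (intro allI impI conjI ballI H1_const L2_const) (simp_all add: L2_norm_def wd_const_zero)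

text \<open>The weak form is tested with the constant 1, whose weak gradient vanishes almost
  everywhere.\<close>

lemma flow_mass:
 assumes "flow gamma eta u u'" shows "EX c. \<forall>t>0. (\<integral>p. u t p \<partial>m) = c"
proof -
 have "((%s. \<integral>p. u s p \<partial>m) has_real_derivative 0) (at t within {0<..})" if "t : {0<..}" for t proof -
  have t: "t > 0" using that by simp
  have "((%s. \<integral>p. u s p * 1 \<partial>m) has_real_derivative (\<integral>p. u' t p * 1 \<partial>m)) (at t)"
  by (rule L2_derivative(1)[OF flowD(3)[OF assms] flowD(2)[OF assms t] t flowD(4)[OF assms t] L2_const])
  moreover have "(\<integral>p. u' t p * 1 \<partial>m) = 0" unfolding flowD(5)[OF assms t H1_const(1)] by (simp add: wd_const_zero)
  ultimately show ?thesis by (simp add: has_field_derivative_at_within)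
 qed
 moreover have "convex {0::real<..}" by (simp add: convex_real_interval)
 ultimately show ?thesis using has_field_derivative_zero_constant[of "{0<..}" "%s. \<integral>p. u s p \<partial>m"] by auto
qed

lemma flow_decay:
 assumes u: "flow gamma eta u u'" and mean: "!!t. t > 0 ==> (\<integral>p. u t p \<partial>m) = 0" and pos: "gamma > 0" "eta > 0"
  and P: "!!v. v : H1_space T m ==> (\<integral>p. v p \<partial>m) = 0 ==> (L2_norm m v)^2 <= C * (SS i. (L2_norm m (wd T v i))^2)" and C: "C > 0" and s: "0 < s" "s <= t"
 shows "L2_norm m (u t) <= exp (- (min (3 * gamma) eta * D / C) * (t - s)) * L2_norm m (u s)"
proof -
 let ?l = "min (3 * gamma) eta * D / C"
 have "(L2_norm m (u t))^2 <= exp (- (2 * ?l) * (t - s)) * (L2_norm m (u s))^2" proof (rule exp_decay[OF _ _ s])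
  fix r :: real assume r: "r > 0"
  show "((%s. (L2_norm m (u s))^2) has_real_derivative 2 * (\<integral>p. u' r p * u r p \<partial>m)) (at r)" by (rule L2_derivative(2)[OF flowD(3)[OF u] flowD(2)[OF u r] r flowD(4)[OF u r]])
  have "?l * (L2_norm m (u r))^2 <= ?l * (C * (SS i. (L2_norm m (wd T (u r) i))^2))" using pos D C by (intro mult_left_mono P flowD(1)[OF u r] mean r) simp
  also have "... = (SS i. (min (3 * gamma) eta * D) * (L2_norm m (wd T (u r) i))^2)" using C by (simp add: sum_distrib_left mult.assoc)
  also have "... <= (SS i. kap gamma eta i * (L2_norm m (wd T (u r) i))^2)" proof (intro sum_mono mult_right_mono)
  show "min (3 * gamma) eta * D <= kap gamma eta i" for i using D by (cases i) (auto intro!: mult_right_mono)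
  qed simp
  finally show "2 * (\<integral>p. u' r p * u r p \<partial>m) <= - (2 * ?l) * (L2_norm m (u r))^2" unfolding flow_energy[OF u r] by linarith
 qed
 also have "... = (exp (- ?l * (t - s)) * L2_norm m (u s))^2" unfolding power_mult_distrib power2_eq_square[of "exp _"] exp_add[symmetric] by simp
 finally show ?thesis by (rule power2_le_imp_le) (simp add: L2_norm_nonneg)
qed

text \<open>\<open>u'\<close> is only known to be in L^2, so the energy identity cannot be applied
  to it. A difference of two time shifts of \<open>u\<close> is a flow of mean 0 by conservation of
  mass and decays by a factor that does not depend on \<open>delta\<close>; dividing by
  \<open>delta\<close> and letting it tend to 0 gives the claim.\<close>

lemma flow_derivative_decay:
 assumes u: "flow gamma eta u u'" and pos: "gamma > 0" "eta > 0"
  and P: "!!v. v : H1_space T m ==> (\<integral>p. v p \<partial>m) = 0 ==> (L2_norm m v)^2 <= C * (SS i. (L2_norm m (wd T v i))^2)" and C: "C > 0" and s: "0 < s" "s <= t"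
 shows "L2_norm m (u' t) <= exp (- (min (3 * gamma) eta * D / C) * (t - s)) * L2_norm m (u' s)"
proof -
 let ?N = "%t delta. L2_norm m (%p. (u (t + delta) p - u t p) / delta)"
 obtain c where c: "!!t. t > 0 ==> (\<integral>p. u t p \<partial>m) = c" using flow_mass[OF u] by blast
 have lim: "(?N r \<longlongrightarrow> L2_norm m (u' r)) (at_right 0)" if r: "r > 0" for r proof -
  have "((%delta. L2_norm m (%p. (u (r + delta) p - u r p) / (r + delta - r) - u' r p)) \<longlongrightarrow> 0) (at_right 0)" proof (rule filterlim_compose[OF flowD(4)[OF u r]])
  have "((%delta. r + delta) \<longlongrightarrow> r + 0) (at_right 0)" by (intro tendsto_intros)
  thus "filterlim (%delta. r + delta) (at r) (at_right 0)" unfolding filterlim_at using eventually_at_right_less[of "0::real"] by (auto elim: eventually_mono)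
  qed
  hence l0: "((%delta. L2_norm m (%p. (u (r + delta) p - u r p) / delta - u' r p)) \<longlongrightarrow> 0) (at_right 0)" by simp
  have "((%delta. ?N r delta - L2_norm m (u' r)) \<longlongrightarrow> 0) (at_right 0)" proof (rule Lim_null_comparison[OF _ l0])
  show "\<forall>\<^sub>F delta in at_right 0. norm (?N r delta - L2_norm m (u' r)) <= L2_norm m (%p. (u (r + delta) p - u r p) / delta - u' r p)" using eventually_at_right_less[of "0::real"]
  proof eventually_elim
  case (elim delta)
  hence "r + delta > 0" using r by simp
  hence "(%p. (u (r + delta) p - u r p) / delta) : L2_space m" using L2_space_cmult[OF L2_space_diff[OF flowD(3)[OF u] flowD(3)[OF u r]], of "r + delta" "1 / delta"] by simp
  from L2_norm_diff_bound[OF this flowD(2)[OF u r]] show ?case by simp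
  qed
  qed
  thus ?thesis by (rule LIM_zero_cancel)
 qed
 let ?e = "exp (- (min (3 * gamma) eta * D / C) * (t - s))"
 have "\<forall>\<^sub>F delta in at_right 0. ?N t delta <= ?e * ?N s delta" using eventually_at_right_less[of "0::real"] proof eventually_elim
  case (elim delta)
  let ?d = "%t p. u (t + delta) p - u t p"
  have fl: "flow gamma eta ?d (%t p. u' (t + delta) p - u' t p)" using elim by (intro flow_diff flow_shift u) simp
  have mz: "(\<integral>p. ?d r p \<partial>m) = 0" if r: "r > 0" for r proof -
  have r': "r + delta > 0" using r elim by simp
  have "(\<integral>p. ?d r p \<partial>m) = (\<integral>p. u (r + delta) p \<partial>m) - (\<integral>p. u r p \<partial>m)"
  by (intro lint_diff L2_space_integrable[OF finite_measure_gibbs] flowD(3)[OF u] r r')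
  thus ?thesis using c[OF r] c[OF r'] by simp
  qed
  have *: "L2_norm m (?d t) <= ?e * L2_norm m (?d s)" by (rule flow_decay[where u = ?d, OF fl mz pos P C s])
  have N: "?N r delta = (1 / delta) * L2_norm m (?d r)" for r using L2_norm_cmult[of m "1 / delta" "?d r"] elim by simp
  have "(1 / delta) * L2_norm m (?d t) <= (1 / delta) * (?e * L2_norm m (?d s))" using * elim by (intro mult_left_mono) auto
  thus ?case unfolding N by (simp only: mult.left_commute)
 qed
 moreover have "((%delta. ?e * ?N s delta) \<longlongrightarrow> ?e * L2_norm m (u' s)) (at_right 0)" by (intro tendsto_mult tendsto_const lim s)
 moreover have "(?N t \<longlongrightarrow> L2_norm m (u' t)) (at_right 0)" by (rule lim) (use s in simp)
 ultimately show ?thesis by (intro tendsto_le[of "at_right 0"]) simp_all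
qed

end

section \<open>Decay of the associated solution to the equilibrium\<close>

context gibbs_domain begin

lemma evolution_flow:
 assumes "C2_boundary T" "fp_evolution sigma x gamma eta D T f0 g"
 shows "EX g'. flow gamma eta g g'"
proof -
 obtain g' where g': "!!t. t > 0 ==> g' t : L2_space m" "!!t. t > 0 ==> g t : fp_domain sigma x D T"
  "!!t. t > 0 ==> ((%s. L2_norm m (%p. (g s p - g t p) / (s - t) - g' t p)) \<longlongrightarrow> 0) (at t)" "!!t. t > 0 ==> AE p in m. g' t p = fp_operator sigma x gamma eta D T (g t) p"
  using assms(2) unfolding fp_evolution_def Let_def by blast
 have "flow gamma eta g g'" unfolding flow_def proof (intro allI impI conjI ballI)
  fix t :: real assume t: "t > 0"
  show "g t : H1_space T m" "g' t : L2_space m" by (rule fp_domainD(1)[OF g'(2)[OF t]], rule g'(1)[OF t])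
  show "((%s. L2_norm m (%p. (g s p - g t p) / (s - t) - g' t p)) \<longlongrightarrow> 0) (at t)" by (rule g'(3)[OF t])
  show "(\<integral>p. g' t p * v p \<partial>m) = - (SS i. kap gamma eta i * (\<integral>p. wd T (g t) i p * wd T v i p \<partial>m))" if "v : H1_space T m" for v
  by (rule green[OF assms(1) g'(2)[OF t] g'(1)[OF t] g'(4)[OF t] that])
 qed
 thus ?thesis by blast
qed

text \<open>The equation holds for positive times only, where the mass is constant. Continuity in
  L^2 at time 0 and finiteness of \<open>m\<close> identify the constant with the mass at time 0,
  which is that of \<open>f0\<close> because the weight cancels.\<close>

lemma evolution_mass:
 assumes flow: "flow gamma eta g g'" and ev: "fp_evolution sigma x gamma eta D T f0 g" and f0: "f0 : borel_measurable B" and t: "t > 0"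
 shows "(\<integral>p. g t p \<partial>m) = (\<integral>p. f0 p \<partial>B)"
proof -
 have g2: "g s : L2_space m" if "s >= 0" for s using ev that unfolding fp_evolution_def Let_def by blast
 have g0: "AE p in m. g 0 p = f0 p * exp (energy sigma x p / D)" using ev unfolding fp_evolution_def Let_def by blast
 have "continuous_curve (L2_norm m) {0..} g" using ev unfolding fp_evolution_def Let_def by blast
 hence "((%s. L2_norm m (%p. g s p - g 0 p)) \<longlongrightarrow> 0) (at 0 within {0..})" unfolding continuous_curve_def by simp
 hence lim: "((%s. L2_norm m (%p. g s p - g 0 p)) \<longlongrightarrow> 0) (at_right 0)" by (rule tendsto_within_subset) auto
 obtain c where c: "!!t. t > 0 ==> (\<integral>p. g t p \<partial>m) = c" using flow_mass[OF flow] by blast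
 have l0: "((%s. L2_norm m (%p. g s p - g 0 p) * L2_norm m (%p. 1)) \<longlongrightarrow> 0) (at_right 0)" using tendsto_mult[OF lim tendsto_const] by simp
 have "((%s. (\<integral>p. g s p \<partial>m) - (\<integral>p. g 0 p \<partial>m)) \<longlongrightarrow> 0) (at_right 0)" proof (rule Lim_null_comparison[OF _ l0])
  show "\<forall>\<^sub>F s in at_right 0. norm ((\<integral>p. g s p \<partial>m) - (\<integral>p. g 0 p \<partial>m)) <= L2_norm m (%p. g s p - g 0 p) * L2_norm m (%p. 1)"
  using eventually_at_right_less[of "0::real"] proof eventually_elim
  case (elim s)
  have s: "g s : L2_space m" "g 0 : L2_space m" using g2 elim by auto
  have "(\<integral>p. g s p \<partial>m) - (\<integral>p. g 0 p \<partial>m) = (\<integral>p. (g s p - g 0 p) * 1 \<partial>m)"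
  using lint_diff[OF L2_space_integrable[OF finite_measure_gibbs s(1)] L2_space_integrable[OF finite_measure_gibbs s(2)]] by simp
  thus ?case using L2_cauchy_schwarz[OF L2_space_diff[OF s] L2_const[of 1]] by simp
  qed
 qed
 hence "((%s. \<integral>p. g s p \<partial>m) \<longlongrightarrow> (\<integral>p. g 0 p \<partial>m)) (at_right 0)" by (rule LIM_zero_cancel)
 moreover have "((%s. \<integral>p. g s p \<partial>m) \<longlongrightarrow> c) (at_right 0)" using eventually_at_right_less[of "0::real"] by (rule tendsto_eventually[OF eventually_mono]) (rule c)
 ultimately have "(\<integral>p. g 0 p \<partial>m) = c" by (rule tendsto_unique[rotated]) simp
 moreover have mg: "g 0 : borel_measurable B" using L2D(1)[OF g2[of 0]] by (simp add: measurable_gibbs)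
 have "(\<integral>p. g 0 p \<partial>m) = (\<integral>p. wt p * g 0 p \<partial>B)" by (rule integral_gibbs(2)[OF mg])
 moreover have "... = (\<integral>p. f0 p \<partial>B)" proof (rule integral_cong_AE[OF borel_measurable_times[OF wt_measurable mg] f0])
  show "AE p in B. wt p * g 0 p = f0 p" using g0[unfolded AE_gibbs] proof eventually_elim
  case (elim p)
  have "wt p * exp (energy sigma x p / D) = 1" unfolding exp_add[symmetric] by simp
  thus ?case unfolding elim by (simp only: mult.left_commute mult_1_right)
  qed
 qed
 ultimately show ?thesis using c[OF t] by simp
qed

lemma exponential_decay:
 assumes pos: "gamma > 0" "eta > 0" and C2: "C2_boundary T" and CP: "CP > 0" "poincare_wirtinger T CP"
  and f0: "f0 : borel_measurable B" "(\<integral>p. f0 p \<partial>B) = 1" and ev: "fp_evolution sigma x gamma eta D T f0 g" and f: "!!t p. t >= 0 ==> p : Omega \<times> T ==> f t p = g t p * wt p"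
  and Z: "1 / Z = (\<integral>p. wt p \<partial>B)" and CW: "CW = (SUP p\<in>Omega \<times> T. wt p) / (INF p\<in>Omega \<times> T. wt p) * CP" and t0: "t0 > 0"
 shows "\<exists>C>0. \<forall>t>t0. weakly_differentiable T (%p. f t p - Z * wt p) & (\<integral>\<^sup>+p. ennreal ((3 * gamma * D * (norm (weak_tgrad T (%q. f t q - Z * wt q) p))^2
  + eta * D * (norm (weak_agrad T (%q. f t q - Z * wt q) p))^2) * exp (energy sigma x p / D)) \<partial>B) <= ennreal (C * exp (- (2 * min (3 * gamma) eta * D / CW) * t))" proof -
 let ?e = "%p. wt p"
 define S where "S = (SUP p\<in>Omega \<times> T. ?e p)"
 define s where "s = (INF p\<in>Omega \<times> T. ?e p)"
 have "0 : Omega" by (simp add: mem_Omega)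
 then obtain p0 where p0: "p0 : Omega \<times> T" using T(3) by blast
 have Sup: "?e p <= S" if "p : Omega \<times> T" for p unfolding S_def by (rule cSUP_upper[OF that]) (intro bdd_aboveI2[of _ _ bnd] wt_bounds(1))
 have Inf: "s <= ?e p" if "p : Omega \<times> T" for p unfolding s_def by (rule cINF_lower[OF _ that]) (intro bdd_belowI2[of _ "1 / bnd"] wt_bounds(2))
 have "1 / bnd <= s" unfolding s_def by (rule cINF_greatest) (use p0 wt_bounds(2) in auto)
 hence s0: "s > 0" using bnd(1) by (smt (verit) divide_pos_pos)
 have S0: "S > 0" by (rule less_le_trans[OF exp_gt_zero Sup[OF p0]])
 have CW0: "CW > 0" unfolding CW S_def[symmetric] s_def[symmetric] using S0 s0 CP(1) by simp
 have P: "(L2_norm m v)^2 <= CW * (SS i. (L2_norm m (wd T v i))^2)" if "v : H1_space T m" "(\<integral>p. v p \<partial>m) = 0" for v unfolding CW S_def[symmetric] s_def[symmetric]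
  by (rule poincare_H1[OF CP(2,1) that Sup Inf s0 less_imp_le[OF S0]])
 define lam where "lam = min (3 * gamma) eta * D / CW"
 obtain g' where fl: "flow gamma eta g g'" using evolution_flow[OF C2 ev] by blast
 have mass: "(\<integral>p. g t p \<partial>m) = 1" if "t > 0" for t using evolution_mass[OF fl ev f0(1) that] f0(2) by simp
 have one: "(\<integral>p. 1 \<partial>m) = (\<integral>p. ?e p \<partial>B)" using integral_gibbs(2)[of "%p. 1"] by simp
 have "abs (\<integral>p. g t0 p * 1 \<partial>m) <= L2_norm m (g t0) * L2_norm m (%p. 1)" by (rule L2_cauchy_schwarz[OF flowD(3)[OF fl t0] L2_const])
 \<comment> \<open>A function of mass 1 excludes the zero measure, so the partition integral is not
   0 and \<open>1 / Z\<close> is a genuine quotient.\<close>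
 hence "L2_norm m (%p. 1) ~= 0" using mass[OF t0] by auto
 hence "(\<integral>p. ?e p \<partial>B) ~= 0" unfolding one[symmetric] L2_norm_def by simp
 hence ZZ: "Z * (\<integral>p. ?e p \<partial>B) = 1" unfolding Z[symmetric] by auto
 define h where "h t p = g t p - Z" for t p
 have hf: "flow gamma eta h g'" using flow_diff[OF fl flow_const[of gamma eta Z]] by (simp add: h_def[abs_def])
 have mz: "(\<integral>p. h t p \<partial>m) = 0" if t: "t > 0" for t proof -
  have "(\<integral>p. h t p \<partial>m) = (\<integral>p. g t p \<partial>m) - (\<integral>p. Z * 1 \<partial>m)" unfolding h_def mult_1_right
  by (intro lint_diff L2_space_integrable[OF finite_measure_gibbs] flowD(3)[OF fl t] L2_const)
  thus ?thesis using mass[OF t] ZZ unfolding integral_mult_right_zero one by simp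
 qed
 define a where "a = L2_norm m (g' t0)"
 define b where "b = L2_norm m (h t0)"
 have ab: "a >= 0" "b >= 0" by (simp_all add: a_def b_def L2_norm_nonneg)
 define K where "K = 2 * bnd ^ 4 * (SS i. kap gamma eta i)"
 have "kap gamma eta i >= 0" for i using pos D by (cases i) auto
 hence K0: "K >= 0" unfolding K_def using bnd(1) by (intro mult_nonneg_nonneg sum_nonneg) auto
 \<comment> \<open>The decay is counted from \<open>t0\<close>; the exponential factor moves the
   origin of time back to 0, and the summand 1 makes \<open>C\<close> positive.\<close>
 define C where "C = (2 * (a * b) + K * b^2) * exp (2 * lam * t0) + 1"
 have C0: "C > 0" using ab K0 by (simp add: C_def add_nonneg_pos)
 have "weakly_differentiable T (%p. f t p - Z * ?e p) & (\<integral>\<^sup>+p. ennreal ((3 * gamma * D * (norm (weak_tgrad T (%q. f t q - Z * ?e q) p))^2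
  + eta * D * (norm (weak_agrad T (%q. f t q - Z * ?e q) p))^2) * exp (energy sigma x p / D)) \<partial>B) <= ennreal (C * exp (- (2 * min (3 * gamma) eta * D / CW) * t))" if t: "t > t0" for t proof -
  have tp: "t > 0" using t t0 by simp
  define E where "E = exp (- lam * (t - t0))"
  have E0: "E >= 0" by (simp add: E_def)
  have hb: "L2_norm m (h t) <= E * b" unfolding E_def b_def lam_def by (rule flow_decay[OF hf mz pos P CW0 t0 less_imp_le[OF t]])
  have ga: "L2_norm m (g' t) <= E * a" unfolding E_def a_def lam_def by (rule flow_derivative_decay[OF fl pos P CW0 t0 less_imp_le[OF t]])
  have "(SS i. kap gamma eta i * (L2_norm m (wd T (h t) i))^2) <= abs (\<integral>p. g' t p * h t p \<partial>m)" using flow_energy[OF hf tp] by linarith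
  also have "... <= L2_norm m (g' t) * L2_norm m (h t)" by (rule L2_cauchy_schwarz[OF flowD(2,3)[OF hf tp]])
  also have "... <= (E * a) * (E * b)" by (intro mult_mono ga hb mult_nonneg_nonneg E0 ab L2_norm_nonneg)
  finally have e1: "(SS i. kap gamma eta i * (L2_norm m (wd T (h t) i))^2) <= E^2 * (a * b)" by (simp add: power2_eq_square mult_ac)
  have "(L2_norm m (h t))^2 <= (E * b)^2" by (rule power_mono[OF hb L2_norm_nonneg])
  hence e2: "K * (L2_norm m (h t))^2 <= K * (E^2 * b^2)" using K0 by (intro mult_left_mono) (simp_all add: power_mult_distrib)
  have E2: "E^2 = exp (2 * lam * t0) * exp (- (2 * min (3 * gamma) eta * D / CW) * t)" proof -
  have "2 * min (3 * gamma) eta * D / CW = 2 * lam" by (simp add: lam_def)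
  thus ?thesis unfolding E_def power2_eq_square exp_add[symmetric] by (simp add: algebra_simps)
  qed
  have "2 * (SS i. kap gamma eta i * (L2_norm m (wd T (h t) i))^2) + K * (L2_norm m (h t))^2 <= E^2 * (2 * (a * b) + K * b^2)" using e1 e2 by (simp add: algebra_simps)
  also have "... = (C - 1) * exp (- (2 * min (3 * gamma) eta * D / CW) * t)" unfolding E2 C_def by simp
  also have "... <= C * exp (- (2 * min (3 * gamma) eta * D / CW) * t)" by (rule mult_right_mono) simp_all
  finally have fin: "2 * (SS i. kap gamma eta i * (L2_norm m (wd T (h t) i))^2) + K * (L2_norm m (h t))^2 <= C * exp (- (2 * min (3 * gamma) eta * D / CW) * t)" .
  have F: "f t p - Z * ?e p = h t p * ?e p" if "p : Omega \<times> T" for p using f[OF less_imp_le[OF tp] that] by (simp add: h_def algebra_simps)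
  note wb = weighted_energy_bound[OF flowD(1)[OF hf tp] F pos, folded K_def]
  show ?thesis using wb(1) order.trans[OF wb(2) ennreal_leI[OF fin]] by blast
 qed
 thus ?thesis using C0 by blast
qed

end

theorem theorem3p11:
  fixes \<gamma> \<eta> \<beta>\<^sub>\<theta> \<beta>\<^sub>a D C\<^sub>P C\<^sub>W C\<^sub>1 t\<^sub>0 :: real
    and \<sigma> :: "real \<Rightarrow> real" and x :: "3 \<Rightarrow> real^2" and T :: "(real^2) set"
    and f\<^sub>0 finf :: "(real^3) \<times> (real^2) \<Rightarrow> real" and f :: "real \<Rightarrow> (real^3) \<times> (real^2) \<Rightarrow> real"
  assumes pos: "\<gamma> > 0" "\<eta> > 0" "\<beta>\<^sub>\<theta> > 0" "\<beta>\<^sub>a > 0"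
    and fluctuation_dissipation: "6 * \<gamma> / \<beta>\<^sub>\<theta>\<^sup>2 = 2 * \<eta> / \<beta>\<^sub>a\<^sup>2"
    and D: "D = \<beta>\<^sub>\<theta>\<^sup>2 / (6 * \<gamma>)"
    and domain: "bounded_C2_domain T"
    and sigma: "\<sigma> C1_differentiable_on UNIV"
    and CP: "C\<^sub>P > 0" "poincare_wirtinger T C\<^sub>P"
    and f0_L2: "f\<^sub>0 \<in> L2_space (density (base_measure T) (\<lambda>p. ennreal (exp (energy \<sigma> x p / D))))"
    and f0_pos: "AE p in base_measure T. f\<^sub>0 p > 0"
    and f0_mass: "(\<integral>p. f\<^sub>0 p \<partial>base_measure T) = 1"
    and solution: "fp_associated_solution \<sigma> x \<gamma> \<eta> D T f\<^sub>0 f"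
    and C1: "1 / C\<^sub>1 = (\<integral>p. exp (- energy \<sigma> x p / D) \<partial>base_measure T)"
    and finf_def: "finf = (\<lambda>p. C\<^sub>1 * exp (- energy \<sigma> x p / D))"
    and CW: "C\<^sub>W = (SUP p\<in>Omega \<times> T. exp (- energy \<sigma> x p / D))
                   / (INF p\<in>Omega \<times> T. exp (- energy \<sigma> x p / D)) * C\<^sub>P"
    and t0: "t\<^sub>0 > 0"
  shows "\<exists>C>0. \<forall>t>t\<^sub>0. weakly_differentiable T (\<lambda>p. f t p - finf p) \<and>
    (\<integral>\<^sup>+p. ennreal ((3 * \<gamma> * D * (norm (weak_tgrad T (\<lambda>q. f t q - finf q) p))\<^sup>2
                 + \<eta> * D * (norm (weak_agrad T (\<lambda>q. f t q - finf q) p))\<^sup>2)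
                 * exp (energy \<sigma> x p / D)) \<partial>base_measure T)
      \<le> ennreal (C * exp (- (2 * min (3 * \<gamma>) \<eta> * D / C\<^sub>W) * t))"
proof -
  have dom: "T \<noteq> {}" "open T" "bounded T" "C2_boundary T" using domain by (simp_all add: bounded_C2_domain_def)
  have "D > 0" using pos D by simp
  then interpret gibbs_domain \<sigma> x D T using dom sigma by unfold_locales
  have f0m: "f\<^sub>0 \<in> borel_measurable (base_measure T)" using L2D(1)[OF f0_L2] by (simp add: measurable_def)
  obtain g where "fp_evolution \<sigma> x \<gamma> \<eta> D T f\<^sub>0 g" "\<forall>t\<ge>0. \<forall>p\<in>Omega \<times> T. f t p = g t p * exp (- energy \<sigma> x p / D)"
    using solution unfolding fp_associated_solution_def by blast
  then show ?thesis
    unfolding finf_def by (intro exponential_decay[OF pos(1,2) dom(4) CP f0m f0_mass _ _ C1 CW t0]) auto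
qed

end
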